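(* Let $N>2$ be an integer and let $\kappa$ be a complex number with $|\Re(\kappa)|+1<\frac{N+1}{3}$; let $\nu$ and $z$ be related by $\nu+\kappa=z$. Then $$H_\nu^{(1)\prime}(z)=-\frac{2}{3\pi}\sum_{n=1}^{N-1}6^{\frac{n+1}{3}}D_n(\kappa)e^{\frac{2(n+1)\pi i}{3}}\sin\left(\frac{(n+1)\pi}{3}\right)\frac{\Gamma\left(\frac{n+1}{3}\right)}{z^{\frac{n+1}{3}}}+R_N^{(H')}(z,\kappa)$$ for $-\frac{\pi}{2}<\arg z<\frac{3\pi}{2}$; $$H_\nu^{(2)\prime}(z)=-\frac{2}{3\pi}\sum_{n=1}^{N-1}6^{\frac{n+1}{3}}D_n(\kappa)e^{-\frac{2(n+1)\pi i}{3}}\sin\left(\frac{(n+1)\pi}{3}\right)\frac{\Gamma\left(\frac{n+1}{3}\right)}{z^{\frac{n+1}{3}}}+R_N^{(H')}(ze^{\pi i},-\kappa)$$ for $-\frac{3\pi}{2}<\arg z<\frac{\pi}{2}$; $$J_\nu'(z)=\frac{1}{3\pi}\sum_{n=1}^{N-1}6^{\frac{n+1}{3}}D_n(\kappa)\sin\left(\frac{(n+1)\pi}{3}\right)\frac{\Gamma\left(\frac{n+1}{3}\right)}{z^{\frac{n+1}{3}}}+R_N^{(J')}(z,\kappa),$$ $$Y_\nu'(z)=-\frac{2}{3\pi}\sum_{n=1}^{N-1}(-1)^n6^{\frac{n+1}{3}}D_n(\kappa)\sin^2\left(\frac{(n+1)\pi}{3}\right)\frac{\Gamma\left(\frac{n+1}{3}\right)}{z^{\frac{n+1}{3}}}+R_N^{(Y')}(z,\kappa)$$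 for $|\arg z|<\frac{\pi}{2}$. The coefficients $D_n(\kappa)$ are given by $$D_n(\kappa)=\frac{B_n(\kappa+1)-B_n(\kappa-1)}{2}=\frac{1}{n!}\left[\frac{d^n}{dt^n}\left(e^{\kappa t}\sinh t\left(\frac16\frac{t^3}{\sinh t-t}\right)^{\frac{n+1}{3}}\right)\right]_{t=0}$$ $$=-\frac{6^{-\frac{n+1}{3}}}{2\Gamma\left(\frac{n+1}{3}\right)}\int_0^{+\infty}t^{\frac{n-2}{3}}e^{-2\pi t}\,i\left(e^{(2\pi\kappa-\frac{\pi}{2}n)i}H_{it+\kappa}^{(1)\prime}(it)-e^{-(2\pi\kappa-\frac{\pi}{2}n)i}H_{it-\kappa}^{(1)\prime}(it)\right)dt,$$ the last (integral) representation being true if $|\Re(\kappa)|+1<\frac{n+1}{3}$. The remainder terms can be expressed as $$R_N^{(H')}(z,\kappa)=-\frac{e^{(2\pi\kappa-\frac{\pi}{2}N)i}}{6\pi z^{\frac{N+1}{3}}}\int_0^{+\infty}t^{\frac{N-2}{3}}e^{-2\pi t}\left(\frac{e^{\frac{(N+1)\pi i}{3}}}{1+i(t/z)^{\frac13}e^{\frac{\pi}{3}i}}-\frac{e^{(N+1)\pi i}}{1-i(t/z)^{\frac13}}\right)H_{it+\kappa}^{(1)\prime}(it)\,dt$$ $$+\frac{e^{-(2\pi\kappa-\frac{\pi}{2}N)i}}{6\pi z^{\frac{N+1}{3}}}\int_0^{+\infty}t^{\frac{N-2}{3}}e^{-2\pi t}\left(\frac{e^{\frac{(N+1)\pi i}{3}}}{1-i(t/z)^{\frac13}e^{\frac{\pi}{3}i}}-\frac{e^{(N+1)\pi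 i}}{1+i(t/z)^{\frac13}}\right)H_{it-\kappa}^{(1)\prime}(it)\,dt,$$ $$R_N^{(J')}(z,\kappa)=-\frac{e^{(2\pi\kappa-\frac{\pi}{2}N)i}}{12\pi z^{\frac{N+1}{3}}}\int_0^{+\infty}t^{\frac{N-2}{3}}e^{-2\pi t}\left(\frac{e^{\frac{(N+1)\pi i}{3}}}{1+i(t/z)^{\frac13}e^{\frac{\pi}{3}i}}-\frac{e^{-\frac{(N+1)\pi i}{3}}}{1+i(t/z)^{\frac13}e^{-\frac{\pi}{3}i}}\right)H_{it+\kappa}^{(1)\prime}(it)\,dt$$ $$+\frac{e^{-(2\pi\kappa-\frac{\pi}{2}N)i}}{12\pi z^{\frac{N+1}{3}}}\int_0^{+\infty}t^{\frac{N-2}{3}}e^{-2\pi t}\left(\frac{e^{\frac{(N+1)\pi i}{3}}}{1-i(t/z)^{\frac13}e^{\frac{\pi}{3}i}}-\frac{e^{-\frac{(N+1)\pi i}{3}}}{1-i(t/z)^{\frac13}e^{-\frac{\pi}{3}i}}\right)H_{it-\kappa}^{(1)\prime}(it)\,dt$$ and $$R_N^{(Y')}(z,\kappa)=-\frac{e^{(2\pi\kappa-\frac{\pi}{2}N)i}}{12\pi i z^{\frac{N+1}{3}}}\int_0^{+\infty}t^{\frac{N-2}{3}}e^{-2\pi t}\left(\frac{e^{\frac{(N+1)\pi i}{3}}}{1+i(t/z)^{\frac13}e^{\frac{\pi}{3}i}}+\frac{e^{-\frac{(N+1)\pi i}{3}}}{1+i(t/z)^{\frac13}e^{-\frac{\pi}{3}i}}-\frac{2e^{(N+1)\pi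 i}}{1-i(t/z)^{\frac13}}\right)H_{it+\kappa}^{(1)\prime}(it)\,dt$$ $$+\frac{e^{-(2\pi\kappa-\frac{\pi}{2}N)i}}{12\pi i z^{\frac{N+1}{3}}}\int_0^{+\infty}t^{\frac{N-2}{3}}e^{-2\pi t}\left(\frac{e^{\frac{(N+1)\pi i}{3}}}{1-i(t/z)^{\frac13}e^{\frac{\pi}{3}i}}+\frac{e^{-\frac{(N+1)\pi i}{3}}}{1-i(t/z)^{\frac13}e^{-\frac{\pi}{3}i}}-\frac{2e^{(N+1)\pi i}}{1+i(t/z)^{\frac13}}\right)H_{it-\kappa}^{(1)\prime}(it)\,dt.$$
   Context: $H_\nu^{(1)},H_\nu^{(2)}$ are the Hankel functions and $J_\nu,Y_\nu$ the Bessel functions of the first and second kind, of complex order $\nu$. A prime denotes the derivative with respect to the argument at fixed order; e.g. $H^{(1)\prime}_{it+\kappa}(it)$ is $\frac{d}{dw}H^{(1)}_{\mu}(w)$ at $w=it$, $\mu=it+\kappa$. The variable $z$ is regarded as a point of the Riemann surface of the logarithm, with the functions being the analytic continuations in $z$ of their principal branches; $ze^{\pi i}$ is the point with argument $\arg z+\pi$; $it$, $t>0$, has argument $\frac{\pi}{2}$. Cube roots (and powers $z^{k/3}$) are positive on the positive real line and defined by analytic continuation elsewhere, i.e. $z^{1/3}=|z|^{1/3}e^{i(\arg z)/3}$ and $(t/z)^{1/3}=t^{1/3}/z^{1/3}$. The polynomials $B_n(\kappa)$ are $$B_n(\kappa)=\frac{1}{n!}\left[\frac{d^n}{dt^n}\left(e^{\kappa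 t}\left(\frac16\frac{t^3}{\sinh t-t}\right)^{\frac{n+1}{3}}\right)\right]_{t=0},$$ where the power of $\frac16\frac{t^3}{\sinh t-t}$ is the branch equal to $1$ at $t=0$. *)

theory Defs
  imports "HOL-Analysis.Analysis"
begin

text \<open>
  The Riemann surface of the logarithm. A point is stored through its global coordinate
  \<open>log z = ln |z| + i arg z\<close>; since the argument is not reduced modulo \<open>2 \<pi>\<close>, every complex
  number is the coordinate of exactly one point.
\<close>

datatype log_surface = Log_Point (ls_log: complex)

definition ls_point :: "real \<Rightarrow> real \<Rightarrow> log_surface" where
  "ls_point r \<theta> = Log_Point (Complex (ln r) \<theta>)"

definition ls_proj :: "log_surface \<Rightarrow> complex" where
  "ls_proj z = exp (ls_log z)"

definition ls_arg :: "log_surface \<Rightarrow> real" where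
  "ls_arg z = Im (ls_log z)"

text \<open>The point \<open>z e\<^sup>i\<^sup>\<theta>\<close>, with argument \<open>arg z + \<theta>\<close>.\<close>

definition ls_rotate :: "log_surface \<Rightarrow> real \<Rightarrow> log_surface" where
  "ls_rotate z \<theta> = Log_Point (ls_log z + \<i> * of_real \<theta>)"

text \<open>The power \<open>z\<^sup>a\<close>, positive for real \<open>a\<close> and \<open>arg z = 0\<close>, continued to the whole surface.\<close>

definition ls_powr :: "log_surface \<Rightarrow> complex \<Rightarrow> complex" where
  "ls_powr z a = exp (a * ls_log z)"

text \<open>The derivative with respect to \<open>z\<close>: by the chain rule \<open>d/dz = (1/z) d/d(log z)\<close>.\<close>

definition ls_deriv :: "(log_surface \<Rightarrow> complex) \<Rightarrow> log_surface \<Rightarrow> complex" where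
  "ls_deriv f z = deriv (\<lambda>w. f (Log_Point w)) (ls_log z) / ls_proj z"

text \<open>
  Bessel and Hankel functions of complex order. The only multivalued ingredient of \<open>J\<^sub>\<nu>\<close> is
  \<open>(z/2)\<^sup>\<nu> = exp (\<nu> (log z - ln 2))\<close>, so these formulas give the analytic continuations to the
  surface of the principal branches. For integer order \<open>Y\<^sub>\<nu>\<close> is the usual limit in the order.
\<close>

definition Bessel_J :: "complex \<Rightarrow> log_surface \<Rightarrow> complex" where
  "Bessel_J \<nu> z = exp (\<nu> * (ls_log z - of_real (ln 2))) *
     (\<Sum>k. (-1) ^ k * rGamma (\<nu> + of_nat k + 1) / fact k * (ls_proj z / 2) ^ (2 * k))"

definition Bessel_Y_quotient :: "complex \<Rightarrow> log_surface \<Rightarrow> complex" where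
  "Bessel_Y_quotient \<nu> z =
     (Bessel_J \<nu> z * cos (\<nu> * of_real pi) - Bessel_J (- \<nu>) z) / sin (\<nu> * of_real pi)"

definition Bessel_Y :: "complex \<Rightarrow> log_surface \<Rightarrow> complex" where
  "Bessel_Y \<nu> z =
     (if \<nu> \<in> \<int> then Lim (at \<nu>) (\<lambda>\<mu>. Bessel_Y_quotient \<mu> z) else Bessel_Y_quotient \<nu> z)"

definition Hankel1 :: "complex \<Rightarrow> log_surface \<Rightarrow> complex" where
  "Hankel1 \<nu> z = Bessel_J \<nu> z + \<i> * Bessel_Y \<nu> z"

definition Hankel2 :: "complex \<Rightarrow> log_surface \<Rightarrow> complex" where
  "Hankel2 \<nu> z = Bessel_J \<nu> z - \<i> * Bessel_Y \<nu> z"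

text \<open>
  The function \<open>t\<^sup>3 / (6 (sinh t - t))\<close> with its removable singularity at \<open>0\<close> filled in. As its
  value there is \<open>1\<close>, near \<open>0\<close> the principal power is the branch equal to \<open>1\<close> at \<open>t = 0\<close>.
\<close>

definition sinh_kernel :: "complex \<Rightarrow> complex" where
  "sinh_kernel t = (if t = 0 then 1 else 1 / 6 * (t ^ 3 / (sinh t - t)))"

definition B_coeff :: "nat \<Rightarrow> complex \<Rightarrow> complex" where
  "B_coeff n \<kappa> =
     1 / fact n * (deriv ^^ n) (\<lambda>t. exp (\<kappa> * t) * sinh_kernel t powr ((of_nat n + 1) / 3)) 0"

definition D_coeff :: "nat \<Rightarrow> complex \<Rightarrow> complex" where
  "D_coeff n \<kappa> = (B_coeff n (\<kappa> + 1) - B_coeff n (\<kappa> - 1)) / 2"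

text \<open>\<open>H\<^sup>(\<^sup>1\<^sup>)\<close>\<open>'\<close> of order \<open>it + \<kappa>\<close> at the point \<open>it\<close> with argument \<open>\<pi>/2\<close>, for \<open>t > 0\<close>.\<close>

definition Hankel1_deriv_imag :: "complex \<Rightarrow> real \<Rightarrow> complex" where
  "Hankel1_deriv_imag \<kappa> t = ls_deriv (Hankel1 (\<i> * of_real t + \<kappa>)) (ls_point t (pi / 2))"

definition D_integrand :: "nat \<Rightarrow> complex \<Rightarrow> real \<Rightarrow> complex" where
  "D_integrand n \<kappa> t =
     of_real (t powr ((real n - 2) / 3) * exp (- 2 * pi * t)) * \<i> *
     (exp ((2 * of_real pi * \<kappa> - of_real pi / 2 * of_nat n) * \<i>) * Hankel1_deriv_imag \<kappa> t
      - exp (- (2 * of_real pi * \<kappa> - of_real pi / 2 * of_nat n) * \<i>) * Hankel1_deriv_imag (- \<kappa>) t)"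

text \<open>The cube root \<open>(t/z)\<^sup>1\<^sup>/\<^sup>3 = t\<^sup>1\<^sup>/\<^sup>3 / z\<^sup>1\<^sup>/\<^sup>3\<close>.\<close>

definition cbrt_quot :: "real \<Rightarrow> log_surface \<Rightarrow> complex" where
  "cbrt_quot t z = of_real (t powr (1 / 3)) / ls_powr z (1 / 3)"

definition RH_integrand1 :: "nat \<Rightarrow> log_surface \<Rightarrow> complex \<Rightarrow> real \<Rightarrow> complex" where
  "RH_integrand1 N z \<kappa> t =
     of_real (t powr ((real N - 2) / 3) * exp (- 2 * pi * t)) *
     (exp ((of_nat N + 1) * of_real pi * \<i> / 3) / (1 + \<i> * cbrt_quot t z * exp (of_real pi / 3 * \<i>))
      - exp ((of_nat N + 1) * of_real pi * \<i>) / (1 - \<i> * cbrt_quot t z)) *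
     Hankel1_deriv_imag \<kappa> t"

definition RH_integrand2 :: "nat \<Rightarrow> log_surface \<Rightarrow> complex \<Rightarrow> real \<Rightarrow> complex" where
  "RH_integrand2 N z \<kappa> t =
     of_real (t powr ((real N - 2) / 3) * exp (- 2 * pi * t)) *
     (exp ((of_nat N + 1) * of_real pi * \<i> / 3) / (1 - \<i> * cbrt_quot t z * exp (of_real pi / 3 * \<i>))
      - exp ((of_nat N + 1) * of_real pi * \<i>) / (1 + \<i> * cbrt_quot t z)) *
     Hankel1_deriv_imag (- \<kappa>) t"

definition R_H :: "nat \<Rightarrow> log_surface \<Rightarrow> complex \<Rightarrow> complex" where
  "R_H N z \<kappa> =
     - exp ((2 * of_real pi * \<kappa> - of_real pi / 2 * of_nat N) * \<i>)
         / (6 * of_real pi * ls_powr z ((of_nat N + 1) / 3))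
       * (LINT t:{0<..}|lborel. RH_integrand1 N z \<kappa> t)
     + exp (- (2 * of_real pi * \<kappa> - of_real pi / 2 * of_nat N) * \<i>)
         / (6 * of_real pi * ls_powr z ((of_nat N + 1) / 3))
       * (LINT t:{0<..}|lborel. RH_integrand2 N z \<kappa> t)"

definition RJ_integrand1 :: "nat \<Rightarrow> log_surface \<Rightarrow> complex \<Rightarrow> real \<Rightarrow> complex" where
  "RJ_integrand1 N z \<kappa> t =
     of_real (t powr ((real N - 2) / 3) * exp (- 2 * pi * t)) *
     (exp ((of_nat N + 1) * of_real pi * \<i> / 3) / (1 + \<i> * cbrt_quot t z * exp (of_real pi / 3 * \<i>))
      - exp (- (of_nat N + 1) * of_real pi * \<i> / 3)
          / (1 + \<i> * cbrt_quot t z * exp (- (of_real pi / 3) * \<i>))) *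
     Hankel1_deriv_imag \<kappa> t"

definition RJ_integrand2 :: "nat \<Rightarrow> log_surface \<Rightarrow> complex \<Rightarrow> real \<Rightarrow> complex" where
  "RJ_integrand2 N z \<kappa> t =
     of_real (t powr ((real N - 2) / 3) * exp (- 2 * pi * t)) *
     (exp ((of_nat N + 1) * of_real pi * \<i> / 3) / (1 - \<i> * cbrt_quot t z * exp (of_real pi / 3 * \<i>))
      - exp (- (of_nat N + 1) * of_real pi * \<i> / 3)
          / (1 - \<i> * cbrt_quot t z * exp (- (of_real pi / 3) * \<i>))) *
     Hankel1_deriv_imag (- \<kappa>) t"

definition R_J :: "nat \<Rightarrow> log_surface \<Rightarrow> complex \<Rightarrow> complex" where
  "R_J N z \<kappa> =
     - exp ((2 * of_real pi * \<kappa> - of_real pi / 2 * of_nat N) * \<i>)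
         / (12 * of_real pi * ls_powr z ((of_nat N + 1) / 3))
       * (LINT t:{0<..}|lborel. RJ_integrand1 N z \<kappa> t)
     + exp (- (2 * of_real pi * \<kappa> - of_real pi / 2 * of_nat N) * \<i>)
         / (12 * of_real pi * ls_powr z ((of_nat N + 1) / 3))
       * (LINT t:{0<..}|lborel. RJ_integrand2 N z \<kappa> t)"

definition RY_integrand1 :: "nat \<Rightarrow> log_surface \<Rightarrow> complex \<Rightarrow> real \<Rightarrow> complex" where
  "RY_integrand1 N z \<kappa> t =
     of_real (t powr ((real N - 2) / 3) * exp (- 2 * pi * t)) *
     (exp ((of_nat N + 1) * of_real pi * \<i> / 3) / (1 + \<i> * cbrt_quot t z * exp (of_real pi / 3 * \<i>))
      + exp (- (of_nat N + 1) * of_real pi * \<i> / 3)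
          / (1 + \<i> * cbrt_quot t z * exp (- (of_real pi / 3) * \<i>))
      - 2 * exp ((of_nat N + 1) * of_real pi * \<i>) / (1 - \<i> * cbrt_quot t z)) *
     Hankel1_deriv_imag \<kappa> t"

definition RY_integrand2 :: "nat \<Rightarrow> log_surface \<Rightarrow> complex \<Rightarrow> real \<Rightarrow> complex" where
  "RY_integrand2 N z \<kappa> t =
     of_real (t powr ((real N - 2) / 3) * exp (- 2 * pi * t)) *
     (exp ((of_nat N + 1) * of_real pi * \<i> / 3) / (1 - \<i> * cbrt_quot t z * exp (of_real pi / 3 * \<i>))
      + exp (- (of_nat N + 1) * of_real pi * \<i> / 3)
          / (1 - \<i> * cbrt_quot t z * exp (- (of_real pi / 3) * \<i>))
      - 2 * exp ((of_nat N + 1) * of_real pi * \<i>) / (1 + \<i> * cbrt_quot t z)) *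
     Hankel1_deriv_imag (- \<kappa>) t"

definition R_Y :: "nat \<Rightarrow> log_surface \<Rightarrow> complex \<Rightarrow> complex" where
  "R_Y N z \<kappa> =
     - exp ((2 * of_real pi * \<kappa> - of_real pi / 2 * of_nat N) * \<i>)
         / (12 * of_real pi * \<i> * ls_powr z ((of_nat N + 1) / 3))
       * (LINT t:{0<..}|lborel. RY_integrand1 N z \<kappa> t)
     + exp (- (2 * of_real pi * \<kappa> - of_real pi / 2 * of_nat N) * \<i>)
         / (12 * of_real pi * \<i> * ls_powr z ((of_nat N + 1) / 3))
       * (LINT t:{0<..}|lborel. RY_integrand2 N z \<kappa> t)"

end

theory Submission
  imports Defs "HOL-Complex_Analysis.Complex_Analysis" "HOL-Real_Asymp.Real_Asymp"
    "HOL-Computational_Algebra.Fundamental_Theorem_Algebra"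
begin

text \<open>
  Both \<open>J\<^sub>\<nu>\<close> and \<open>Y\<^sub>\<nu>\<close> are combinations of the entire continuation in \<open>\<zeta> = log z\<close> of
  \<open>S(\<nu>, \<zeta>) = \<integral>\<^sub>0\<^sup>\<infinity> exp (- z sinh t + \<nu> t) dt\<close>. Along \<open>\<nu> = z - \<kappa>\<close> the phase is \<open>- z (sinh t - t)\<close>, with a double
  saddle at \<open>0\<close>, and the derivative \<open>H\<^sup>(\<^sup>1\<^sup>)\<close>\<open>'\<close> becomes a difference of two branches of one function \<open>A\<close> (called
  \<open>anger_diff\<close>). The connection formulas of the Bessel functions give the jump of \<open>A\<close> between
  \<open>arg z = 3 \<pi> / 2\<close> and \<open>arg z = - 3 \<pi> / 2\<close> (after exchanging \<open>\<kappa>\<close> with \<open>- \<kappa>\<close>) as \<open>e\<^sup>-\<^sup>2\<^sup>\<pi>\<^sup>t H\<^sup>(\<^sup>1\<^sup>)\<close>\<open>'\<close> at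
  \<open>it\<close>. In the variable \<open>w = z\<^sup>1\<^sup>/\<^sup>3\<close> the branches of \<open>\<kappa>\<close> and \<open>- \<kappa>\<close> live on the right and the left half
  plane, and Cauchy's formula applied to \<open>w\<^sup>N A\<close>, which grows polynomially, represents it as a polynomial plus a
  Stieltjes transform of the jump along the imaginary axis. Watson's lemma on \<open>w > 0\<close>, with coefficients
  from Lagrange inversion, identifies the polynomial; the Stieltjes transforms are the remainders.
\<close>

section \<open>Integrals over half lines\<close>

text \<open>The order moves with the argument: a half turn at fixed \<nu> sends \<nu> = z - \<kappa>
  to - \<nu> = (- z) - (- \<kappa>). Each half turn therefore exchanges \<kappa> with - \<kappa>,
  and two sheets have to be glued. The sector |arg z| \<le> 3 \<pi> / 2, in which
  \<open>anger_diff\<close> stays bounded for large |z|, has opening 3 \<pi>; the cube root fits it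
  into one half plane, and the sheet of - \<kappa>, taken at - w, fills the other. Differentiation
  at fixed order shifts \<kappa> by \<plusminus> 1. Hence D_n is half a difference of values of B_n,
  and hence the 1 in |Re \<kappa>| + 1. Near z = 0 the function is O(|z|^(- \<rho>)) for every
  \<rho> > |Re \<kappa>| + 1, and the bound (N + 1) / 3 makes its product with w^N integrable along
  the cut at the origin. The same factor w^N produces growth of degree N at infinity, so Cauchy's
  formula determines the product only up to a polynomial, which needs an independent
  expansion.\<close>

lemma exp_minus_half_line:
  fixes \<delta> c :: real
  assumes "\<delta> > 0"
  shows "set_integrable lborel {c..} (\<lambda>x. exp (- \<delta> * x))"
    and "(LINT x:{c..}|lborel. exp (- \<delta> * x)) = exp (- \<delta> * c) / \<delta>"
proof -
  have hi: "((\<lambda>x. exp (- \<delta> * x)) has_integral exp (- \<delta> * c) / \<delta>) {c..}"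
    using has_integral_exp_minus_to_infinity[OF assms] .
  then have "(\<lambda>x. exp (- \<delta> * x)) absolutely_integrable_on {c..}"
    by (intro nonnegative_absolutely_integrable_1) (auto simp: integrable_on_def)
  then show int: "set_integrable lborel {c..} (\<lambda>x. exp (- \<delta> * x))"
    unfolding set_integrable_def
    by (subst (asm) integrable_completion)
       (auto intro!: borel_measurable_continuous_on_indicator continuous_intros)
  show "(LINT x:{c..}|lborel. exp (- \<delta> * x)) = exp (- \<delta> * c) / \<delta>"
    using set_borel_integral_eq_integral(2)[OF int] hi by (simp add: integral_unique)
qed

lemma half_line_integrable:
  fixes f :: "real \<Rightarrow> complex"
  assumes "continuous_on {c..} f" "\<And>x. x \<ge> c \<Longrightarrow> norm (f x) \<le> C * exp (- \<delta> * x)" "\<delta> > 0"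
  shows "set_integrable lborel {c..} f"
proof (rule set_integrable_bound)
  show "set_integrable lborel {c..} (\<lambda>x. C * exp (- \<delta> * x))"
    by (intro set_integrable_mult_right exp_minus_half_line assms)
  show "set_borel_measurable lborel {c..} f"
    unfolding set_borel_measurable_def
    by (simp, intro borel_measurable_continuous_on_indicator assms) auto
  show "AE x in lborel. x \<in> {c..} \<longrightarrow> norm (f x) \<le> norm (C * exp (- \<delta> * x))"
    using assms(2) by (intro AE_I2) (smt (verit) atLeast_iff norm_ge_zero real_norm_def)
qed

lemma half_line_bound:
  fixes f :: "real \<Rightarrow> complex"
  assumes "continuous_on {c..} f" "\<And>x. x \<ge> c \<Longrightarrow> norm (f x) \<le> C * exp (- \<delta> * x)" "\<delta> > 0"
  shows "norm (LINT x:{c..}|lborel. f x) \<le> C * exp (- \<delta> * c) / \<delta>"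
proof -
  have "norm (LINT x:{c..}|lborel. f x) \<le> (LINT x:{c..}|lborel. norm (f x))"
    by (rule set_integral_norm_bound[OF half_line_integrable[OF assms]])
  also have "\<dots> \<le> (LINT x:{c..}|lborel. C * exp (- \<delta> * x))"
    by (rule set_integral_mono)
       (use assms exp_minus_half_line(1)[OF assms(3), of c] in \<open>auto intro!: set_integrable_norm half_line_integrable\<close>)
  also have "\<dots> = C * exp (- \<delta> * c) / \<delta>"
    using exp_minus_half_line(2)[OF assms(3), of c] by simp
  finally show ?thesis .
qed

lemma half_line_tendsto:
  fixes f :: "real \<Rightarrow> complex"
  assumes "set_integrable lborel {c..} f"
  shows "((\<lambda>X. integral {c..X} f) \<longlongrightarrow> (LINT x:{c..}|lborel. f x)) at_top"
proof -
  have "((\<lambda>X. LINT x:{c..X}|lborel. f x) \<longlongrightarrow> (LINT x:{c..}|lborel. f x)) at_top"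
    by (rule tendsto_set_lebesgue_integral_at_top) (use assms in auto)
  moreover have "(LINT x:{c..X}|lborel. f x) = integral {c..X} f" for X
    by (rule set_borel_integral_eq_integral(2)) (rule set_integrable_subset[OF assms], auto)
  ultimately show ?thesis by simp
qed

lemma half_line_tail:
  fixes f :: "real \<Rightarrow> complex"
  assumes "continuous_on {c..} f" "\<And>x. x \<ge> c \<Longrightarrow> norm (f x) \<le> C * exp (- \<delta> * x)" "\<delta> > 0" "X \<ge> c"
  shows "norm (integral {c..X} f - (LINT x:{c..}|lborel. f x)) \<le> C * exp (- \<delta> * X) / \<delta>"
proof -
  have int: "set_integrable lborel {c..} f" by (rule half_line_integrable[OF assms(1-3)])
  have i1: "f integrable_on {c..}" and e1: "(LINT x:{c..}|lborel. f x) = integral {c..} f"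
    using set_borel_integral_eq_integral[OF int] by auto
  have int2: "set_integrable lborel {X..} f" by (rule set_integrable_subset[OF int]) (use assms in auto)
  have i2: "f integrable_on {X..}" and e2: "(LINT x:{X..}|lborel. f x) = integral {X..} f"
    using set_borel_integral_eq_integral[OF int2] by auto
  have i3: "f integrable_on {c..X}"
    by (rule integrable_continuous_real, rule continuous_on_subset[OF assms(1)]) auto
  have "integral ({c..X} \<union> {X..}) f = integral {c..X} f + integral {X..} f"
    by (rule Henstock_Kurzweil_Integration.integral_Un[OF i3 i2])
       (rule negligible_subset[of "{X}"], auto)
  moreover have "{c..X} \<union> {X..} = {c..}" using assms by auto
  moreover have "norm (LINT x:{X..}|lborel. f x) \<le> C * exp (- \<delta> * X) / \<delta>"
    by (rule half_line_bound) (use assms in \<open>auto intro: continuous_on_subset\<close>)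
  ultimately show ?thesis using e1 e2 by (simp add: norm_minus_commute)
qed

text \<open>The integrals over [0, n] converge locally uniformly because the majorant
  \<open>C * exp (- \<delta> * x)\<close> bounds the tails, and derivatives pass to locally uniform
  limits of holomorphic functions. Hence the uniform majorant is asked of \<phi> and not of \<phi>';
  integrability of \<phi>' at the point w suffices to name the limit.\<close>

lemma half_line_has_field_derivative:
  fixes \<phi> :: "complex \<Rightarrow> real \<Rightarrow> complex"
  assumes U: "open U" "w \<in> U"
    and d: "\<And>w x. w \<in> U \<Longrightarrow> x \<ge> 0 \<Longrightarrow> ((\<lambda>w. \<phi> w x) has_field_derivative \<phi>' w x) (at w)"
    and c: "\<And>w. w \<in> U \<Longrightarrow> continuous_on {0..} (\<phi> w)"
    and c': "continuous_on (U \<times> {0..}) (\<lambda>(w, x). \<phi>' w x)"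
    and b: "\<And>w x. w \<in> U \<Longrightarrow> x \<ge> 0 \<Longrightarrow> norm (\<phi> w x) \<le> C * exp (- \<delta> * x)" and \<delta>: "\<delta> > 0"
    and i': "set_integrable lborel {0..} (\<phi>' w)"
  shows "((\<lambda>w. LINT x:{0..}|lborel. \<phi> w x) has_field_derivative (LINT x:{0..}|lborel. \<phi>' w x)) (at w)"
proof -
  define F where "F = (\<lambda>n w. integral (cbox 0 (real n)) (\<phi> w))"
  define F' where "F' = (\<lambda>n w. integral (cbox 0 (real n)) (\<phi>' w))"
  have "(F n has_field_derivative F' n v) (at v)" if v: "v \<in> U" for n v
  proof -
    obtain r where r: "r > 0" "ball v r \<subseteq> U" using U v openE by blast
    have "(F n has_field_derivative F' n v) (at v within ball v r)"
      unfolding F_def F'_def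
    proof (rule leibniz_rule_field_derivative)
      show "continuous_on (ball v r \<times> cbox 0 (real n)) (\<lambda>(x, t). \<phi>' x t)"
        by (rule continuous_on_subset[OF c']) (use r in auto)
      show "\<phi> x integrable_on cbox 0 (real n)" if "x \<in> ball v r" for x
        by (rule integrable_continuous, rule continuous_on_subset[OF c]) (use r that in auto)
      show "((\<lambda>x. \<phi> x t) has_field_derivative \<phi>' x t) (at x within ball v r)"
        if "x \<in> ball v r" "t \<in> cbox 0 (real n)" for x t
        by (rule has_field_derivative_at_within, rule d) (use r that in auto)
    qed (use r in auto)
    then show ?thesis using r by (simp add: at_within_open[OF _ open_ball])
  qed
  moreover have "\<exists>d>0. cball v d \<subseteq> U \<and>
      uniform_limit (cball v d) F (\<lambda>w. LINT x:{0..}|lborel. \<phi> w x) sequentially"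
    if v: "v \<in> U" for v
  proof -
    obtain r where r: "r > 0" "cball v r \<subseteq> U" using U v open_contains_cball by blast
    have "uniform_limit (cball v r) F (\<lambda>w. LINT x:{0..}|lborel. \<phi> w x) sequentially"
    proof (rule uniform_limitI)
      fix e :: real assume e: "e > 0"
      have "((\<lambda>n. C * exp (- \<delta> * real n) / \<delta>) \<longlongrightarrow> 0) sequentially"
        using \<delta> by real_asymp
      then have "eventually (\<lambda>n. C * exp (- \<delta> * real n) / \<delta> < e) sequentially"
        using e by (rule order_tendstoD)
      then show "\<forall>\<^sub>F n in sequentially. \<forall>x\<in>cball v r. dist (F n x) (LINT xa:{0..}|lborel. \<phi> x xa) < e"
      proof eventually_elim
        case (elim n)
        show ?case
        proof
          fix x assume "x \<in> cball v r"
          then have x: "x \<in> U" using r by auto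
          have "norm (integral {0..real n} (\<phi> x) - (LINT xa:{0..}|lborel. \<phi> x xa)) \<le> C * exp (- \<delta> * real n) / \<delta>"
            by (rule half_line_tail) (use x b c \<delta> in auto)
          then show "dist (F n x) (LINT xa:{0..}|lborel. \<phi> x xa) < e"
            using elim by (simp add: F_def dist_norm)
        qed
      qed
    qed
    with r show ?thesis by blast
  qed
  ultimately obtain g' where g': "\<And>x. x \<in> U \<Longrightarrow> ((\<lambda>w. LINT x:{0..}|lborel. \<phi> w x) has_field_derivative g' x) (at x)"
      "\<And>x. x \<in> U \<Longrightarrow> (\<lambda>n. F' n x) \<longlonglongrightarrow> g' x"
    using has_complex_derivative_uniform_sequence[OF U(1), of F F'] by blast
  have "(\<lambda>n. F' n w) \<longlonglongrightarrow> (LINT x:{0..}|lborel. \<phi>' w x)"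
    unfolding F'_def
    using filterlim_compose[OF half_line_tendsto[OF i'] filterlim_real_sequentially] by simp
  with g'[OF U(2)] show ?thesis using LIMSEQ_unique by metis
qed

section \<open>The Sommerfeld integral\<close>

text \<open>The integrand exp (- z sinh t + \<mu> t) after a translation of t that gives the
  dominant exponential the coefficient 1. Convergence at + \<infinity> then depends on neither m nor
  q, and both become entire parameters.\<close>

definition bessel_kernel :: "complex \<Rightarrow> complex \<Rightarrow> complex \<Rightarrow> complex" where
  "bessel_kernel m q t = exp (- exp t + q * exp (- t) + m * t)"

text \<open>The integral of \<open>bessel_kernel m q\<close> from \<open>a\<close> to \<open>+ \<infinity>\<close>, along the segment from \<open>a\<close> to \<open>0\<close> and the positive axis.\<close>

definition kernel_tail :: "complex \<Rightarrow> complex \<Rightarrow> complex \<Rightarrow> complex" where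
  "kernel_tail m q a = (LINT x:{0..}|lborel. bessel_kernel m q (of_real x))
     - contour_integral (linepath 0 a) (bessel_kernel m q)"

text \<open>\<open>exp x\<close> is replaced by x^2 / 2 and the square is completed around (M + 1) /
  k; the spare 1 in M + 1 yields the decay exp (- x).\<close>

lemma exp_dominates_linear:
  fixes k M x :: real
  assumes "k > 0" "x \<ge> 0"
  shows "- k * exp x + M * x \<le> (M + 1)\<^sup>2 / (2 * k) - x"
proof -
  have "exp x \<ge> x\<^sup>2 / 2" using exp_lower_Taylor_quadratic[OF assms(2)] assms(2) by linarith
  then have "k * exp x \<ge> k * (x\<^sup>2 / 2)" using assms by (intro mult_left_mono) auto
  moreover have "0 \<le> (k / 2) * (x - (M + 1) / k)\<^sup>2" using assms by simp
  moreover have "(k / 2) * (x - (M + 1) / k)\<^sup>2 = k * (x\<^sup>2 / 2) - (M + 1) * x + (M + 1)\<^sup>2 / (2 * k)"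
    using assms by (simp add: power2_eq_square field_simps)
  ultimately show ?thesis by (simp add: algebra_simps)
qed

lemma Re_le_norm_mult: "Re (a * b) \<le> norm a * norm b"
  by (metis complex_Re_le_cmod norm_mult)

text \<open>The constant depends on the parameters only through the bounds R, M, Q and the lower
  bound k of the cosine. One estimate thus serves single half lines, segments of varying height and
  whole neighbourhoods of parameters.\<close>

lemma norm_bessel_kernel_le:
  assumes "norm c \<le> R" "norm m \<le> M" "norm q \<le> Q" "cos (Im c) \<ge> k" "k > 0" "x \<ge> 0"
  shows "norm (bessel_kernel m q (c + of_real x))
    \<le> exp (Q * exp R + M * R + (M + 1)\<^sup>2 / (2 * (exp (- R) * k))) * exp (- 1 * x)"
proof -
  have R: "R \<ge> 0" "M \<ge> 0" "Q \<ge> 0" using assms norm_ge_zero[of c] norm_ge_zero[of m] norm_ge_zero[of q] by linarith+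
  have rc: "\<bar>Re c\<bar> \<le> R" using assms abs_Re_le_cmod[of c] by linarith
  have e1: "Re (exp (c + of_real x)) \<ge> exp (- R) * k * exp x"
  proof -
    have "exp (- R) * k * exp x \<le> exp (Re c) * cos (Im c) * exp x"
      using assms rc by (intro mult_mono) auto
    then show ?thesis unfolding Re_exp by (simp add: exp_add algebra_simps)
  qed
  have e2: "Re (q * exp (- (c + of_real x))) \<le> Q * exp R"
  proof -
    have "Re (q * exp (- (c + of_real x))) \<le> norm q * norm (exp (- (c + of_real x)))"
      by (rule Re_le_norm_mult)
    also have "\<dots> \<le> Q * exp R" using assms rc R by (intro mult_mono) auto
    finally show ?thesis .
  qed
  have e3: "Re (m * (c + of_real x)) \<le> M * R + M * x"
  proof -
    have "norm m * norm (c + of_real x) \<le> M * (R + x)"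
      using assms R norm_triangle_ineq[of c "of_real x"] by (intro mult_mono) auto
    then show ?thesis using Re_le_norm_mult[of m "c + of_real x"] by (simp add: algebra_simps)
  qed
  have "norm (bessel_kernel m q (c + of_real x)) =
      exp (- Re (exp (c + of_real x)) + Re (q * exp (- (c + of_real x))) + Re (m * (c + of_real x)))"
    by (simp add: bessel_kernel_def)
  also have "\<dots> \<le> exp (- (exp (- R) * k * exp x) + Q * exp R + (M * R + M * x))"
    using e1 e2 e3 by simp
  also have "\<dots> \<le> exp (Q * exp R + M * R + (M + 1)\<^sup>2 / (2 * (exp (- R) * k)) - x)"
    using exp_dominates_linear[of "exp (- R) * k" x M] assms by simp
  also have "\<dots> = exp (Q * exp R + M * R + (M + 1)\<^sup>2 / (2 * (exp (- R) * k))) * exp (- 1 * x)"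
    by (subst exp_add[symmetric]) simp
  finally show ?thesis .
qed

lemma bessel_kernel_holomorphic [holomorphic_intros]:
  assumes "f holomorphic_on S" "m holomorphic_on S" "q holomorphic_on S"
  shows "(\<lambda>w. bessel_kernel (m w) (q w) (f w)) holomorphic_on S"
  unfolding bessel_kernel_def by (intro holomorphic_intros assms)

lemma bessel_kernel_continuous [continuous_intros]:
  assumes "continuous_on S f" "continuous_on S m" "continuous_on S q"
  shows "continuous_on S (\<lambda>w. bessel_kernel (m w) (q w) (f w))"
  unfolding bessel_kernel_def by (intro continuous_intros assms)

lemma entire_primitive:
  assumes "f holomorphic_on UNIV"
  obtains F where "\<And>z. (F has_field_derivative f z) (at z)"
  using holomorphic_convex_primitive'[OF convex_UNIV open_UNIV assms] by auto

lemma contour_integral_linepath_primitive: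
  assumes "\<And>z. (F has_field_derivative f z) (at z)"
  shows "contour_integral (linepath a b) f = F b - F a"
    and "(f has_contour_integral (F b - F a)) (linepath a b)"
proof -
  show "(f has_contour_integral (F b - F a)) (linepath a b)"
    using contour_integral_primitive[of UNIV F f "linepath a b"] assms by auto
  then show "contour_integral (linepath a b) f = F b - F a" by (rule contour_integral_unique)
qed

text \<open>The kernel is entire in t, so one primitive turns every deformation of a path below into
  a cancellation of end values.\<close>

lemma bessel_kernel_primitive:
  obtains F where "\<And>z. (F has_field_derivative bessel_kernel m q z) (at z)"
  using entire_primitive[of "bessel_kernel m q"]
    bessel_kernel_holomorphic[OF holomorphic_on_ident holomorphic_on_const[of m] holomorphic_on_const[of q], of UNIV]
  by blast

lemma integral_horizontal_primitive:
  fixes f F :: "complex \<Rightarrow> complex"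
  assumes "\<And>z. (F has_field_derivative f z) (at z)" "a \<le> b"
  shows "integral {a..b} (\<lambda>x. f (c + of_real x)) = F (c + of_real b) - F (c + of_real a)"
proof -
  have "((\<lambda>x. f (c + of_real x)) has_integral (F (c + of_real b) - F (c + of_real a))) {a..b}"
  proof (rule fundamental_theorem_of_calculus)
    fix x assume "x \<in> {a..b}"
    have "((\<lambda>w. F (c + w)) has_field_derivative f (c + of_real x)) (at (of_real x))"
      using DERIV_shift[of F "f (c + of_real x)" "of_real x" c] assms(1) by (simp add: add.commute)
    from has_vector_derivative_real_field[OF this]
    show "((\<lambda>x. F (c + of_real x)) has_vector_derivative (f (c + of_real x))) (at x within {a..b})" .
  qed (use assms in auto)
  then show ?thesis by (simp add: integral_unique)
qed

lemma half_line_bessel_kernel_tendsto: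
  assumes "\<bar>Im c\<bar> < pi / 2"
  shows "set_integrable lborel {0..} (\<lambda>x. bessel_kernel m q (c + of_real x))"
    and "((\<lambda>X. integral {0..X} (\<lambda>x. bessel_kernel m q (c + of_real x))) \<longlongrightarrow>
         (LINT x:{0..}|lborel. bessel_kernel m q (c + of_real x))) at_top"
proof -
  have "cos (Im c) > 0" using assms by (intro cos_gt_zero_pi) auto
  then show *: "set_integrable lborel {0..} (\<lambda>x. bessel_kernel m q (c + of_real x))"
    by (intro half_line_integrable[where \<delta>=1, OF _ norm_bessel_kernel_le[of c "norm c" m "norm m" q "norm q" "cos (Im c)"]])
       (auto intro!: continuous_intros)
  show "((\<lambda>X. integral {0..X} (\<lambda>x. bessel_kernel m q (c + of_real x))) \<longlongrightarrow>
         (LINT x:{0..}|lborel. bessel_kernel m q (c + of_real x))) at_top"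
    by (rule half_line_tendsto[OF *])
qed

text \<open>Half lines of different height within |Im c| < \<pi> / 2 are joined far to the right by
  a segment on which the kernel is exponentially small.\<close>

lemma kernel_tail_path:
  assumes c: "\<bar>Im c\<bar> < pi / 2"
  shows "kernel_tail m q a =
    (LINT x:{0..}|lborel. bessel_kernel m q (c + of_real x)) + contour_integral (linepath a c) (bessel_kernel m q)"
proof -
  obtain F where F: "\<And>z. (F has_field_derivative bessel_kernel m q z) (at z)"
    using bessel_kernel_primitive[of m q] by metis
  have lim: "((\<lambda>X. F (c + of_real X) - F c) \<longlongrightarrow> (LINT x:{0..}|lborel. bessel_kernel m q (c + of_real x))) at_top"
    if "\<bar>Im c\<bar> < pi / 2" for c
    using half_line_bessel_kernel_tendsto(2)[OF that]
    by (rule Lim_transform_eventually)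
       (use integral_horizontal_primitive[OF F] in \<open>auto intro!: eventually_mono[OF eventually_ge_at_top[of 0]]\<close>)
  have cc: "cos (Im c) > 0" using c by (intro cos_gt_zero_pi) auto
  define K where "K = exp (norm q * exp (norm c) + norm m * norm c + (norm m + 1)\<^sup>2 / (2 * (exp (- norm c) * cos (Im c))))"
  have "((\<lambda>X. F (c + of_real X) - F (of_real X)) \<longlongrightarrow> 0) at_top"
  proof (rule Lim_null_comparison)
    show "\<forall>\<^sub>F X in at_top. norm (F (c + of_real X) - F (of_real X)) \<le> K * exp (- 1 * X) * norm c"
    proof (rule eventually_mono[OF eventually_ge_at_top[of 0]])
      fix X :: real assume X: "X \<ge> 0"
      have "norm (F (c + of_real X) - F (of_real X)) \<le> K * exp (- 1 * X) * norm ((c + of_real X) - of_real X)"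
      proof (rule has_contour_integral_bound_linepath[OF contour_integral_linepath_primitive(2)[OF F]])
        fix x assume "x \<in> closed_segment (complex_of_real X) (c + complex_of_real X)"
        then obtain s where s: "0 \<le> s" "s \<le> 1" "x = (1 - s) *\<^sub>R of_real X + s *\<^sub>R (c + of_real X)"
          by (auto simp: in_segment)
        then have x: "x = s *\<^sub>R c + of_real X" by (simp add: algebra_simps scaleR_conv_of_real)
        \<comment> \<open>Heights on the segment interpolate between 0 and \<open>Im c\<close>, and
          the cosine is smallest at \<open>Im c\<close>; the bound at c therefore holds on all of
          it.\<close>
        have "cos (Im c) \<le> cos (Im (s *\<^sub>R c))"
        proof -
          have "\<bar>s * Im c\<bar> \<le> 1 * \<bar>Im c\<bar>" unfolding abs_mult using s by (intro mult_mono) auto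
          then have "cos \<bar>Im c\<bar> \<le> cos \<bar>s * Im c\<bar>" using c by (intro cos_monotone_0_pi_le) auto
          then show ?thesis by simp
        qed
        then show "norm (bessel_kernel m q x) \<le> K * exp (- 1 * X)"
          unfolding x K_def using s X cc mult_right_mono[of s 1 "norm c"]
          by (intro norm_bessel_kernel_le) (auto simp: abs_of_nonneg)
      qed (simp add: K_def)
      then show "norm (F (c + of_real X) - F (of_real X)) \<le> K * exp (- 1 * X) * norm c" by simp
    qed
    show "((\<lambda>X. K * exp (- 1 * X) * norm c) \<longlongrightarrow> 0) at_top" by real_asymp
  qed
  moreover have "((\<lambda>X. (F (c + of_real X) - F c) - (F (0 + of_real X) - F 0)) \<longlongrightarrow>
     (LINT x:{0..}|lborel. bessel_kernel m q (c + of_real x)) - (LINT x:{0..}|lborel. bessel_kernel m q (0 + of_real x))) at_top"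
    by (intro tendsto_diff lim) (use c in auto)
  ultimately have "((\<lambda>X. (F (c + of_real X) - F (of_real X)) - ((F (c + of_real X) - F c) - (F (0 + of_real X) - F 0))) \<longlongrightarrow>
     0 - ((LINT x:{0..}|lborel. bessel_kernel m q (c + of_real x)) - (LINT x:{0..}|lborel. bessel_kernel m q (0 + of_real x)))) at_top"
    by (rule tendsto_diff)
  then have "((\<lambda>X::real. F c - F 0) \<longlongrightarrow>
     0 - ((LINT x:{0..}|lborel. bessel_kernel m q (c + of_real x)) - (LINT x:{0..}|lborel. bessel_kernel m q (0 + of_real x)))) at_top"
    by simp
  then have "F c - F 0 = 0 - ((LINT x:{0..}|lborel. bessel_kernel m q (c + of_real x)) - (LINT x:{0..}|lborel. bessel_kernel m q (0 + of_real x)))"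
    by (rule tendsto_unique[OF trivial_limit_at_top_linorder tendsto_const])
  then show ?thesis
    unfolding kernel_tail_def contour_integral_linepath_primitive(1)[OF F] by (simp add: algebra_simps)
qed

text \<open>All three parameters are functions of one variable since order, argument and endpoint
  move together along \<nu> = z - \<kappa>. The half line is differentiated by
  \<open>half_line_has_field_derivative\<close>; the segment is pulled back to [0, 1], which turns
  its moving endpoint into a parameter of the integrand.\<close>

lemma kernel_tail_holomorphic:
  assumes m: "m holomorphic_on UNIV" and q: "q holomorphic_on UNIV" and a: "a holomorphic_on UNIV"
  shows "(\<lambda>w. kernel_tail (m w) (q w) (a w)) holomorphic_on UNIV"
proof -
  have der: "(f has_field_derivative deriv f w) (at w)" "continuous_on UNIV (deriv f)" "continuous_on UNIV f"
    if "f holomorphic_on UNIV" for f :: "complex \<Rightarrow> complex" and w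
    using that by (auto intro: holomorphic_derivI holomorphic_on_imp_continuous_on holomorphic_deriv)
  note [continuous_intros] =
    continuous_on_compose2[OF der(3)[OF m]] continuous_on_compose2[OF der(2)[OF m]]
    continuous_on_compose2[OF der(3)[OF q]] continuous_on_compose2[OF der(2)[OF q]]
    continuous_on_compose2[OF der(3)[OF a]] continuous_on_compose2[OF der(2)[OF a]]
  have "(\<lambda>w. LINT x:{0..}|lborel. bessel_kernel (m w) (q w) (of_real x)) holomorphic_on UNIV"
    unfolding holomorphic_on_open[OF open_UNIV]
  proof
    fix w0 :: complex
    define \<phi>' where "\<phi>' = (\<lambda>w x. bessel_kernel (m w) (q w) (of_real x) *
        (deriv q w * exp (- of_real x) + deriv m w * of_real x))"
    have "bounded (m ` cball w0 1)" "bounded (q ` cball w0 1)"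
      using der(3)[OF m] der(3)[OF q]
      by (auto intro!: compact_imp_bounded compact_continuous_image intro: continuous_on_subset)
    then obtain M Q where MQ: "\<And>w. w \<in> cball w0 1 \<Longrightarrow> norm (m w) \<le> M" "\<And>w. w \<in> cball w0 1 \<Longrightarrow> norm (q w) \<le> Q"
      unfolding bounded_iff by (metis imageI)
    define K where "K = exp (Q * exp 0 + M * 0 + (M + 1)\<^sup>2 / (2 * (exp (- 0) * 1)))"
    have b: "norm (bessel_kernel (m w) (q w) (of_real x)) \<le> K * exp (- 1 * x)"
      if "w \<in> ball w0 1" "x \<ge> 0" for w x
      using norm_bessel_kernel_le[of 0 0 "m w" M "q w" Q 1 x] MQ[of w] that by (simp add: K_def)
    have "((\<lambda>w. LINT x:{0..}|lborel. bessel_kernel (m w) (q w) (of_real x)) has_field_derivative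
        (LINT x:{0..}|lborel. \<phi>' w0 x)) (at w0)"
    proof (rule half_line_has_field_derivative[of "ball w0 1" _ _ _ K 1])
      show "((\<lambda>w. bessel_kernel (m w) (q w) (complex_of_real x)) has_field_derivative \<phi>' w x) (at w)" for w x
        using DERIV_fun_exp[OF DERIV_add[OF DERIV_add[OF DERIV_const[of "- exp (of_real x)"]
            DERIV_cmult_right[OF der(1)[OF q, of w], of "exp (- of_real x)"]]
            DERIV_cmult_right[OF der(1)[OF m, of w], of "of_real x"]]]
        unfolding bessel_kernel_def \<phi>'_def by simp
      show "continuous_on {0..} (\<lambda>x. bessel_kernel (m w) (q w) (complex_of_real x))" for w
        by (intro continuous_intros)
      show "continuous_on (ball w0 1 \<times> {0..}) (\<lambda>(w, x). \<phi>' w x)"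
        unfolding \<phi>'_def case_prod_unfold by (intro continuous_intros) auto
      show "set_integrable lborel {0..} (\<phi>' w0)"
      proof (rule half_line_integrable)
        show "continuous_on {0..} (\<phi>' w0)"
          unfolding \<phi>'_def by (intro continuous_intros)
        fix x :: real assume x: "0 \<le> x"
        have "norm (deriv q w0 * exp (- of_real x) + deriv m w0 * of_real x) \<le>
              norm (deriv q w0) * exp (- x) + norm (deriv m w0) * x"
          using x norm_triangle_ineq[of "deriv q w0 * exp (- of_real x)" "deriv m w0 * of_real x"]
          by (simp add: norm_mult)
        \<comment> \<open>Half of the decay is spent on absorbing the linear factor x, which the
          derivative of the order brings down.\<close>
        also have "\<dots> \<le> norm (deriv q w0) * exp (x/2) + norm (deriv m w0) * (2 * exp (x/2))"
        proof -
          have "x \<le> 2 * exp (x/2)" using x exp_ge_add_one_self[of "x/2"] by linarith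
          then show ?thesis using x by (intro add_mono mult_left_mono) auto
        qed
        finally have "norm (\<phi>' w0 x) \<le> (K * exp (- 1 * x)) *
            (norm (deriv q w0) * exp (x/2) + norm (deriv m w0) * (2 * exp (x/2)))"
          unfolding \<phi>'_def norm_mult using b[of w0 x] x by (intro mult_mono) (auto simp: K_def)
        also have "\<dots> = (K * (norm (deriv q w0) + 2 * norm (deriv m w0))) * exp (- (1 / 2) * x)"
        proof -
          have "exp (- (1/2) * x) = exp (- 1 * x) * exp (x/2)" by (simp flip: exp_add)
          then show ?thesis by (simp add: algebra_simps)
        qed
        finally show "norm (\<phi>' w0 x) \<le> \<dots>" .
      qed auto
    qed (use b in auto)
    then show "\<exists>f'. ((\<lambda>w. LINT x:{0..}|lborel. bessel_kernel (m w) (q w) (of_real x)) has_field_derivative f') (at w0)"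
      by blast
  qed
  moreover have "(\<lambda>w. contour_integral (linepath 0 (a w)) (bessel_kernel (m w) (q w))) holomorphic_on UNIV"
  proof -
    define h' where "h' = (\<lambda>s w. - (exp (of_real s * a w) * (of_real s * deriv a w))
          + (q w * (exp (- (of_real s * a w)) * - (of_real s * deriv a w)) + deriv q w * exp (- (of_real s * a w)))
          + (m w * (of_real s * deriv a w) + deriv m w * (of_real s * a w)))"
    have "(\<lambda>w. integral (cbox 0 1) (\<lambda>s. bessel_kernel (m w) (q w) (of_real s * a w) * a w)) holomorphic_on UNIV"
    proof (rule leibniz_rule_holomorphic)
      fix w :: complex and s :: real
      have ds: "((\<lambda>w. of_real s * a w) has_field_derivative of_real s * deriv a w) (at w)"
        by (rule DERIV_cmult[OF der(1)[OF a]])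
      have "((\<lambda>w. - exp (of_real s * a w) + q w * exp (- (of_real s * a w)) + m w * (of_real s * a w))
          has_field_derivative h' s w) (at w)"
        unfolding h'_def
        by (rule DERIV_add[OF DERIV_add[OF DERIV_minus[OF DERIV_fun_exp[OF ds]]
              DERIV_mult'[OF der(1)[OF q] DERIV_fun_exp[OF DERIV_minus[OF ds]]]] DERIV_mult'[OF der(1)[OF m] ds]])
      from DERIV_mult'[OF DERIV_fun_exp[OF this] der(1)[OF a]]
      show "((\<lambda>w. bessel_kernel (m w) (q w) (complex_of_real s * a w) * a w) has_field_derivative
          bessel_kernel (m w) (q w) (of_real s * a w) * deriv a w +
          exp (- exp (of_real s * a w) + q w * exp (- (of_real s * a w)) + m w * (of_real s * a w)) * h' s w * a w) (at w within UNIV)"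
        unfolding bessel_kernel_def by simp
    qed (auto intro!: continuous_intros integrable_continuous_interval simp: case_prod_unfold h'_def)
    then show ?thesis
      by (simp add: contour_integral_integral linepath_def scaleR_conv_of_real)
  qed
  ultimately show ?thesis unfolding kernel_tail_def by (intro holomorphic_intros)
qed

text \<open>The substitution \<open>t = \<tau> - log (z / 2)\<close> turns \<open>exp (- z sinh t + \<mu> t)\<close> into \<open>bessel_kernel\<close> with
  \<open>q = (z / 2)\<^sup>2\<close>. The moving endpoint makes the integral entire in \<open>\<zeta> = log z\<close>, with no restriction on \<open>arg z\<close>.\<close>

definition sommerfeld_integral :: "complex \<Rightarrow> complex \<Rightarrow> complex" where
  "sommerfeld_integral \<mu> \<zeta> = exp (- \<mu> * (\<zeta> - of_real (ln 2))) * kernel_tail \<mu> ((exp \<zeta> / 2)\<^sup>2) (\<zeta> - of_real (ln 2))"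

lemma sommerfeld_integral_holomorphic:
  assumes "m holomorphic_on UNIV" "f holomorphic_on UNIV"
  shows "(\<lambda>w. sommerfeld_integral (m w) (f w)) holomorphic_on UNIV"
  unfolding sommerfeld_integral_def
  by (intro holomorphic_intros kernel_tail_holomorphic assms) auto

lemma half_exp_eq: "exp \<zeta> / 2 = exp (\<zeta> - of_real (ln 2))" for \<zeta> :: complex
  by (simp add: exp_diff exp_of_real)

lemma bessel_kernel_shift:
  "exp (- \<mu> * (\<zeta> - of_real (ln 2))) * bessel_kernel \<mu> ((exp \<zeta> / 2)\<^sup>2) (\<zeta> - of_real (ln 2) + t)
    = exp (- exp \<zeta> * sinh t + \<mu> * t)"
proof -
  have e1: "exp (\<zeta> - of_real (ln 2) + t) = exp \<zeta> / 2 * exp t" by (simp add: exp_add half_exp_eq)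
  have e2: "(exp \<zeta> / 2)\<^sup>2 * exp (- (\<zeta> - of_real (ln 2) + t)) = exp \<zeta> / 2 * exp (- t)"
    unfolding half_exp_eq power2_eq_square by (simp add: algebra_simps flip: exp_add)
  have e3: "exp \<zeta> * sinh t = exp \<zeta> / 2 * exp t - exp \<zeta> / 2 * exp (- t)"
    by (simp add: sinh_field_def field_simps)
  show ?thesis
    unfolding bessel_kernel_def e1 e2 by (simp add: e3 algebra_simps flip: exp_add)
qed

text \<open>The phase - z sinh t decays along p + [0, \<infinity>) when arg z + Im p lies within
  \<pi> / 2 of 0. A suitable segment from 0 to p therefore gives a convergent integral for every arg
  z, and p remains free for choosing a path of descent.\<close>

lemma sommerfeld_integral_path:
  assumes "\<bar>Im (\<zeta> + p)\<bar> < pi / 2"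
  shows "sommerfeld_integral \<mu> \<zeta> =
    contour_integral (linepath 0 p) (\<lambda>t. exp (- exp \<zeta> * sinh t + \<mu> * t))
    + (LINT x:{0..}|lborel. exp (- exp \<zeta> * sinh (p + of_real x) + \<mu> * (p + of_real x)))"
    and "set_integrable lborel {0..} (\<lambda>x. exp (- exp \<zeta> * sinh (p + of_real x) + \<mu> * (p + of_real x)))"
proof -
  let ?q = "(exp \<zeta> / 2)\<^sup>2" and ?e = "exp (- \<mu> * (\<zeta> - of_real (ln 2)))"
  have 1: "?e * (LINT x:{0..}|lborel. bessel_kernel \<mu> ?q (\<zeta> - of_real (ln 2) + p + of_real x))
    = (LINT x:{0..}|lborel. exp (- exp \<zeta> * sinh (p + of_real x) + \<mu> * (p + of_real x)))"
    by (subst set_integral_mult_right[symmetric])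
       (simp only: bessel_kernel_shift add.assoc)
  have 2: "?e * contour_integral (linepath (\<zeta> - of_real (ln 2)) (\<zeta> - of_real (ln 2) + p)) (bessel_kernel \<mu> ?q)
    = contour_integral (linepath 0 p) (\<lambda>t. exp (- exp \<zeta> * sinh t + \<mu> * t))"
  proof -
    have "?e * contour_integral (linepath (\<zeta> - of_real (ln 2)) (\<zeta> - of_real (ln 2) + p)) (bessel_kernel \<mu> ?q)
      = ?e * integral {0..1} (\<lambda>s. bessel_kernel \<mu> ?q (\<zeta> - of_real (ln 2) + of_real s * p) * p)"
      by (simp add: contour_integral_integral linepath_def scaleR_conv_of_real algebra_simps)
    also have "\<dots> = integral {0..1} (\<lambda>s. ?e * bessel_kernel \<mu> ?q (\<zeta> - of_real (ln 2) + of_real s * p) * p)"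
      by (simp flip: mult.assoc integral_mult_right)
    also have "\<dots> = integral {0..1} (\<lambda>s. exp (- exp \<zeta> * sinh (of_real s * p) + \<mu> * (of_real s * p)) * p)"
      by (simp only: bessel_kernel_shift)
    also have "\<dots> = contour_integral (linepath 0 p) (\<lambda>t. exp (- exp \<zeta> * sinh t + \<mu> * t))"
      by (simp add: contour_integral_integral linepath_def scaleR_conv_of_real)
    finally show ?thesis .
  qed
  show "sommerfeld_integral \<mu> \<zeta> = contour_integral (linepath 0 p) (\<lambda>t. exp (- exp \<zeta> * sinh t + \<mu> * t))
    + (LINT x:{0..}|lborel. exp (- exp \<zeta> * sinh (p + of_real x) + \<mu> * (p + of_real x)))"
  proof -
    have "\<bar>Im (\<zeta> - of_real (ln 2) + p)\<bar> < pi / 2" using assms by simp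
    from kernel_tail_path[OF this, of \<mu> ?q "\<zeta> - of_real (ln 2)"] show ?thesis
      unfolding sommerfeld_integral_def by (simp only: distrib_left 1 2) (rule add.commute)
  qed
  have "set_integrable lborel {0..} (\<lambda>x. ?e * bessel_kernel \<mu> ?q (\<zeta> - of_real (ln 2) + p + of_real x))"
    by (intro set_integrable_mult_right half_line_bessel_kernel_tendsto) (use assms in simp)
  then show "set_integrable lborel {0..} (\<lambda>x. exp (- exp \<zeta> * sinh (p + of_real x) + \<mu> * (p + of_real x)))"
    by (simp only: bessel_kernel_shift add.assoc)
qed

section \<open>Half turns, reflection of the order, and the derivative\<close>

lemma kernel_tail_diff:
  "kernel_tail m q a - kernel_tail m q b = contour_integral (linepath a b) (bessel_kernel m q)"
proof -
  obtain F where F: "\<And>z. (F has_field_derivative bessel_kernel m q z) (at z)"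
    using bessel_kernel_primitive[of m q] by metis
  show ?thesis
    unfolding kernel_tail_def contour_integral_linepath_primitive(1)[OF F] by simp
qed

lemma exp_add_pm_pi_i:
  assumes "w = \<i> * of_real pi \<or> w = - (\<i> * of_real pi)"
  shows "exp (\<zeta> + w) = - exp \<zeta>" "exp (\<zeta> - w) = - exp \<zeta>" "sinh (w - t) = sinh t"
proof -
  have e: "exp w = -1" "exp (- w) = -1" using assms by (auto simp: exp_minus)
  show "exp (\<zeta> + w) = - exp \<zeta>" "exp (\<zeta> - w) = - exp \<zeta>"
    using e exp_add[of \<zeta> w] exp_add[of \<zeta> "-w"] by auto
  show "sinh (w - t) = sinh t"
    using e exp_add[of w "-t"] exp_add[of "-w" t] by (simp add: sinh_field_def)
qed

text \<open>A half turn leaves q = (z / 2)^2 unchanged; only the endpoint of the tail moves, by w.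
  The difference is an integral of the unrotated integrand over the segment between w and 0.\<close>

lemma sommerfeld_integral_rotate:
  assumes w: "w = \<i> * of_real pi \<or> w = - (\<i> * of_real pi)"
  shows "sommerfeld_integral \<mu> (\<zeta> + w) = exp (- \<mu> * w) * (sommerfeld_integral \<mu> \<zeta>
    + contour_integral (linepath w 0) (\<lambda>t. exp (- exp \<zeta> * sinh t + \<mu> * t)))"
proof -
  define a where "a = \<zeta> - of_real (ln 2)"
  define q where "q = (exp \<zeta> / 2)\<^sup>2"
  define g where "g = (\<lambda>t. exp (- exp \<zeta> * sinh t + \<mu> * t))"
  have shift: "exp (- \<mu> * a) * bessel_kernel \<mu> q (a + t) = g t" for t
    using bessel_kernel_shift[of \<mu> \<zeta> t] by (simp add: a_def q_def g_def)
  obtain F where F: "\<And>z. (F has_field_derivative bessel_kernel \<mu> q z) (at z)"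
    using bessel_kernel_primitive[of \<mu> q] by metis
  have "((\<lambda>t. exp (- \<mu> * a) * F (a + t)) has_field_derivative g t) (at t)" for t
    unfolding shift[symmetric]
    using DERIV_shift[of F "bessel_kernel \<mu> q (t + a)" t a] F[of "t + a"]
    by (intro DERIV_cmult) (simp add: add.commute)
  from contour_integral_linepath_primitive(1)[OF this, of w 0]
  have g: "contour_integral (linepath w 0) g = exp (- \<mu> * a) * (F a - F (a + w))" by (simp add: right_diff_distrib)
  have kt: "kernel_tail \<mu> q (a + w) = kernel_tail \<mu> q a + (F a - F (a + w))"
    using kernel_tail_diff[of \<mu> q "a + w" a] contour_integral_linepath_primitive(1)[OF F] by (simp add: algebra_simps)
  have "exp (- \<mu> * (a + w)) = exp (- \<mu> * w) * exp (- \<mu> * a)" by (simp add: algebra_simps flip: exp_add)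
  moreover have "\<zeta> + w - of_real (ln 2) = a + w" "(exp (\<zeta> + w) / 2)\<^sup>2 = q"
    using exp_add_pm_pi_i(1)[OF w] by (simp_all add: a_def q_def)
  ultimately show ?thesis
    unfolding sommerfeld_integral_def g_def[symmetric] g
    by (simp only: kt a_def[symmetric] q_def[symmetric] distrib_left mult.assoc)
qed

text \<open>Both sides are the same Hankel integral, read from either end of its contour.\<close>

lemma sommerfeld_integral_reflect:
  assumes w: "w = \<i> * of_real pi \<or> w = - (\<i> * of_real pi)"
  shows "sommerfeld_integral \<nu> (\<zeta> + w) + sommerfeld_integral (- \<nu>) \<zeta>
    = exp (- \<nu> * w) * (sommerfeld_integral (- \<nu>) (\<zeta> + w) + sommerfeld_integral \<nu> \<zeta>)"
proof -
  define g where "g = (\<lambda>\<nu> t. exp (- exp \<zeta> * sinh t + \<nu> * t))"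
  have "g (- \<nu>) holomorphic_on UNIV" unfolding g_def sinh_field_def
    by (intro holomorphic_intros) auto
  then obtain G where G: "\<And>z. (G has_field_derivative g (- \<nu>) z) (at z)"
    by (rule entire_primitive) auto
  \<comment> \<open>The substitution t \<rightarrow> w - t fixes sinh t, changes the sign of \<nu>
    up to the factor \<open>exp (\<nu> * w)\<close>, and interchanges the ends of the
    segment.\<close>
  have "g \<nu> t = - (exp (\<nu> * w) * (- g (- \<nu>) (w - t)))" for t
    unfolding g_def exp_add_pm_pi_i(3)[OF w] by (simp add: algebra_simps flip: exp_add)
  moreover have "((\<lambda>t. - (exp (\<nu> * w) * G (w - t))) has_field_derivative - (exp (\<nu> * w) * (- g (- \<nu>) (w - t)))) (at t)" for t
    by (auto intro!: derivative_eq_intros DERIV_chain2[where f=G] G)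
  ultimately have "((\<lambda>t. - (exp (\<nu> * w) * G (w - t))) has_field_derivative g \<nu> t) (at t)" for t by simp
  from contour_integral_linepath_primitive(1)[OF this, of w 0]
  have "contour_integral (linepath w 0) (g \<nu>) = exp (\<nu> * w) * (G 0 - G w)" by (simp add: algebra_simps)
  then have "contour_integral (linepath w 0) (g \<nu>) = exp (\<nu> * w) * contour_integral (linepath w 0) (g (- \<nu>))"
    using contour_integral_linepath_primitive(1)[OF G] by simp
  moreover have "exp (\<nu> * w) * exp (- \<nu> * w) = 1" by (simp flip: exp_add)
  moreover have "sommerfeld_integral \<nu> (\<zeta> + w) =
      exp (- \<nu> * w) * (sommerfeld_integral \<nu> \<zeta> + contour_integral (linepath w 0) (g \<nu>))"
    unfolding g_def by (rule sommerfeld_integral_rotate[OF w])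
  moreover have "sommerfeld_integral (- \<nu>) (\<zeta> + w) =
      exp (\<nu> * w) * (sommerfeld_integral (- \<nu>) \<zeta> + contour_integral (linepath w 0) (g (- \<nu>)))"
    using sommerfeld_integral_rotate[OF w, of "- \<nu>" \<zeta>] unfolding g_def by simp
  ultimately show ?thesis by algebra
qed

text \<open>For |arg z| < \<pi> / 2 the straight path converges, and the factor - z sinh t brought
  down by differentiation splits into the orders \<mu> - 1 and \<mu> + 1. Both sides are entire in
  \<zeta>, so the identity continues to all arguments.\<close>

lemma sommerfeld_integral_deriv:
  "deriv (sommerfeld_integral \<mu>) \<zeta> =
     exp \<zeta> / 2 * (sommerfeld_integral (\<mu> - 1) \<zeta> - sommerfeld_integral (\<mu> + 1) \<zeta>)"
proof -
  have hol: "sommerfeld_integral m holomorphic_on UNIV" for m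
    using sommerfeld_integral_holomorphic[of "\<lambda>_. m" "\<lambda>w. w"] by (simp add: holomorphic_on_const holomorphic_on_ident)
  define S where "S = {\<zeta>::complex. - (pi/2) < Im \<zeta> \<and> Im \<zeta> < pi/2}"
  have S: "open S" unfolding S_def Collect_conj_eq
    by (intro open_Int open_Collect_less continuous_intros)
  have rep: "sommerfeld_integral m \<zeta> = (LINT x:{0..}|lborel. exp (- exp \<zeta> * sinh (of_real x) + m * of_real x))"
    and int: "set_integrable lborel {0..} (\<lambda>x. exp (- exp \<zeta> * sinh (of_real x) + m * of_real x))"
    if "\<zeta> \<in> S" for \<zeta> m
  proof -
    have "\<bar>Im (\<zeta> + 0)\<bar> < pi / 2" using that by (auto simp: S_def)
    from sommerfeld_integral_path[OF this, of m] show
      "sommerfeld_integral m \<zeta> = (LINT x:{0..}|lborel. exp (- exp \<zeta> * sinh (of_real x) + m * of_real x))"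
      "set_integrable lborel {0..} (\<lambda>x. exp (- exp \<zeta> * sinh (of_real x) + m * of_real x))"
      by simp_all
  qed
  have "deriv (sommerfeld_integral \<mu>) \<zeta> =
     exp \<zeta> / 2 * (sommerfeld_integral (\<mu> - 1) \<zeta> - sommerfeld_integral (\<mu> + 1) \<zeta>)"
    if \<zeta>: "\<zeta> \<in> S" for \<zeta>
  proof -
    obtain r where r: "r > 0" "cball \<zeta> r \<subseteq> S" using S \<zeta> open_contains_cball by blast
    define R where "R = norm \<zeta> + r + ln 2"
    have "\<exists>w\<in>cball \<zeta> r. \<forall>w'\<in>cball \<zeta> r. cos (Im w) \<le> cos (Im w')"
      by (intro continuous_attains_inf continuous_intros) (use r in auto)
    then obtain w0 where w0: "w0 \<in> cball \<zeta> r" "\<And>w. w \<in> cball \<zeta> r \<Longrightarrow> cos (Im w0) \<le> cos (Im w)" by blast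
    have k: "cos (Im w0) > 0" using w0 r by (intro cos_gt_zero_pi) (auto simp: S_def)
    define Q where "Q = (exp R / 2)\<^sup>2"
    define K where "K = exp (norm \<mu> * R) * exp (Q * exp R + norm \<mu> * R + (norm \<mu> + 1)\<^sup>2 / (2 * (exp (- R) * cos (Im w0))))"
    define \<phi> where "\<phi> = (\<lambda>m \<zeta> x. exp (- exp \<zeta> * sinh (complex_of_real x) + m * of_real x))"
    have b: "norm (\<phi> \<mu> w x) \<le> K * exp (- 1 * x)" if w: "w \<in> ball \<zeta> r" and x: "x \<ge> 0" for w x
    proof -
      have nw: "norm w \<le> norm \<zeta> + r" using w norm_triangle_ineq4[of \<zeta> "\<zeta> - w"] by (auto simp: dist_norm)
      have n: "norm (w - of_real (ln 2)) \<le> R"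
        unfolding R_def using nw norm_triangle_ineq4[of w "of_real (ln 2)"] by simp
      have q: "norm ((exp w / 2)\<^sup>2) \<le> Q"
      proof -
        have "Re w \<le> norm \<zeta> + r + ln 2" using nw abs_Re_le_cmod[of w] ln2_ge_two_thirds by linarith
        then show ?thesis
          unfolding Q_def norm_power norm_divide by (intro power_mono divide_right_mono) (auto simp: R_def)
      qed
      have "norm (exp (- \<mu> * (w - of_real (ln 2)))) \<le> exp (norm \<mu> * R)"
        using complex_Re_le_cmod[of "- \<mu> * (w - of_real (ln 2))"] mult_left_mono[OF n, of "norm \<mu>"]
        by (simp add: norm_mult)
      moreover have "norm (bessel_kernel \<mu> ((exp w / 2)\<^sup>2) (w - of_real (ln 2) + of_real x))
        \<le> exp (Q * exp R + norm \<mu> * R + (norm \<mu> + 1)\<^sup>2 / (2 * (exp (- R) * cos (Im w0)))) * exp (- 1 * x)"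
        by (rule norm_bessel_kernel_le) (use n q x k w0(2)[of w] w in auto)
      ultimately show ?thesis
        unfolding \<phi>_def bessel_kernel_shift[symmetric] norm_mult K_def mult.assoc
        by (intro mult_mono) auto
    qed
    define \<phi>' where "\<phi>' = (\<lambda>\<zeta> x. exp \<zeta> / 2 * (\<phi> (\<mu> - 1) \<zeta> x - \<phi> (\<mu> + 1) \<zeta> x))"
    have "((\<lambda>w. LINT x:{0..}|lborel. \<phi> \<mu> w x) has_field_derivative (LINT x:{0..}|lborel. \<phi>' \<zeta> x)) (at \<zeta>)"
    proof (rule half_line_has_field_derivative[of "ball \<zeta> r" _ _ _ K 1])
      show "((\<lambda>w. \<phi> \<mu> w x) has_field_derivative \<phi>' w x) (at w)" for w x
      proof -
        have eq: "\<phi>' w x = \<phi> \<mu> w x * (- exp w * sinh (of_real x))"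
        proof -
          have "\<phi> (\<mu> - 1) w x = \<phi> \<mu> w x * exp (- of_real x)" "\<phi> (\<mu> + 1) w x = \<phi> \<mu> w x * exp (of_real x)"
            by (simp_all add: \<phi>_def algebra_simps flip: exp_add)
          then show ?thesis unfolding \<phi>'_def sinh_field_def by (simp add: field_simps)
        qed
        show ?thesis unfolding eq unfolding \<phi>_def
          by (rule derivative_eq_intros refl | simp)+
      qed
      show "set_integrable lborel {0..} (\<phi>' \<zeta>)"
        unfolding \<phi>'_def \<phi>_def by (intro set_integrable_mult_right set_integral_diff int \<zeta>)
    qed (use r b in \<open>auto simp: \<phi>_def \<phi>'_def case_prod_unfold intro!: continuous_intros\<close>)
    moreover have "(LINT x:{0..}|lborel. \<phi>' \<zeta> x) =
      exp \<zeta> / 2 * (sommerfeld_integral (\<mu> - 1) \<zeta> - sommerfeld_integral (\<mu> + 1) \<zeta>)"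
      unfolding \<phi>'_def rep[OF \<zeta>] \<phi>_def by (simp only: set_integral_mult_right set_integral_diff(2)[OF int[OF \<zeta>] int[OF \<zeta>]])
    ultimately have "((\<lambda>w. LINT x:{0..}|lborel. \<phi> \<mu> w x) has_field_derivative
      exp \<zeta> / 2 * (sommerfeld_integral (\<mu> - 1) \<zeta> - sommerfeld_integral (\<mu> + 1) \<zeta>)) (at \<zeta>)" by simp
    then have "(sommerfeld_integral \<mu> has_field_derivative
      exp \<zeta> / 2 * (sommerfeld_integral (\<mu> - 1) \<zeta> - sommerfeld_integral (\<mu> + 1) \<zeta>)) (at \<zeta>)"
      by (rule has_field_derivative_transform_within_open[OF _ S \<zeta>]) (simp add: rep \<phi>_def)
    then show ?thesis by (rule DERIV_imp_deriv)
  qed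
  moreover have "0 \<in> S" by (simp add: S_def)
  ultimately show ?thesis
    by (intro analytic_continuation_open[of S UNIV "deriv (sommerfeld_integral \<mu>)"
        "\<lambda>\<zeta>. exp \<zeta> / 2 * (sommerfeld_integral (\<mu> - 1) \<zeta> - sommerfeld_integral (\<mu> + 1) \<zeta>)" \<zeta>])
       (auto intro!: holomorphic_intros holomorphic_deriv hol S)
qed

section \<open>Bessel and Hankel functions as Sommerfeld integrals\<close>

text \<open>Boundedness of h makes the integrated terms O((|q| B)^k / k!), so the exponential series
  may be integrated term by term. Both parts of Schlaefli's contour, the tails and the vertical
  segment, are expanded in q this way.\<close>

lemma exp_series_set_integral:
  fixes g h :: "real \<Rightarrow> complex"
  assumes g: "set_integrable lborel S g" and h: "continuous_on S h" and S: "S \<in> sets borel"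
    and B: "\<And>x. x \<in> S \<Longrightarrow> norm (h x) \<le> B"
  shows "(\<lambda>k. q ^ k / fact k * (LINT x:S|lborel. g x * h x ^ k)) sums (LINT x:S|lborel. g x * exp (q * h x))"
proof -
  define f where "f = (\<lambda>k x. indicator S x *\<^sub>R (q ^ k / fact k * (g x * h x ^ k)))"
  have n: "norm (f k x) \<le> norm ((norm q ^ k / fact k * B ^ k) *\<^sub>R (indicator S x *\<^sub>R norm (g x)))" for k x
  proof (cases "x \<in> S")
    case True
    have "norm (h x) ^ k \<le> B ^ k" by (intro power_mono B True) auto
    then have "norm q ^ k / fact k * (norm (g x) * norm (h x) ^ k) \<le> norm q ^ k / fact k * (norm (g x) * B ^ k)"
      by (intro mult_left_mono) auto
    moreover have "B \<ge> 0" using B[OF True] norm_ge_zero[of "h x"] by linarith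
    ultimately show ?thesis using True
      by (simp add: f_def norm_mult norm_divide norm_power abs_mult algebra_simps)
  qed (auto simp: f_def)
  have gi: "integrable lborel (\<lambda>x. indicator S x *\<^sub>R norm (g x))"
    using set_integrable_norm[OF g] by (simp add: set_integrable_def)
  have int: "integrable lborel (f k)" for k
  proof (rule Bochner_Integration.integrable_bound)
    show "integrable lborel (\<lambda>x. (norm q ^ k / fact k * B ^ k) *\<^sub>R (indicator S x *\<^sub>R norm (g x)))"
      using gi by simp
    have "(\<lambda>x. indicator S x *\<^sub>R g x) \<in> borel_measurable borel"
      using g by (auto simp: set_integrable_def)
    moreover have "(\<lambda>x. indicator S x *\<^sub>R h x ^ k) \<in> borel_measurable borel"
      by (intro borel_measurable_continuous_on_indicator continuous_intros h S)
    ultimately have "(\<lambda>x. q ^ k / fact k * ((indicator S x *\<^sub>R g x) * (indicator S x *\<^sub>R h x ^ k))) \<in> borel_measurable borel"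
      by measurable
    moreover have "f k = (\<lambda>x. q ^ k / fact k * ((indicator S x *\<^sub>R g x) * (indicator S x *\<^sub>R h x ^ k)))"
      by (auto simp: f_def fun_eq_iff indicator_def)
    ultimately show "f k \<in> borel_measurable lborel" by simp
  qed (use n in auto)
  have "(\<lambda>k. integral\<^sup>L lborel (f k)) sums (\<integral>x. (\<Sum>k. f k x) \<partial>lborel)"
  proof (rule sums_integral)
    show "AE x in lborel. summable (\<lambda>k. norm (f k x))"
    proof (rule AE_I2)
      fix x
      have "summable (\<lambda>k. (norm q ^ k / fact k * norm (h x) ^ k))"
        using summable_norm_exp[of "q * h x"] by (simp add: norm_mult norm_power power_mult_distrib divide_inverse mult_ac)
      then have "summable (\<lambda>k. (norm q ^ k / fact k * norm (h x) ^ k) * (indicator S x * norm (g x)))"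
        by (rule summable_mult2)
      moreover have "norm (f k x) = (norm q ^ k / fact k * norm (h x) ^ k) * (indicator S x * norm (g x))" for k
        by (simp add: f_def norm_mult norm_divide norm_power)
      ultimately show "summable (\<lambda>k. norm (f k x))" by simp
    qed
    have "norm (\<integral>x. norm (f k x) \<partial>lborel) \<le> (norm q * \<bar>B\<bar>) ^ k / fact k * (\<integral>x. indicator S x *\<^sub>R norm (g x) \<partial>lborel)" for k
    proof -
      have "(\<integral>x. norm (f k x) \<partial>lborel) \<le> (\<integral>x. \<bar>norm q ^ k / fact k * B ^ k\<bar> *\<^sub>R (indicator S x *\<^sub>R norm (g x)) \<partial>lborel)"
      proof (rule integral_mono)
        show "integrable lborel (\<lambda>x. norm (f k x))" by (rule integrable_norm[OF int])
        show "integrable lborel (\<lambda>x. \<bar>norm q ^ k / fact k * B ^ k\<bar> *\<^sub>R (indicator S x *\<^sub>R norm (g x)))"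
          using gi by (rule integrable_scaleR_right)
        show "norm (f k x) \<le> \<bar>norm q ^ k / fact k * B ^ k\<bar> *\<^sub>R (indicator S x *\<^sub>R norm (g x))" for x
          using n[of k x] by (simp only: norm_scaleR real_norm_def abs_mult abs_norm_cancel abs_indicator real_scaleR_def)
      qed
      then show ?thesis by (simp add: power_mult_distrib abs_mult power_abs)
    qed
    note bound = this
    have "summable (\<lambda>k. (norm q * \<bar>B\<bar>) ^ k / fact k)"
      using summable_exp[of "norm q * \<bar>B\<bar>"] by (simp add: divide_inverse_commute)
    then have "summable (\<lambda>k. (norm q * \<bar>B\<bar>) ^ k / fact k * (\<integral>x. indicator S x *\<^sub>R norm (g x) \<partial>lborel))"
      by (rule summable_mult2)
    then show "summable (\<lambda>k. \<integral>x. norm (f k x) \<partial>lborel)"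
      by (rule summable_comparison_test'[where N=0]) (rule bound)
  qed (rule int)
  moreover have "(\<Sum>k. f k x) = indicator S x *\<^sub>R (g x * exp (q * h x))" for x
  proof -
    have "(\<lambda>k. indicator S x * g x * ((q * h x) ^ k /\<^sub>R fact k)) sums (indicator S x * g x * exp (q * h x))"
      by (intro sums_mult exp_converges)
    moreover have "f k x = indicator S x * g x * ((q * h x) ^ k /\<^sub>R fact k)" for k
      by (simp add: f_def indicator_def power_mult_distrib scaleR_conv_of_real divide_inverse)
    ultimately show ?thesis by (cases "x \<in> S") (simp_all add: sums_iff)
  qed
  moreover have "integral\<^sup>L lborel (f k) = q ^ k / fact k * (LINT x:S|lborel. g x * h x ^ k)" for k
    unfolding f_def set_lebesgue_integral_def
    by (simp flip: integral_mult_right_zero)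
  ultimately show ?thesis by (simp add: set_lebesgue_integral_def)
qed

text \<open>Each power of exp (- t) lowers the order by 1, so the coefficients in q are again tails,
  now with q = 0.\<close>

lemma kernel_tail_sums:
  "(\<lambda>k. q ^ k / fact k * kernel_tail (- \<nu> - of_nat k) 0 0) sums kernel_tail (- \<nu>) q 0"
proof -
  have t: "kernel_tail m q 0 = (LINT x:{0..}|lborel. bessel_kernel m q (of_real x))" for m q
    by (simp add: kernel_tail_def contour_integral_trivial)
  have "(\<lambda>k. q ^ k / fact k * (LINT x:{0..}|lborel. bessel_kernel (- \<nu>) 0 (of_real x) * exp (- of_real x) ^ k))
    sums (LINT x:{0..}|lborel. bessel_kernel (- \<nu>) 0 (of_real x) * exp (q * exp (- of_real x)))"
    by (rule exp_series_set_integral[where B=1])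
       (use half_line_bessel_kernel_tendsto(1)[of 0 "- \<nu>" 0] in \<open>auto intro!: continuous_intros\<close>)
  moreover have "bessel_kernel (- \<nu>) 0 (of_real x) * exp (- of_real x) ^ k = bessel_kernel (- \<nu> - of_nat k) 0 (of_real x)" for x k
    unfolding bessel_kernel_def by (simp add: algebra_simps flip: exp_add exp_of_nat_mult)
  moreover have "bessel_kernel (- \<nu>) 0 (of_real x) * exp (q * exp (- of_real x)) = bessel_kernel (- \<nu>) q (of_real x)" for x
    unfolding bessel_kernel_def by (simp add: algebra_simps flip: exp_add)
  ultimately show ?thesis by (simp add: t)
qed

text \<open>The vertical piece of Schlaefli's contour for the Bessel function of the first kind. The
  two rays at heights - \<pi> and \<pi> are carried by \<open>kernel_tail\<close>, because exp (x
  \<plusminus> \<i> \<pi>) = - exp x.\<close>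

definition hankel_loop :: "complex \<Rightarrow> complex \<Rightarrow> complex" where
  "hankel_loop \<nu> q = contour_integral (linepath (- (\<i> * of_real pi)) (\<i> * of_real pi)) (\<lambda>t. exp (exp t - q * exp (- t) - \<nu> * t))"

lemma hankel_loop_sums:
  "(\<lambda>k. (- q) ^ k / fact k * hankel_loop (\<nu> + of_nat k) 0) sums hankel_loop \<nu> q"
proof -
  define p where "p = linepath (- (\<i> * of_real pi)) (\<i> * complex_of_real pi)"
  have p: "continuous_on S p" "Re (p s) = 0" for s S
    unfolding p_def by (intro continuous_intros) (simp add: linepath_def)
  define c where "c = \<i> * complex_of_real pi - - (\<i> * of_real pi)"
  have t: "hankel_loop m q = (LINT s:{0..1}|lborel. exp (exp (p s) - q * exp (- p s) - m * p s) * c)" for m q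
  proof -
    have "set_integrable lborel {0..1} (\<lambda>s. exp (exp (p s) - q * exp (- p s) - m * p s) * c)"
      by (intro borel_integrable_atLeastAtMost' continuous_intros p)
    from set_borel_integral_eq_integral(2)[OF this] show ?thesis
      unfolding hankel_loop_def contour_integral_integral p_def c_def by simp
  qed
  have "(\<lambda>k. (- q) ^ k / fact k * (LINT s:{0..1}|lborel. exp (exp (p s) - \<nu> * p s) * c * exp (- p s) ^ k))
    sums (LINT s:{0..1}|lborel. exp (exp (p s) - \<nu> * p s) * c * exp ((- q) * exp (- p s)))"
    by (rule exp_series_set_integral[where B=1])
       (auto intro!: continuous_intros borel_integrable_atLeastAtMost' p simp: p(2))
  moreover have "exp (exp (p s) - \<nu> * p s) * c * exp (- p s) ^ k = exp (exp (p s) - 0 * exp (- p s) - (\<nu> + of_nat k) * p s) * c" for s k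
    by (simp add: algebra_simps flip: exp_add exp_of_nat_mult mult.assoc)
  moreover have "exp (exp (p s) - \<nu> * p s) * c * exp ((- q) * exp (- p s)) = exp (exp (p s) - q * exp (- p s) - \<nu> * p s) * c" for s
    by (simp add: algebra_simps flip: exp_add mult.assoc)
  ultimately show ?thesis by (simp only: t)
qed

text \<open>Translation by w and by - w turns both tails into integrals of the same entire function
  k, so the dependence on a cancels. The freedom of a is used twice: a = log (z / 2) for the Bessel
  function, and real a \<rightarrow> - \<infinity> for Euler's integral.\<close>

lemma kernel_tail_hankel_loop:
  defines "w \<equiv> \<i> * of_real pi"
  shows "exp (- \<nu> * w) * kernel_tail (- \<nu>) q (a - w) - exp (\<nu> * w) * kernel_tail (- \<nu>) q (a + w)
    = (exp (- \<nu> * w) - exp (\<nu> * w)) * kernel_tail (- \<nu>) q 0 + hankel_loop \<nu> q"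
proof -
  define k where "k = (\<lambda>t. exp (exp t - q * exp (- t) - \<nu> * t))"
  have w: "exp w = -1" "exp (-w) = -1" by (simp_all add: w_def exp_minus)
  obtain F where F: "\<And>z. (F has_field_derivative bessel_kernel (- \<nu>) q z) (at z)"
    using bessel_kernel_primitive[of "- \<nu>" q] by metis
  have k1: "exp (\<nu> * w) * bessel_kernel (- \<nu>) q (t + w) = k t" for t
    using w exp_add[of t w] exp_add[of "-t" "-w"] unfolding bessel_kernel_def k_def
    by (simp add: algebra_simps flip: exp_add)
  have k2: "exp (- \<nu> * w) * bessel_kernel (- \<nu>) q (t - w) = k t" for t
    using w exp_add[of t "-w"] exp_add[of "-t" "w"] unfolding bessel_kernel_def k_def
    by (simp add: algebra_simps flip: exp_add)
  have G1: "((\<lambda>t. exp (\<nu> * w) * F (t + w)) has_field_derivative k t) (at t)" for t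
    unfolding k1[symmetric] using DERIV_shift[of F "bessel_kernel (- \<nu>) q (t + w)" t w] F by (intro DERIV_cmult) simp
  have G2: "((\<lambda>t. exp (- \<nu> * w) * F (t - w)) has_field_derivative k t) (at t)" for t
    unfolding k2[symmetric] using DERIV_shift[of F "bessel_kernel (- \<nu>) q (t - w)" t "-w"] F by (intro DERIV_cmult) simp
  have "exp (\<nu> * w) * F (w + w) - exp (\<nu> * w) * F (a + w) = exp (- \<nu> * w) * F 0 - exp (- \<nu> * w) * F (a - w)"
    using contour_integral_linepath_primitive(1)[OF G1, of a w]
      contour_integral_linepath_primitive(1)[OF G2, of a w] by simp
  moreover have "hankel_loop \<nu> q = exp (\<nu> * w) * F (w + w) - exp (\<nu> * w) * F 0"
    using contour_integral_linepath_primitive(1)[OF G1, of "-w" w] by (simp add: hankel_loop_def w_def k_def)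
  ultimately show ?thesis
    unfolding kernel_tail_def contour_integral_linepath_primitive(1)[OF F] by algebra
qed

text \<open>Euler's integral under the substitution u = exp x; the half line from a exhausts the
  real axis as a tends to - \<infinity>.\<close>

lemma kernel_tail_Gamma:
  assumes s: "Re s > 0"
  shows "((\<lambda>a. kernel_tail s 0 (of_real a)) \<longlongrightarrow> Gamma s) at_bot"
proof -
  define f where "f = (\<lambda>t. complex_of_real t powr (s - 1) / of_real (exp t))"
  have r: "range exp = {0::real<..}" by (auto simp: image_iff) (metis exp_ln)
  have "f absolutely_integrable_on (range exp) \<and> integral (range exp) f = Gamma s"
    unfolding r f_def using absolutely_integrable_Gamma_integral'[OF s] Gamma_integral_complex'[OF s]
    by (auto simp: integral_unique)
  then have *: "(\<lambda>x. \<bar>exp x\<bar> *\<^sub>R f (exp x)) absolutely_integrable_on UNIV \<and> integral UNIV (\<lambda>x. \<bar>exp x\<bar> *\<^sub>R f (exp x)) = Gamma s"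
    by (subst has_absolute_integral_change_of_variables_real) (auto intro!: derivative_eq_intros simp: inj_on_def)
  have "\<bar>exp x\<bar> *\<^sub>R f (exp x) = bessel_kernel s 0 (of_real x)" for x
  proof -
    have "complex_of_real (exp x) powr (s - 1) = exp ((s - 1) * of_real x)"
      by (simp add: powr_def Ln_of_real)
    moreover have "c / complex_of_real (exp (exp x)) = c * exp (- exp (of_real x))" for c
      by (simp add: exp_minus exp_of_real divide_inverse)
    ultimately have "\<bar>exp x\<bar> *\<^sub>R f (exp x) = exp (of_real x) * (exp ((s - 1) * of_real x) * exp (- exp (of_real x)))"
      by (simp add: f_def scaleR_conv_of_real exp_of_real)
    then show ?thesis by (simp add: bessel_kernel_def algebra_simps flip: exp_add)
  qed
  with * have "(\<lambda>x. bessel_kernel s 0 (of_real x)) absolutely_integrable_on UNIV"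
    and I: "integral UNIV (\<lambda>x. bessel_kernel s 0 (of_real x)) = Gamma s" by simp_all
  then have int: "set_integrable lborel UNIV (\<lambda>x. bessel_kernel s 0 (complex_of_real x))"
    unfolding set_integrable_def
    by (subst (asm) integrable_completion)
       (auto intro!: borel_measurable_continuous_onI continuous_intros)
  have int1: "set_integrable lborel {..0} (\<lambda>x. bessel_kernel s 0 (complex_of_real x))"
    and int2: "set_integrable lborel {0<..} (\<lambda>x. bessel_kernel s 0 (complex_of_real x))"
    by (rule set_integrable_subset[OF int], simp, simp)+
  obtain F where F: "\<And>z. (F has_field_derivative bessel_kernel s 0 z) (at z)"
    using bessel_kernel_primitive[of s 0] by metis
  have "((\<lambda>a. LINT x:{a..0}|lborel. bessel_kernel s 0 (complex_of_real x)) \<longlongrightarrow> (LINT x:{..0}|lborel. bessel_kernel s 0 (complex_of_real x))) at_bot"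
    by (rule tendsto_set_lebesgue_integral_at_bot) (use int1 in auto)
  then have "((\<lambda>a. F 0 - F (of_real a)) \<longlongrightarrow> (LINT x:{..0}|lborel. bessel_kernel s 0 (complex_of_real x))) at_bot"
  proof (rule Lim_transform_eventually)
    show "\<forall>\<^sub>F a in at_bot. (LINT x:{a..0}|lborel. bessel_kernel s 0 (complex_of_real x)) = F 0 - F (of_real a)"
      using eventually_le_at_bot[of 0]
    proof eventually_elim
      case (elim a)
      have "set_integrable lborel {a..0} (\<lambda>x. bessel_kernel s 0 (complex_of_real x))"
        by (rule set_integrable_subset[OF int]) auto
      from set_borel_integral_eq_integral(2)[OF this] show ?case
        using integral_horizontal_primitive[OF F elim, of 0] by simp
    qed
  qed
  then have "((\<lambda>a. (LINT x:{0..}|lborel. bessel_kernel s 0 (of_real x)) + (F 0 - F (of_real a))) \<longlongrightarrow>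
     (LINT x:{0..}|lborel. bessel_kernel s 0 (of_real x)) + (LINT x:{..0}|lborel. bessel_kernel s 0 (complex_of_real x))) at_bot"
    by (intro tendsto_intros)
  moreover have "(LINT x:{0..}|lborel. bessel_kernel s 0 (of_real x)) = (LINT x:{0<..}|lborel. bessel_kernel s 0 (of_real x))"
    by (rule set_integral_discrete_difference[of "{0}"]) auto
  moreover have "(LINT x:{0<..}|lborel. bessel_kernel s 0 (of_real x)) + (LINT x:{..0}|lborel. bessel_kernel s 0 (complex_of_real x))
     = (LINT x:{0<..} \<union> {..0}|lborel. bessel_kernel s 0 (of_real x))"
    by (rule set_integral_Un[symmetric]) (use int1 int2 in auto)
  moreover have "{0<..} \<union> {..0} = (UNIV :: real set)" by auto
  ultimately show ?thesis
    using set_borel_integral_eq_integral(2)[OF int] I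
    by (simp add: kernel_tail_def contour_integral_linepath_primitive(1)[OF F] algebra_simps)
qed

lemma kernel_tail_entire: "(\<lambda>m. kernel_tail (f m) q a) holomorphic_on UNIV" if "f holomorphic_on UNIV"
  by (rule kernel_tail_holomorphic) (auto intro: that)

text \<open>Hankel's loop integral for the reciprocal Gamma function: for \<open>Re \<nu> < 0\<close> the vertical part
  of the loop can be moved to \<open>-\<infinity>\<close>, which leaves Euler's integral.\<close>

lemma hankel_loop_rGamma:
  defines "w \<equiv> \<i> * of_real pi"
  shows "(exp (- \<nu> * w) - exp (\<nu> * w)) * kernel_tail (- \<nu>) 0 0 + hankel_loop \<nu> 0 = 2 * of_real pi * \<i> * rGamma (\<nu> + 1)"
proof -
  define h where "h = (\<lambda>\<nu>. exp (- \<nu> * w) * kernel_tail (- \<nu>) 0 (0 - w) - exp (\<nu> * w) * kernel_tail (- \<nu>) 0 (0 + w))"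
  have h: "h \<nu> = exp (- \<nu> * w) * kernel_tail (- \<nu>) 0 (a - w) - exp (\<nu> * w) * kernel_tail (- \<nu>) 0 (a + w)" for \<nu> a
    unfolding h_def w_def kernel_tail_hankel_loop ..
  have "h \<nu> = 2 * of_real pi * \<i> * rGamma (\<nu> + 1)" if \<nu>: "Re \<nu> < 0" for \<nu>
  proof -
    \<comment> \<open>On a vertical segment of length \<pi> at abscissa a the kernel is O(exp (- Re
      \<nu> * a)), which vanishes at - \<infinity> because Re \<nu> < 0; shifting the endpoint by
      \<plusminus> w is harmless in the limit.\<close>
    have near: "((\<lambda>a. kernel_tail (- \<nu>) 0 (of_real a + v) - kernel_tail (- \<nu>) 0 (of_real a)) \<longlongrightarrow> 0) at_bot"
      if v: "v = w \<or> v = - w" for v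
    proof (rule Lim_null_comparison)
      show "\<forall>\<^sub>F a in at_bot. norm (kernel_tail (- \<nu>) 0 (of_real a + v) - kernel_tail (- \<nu>) 0 (of_real a))
          \<le> exp (1 + \<bar>Im \<nu>\<bar> * pi - Re \<nu> * a) * norm ((complex_of_real a) - (of_real a + v))"
        using eventually_le_at_bot[of 0]
      proof eventually_elim
        case (elim a)
        obtain F where F: "\<And>z. (F has_field_derivative bessel_kernel (- \<nu>) 0 z) (at z)"
          using bessel_kernel_primitive[of "- \<nu>" 0] by metis
        have "norm (contour_integral (linepath (of_real a + v) (of_real a)) (bessel_kernel (- \<nu>) 0))
            \<le> exp (1 + \<bar>Im \<nu>\<bar> * pi - Re \<nu> * a) * norm ((complex_of_real a) - (of_real a + v))"
        proof (rule has_contour_integral_bound_linepath)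
          show "(bessel_kernel (- \<nu>) 0 has_contour_integral
            contour_integral (linepath (of_real a + v) (of_real a)) (bessel_kernel (- \<nu>) 0)) (linepath (of_real a + v) (of_real a))"
            using contour_integral_linepath_primitive[OF F] by simp
          fix x assume "x \<in> closed_segment (of_real a + v) (complex_of_real a)"
          then obtain s where s: "0 \<le> s" "s \<le> 1" "x = (1 - s) *\<^sub>R (of_real a + v) + s *\<^sub>R of_real a"
            by (auto simp: in_segment)
          have x: "Re x = a" using v unfolding s(3) by (auto simp: w_def algebra_simps)
          have "Im x = (1 - s) * Im v" using v unfolding s(3) by (auto simp: w_def)
          moreover have "\<bar>(1 - s) * Im v\<bar> \<le> 1 * pi"
            unfolding abs_mult using v s by (intro mult_mono) (auto simp: w_def)
          ultimately have ix: "\<bar>Im x\<bar> \<le> pi" by simp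
          have "Im \<nu> * Im x \<le> \<bar>Im \<nu>\<bar> * pi"
            using mult_mono[OF order_refl[of "\<bar>Im \<nu>\<bar>"] ix] abs_ge_self[of "Im \<nu> * Im x"] by (simp add: abs_mult)
          moreover have "- Re (exp x) \<le> 1"
          proof -
            have "\<bar>Re (exp x)\<bar> \<le> norm (exp x)" by (rule abs_Re_le_cmod)
            also have "\<dots> \<le> 1" using x elim by simp
            finally show ?thesis by simp
          qed
          ultimately show "norm (bessel_kernel (- \<nu>) 0 x) \<le> exp (1 + \<bar>Im \<nu>\<bar> * pi - Re \<nu> * a)"
            by (simp add: bessel_kernel_def x)
        qed simp
        then show ?case by (simp only: kernel_tail_diff)
      qed
      show "((\<lambda>a. exp (1 + \<bar>Im \<nu>\<bar> * pi - Re \<nu> * a) * norm ((complex_of_real a) - (of_real a + v))) \<longlongrightarrow> 0) at_bot"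
      proof -
        have "((\<lambda>a. exp (1 + \<bar>Im \<nu>\<bar> * pi - Re \<nu> * a) * norm v) \<longlongrightarrow> 0) at_bot"
          using \<nu> by real_asymp
        then show ?thesis by simp
      qed
    qed
    have lim: "((\<lambda>a. kernel_tail (- \<nu>) 0 (of_real a + v)) \<longlongrightarrow> Gamma (- \<nu>)) at_bot" if "v = w \<or> v = - w" for v
      using tendsto_add[OF near[OF that] kernel_tail_Gamma[of "- \<nu>"]] \<nu> by simp
    have "((\<lambda>a. exp (- \<nu> * w) * kernel_tail (- \<nu>) 0 (of_real a - w) - exp (\<nu> * w) * kernel_tail (- \<nu>) 0 (of_real a + w))
      \<longlongrightarrow> exp (- \<nu> * w) * Gamma (- \<nu>) - exp (\<nu> * w) * Gamma (- \<nu>)) at_bot"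
      using lim[of w] lim[of "- w"] by (intro tendsto_intros) simp_all
    then have "((\<lambda>a::real. h \<nu>) \<longlongrightarrow> exp (- \<nu> * w) * Gamma (- \<nu>) - exp (\<nu> * w) * Gamma (- \<nu>)) at_bot"
      by (simp only: h[symmetric])
    then have "h \<nu> = exp (- \<nu> * w) * Gamma (- \<nu>) - exp (\<nu> * w) * Gamma (- \<nu>)"
      by (rule tendsto_unique[OF trivial_limit_at_bot_linorder tendsto_const])
    also have "\<dots> = - (2 * \<i> * sin (of_real pi * \<nu>)) * Gamma (- \<nu>)"
    proof -
      have "2 * \<i> * sin (of_real pi * \<nu>) = exp (\<nu> * w) - exp (- \<nu> * w)"
        by (simp add: sin_exp_eq w_def mult_ac)
      then show ?thesis by algebra
    qed
    \<comment> \<open>The reflection formula trades \<Gamma>(- \<nu>) sin (\<pi> \<nu>) for the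
      reciprocal Gamma function.\<close>
    also have "\<dots> = 2 * of_real pi * \<i> * rGamma (\<nu> + 1)"
    proof -
      have g: "rGamma (- \<nu>) \<noteq> 0"
      proof
        assume "rGamma (- \<nu>) = 0"
        then obtain n where n: "- \<nu> = of_int n" "n \<le> 0" by (auto simp: rGamma_eq_zero_iff elim: nonpos_Ints_cases)
        have "- Re \<nu> = of_int n" using arg_cong[OF n(1), of Re] by simp
        then show False using n(2) \<nu> by simp
      qed
      have "rGamma (- \<nu>) * rGamma (1 + \<nu>) = - (sin (of_real pi * \<nu>) / of_real pi)"
        using rGamma_reflection_complex[of "- \<nu>"] by simp
      then have "sin (of_real pi * \<nu>) = - (of_real pi * (rGamma (- \<nu>) * rGamma (1 + \<nu>)))" by simp
      then show ?thesis using g by (simp add: Gamma_def add.commute)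
    qed
    finally show ?thesis .
  qed
  \<comment> \<open>Both sides are entire in \<nu>, so agreement on this half plane is agreement
    everywhere.\<close>
  moreover have "open {\<nu>::complex. Re \<nu> < 0}" by (simp add: open_halfspace_Re_lt)
  moreover have "{\<nu>::complex. Re \<nu> < 0} \<noteq> {}"
    by (auto intro!: exI[of _ "-1"])
  moreover have "h holomorphic_on UNIV"
    unfolding h_def by (intro holomorphic_intros kernel_tail_entire)
  moreover have "(\<lambda>\<nu>. 2 * of_real pi * \<i> * rGamma (\<nu> + 1)) holomorphic_on UNIV"
    by (intro holomorphic_intros)
  ultimately have "h \<nu> = 2 * of_real pi * \<i> * rGamma (\<nu> + 1)"
    by (intro analytic_continuation_open[of "{\<nu>::complex. Re \<nu> < 0}" UNIV h "\<lambda>\<nu>. 2 * of_real pi * \<i> * rGamma (\<nu> + 1)" \<nu>]) (simp_all add: connected_UNIV)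
  then show ?thesis unfolding h_def w_def kernel_tail_hankel_loop .
qed

text \<open>Schlaefli's integral. Expanding tails and loop in q leaves in degree k the same
  combination with \<nu> + k and q = 0, which \<open>hankel_loop_rGamma\<close> evaluates as the
  coefficient of the Bessel series.\<close>

lemma Bessel_J_sommerfeld:
  defines "w \<equiv> \<i> * of_real pi"
  shows "Bessel_J \<nu> (Log_Point \<zeta>) =
    (sommerfeld_integral (- \<nu>) (\<zeta> - w) - sommerfeld_integral (- \<nu>) (\<zeta> + w)) / (2 * of_real pi * \<i>)"
proof -
  define q where "q = (exp \<zeta> / 2)\<^sup>2"
  define a where "a = \<zeta> - of_real (ln 2)"
  define E where "E = exp (- \<nu> * w) - exp (\<nu> * w)"
  have ee: "exp (\<zeta> - w) = - exp \<zeta>" "exp (\<zeta> + w) = - exp \<zeta>"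
    using exp_add_pm_pi_i[of w \<zeta>] by (auto simp: w_def)
  have "sommerfeld_integral (- \<nu>) (\<zeta> - w) = exp (\<nu> * a) * (exp (- \<nu> * w) * kernel_tail (- \<nu>) q (a - w))"
    unfolding sommerfeld_integral_def ee q_def a_def by (simp add: algebra_simps flip: exp_add mult.assoc)
  moreover have "sommerfeld_integral (- \<nu>) (\<zeta> + w) = exp (\<nu> * a) * (exp (\<nu> * w) * kernel_tail (- \<nu>) q (a + w))"
    unfolding sommerfeld_integral_def ee q_def a_def by (simp add: algebra_simps flip: exp_add mult.assoc)
  ultimately have S: "sommerfeld_integral (- \<nu>) (\<zeta> - w) - sommerfeld_integral (- \<nu>) (\<zeta> + w)
      = exp (\<nu> * a) * (E * kernel_tail (- \<nu>) q 0 + hankel_loop \<nu> q)"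
    using kernel_tail_hankel_loop[of \<nu> q a] unfolding E_def w_def
    by (simp only: right_diff_distrib[symmetric])
  have "(\<lambda>k. E * (q ^ k / fact k * kernel_tail (- \<nu> - of_nat k) 0 0) + (- q) ^ k / fact k * hankel_loop (\<nu> + of_nat k) 0)
     sums (E * kernel_tail (- \<nu>) q 0 + hankel_loop \<nu> q)"
    by (intro sums_add sums_mult kernel_tail_sums hankel_loop_sums)
  moreover have "E * (q ^ k / fact k * kernel_tail (- \<nu> - of_nat k) 0 0) + (- q) ^ k / fact k * hankel_loop (\<nu> + of_nat k) 0
     = 2 * of_real pi * \<i> * ((-1) ^ k * rGamma (\<nu> + of_nat k + 1) / fact k * (exp \<zeta> / 2) ^ (2 * k))" for k
  proof -
    have k: "exp (of_nat k * w) = (-1) ^ k" "exp (- (of_nat k * w)) = (-1) ^ k"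
      by (simp_all add: exp_of_nat_mult exp_minus w_def flip: power_inverse)
    have qk: "(- q) ^ k = (-1) ^ k * q ^ k" by (rule power_minus)
    \<comment> \<open>The tails are expanded in q, the loop in - q; the missing sign comes from exp
      (\<plusminus> k w) = (- 1)^k.\<close>
    have "E * q ^ k = (-q) ^ k * (exp (- (\<nu> + of_nat k) * w) - exp ((\<nu> + of_nat k) * w))"
    proof -
      have "exp (- (\<nu> + of_nat k) * w) = exp (- (of_nat k * w)) * exp (- \<nu> * w)"
        "exp ((\<nu> + of_nat k) * w) = exp (of_nat k * w) * exp (\<nu> * w)"
        by (simp_all add: algebra_simps flip: exp_add)
      then have "exp (- (\<nu> + of_nat k) * w) = (-1) ^ k * exp (- \<nu> * w)" "exp ((\<nu> + of_nat k) * w) = (-1) ^ k * exp (\<nu> * w)"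
        unfolding k .
      note e = this
      have gen: "s * s = 1 \<Longrightarrow> x = s * a \<Longrightarrow> y = s * b \<Longrightarrow> (a - b) * Q = s * Q * (x - y)" for s Q a b x y :: complex
        by algebra
      have "(-1) ^ k * (-1) ^ k = (1::complex)" by (simp flip: power_mult_distrib)
      from gen[OF this e] show ?thesis unfolding E_def qk .
    qed
    note E = this
    have gen: "E * Q = P * D \<Longrightarrow> E * (Q / f * K) + P / f * L = P / f * (D * K + L)" for E Q P D K L f :: complex
    proof -
      assume "E * Q = P * D"
      moreover have "E * (Q / f * K) = (E * Q) * (K / f)" by simp
      ultimately have "E * (Q / f * K) = P * D * (K / f)" by simp
      then show ?thesis by (simp add: divide_inverse algebra_simps)
    qed
    have "- \<nu> - of_nat k = - (\<nu> + of_nat k)" by simp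
    then have "E * (q ^ k / fact k * kernel_tail (- \<nu> - of_nat k) 0 0) + (- q) ^ k / fact k * hankel_loop (\<nu> + of_nat k) 0
      = (- q) ^ k / fact k * ((exp (- (\<nu> + of_nat k) * w) - exp ((\<nu> + of_nat k) * w)) * kernel_tail (- (\<nu> + of_nat k)) 0 0 + hankel_loop (\<nu> + of_nat k) 0)"
      using gen[OF E] by simp
    also have "\<dots> = (- q) ^ k / fact k * (2 * of_real pi * \<i> * rGamma (\<nu> + of_nat k + 1))"
      unfolding w_def hankel_loop_rGamma ..
    also have "\<dots> = 2 * of_real pi * \<i> * ((-1) ^ k * rGamma (\<nu> + of_nat k + 1) / fact k * (exp \<zeta> / 2) ^ (2 * k))"
      unfolding qk by (simp add: q_def power_mult)
    finally show ?thesis .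
  qed
  ultimately have "(\<lambda>k. 2 * of_real pi * \<i> * ((-1) ^ k * rGamma (\<nu> + of_nat k + 1) / fact k * (exp \<zeta> / 2) ^ (2 * k)))
     sums (E * kernel_tail (- \<nu>) q 0 + hankel_loop \<nu> q)" by simp
  from sums_mult[OF this, of "1 / (2 * of_real pi * \<i>)"]
  have "(\<lambda>k. (-1) ^ k * rGamma (\<nu> + of_nat k + 1) / fact k * (exp \<zeta> / 2) ^ (2 * k))
     sums ((E * kernel_tail (- \<nu>) q 0 + hankel_loop \<nu> q) / (2 * of_real pi * \<i>))" by simp
  then show ?thesis unfolding S Bessel_J_def ls_proj_def a_def by (simp add: sums_iff)
qed

section \<open>The second kind and the Hankel functions\<close>

lemma Bessel_Y_quotient_sommerfeld:
  defines "w \<equiv> \<i> * of_real pi"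
  assumes "\<nu> \<notin> \<int>"
  shows "Bessel_Y_quotient \<nu> (Log_Point \<zeta>) =
    - (sommerfeld_integral (- \<nu>) (\<zeta> - w) + sommerfeld_integral (- \<nu>) (\<zeta> + w) + 2 * sommerfeld_integral \<nu> \<zeta>) / (2 * of_real pi)"
proof -
  define e f where "e = exp (\<nu> * w)" and "f = exp (- \<nu> * w)"
  have s: "sin (\<nu> * of_real pi) \<noteq> 0"
    using assms by (auto simp: sin_eq_0 mult.commute Ints_def)
  have iw: "\<i> * (\<nu> * of_real pi) = \<nu> * w" by (simp add: w_def mult_ac)
  have c: "cos (\<nu> * of_real pi) = (e + f) / 2" and s2: "sin (\<nu> * of_real pi) = (e - f) / (2 * \<i>)"
    unfolding cos_exp_eq sin_exp_eq e_def f_def iw by simp_all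
  \<comment> \<open>Reflection rewrites \<open>Bessel_J (- \<nu>)\<close> through the same three
    values that occur on the right side; then the factor e - f, a multiple of sin (\<nu> \<pi>),
    cancels.\<close>
  have r1: "sommerfeld_integral \<nu> (\<zeta> - w) + sommerfeld_integral (- \<nu>) \<zeta>
    = e * (sommerfeld_integral (- \<nu>) (\<zeta> - w) + sommerfeld_integral \<nu> \<zeta>)"
    using sommerfeld_integral_reflect[of "- w" \<nu> \<zeta>] by (simp add: w_def e_def)
  have r2: "sommerfeld_integral \<nu> (\<zeta> + w) + sommerfeld_integral (- \<nu>) \<zeta>
    = f * (sommerfeld_integral (- \<nu>) (\<zeta> + w) + sommerfeld_integral \<nu> \<zeta>)"
    using sommerfeld_integral_reflect[of w \<nu> \<zeta>] by (simp add: w_def f_def)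
  define X where "X = sommerfeld_integral (- \<nu>) (\<zeta> - w)"
  define Y where "Y = sommerfeld_integral (- \<nu>) (\<zeta> + w)"
  define Z where "Z = sommerfeld_integral \<nu> \<zeta>"
  have J: "Bessel_J \<nu> (Log_Point \<zeta>) = (X - Y) / (2 * of_real pi * \<i>)"
    unfolding Bessel_J_sommerfeld X_def Y_def w_def ..
  have "Bessel_J (- \<nu>) (Log_Point \<zeta>) = (e * (X + Z) - f * (Y + Z)) / (2 * of_real pi * \<i>)"
    unfolding Bessel_J_sommerfeld X_def Y_def Z_def w_def[symmetric] r1[symmetric] r2[symmetric] by simp
  note J2 = this
  have "Bessel_J \<nu> (Log_Point \<zeta>) * cos (\<nu> * of_real pi) - Bessel_J (- \<nu>) (Log_Point \<zeta>)
    = - (X + Y + 2 * Z) / (2 * of_real pi) * ((e - f) / (2 * \<i>))"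
    unfolding J J2 c by (simp add: field_simps)
  then show ?thesis
    unfolding Bessel_Y_quotient_def using s unfolding s2 X_def Y_def Z_def by simp
qed

text \<open>At integers the formula survives because its right side is entire in \<nu>, hence equals
  the limit that defines \<open>Bessel_Y\<close> there.\<close>

lemma Bessel_Y_sommerfeld:
  defines "w \<equiv> \<i> * of_real pi"
  shows "Bessel_Y \<nu> (Log_Point \<zeta>) =
    - (sommerfeld_integral (- \<nu>) (\<zeta> - w) + sommerfeld_integral (- \<nu>) (\<zeta> + w) + 2 * sommerfeld_integral \<nu> \<zeta>) / (2 * of_real pi)"
proof (cases "\<nu> \<in> \<int>")
  case False
  then show ?thesis using Bessel_Y_quotient_sommerfeld[OF False] by (simp add: Bessel_Y_def w_def)
next
  case True
  define g where "g = (\<lambda>\<nu>. - (sommerfeld_integral (- \<nu>) (\<zeta> - w) + sommerfeld_integral (- \<nu>) (\<zeta> + w) + 2 * sommerfeld_integral \<nu> \<zeta>) / (2 * of_real pi))"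
  have "g holomorphic_on UNIV"
    unfolding g_def by (intro holomorphic_intros sommerfeld_integral_holomorphic) auto
  then have "isCont g \<nu>"
    using continuous_on_eq_continuous_at holomorphic_on_imp_continuous_on by blast
  then have "(g \<longlongrightarrow> g \<nu>) (at \<nu>)" by (simp add: isCont_def)
  moreover have "\<forall>\<^sub>F \<mu> in at \<nu>. g \<mu> = Bessel_Y_quotient \<mu> (Log_Point \<zeta>)"
  proof -
    have "\<forall>\<^sub>F \<mu> in at \<nu>. \<mu> \<notin> \<int>"
    proof -
      have "\<not> \<nu> islimpt (\<int> :: complex set)"
        by (rule discrete_imp_not_islimpt[of 1]) (auto simp: dist_complex_def elim!: Ints_cases simp flip: of_int_diff)
      then show ?thesis by (simp add: islimpt_iff_eventually)
    qed
    then show ?thesis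
      by eventually_elim (simp add: g_def w_def Bessel_Y_quotient_sommerfeld)
  qed
  ultimately have "((\<lambda>\<mu>. Bessel_Y_quotient \<mu> (Log_Point \<zeta>)) \<longlongrightarrow> g \<nu>) (at \<nu>)"
    by (rule Lim_transform_eventually)
  then show ?thesis using True by (simp add: Bessel_Y_def tendsto_Lim g_def)
qed

text \<open>Adding \<i> Y to J cancels the value at \<zeta> + \<i> \<pi>. What remains are two tails
  that together form Sommerfeld's contour.\<close>

lemma Hankel1_sommerfeld:
  "Hankel1 \<nu> (Log_Point \<zeta>) = (sommerfeld_integral (- \<nu>) (\<zeta> - \<i> * of_real pi) + sommerfeld_integral \<nu> \<zeta>) / (of_real pi * \<i>)"
  unfolding Hankel1_def Bessel_J_sommerfeld Bessel_Y_sommerfeld by (simp add: field_simps)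

lemma Hankel2_sommerfeld:
  "Hankel2 \<nu> (Log_Point \<zeta>) = - (sommerfeld_integral (- \<nu>) (\<zeta> + \<i> * of_real pi) + sommerfeld_integral \<nu> \<zeta>) / (of_real pi * \<i>)"
  unfolding Hankel2_def Bessel_J_sommerfeld Bessel_Y_sommerfeld by (simp add: field_simps)

section \<open>Growth in the sector\<close>

lemma nonneg_from_deriv:
  fixes f :: "real \<Rightarrow> real"
  assumes "\<And>x. (f has_real_derivative f' x) (at x)" "\<And>x. x \<ge> 0 \<Longrightarrow> x \<le> b \<Longrightarrow> f' x \<ge> 0" "f 0 = 0" "0 \<le> x" "x \<le> b"
  shows "f x \<ge> 0"
proof -
  have "f 0 \<le> f x"
    by (rule DERIV_nonneg_imp_nondecreasing[OF assms(4)]) (use assms in \<open>metis order_trans\<close>)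
  then show ?thesis using assms by simp
qed

text \<open>Each bound integrates the previous one, starting from sin x \<le> x.\<close>

lemma trig_taylor_bounds:
  fixes x :: real
  assumes x: "x \<ge> 0"
  shows cos_ge_taylor: "cos x \<ge> 1 - x ^ 2 / 2"
    and sin_ge_taylor: "sin x \<ge> x - x ^ 3 / 6"
    and cos_le_taylor: "cos x \<le> 1 - x ^ 2 / 2 + x ^ 4 / 24"
proof -
  have c: "cos x \<ge> 1 - x ^ 2 / 2" if "x \<ge> 0" for x :: real
  proof -
    have "0 \<le> cos x - (1 - x ^ 2 / 2)"
      by (rule nonneg_from_deriv[where f="\<lambda>x. cos x - (1 - x ^ 2 / 2)" and f'="\<lambda>x. - sin x + x" and b=x])
         (use that in \<open>auto intro!: derivative_eq_intros sin_x_le_x\<close>)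
    then show ?thesis by simp
  qed
  have s: "sin x \<ge> x - x ^ 3 / 6" if "x \<ge> 0" for x :: real
  proof -
    have "0 \<le> sin x - (x - x ^ 3 / 6)"
      by (rule nonneg_from_deriv[where f="\<lambda>x. sin x - (x - x ^ 3 / 6)" and f'="\<lambda>x. cos x - (1 - x ^ 2 / 2)" and b=x])
         (use that c in \<open>auto intro!: derivative_eq_intros\<close>)
    then show ?thesis by simp
  qed
  show "cos x \<ge> 1 - x ^ 2 / 2" "sin x \<ge> x - x ^ 3 / 6" using c s x by auto
  show "cos x \<le> 1 - x ^ 2 / 2 + x ^ 4 / 24"
  proof -
    have "0 \<le> 1 - x ^ 2 / 2 + x ^ 4 / 24 - cos x"
      by (rule nonneg_from_deriv[where f="\<lambda>x. 1 - x ^ 2 / 2 + x ^ 4 / 24 - cos x" and f'="\<lambda>x. sin x - (x - x ^ 3 / 6)" and b=x])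
         (use x s in \<open>auto intro!: derivative_eq_intros\<close>)
    then show ?thesis by simp
  qed
qed

lemma hyperbolic_taylor_bounds:
  fixes x :: real
  assumes x: "x \<ge> 0"
  shows cosh_ge_taylor: "cosh x \<ge> 1 + x ^ 2 / 2"
    and sinh_ge_taylor: "sinh x \<ge> x + x ^ 3 / 6"
proof -
  have s1: "sinh x \<ge> x" if "x \<ge> 0" for x :: real
  proof -
    have "0 \<le> sinh x - x"
      by (rule nonneg_from_deriv[where f="\<lambda>x. sinh x - x" and f'="\<lambda>x. cosh x - 1" and b=x])
         (use that in \<open>auto intro!: derivative_eq_intros simp: cosh_real_ge_1\<close>)
    then show ?thesis by simp
  qed
  have c: "cosh x \<ge> 1 + x ^ 2 / 2" if "x \<ge> 0" for x :: real
  proof -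
    have "0 \<le> cosh x - (1 + x ^ 2 / 2)"
      by (rule nonneg_from_deriv[where f="\<lambda>x. cosh x - (1 + x ^ 2 / 2)" and f'="\<lambda>x. sinh x - x" and b=x])
         (use that s1 in \<open>auto intro!: derivative_eq_intros\<close>)
    then show ?thesis by simp
  qed
  show "cosh x \<ge> 1 + x ^ 2 / 2" using c x by auto
  show "sinh x \<ge> x + x ^ 3 / 6"
  proof -
    have "0 \<le> sinh x - (x + x ^ 3 / 6)"
      by (rule nonneg_from_deriv[where f="\<lambda>x. sinh x - (x + x ^ 3 / 6)" and f'="\<lambda>x. cosh x - (1 + x ^ 2 / 2)" and b=x])
         (use x c in \<open>auto intro!: derivative_eq_intros\<close>)
    then show ?thesis by simp
  qed
qed

text \<open>The two quantities are the real part and the negated imaginary part of sinh t - t at t =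
  s (1 - \<i> / 2). Near 0 this is t^3 / 6, whose argument is - 3 arctan (1 / 2), about - 80
  degrees: the signs fit the range 0 \<le> arg z \<le> \<pi> / 2.\<close>

lemma slanted_path_bounds_1:
  fixes s :: real
  assumes s: "0 \<le> s" "s \<le> 1"
  shows "sinh s * cos (s / 2) - s \<ge> 0" "cosh s * sin (s / 2) - s / 2 \<ge> 0"
proof -
  have s2: "s ^ 2 \<le> 1" using s by (simp add: power_le_one)
  have "s \<le> (s + s ^ 3 / 6) * (1 - (s / 2) ^ 2 / 2)"
  proof -
    have "(s + s ^ 3 / 6) * (1 - (s / 2) ^ 2 / 2) - s = s ^ 3 * (2 - s ^ 2) / 48"
      by (simp add: algebra_simps power2_eq_square power3_eq_cube)
    moreover have "s ^ 3 * (2 - s ^ 2) / 48 \<ge> 0" using s s2 by (intro divide_nonneg_nonneg mult_nonneg_nonneg) auto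
    ultimately show ?thesis by linarith
  qed
  also have "\<dots> \<le> sinh s * cos (s / 2)"
    using s s2 by (intro mult_mono sinh_ge_taylor cos_ge_taylor) (auto simp: power_divide)
  finally show "sinh s * cos (s / 2) - s \<ge> 0" by simp
  have "s / 2 \<le> (1 + s ^ 2 / 2) * (s / 2 - (s / 2) ^ 3 / 6)"
  proof -
    have "(1 + s ^ 2 / 2) * (s / 2 - (s / 2) ^ 3 / 6) - s / 2 = s ^ 3 * (22 - s ^ 2) / 96"
      by (simp add: algebra_simps power2_eq_square power3_eq_cube)
    moreover have "s ^ 3 * (22 - s ^ 2) / 96 \<ge> 0" using s s2 by (intro divide_nonneg_nonneg mult_nonneg_nonneg) auto
    ultimately show ?thesis by linarith
  qed
  also have "\<dots> \<le> cosh s * sin (s / 2)"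
  proof (intro mult_mono cosh_ge_taylor sin_ge_taylor)
    have "s / 2 - (s / 2) ^ 3 / 6 = s / 2 * (1 - s ^ 2 / 24)" by (simp add: algebra_simps power2_eq_square power3_eq_cube)
    moreover have "0 \<le> s / 2 * (1 - s ^ 2 / 24)" using s s2 by (intro mult_nonneg_nonneg) auto
    ultimately show "0 \<le> s / 2 - (s / 2) ^ 3 / 6" by simp
  qed (use s in \<open>auto simp: cosh_real_nonneg\<close>)
  finally show "cosh s * sin (s / 2) - s / 2 \<ge> 0" by simp
qed

text \<open>The same two components at t = v (1 - \<i>), with the sign of the real part reversed:
  now t^3 has argument - 3 \<pi> / 4, which fits \<pi> / 2 \<le> arg z \<le> \<pi>. The range v
  \<le> 2 keeps sin v nonnegative and v^2 \<le> 4.\<close>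

lemma slanted_path_bounds_2:
  fixes v :: real
  assumes v: "0 \<le> v" "v \<le> 2"
  shows "v - sinh v * cos v \<ge> 0" "cosh v * sin v - v \<ge> 0"
proof -
  have d: "1 - (cosh x * cos x - sinh x * sin x) \<ge> 0" if "0 \<le> x" "x \<le> 2" for x :: real
  proof (rule nonneg_from_deriv[where f="\<lambda>x. 1 - (cosh x * cos x - sinh x * sin x)" and f'="\<lambda>x. 2 * (cosh x * sin x)" and b=2])
    show "((\<lambda>x. 1 - (cosh x * cos x - sinh x * sin x)) has_real_derivative 2 * (cosh x * sin x)) (at x)" for x :: real
      by (auto intro!: derivative_eq_intros)
    show "0 \<le> 2 * (cosh x * sin x)" if "0 \<le> x" "x \<le> 2" for x :: real
      using that pi_gt3 by (intro mult_nonneg_nonneg sin_ge_zero) (auto simp: cosh_real_nonneg)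
  qed (use that in auto)
  show "v - sinh v * cos v \<ge> 0"
  proof (rule nonneg_from_deriv[where f="\<lambda>v. v - sinh v * cos v" and f'="\<lambda>x. 1 - (cosh x * cos x - sinh x * sin x)" and b=2])
    show "((\<lambda>v. v - sinh v * cos v) has_real_derivative 1 - (cosh x * cos x - sinh x * sin x)) (at x)" for x :: real
      by (auto intro!: derivative_eq_intros)
  qed (use d v in auto)
  have v2: "v ^ 2 \<le> 4" using power_mono[OF v(2) v(1), of 2] by simp
  have "v \<le> (1 + v ^ 2 / 2) * (v - v ^ 3 / 6)"
  proof -
    have "(1 + v ^ 2 / 2) * (v - v ^ 3 / 6) - v = v ^ 3 * (4 - v ^ 2) / 12"
      by (simp add: algebra_simps power2_eq_square power3_eq_cube)
    moreover have "v ^ 3 * (4 - v ^ 2) / 12 \<ge> 0" using v v2 by (intro divide_nonneg_nonneg mult_nonneg_nonneg) auto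
    ultimately show ?thesis by linarith
  qed
  also have "\<dots> \<le> cosh v * sin v"
  proof (intro mult_mono cosh_ge_taylor sin_ge_taylor)
    have "v - v ^ 3 / 6 = v * (1 - v ^ 2 / 6)" by (simp add: algebra_simps power2_eq_square power3_eq_cube)
    moreover have "0 \<le> v * (1 - v ^ 2 / 6)" using v v2 by (intro mult_nonneg_nonneg) auto
    ultimately show "0 \<le> v - v ^ 3 / 6" by simp
  qed (use v in \<open>auto simp: cosh_real_nonneg\<close>)
  finally show "cosh v * sin v - v \<ge> 0" by simp
qed

section \<open>Descent paths for the coupled order and growth of the Anger function\<close>

lemma exp_ge_linear: "X \<le> exp X / 8 + 2" for X :: real
proof -
  have "exp (X - 3) * 8 \<le> exp (X - 3) * exp 3"
    using exp_lower_Taylor_quadratic[of "3::real"] by (intro mult_left_mono) auto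
  also have "\<dots> = exp X" by (simp flip: exp_add)
  finally show ?thesis using exp_ge_add_one_self[of "X - 3"] by simp
qed

text \<open>For |arg z| < \<pi> / 2 this is the integral of exp (- z (sinh t - t) - \<kappa> t) over
  t > 0: \<pi> times the associated Anger-Weber function of order - \<nu> at z, where \<nu> = z -
  \<kappa>.\<close>

definition anger :: "complex \<Rightarrow> complex \<Rightarrow> complex" where
  "anger \<kappa> \<zeta> = sommerfeld_integral (exp \<zeta> - \<kappa>) \<zeta>"

text \<open>Minus the integral of sinh t exp (- z (sinh t - t) - \<kappa> t), continued to all
  arguments: the z-derivative of the Sommerfeld integral at fixed order. Shifts of the order by 1
  appear as shifts of \<kappa>.\<close>

definition anger_diff :: "complex \<Rightarrow> complex \<Rightarrow> complex" where
  "anger_diff \<kappa> \<zeta> = (anger (\<kappa> + 1) \<zeta> - anger (\<kappa> - 1) \<zeta>) / 2"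

lemma anger_holomorphic: "anger \<kappa> holomorphic_on UNIV"
  unfolding anger_def[abs_def] by (intro sommerfeld_integral_holomorphic holomorphic_intros)

lemma Re_sinh: "Re (sinh z) = sinh (Re z) * cos (Im z)"
  and Im_sinh: "Im (sinh z) = cosh (Re z) * sin (Im z)"
  by (simp_all add: sinh_field_def cosh_field_def Re_exp Im_exp algebra_simps)

lemma Re_exp_mult: "Re (exp \<zeta> * u) = norm (exp \<zeta>) * (cos (Im \<zeta>) * Re u - sin (Im \<zeta>) * Im u)"
  by (simp add: Re_exp Im_exp algebra_simps)

text \<open>Depending on the argument of \<open>z\<close> the path follows a different valley of \<open>- z (sinh t - t)\<close>.\<close>

definition anger_path :: "complex \<Rightarrow> complex \<Rightarrow> bool" where
  "anger_path \<zeta> p \<longleftrightarrow> \<bar>Im (\<zeta> + p)\<bar> < pi / 2 \<and> norm p \<le> 2 * pi \<and>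
     (\<forall>s\<in>{0..1}. Re (exp \<zeta> * (sinh (of_real s * p) - of_real s * p)) \<ge> 0) \<and>
     (\<forall>x\<ge>0. Re (exp \<zeta> * (sinh (p + of_real x) - (p + of_real x))) \<ge> norm (exp \<zeta>) * max 0 (exp x / 8 - 4))"

text \<open>Reflection in the real axis leaves only arg z \<ge> 0 to be treated.\<close>

lemma anger_path_cnj:
  assumes "anger_path (cnj \<zeta>) p"
  shows "anger_path \<zeta> (cnj p)"
proof -
  have *: "Re (exp \<zeta> * (sinh (cnj u) - cnj u)) = Re (exp (cnj \<zeta>) * (sinh u - u))" for u
    unfolding Re_exp_mult by (simp add: Re_sinh Im_sinh algebra_simps)
  have a: "of_real s * cnj p = cnj (of_real s * p)" for s by simp
  have b: "cnj p + of_real x = cnj (p + of_real x)" for x by simp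
  have c: "\<bar>Im (\<zeta> + cnj p)\<bar> = \<bar>Im (cnj \<zeta> + p)\<bar>" by simp
  show ?thesis using assms unfolding anger_path_def a b c * by simp
qed

text \<open>A point (a, b) of the unit circle in the closed first quadrant satisfies a + b \<ge> 1.
  A common lower bound for both components of sinh t - t thus survives multiplication by exp (\<i>
  arg z).\<close>

lemma combination_ge:
  fixes a b A B M :: real
  assumes "a \<ge> 0" "b \<ge> 0" "a\<^sup>2 + b\<^sup>2 = 1" "A \<ge> M" "B \<ge> M" "M \<ge> 0"
  shows "a * A + b * B \<ge> M"
proof -
  have "a\<^sup>2 \<le> 1\<^sup>2" "b\<^sup>2 \<le> 1\<^sup>2" using assms(3) zero_le_power2[of a] zero_le_power2[of b]
    unfolding power_one by linarith+
  then have "a \<le> 1" "b \<le> 1" by (auto intro: power2_le_imp_le)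
  then have "a * a \<le> a * 1" "b * b \<le> b * 1" using assms by (intro mult_left_mono, simp, simp)+
  then have "a + b \<ge> 1" using assms(3) by (simp add: power2_eq_square)
  then have "M \<le> (a + b) * M" using assms(6) mult_right_mono[of 1 "a + b" M] by simp
  also have "\<dots> \<le> a * A + b * B" using assms mult_left_mono[of M A a] mult_left_mono[of M B b] by (simp add: distrib_right)
  finally show ?thesis .
qed

text \<open>The slope - 1 / 2 serves this quadrant; after the slanted segment the path continues
  horizontally at height - 1 / 2, and arg z - 1 / 2 stays within \<pi> / 2 of 0.\<close>

lemma anger_path_first:
  assumes "0 \<le> Im \<zeta>" "Im \<zeta> \<le> pi / 2"
  shows "anger_path \<zeta> (Complex 1 (- 1 / 2))"
proof -
  let ?p = "Complex 1 (- 1 / 2)"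
  have cs: "cos (Im \<zeta>) \<ge> 0" "sin (Im \<zeta>) \<ge> 0" using assms by (auto intro!: cos_ge_zero sin_ge_zero)
  have Re_eq: "Re (exp \<zeta> * (sinh (Complex X (- \<eta>)) - Complex X (- \<eta>))) =
    norm (exp \<zeta>) * (cos (Im \<zeta>) * (sinh X * cos \<eta> - X) + sin (Im \<zeta>) * (cosh X * sin \<eta> - \<eta>))" for X \<eta>
    unfolding Re_exp_mult by (simp add: Re_sinh Im_sinh algebra_simps)
  have "norm ?p \<le> \<bar>1\<bar> + \<bar>- 1 / 2\<bar>" using cmod_le[of ?p] by simp
  then have "norm ?p \<le> 2 * pi" using pi_gt3 by simp
  moreover have "0 \<le> Re (exp \<zeta> * (sinh (of_real s * ?p) - of_real s * ?p))" if "s \<in> {0..1}" for s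
  proof -
    have "of_real s * ?p = Complex s (- (s / 2))" by (simp add: complex_eq_iff)
    then show ?thesis using that cs slanted_path_bounds_1[of s]
      unfolding \<open>of_real s * ?p = _\<close> Re_eq
      by (intro mult_nonneg_nonneg add_nonneg_nonneg norm_ge_zero) auto
  qed
  moreover have "norm (exp \<zeta>) * max 0 (exp x / 8 - 4) \<le> Re (exp \<zeta> * (sinh (?p + of_real x) - (?p + of_real x)))" if x: "x \<ge> 0" for x
  proof -
    define X where "X = 1 + x"
    have px: "?p + of_real x = Complex X (- (1/2))" by (simp add: complex_eq_iff X_def)
    have X: "X \<ge> 1" "X ^ 2 \<ge> 1" using x by (auto simp: X_def)
    have shX: "sinh X = exp X / 2 - exp (- X) / 2" "cosh X = exp X / 2 + exp (- X) / 2"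
      by (simp_all add: sinh_field_def cosh_field_def field_simps)
    have eX: "exp X \<ge> exp x" "exp (- X) \<le> 1" using x by (auto simp: X_def)
    have c: "cos (1/2) \<ge> (7/8 :: real)" using cos_ge_taylor[of "1/2"] by (simp add: power_divide)
    have s: "sin (1/2) \<ge> (11/24 :: real)" using sin_ge_taylor[of "1/2"] by (simp add: power_divide)
    have sc: "sinh X * (7/8) \<le> sinh X * cos (1/2)" using X c by (intro mult_left_mono) auto
    have cs': "cosh X * (11/24) \<le> cosh X * sin (1/2)" using s by (intro mult_left_mono) (auto simp: cosh_real_nonneg)
    have U: "sinh X * cos (1/2) - X \<ge> max 0 (exp x / 8 - 4)"
    proof (rule max.boundedI)
      have "X * (X ^ 2 - 1) \<ge> 0" using X by (intro mult_nonneg_nonneg) auto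
      then have "X ^ 3 \<ge> X" by (simp add: power3_eq_cube power2_eq_square algebra_simps)
      then show "0 \<le> sinh X * cos (1/2) - X" using sinh_ge_taylor[of X] X sc by linarith
      show "exp x / 8 - 4 \<le> sinh X * cos (1/2) - X"
        using sc exp_ge_linear[of X] exp_ge_zero[of X] eX shX by linarith
    qed
    have V: "cosh X * sin (1/2) - 1/2 \<ge> max 0 (exp x / 8 - 4)"
    proof (rule max.boundedI)
      show "0 \<le> cosh X * sin (1/2) - 1/2" using cosh_ge_taylor[of X] X cs' by linarith
      show "exp x / 8 - 4 \<le> cosh X * sin (1/2) - 1/2"
        using cs' eX exp_ge_zero[of "-X"] exp_ge_zero[of X] shX by linarith
    qed
    have "max 0 (exp x / 8 - 4) \<le> cos (Im \<zeta>) * (sinh X * cos (1/2) - X) + sin (Im \<zeta>) * (cosh X * sin (1/2) - 1/2)"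
      by (rule combination_ge) (use cs U V in auto)
    then show ?thesis unfolding px Re_eq by (intro mult_left_mono) auto
  qed
  moreover have "\<bar>Im (\<zeta> + ?p)\<bar> < pi / 2" unfolding abs_less_iff using assms pi_gt3 by simp
  ultimately show ?thesis unfolding anger_path_def by blast
qed

text \<open>The height - 2 is chosen with 2 > \<pi> / 2, so that arg z - 2 < \<pi> / 2 up to arg z =
  \<pi>, and with cos 2 < 0 < sin 2, so that both components grow along the horizontal part.\<close>

lemma anger_path_second:
  assumes "pi / 2 \<le> Im \<zeta>" "Im \<zeta> \<le> pi"
  shows "anger_path \<zeta> (Complex 2 (- 2))"
proof -
  let ?p = "Complex 2 (- 2)"
  have "cos (pi - Im \<zeta>) \<ge> 0" using assms by (intro cos_ge_zero) auto
  then have cs: "- cos (Im \<zeta>) \<ge> 0" "sin (Im \<zeta>) \<ge> 0" using assms by (auto intro!: sin_ge_zero)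
  have Re_eq: "Re (exp \<zeta> * (sinh (Complex X (- \<eta>)) - Complex X (- \<eta>))) =
    norm (exp \<zeta>) * (- cos (Im \<zeta>) * (X - sinh X * cos \<eta>) + sin (Im \<zeta>) * (cosh X * sin \<eta> - \<eta>))" for X \<eta>
    unfolding Re_exp_mult by (simp add: Re_sinh Im_sinh algebra_simps)
  have "norm ?p \<le> \<bar>2\<bar> + \<bar>- 2\<bar>" using cmod_le[of ?p] by simp
  then have "norm ?p \<le> 2 * pi" using pi_gt3 by simp
  moreover have "0 \<le> Re (exp \<zeta> * (sinh (of_real s * ?p) - of_real s * ?p))" if "s \<in> {0..1}" for s
  proof -
    have "of_real s * ?p = Complex (2 * s) (- (2 * s))" by (simp add: complex_eq_iff)
    then show ?thesis using that cs slanted_path_bounds_2[of "2 * s"]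
      unfolding \<open>of_real s * ?p = _\<close> Re_eq
      by (intro mult_nonneg_nonneg add_nonneg_nonneg norm_ge_zero) auto
  qed
  moreover have "norm (exp \<zeta>) * max 0 (exp x / 8 - 4) \<le> Re (exp \<zeta> * (sinh (?p + of_real x) - (?p + of_real x)))" if x: "x \<ge> 0" for x
  proof -
    define X where "X = 2 + x"
    have px: "?p + of_real x = Complex X (- 2)" by (simp add: complex_eq_iff X_def)
    have X: "X \<ge> 2" "X ^ 2 \<ge> 4" using x power_mono[of 2 X 2] by (auto simp: X_def)
    have shX: "sinh X = exp X / 2 - exp (- X) / 2" "cosh X = exp X / 2 + exp (- X) / 2"
      by (simp_all add: sinh_field_def cosh_field_def field_simps)
    have eX: "exp X \<ge> exp x" "exp (- X) \<le> 1" using x by (auto simp: X_def)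
    have c: "cos 2 \<le> (- 1/3 :: real)" using cos_le_taylor[of 2] by simp
    have s: "sin 2 \<ge> (2/3 :: real)" using sin_ge_taylor[of 2] by simp
    have sc: "sinh X * cos 2 \<le> sinh X * (- 1/3)" using X c by (intro mult_left_mono) auto
    have cs': "cosh X * (2/3) \<le> cosh X * sin 2" using s by (intro mult_left_mono) (auto simp: cosh_real_nonneg)
    have U: "X - sinh X * cos 2 \<ge> max 0 (exp x / 8 - 4)"
    proof (rule max.boundedI)
      show "0 \<le> X - sinh X * cos 2" using sinh_ge_taylor[of X] X sc zero_le_power[of X 3] by linarith
      show "exp x / 8 - 4 \<le> X - sinh X * cos 2"
        using sc X eX shX exp_ge_zero[of X] by linarith
    qed
    have V: "cosh X * sin 2 - 2 \<ge> max 0 (exp x / 8 - 4)"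
    proof (rule max.boundedI)
      show "0 \<le> cosh X * sin 2 - 2" using cosh_ge_taylor[of X] X cs' by linarith
      show "exp x / 8 - 4 \<le> cosh X * sin 2 - 2"
        using cs' eX exp_ge_zero[of "-X"] exp_ge_zero[of X] shX by linarith
    qed
    have "max 0 (exp x / 8 - 4) \<le> - cos (Im \<zeta>) * (X - sinh X * cos 2) + sin (Im \<zeta>) * (cosh X * sin 2 - 2)"
      by (rule combination_ge) (use cs U V in auto)
    then show ?thesis unfolding px Re_eq by (intro mult_left_mono) auto
  qed
  moreover have "\<bar>Im (\<zeta> + ?p)\<bar> < pi / 2" unfolding abs_less_iff using assms pi_gt3 pi_half_less_two by simp
  ultimately show ?thesis unfolding anger_path_def by blast
qed

text \<open>On the imaginary axis sinh t - t is purely imaginary, and on its lower half the sign is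
  favourable where sin (arg z) \<le> 0. The path therefore descends vertically until z exp t is
  positive.\<close>

lemma anger_path_third:
  assumes "pi \<le> Im \<zeta>" "Im \<zeta> \<le> 3 * pi / 2"
  shows "anger_path \<zeta> (- \<i> * of_real (Im \<zeta>))"
proof -
  let ?p = "- \<i> * complex_of_real (Im \<zeta>)"
  have "sin (Im \<zeta> - pi) \<ge> 0" using assms by (intro sin_ge_zero) auto
  then have s: "sin (Im \<zeta>) \<le> 0" by (simp add: sin_diff)
  have "0 \<le> Re (exp \<zeta> * (sinh (of_real s * ?p) - of_real s * ?p))" if "s \<in> {0..1}" for s
  proof -
    have "- sin (Im \<zeta>) * (s * Im \<zeta> - sin (s * Im \<zeta>)) \<ge> 0"
      using that s assms pi_gt_zero sin_x_le_x[of "s * Im \<zeta>"] by (intro mult_nonneg_nonneg) auto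
    then show ?thesis
      unfolding Re_exp_mult by (simp add: Re_sinh Im_sinh algebra_simps)
  qed
  moreover have "norm (exp \<zeta>) * max 0 (exp x / 8 - 4) \<le> Re (exp \<zeta> * (sinh (?p + of_real x) - (?p + of_real x)))" if x: "x \<ge> 0" for x
  proof -
    define c where "c = cos (Im \<zeta>)"
    define s where "s = sin (Im \<zeta>)"
    have cs: "c\<^sup>2 + s\<^sup>2 = 1" "s\<^sup>2 \<ge> 0" by (simp_all add: c_def s_def)
    \<comment> \<open>Writing cosh x = sinh x + (cosh x - sinh x) collects sinh x with the full
      coefficient 1 and leaves nonnegative terms besides - c x.\<close>
    have "c * (sinh x * c - x) - s * (- (cosh x * s) + Im \<zeta>) = sinh x * (c\<^sup>2 + s\<^sup>2) + (cosh x - sinh x) * s\<^sup>2 - c * x + (- s) * Im \<zeta>"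
      by (simp add: algebra_simps power2_eq_square)
    also have "\<dots> \<ge> sinh x + 0 - x + 0"
    proof -
      have "cosh x - sinh x \<ge> 0" by (simp add: sinh_le_cosh_real)
      then have "(cosh x - sinh x) * s\<^sup>2 \<ge> 0" by simp
      moreover have "c * x \<le> 1 * x" using x by (intro mult_right_mono) (auto simp: c_def)
      moreover have "(- s) * Im \<zeta> \<ge> 0" using assms s s_def pi_gt_zero by (intro mult_nonneg_nonneg) auto
      ultimately show ?thesis using cs by simp
    qed
    also have "sinh x + 0 - x + 0 \<ge> max 0 (exp x / 8 - 4)"
    proof (rule max.boundedI)
      show "0 \<le> sinh x + 0 - x + 0" using sinh_ge_taylor[of x] x zero_le_power[of x 3] by linarith
      show "exp x / 8 - 4 \<le> sinh x + 0 - x + 0"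
      proof -
        have "sinh x = exp x / 2 - exp (- x) / 2" "exp (- x) \<le> 1" using x by (simp_all add: sinh_field_def field_simps)
        then show ?thesis using exp_ge_linear[of x] exp_ge_zero[of x] by linarith
      qed
    qed
    finally have "max 0 (exp x / 8 - 4) \<le> c * (sinh x * c - x) - s * (- (cosh x * s) + Im \<zeta>)" .
    then show ?thesis
      unfolding Re_exp_mult by (intro mult_left_mono) (auto simp: Re_sinh Im_sinh c_def s_def)
  qed
  ultimately show ?thesis using assms pi_gt_zero unfolding anger_path_def by (auto simp: norm_mult)
qed

lemma anger_path_exists:
  assumes "\<bar>Im \<zeta>\<bar> \<le> 3 * pi / 2"
  shows "\<exists>p. anger_path \<zeta> p"
proof -
  have pos: "\<exists>p. anger_path \<zeta> p" if "0 \<le> Im \<zeta>" "Im \<zeta> \<le> 3 * pi / 2" for \<zeta>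
    using that anger_path_first[of \<zeta>] anger_path_second[of \<zeta>] anger_path_third[of \<zeta>] by fastforce
  show ?thesis
  proof (cases "Im \<zeta> \<ge> 0")
    case False
    then obtain p where "anger_path (cnj \<zeta>) p" using pos[of "cnj \<zeta>"] assms by auto
    then show ?thesis using anger_path_cnj by blast
  qed (use pos assms in auto)
qed

text \<open>The integrand is bounded on the segment to p. Beyond it the damping |z| (exp x / 8 - 4)
  sets in only when exp x is of size 1 / |z|; for |z| < 1 it is traded for |z|^(- \<rho>) exp (-
  \<rho> x), which beats exp (|Re \<kappa>| x) because \<rho> is larger.\<close>

lemma anger_growth:
  assumes \<rho>: "\<rho> > \<bar>Re \<kappa>\<bar>"
  shows "\<exists>C. \<forall>\<zeta>. \<bar>Im \<zeta>\<bar> \<le> 3 * pi / 2 \<longrightarrow> norm (anger \<kappa> \<zeta>) \<le> C * (1 + exp (- \<rho> * Re \<zeta>))"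
proof -
  define K where "K = norm \<kappa> * (2 * pi)"
  define M where "M = \<bar>Re \<kappa>\<bar>"
  define C1 where "C1 = exp (K + 4 + (M + 1)\<^sup>2 / (2 * (1/8)))"
  define C2 where "C2 = exp (K + 4 + \<rho> * ln \<rho> + \<rho> * ln 8)"
  have \<rho>0: "\<rho> > 0" using \<rho> by linarith
  have "norm (anger \<kappa> \<zeta>) \<le> (exp K * (2 * pi) + C1 + C2 / (\<rho> - M)) * (1 + exp (- \<rho> * Re \<zeta>))"
    if \<zeta>: "\<bar>Im \<zeta>\<bar> \<le> 3 * pi / 2" for \<zeta>
  proof -
    obtain p where p: "anger_path \<zeta> p" using anger_path_exists[OF \<zeta>] by blast
    define g where "g = (\<lambda>t. exp (- exp \<zeta> * sinh t + (exp \<zeta> - \<kappa>) * t))"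
    have ng: "norm (g t) = exp (- Re (exp \<zeta> * (sinh t - t)) - Re (\<kappa> * t))" for t
      by (simp add: g_def algebra_simps)
    have np: "norm p \<le> 2 * pi" using p by (simp add: anger_path_def)
    have "norm (contour_integral (linepath 0 p) g) \<le> exp K * norm (p - 0)"
    proof (rule has_contour_integral_bound_linepath)
      show "(g has_contour_integral contour_integral (linepath 0 p) g) (linepath 0 p)"
        by (intro has_contour_integral_integral contour_integrable_continuous_linepath)
           (auto simp: g_def sinh_field_def intro!: continuous_intros)
      fix t assume "t \<in> closed_segment 0 p"
      then obtain s where s: "0 \<le> s" "s \<le> 1" "t = of_real s * p" by (auto simp: in_segment scaleR_conv_of_real)
      have "- Re (exp \<zeta> * (sinh t - t)) \<le> 0" using p s by (auto simp: anger_path_def)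
      moreover have "- Re (\<kappa> * t) \<le> K"
      proof -
        have "norm t \<le> 1 * (2 * pi)" unfolding s(3) norm_mult using s np by (intro mult_mono) auto
        then have "norm \<kappa> * norm t \<le> K" unfolding K_def by (intro mult_left_mono) auto
        then show ?thesis using Re_le_norm_mult[of "- \<kappa>" t] by simp
      qed
      ultimately show "norm (g t) \<le> exp K" unfolding ng by simp
    qed simp
    also have "\<dots> \<le> exp K * (2 * pi)" using np by (intro mult_left_mono) auto
    finally have first: "norm (contour_integral (linepath 0 p) g) \<le> exp K * (2 * pi)" .
    have ngx: "norm (g (p + of_real x)) \<le> exp (K + M * x - norm (exp \<zeta>) * max 0 (exp x / 8 - 4))" if x: "x \<ge> 0" for x
    proof -
      have "- Re (\<kappa> * (p + of_real x)) \<le> K + M * x"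
      proof -
        have "norm \<kappa> * norm p \<le> K" unfolding K_def using np by (intro mult_left_mono) auto
        moreover have "- Re \<kappa> * x \<le> M * x" unfolding M_def using x by (intro mult_right_mono) auto
        ultimately show ?thesis using Re_le_norm_mult[of "- \<kappa>" p] by (simp add: algebra_simps)
      qed
      moreover have "norm (exp \<zeta>) * max 0 (exp x / 8 - 4) \<le> Re (exp \<zeta> * (sinh (p + of_real x) - (p + of_real x)))"
        using p x unfolding anger_path_def by blast
      ultimately show ?thesis unfolding ng by simp
    qed
    have cont: "continuous_on {0..} (\<lambda>x. g (p + of_real x))"
      unfolding g_def sinh_field_def by (intro continuous_intros) auto
    have second: "norm (LINT x:{0..}|lborel. g (p + of_real x)) \<le> C1 + C2 / (\<rho> - M) * exp (- \<rho> * Re \<zeta>)"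
    proof (cases "norm (exp \<zeta>) \<ge> 1")
      case True
      have "norm (LINT x:{0..}|lborel. g (p + of_real x)) \<le> C1 * exp (- 1 * 0) / 1"
      proof (rule half_line_bound[OF cont])
        fix x :: real assume x: "0 \<le> x"
        have "1 * max 0 (exp x / 8 - 4) \<le> norm (exp \<zeta>) * max 0 (exp x / 8 - 4)"
          using True by (intro mult_right_mono) auto
        then have "K + M * x - norm (exp \<zeta>) * max 0 (exp x / 8 - 4) \<le> K + 4 + (- (1/8) * exp x + M * x)"
          by (simp add: max_def split: if_splits)
        also have "\<dots> \<le> K + 4 + ((M + 1)\<^sup>2 / (2 * (1/8)) - x)"
          using exp_dominates_linear[of "1/8" x M] x by simp
        finally have "exp (K + M * x - norm (exp \<zeta>) * max 0 (exp x / 8 - 4)) \<le> C1 * exp (- 1 * x)"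
          by (simp add: C1_def flip: exp_add)
        then show "norm (g (p + of_real x)) \<le> C1 * exp (- 1 * x)" using ngx[OF x] by linarith
      qed simp
      moreover have "C2 / (\<rho> - M) * exp (- \<rho> * Re \<zeta>) \<ge> 0" using \<rho> by (simp add: C2_def M_def)
      ultimately show ?thesis by simp
    next
      case False
      have "norm (LINT x:{0..}|lborel. g (p + of_real x)) \<le> (C2 * exp (- \<rho> * Re \<zeta>)) * exp (- (\<rho> - M) * 0) / (\<rho> - M)"
      proof (rule half_line_bound[OF cont])
        fix x :: real assume x: "0 \<le> x"
        define y where "y = exp (Re \<zeta>) * exp x / 8"
        \<comment> \<open>The tangent of the logarithm at 1 bounds exp (- y) by a constant multiple
          of y^(- \<rho>), with y = |z| exp x / 8.\<close>
        have "ln (y / \<rho>) \<le> y / \<rho> - 1" using \<rho>0 by (intro ln_le_minus_one) (simp add: y_def)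
        then have "\<rho> * ln (y / \<rho>) \<le> y - \<rho>" using \<rho>0 by (simp add: field_simps)
        moreover have "ln (y / \<rho>) = Re \<zeta> + x - ln 8 - ln \<rho>" using \<rho>0 by (simp add: y_def ln_div ln_mult)
        ultimately have y: "- y \<le> \<rho> * ln \<rho> + \<rho> * ln 8 - \<rho> * Re \<zeta> - \<rho> * x" using \<rho>0 by (simp add: algebra_simps)
        have "norm (exp \<zeta>) * (exp x / 8 - 4) \<le> norm (exp \<zeta>) * max 0 (exp x / 8 - 4)"
          by (intro mult_left_mono) auto
        moreover have "norm (exp \<zeta>) * (exp x / 8 - 4) \<ge> y - 4" using False by (simp add: y_def algebra_simps)
        ultimately have "K + M * x - norm (exp \<zeta>) * max 0 (exp x / 8 - 4) \<le> K + 4 + \<rho> * ln \<rho> + \<rho> * ln 8 - \<rho> * Re \<zeta> - (\<rho> - M) * x"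
          using y by (simp add: algebra_simps)
        then have "exp (K + M * x - norm (exp \<zeta>) * max 0 (exp x / 8 - 4)) \<le> C2 * exp (- \<rho> * Re \<zeta>) * exp (- (\<rho> - M) * x)"
          by (simp add: C2_def algebra_simps flip: exp_add)
        then show "norm (g (p + of_real x)) \<le> C2 * exp (- \<rho> * Re \<zeta>) * exp (- (\<rho> - M) * x)" using ngx[OF x] by linarith
      qed (use \<rho> M_def in simp)
      moreover have "C1 \<ge> 0" by (simp add: C1_def)
      ultimately show ?thesis by simp
    qed
    have anger: "anger \<kappa> \<zeta> = contour_integral (linepath 0 p) g + (LINT x:{0..}|lborel. g (p + of_real x))"
      unfolding anger_def g_def using p by (intro sommerfeld_integral_path) (simp add: anger_path_def)
    have "norm (anger \<kappa> \<zeta>) \<le> exp K * (2 * pi) + (C1 + C2 / (\<rho> - M) * exp (- \<rho> * Re \<zeta>))"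
      unfolding anger using first second norm_triangle_ineq[of "contour_integral (linepath 0 p) g" "LINT x:{0..}|lborel. g (p + of_real x)"] by linarith
    also have "\<dots> \<le> (exp K * (2 * pi) + C1 + C2 / (\<rho> - M)) * (1 + exp (- \<rho> * Re \<zeta>))"
    proof -
      have "C2 / (\<rho> - M) \<ge> 0" "(exp K * (2 * pi) + C1) * exp (- \<rho> * Re \<zeta>) \<ge> 0" using \<rho> by (simp_all add: C1_def C2_def M_def)
      then show ?thesis by (simp add: algebra_simps)
    qed
    finally show ?thesis .
  qed
  then show ?thesis by blast
qed

section \<open>A dispersion relation in two half planes\<close>

lemma contour_integral_horizontal:
  assumes "a < b" "(\<lambda>x. K (Complex x y)) integrable_on {a..b}"
  shows "contour_integral (linepath (Complex a y) (Complex b y)) K = integral {a..b} (\<lambda>x. K (Complex x y))"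
proof -
  have l: "linepath (Complex a y) (Complex b y) s = Complex ((b - a) * s + a) y" for s
    by (simp add: linepath_def complex_eq_iff algebra_simps)
  have d: "Complex b y - Complex a y = of_real (b - a)" by (simp add: complex_eq_iff)
  have "((\<lambda>x. K (Complex ((b - a) *\<^sub>R x + a) y)) has_integral
      (integral {a..b} (\<lambda>x. K (Complex x y)) /\<^sub>R (b - a) ^ DIM(real))) (cbox ((a - a) /\<^sub>R (b - a)) ((b - a) /\<^sub>R (b - a)))"
    by (rule has_integral_affinity') (use assms in auto)
  then have aff: "integral {0..1} (\<lambda>s. K (Complex ((b - a) * s + a) y)) = integral {a..b} (\<lambda>x. K (Complex x y)) /\<^sub>R \<bar>b - a\<bar>"
    using assms(1) by (simp add: integral_unique)
  have "contour_integral (linepath (Complex a y) (Complex b y)) K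
     = integral {0..1} (\<lambda>s. K (Complex ((b - a) * s + a) y) * of_real (b - a))"
    unfolding contour_integral_integral by (simp add: l d)
  also have "\<dots> = (b - a) *\<^sub>R integral {0..1} (\<lambda>s. K (Complex ((b - a) * s + a) y))"
    by (simp add: scaleR_conv_of_real mult.commute)
  also have "integral {0..1} (\<lambda>s. K (Complex ((b - a) * s + a) y)) = integral {a..b} (\<lambda>x. K (Complex x y)) /\<^sub>R \<bar>b - a\<bar>"
    by (rule aff)
  finally show ?thesis using assms(1) by simp
qed

lemma contour_integral_rectpath:
  assumes "a < b" "c < d" and K: "continuous_on (path_image (rectpath (Complex a c) (Complex b d))) K"
  shows "contour_integral (rectpath (Complex a c) (Complex b d)) K =
    integral {a..b} (\<lambda>x. K (Complex x c)) - integral {a..b} (\<lambda>x. K (Complex x d))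
    + contour_integral (linepath (Complex b c) (Complex b d)) K
    - contour_integral (linepath (Complex a c) (Complex a d)) K"
proof -
  let ?p1 = "linepath (Complex a c) (Complex b c)" and ?p2 = "linepath (Complex b c) (Complex b d)"
    and ?p3 = "linepath (Complex b d) (Complex a d)" and ?p4 = "linepath (Complex a d) (Complex a c)"
  have r: "rectpath (Complex a c) (Complex b d) = ?p1 +++ ?p2 +++ ?p3 +++ ?p4"
    by (simp add: rectpath_def Let_def)
  have "path_image (rectpath (Complex a c) (Complex b d)) =
    path_image ?p1 \<union> path_image ?p2 \<union> path_image ?p3 \<union> path_image ?p4"
    unfolding r by (simp add: path_image_join Un_assoc)
  with K have cont: "continuous_on (path_image ?p1) K" "continuous_on (path_image ?p2) K"
    "continuous_on (path_image ?p3) K" "continuous_on (path_image ?p4) K"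
    by (auto elim!: continuous_on_subset)
  then have int: "K contour_integrable_on ?p1" "K contour_integrable_on ?p2"
    "K contour_integrable_on ?p3" "K contour_integrable_on ?p4"
    by (auto intro!: contour_integrable_continuous_linepath)
  have seg: "Complex x e \<in> closed_segment (Complex a e) (Complex b e)" if "x \<in> {a..b}" for x e
    using that assms(1) by (auto simp: closed_segment_same_Im closed_segment_eq_real_ivl)
  have cplx: "continuous_on {a..b} (\<lambda>x. Complex x e)" for e
    unfolding Complex_eq by (intro continuous_intros)
  have h1: "(\<lambda>x. K (Complex x c)) integrable_on {a..b}"
    by (rule integrable_continuous_real, rule continuous_on_compose2[OF cont(1) cplx]) (use seg in auto)
  have h3: "(\<lambda>x. K (Complex x d)) integrable_on {a..b}"
    by (rule integrable_continuous_real, rule continuous_on_compose2[OF cont(3) cplx])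
       (use seg in \<open>auto simp: closed_segment_commute\<close>)
  show ?thesis
    unfolding r using int contour_integral_horizontal[OF assms(1) h1] contour_integral_horizontal[OF assms(1) h3]
      contour_integral_reverse_linepath[OF cont(3)[unfolded path_image_linepath]]
      contour_integral_reverse_linepath[OF cont(4)[unfolded path_image_linepath]]
    by (simp add: contour_integrable_joinI)
qed

text \<open>The Cauchy kernel dv / (v - w) on the imaginary axis: v = \<i> exp x on the upper half,
  where the jump is jp, and v = - \<i> exp x on the lower half, where it is jm. The signs are those
  of the positively oriented boundary of the right half plane.\<close>

definition dispersion_integrand :: "(real \<Rightarrow> complex) \<Rightarrow> (real \<Rightarrow> complex) \<Rightarrow> complex \<Rightarrow> real \<Rightarrow> complex" where
  "dispersion_integrand jp jm w x =
     (exp x *\<^sub>R jm x) * (\<i> / (\<i> * exp x + w)) - (exp x *\<^sub>R jp x) * (\<i> / (\<i> * exp x - w))"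

lemma dispersion_denominator:
  assumes "Re w > 0"
  shows "norm (\<i> * complex_of_real e + w) \<ge> Re w" "norm (\<i> * complex_of_real e - w) \<ge> Re w"
    "\<i> * complex_of_real e + w \<noteq> 0" "\<i> * complex_of_real e - w \<noteq> 0"
proof -
  show 1: "norm (\<i> * complex_of_real e + w) \<ge> Re w" using complex_Re_le_cmod[of "\<i> * of_real e + w"] by simp
  show 2: "norm (\<i> * complex_of_real e - w) \<ge> Re w" using complex_Re_le_cmod[of "w - \<i> * of_real e"] by (simp add: norm_minus_commute)
  show "\<i> * complex_of_real e + w \<noteq> 0" "\<i> * complex_of_real e - w \<noteq> 0" using 1 2 assms by auto
qed

lemma integrable_mult_bounded:
  fixes f g :: "real \<Rightarrow> complex"
  assumes f: "integrable lborel f" and g: "continuous_on UNIV g" "\<And>x. norm (g x) \<le> B"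
  shows "integrable lborel (\<lambda>x. f x * g x)"
proof (rule Bochner_Integration.integrable_bound)
  show "integrable lborel (\<lambda>x. B * norm (f x))" using f by simp
  have "g \<in> borel_measurable borel" by (intro borel_measurable_continuous_onI g)
  then show "(\<lambda>x. f x * g x) \<in> borel_measurable lborel" using f by simp
  show "AE x in lborel. norm (f x * g x) \<le> norm (B * norm (f x))"
  proof (rule AE_I2)
    fix x
    have "norm (f x) * norm (g x) \<le> norm (f x) * B" by (intro mult_left_mono g) auto
    then show "norm (f x * g x) \<le> norm (B * norm (f x))" by (simp add: norm_mult mult.commute)
  qed
qed

lemma dispersion_integrable:
  assumes "integrable lborel (\<lambda>x. exp x *\<^sub>R jp x)" "integrable lborel (\<lambda>x. exp x *\<^sub>R jm x)" "Re w > 0"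
  shows "integrable lborel (dispersion_integrand jp jm w)"
proof -
  have "integrable lborel (\<lambda>x. (exp x *\<^sub>R jm x) * (\<i> / (\<i> * exp x + w)))"
    by (rule integrable_mult_bounded[OF assms(2), where B="1 / Re w"])
       (use dispersion_denominator[OF assms(3)] assms(3) in \<open>auto intro!: continuous_intros divide_left_mono simp: norm_divide\<close>)
  moreover have "integrable lborel (\<lambda>x. (exp x *\<^sub>R jp x) * (\<i> / (\<i> * exp x - w)))"
    by (rule integrable_mult_bounded[OF assms(1), where B="1 / Re w"])
       (use dispersion_denominator[OF assms(3)] assms(3) in \<open>auto intro!: continuous_intros divide_left_mono simp: norm_divide\<close>)
  ultimately show ?thesis unfolding dispersion_integrand_def[abs_def] by (rule Bochner_Integration.integrable_diff)
qed

lemma exp_eq_iff_strip: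
  assumes "\<bar>Im \<xi> - Im \<xi>0\<bar> < 2 * pi" "exp \<xi> = exp \<xi>0"
  shows "\<xi> = \<xi>0"
proof -
  obtain n :: int where n: "\<xi> = \<xi>0 + complex_of_real (real_of_int (2 * n) * pi) * \<i>"
    using assms(2) exp_eq by blast
  then have "\<bar>of_int (2 * n) * pi\<bar> < 2 * pi" using assms(1) by simp
  then have "n = 0" by (simp add: abs_mult)
  then show ?thesis using n by simp
qed

lemma norm_exp_plus_ge:
  assumes "\<bar>Im \<xi>\<bar> \<le> pi / 2"
  shows "norm (exp \<xi> + 1) \<ge> 1" "norm (exp \<xi> + 1) \<ge> exp (Re \<xi>)"
proof -
  have c: "Re (exp \<xi>) \<ge> 0" using assms by (auto simp: Re_exp intro!: mult_nonneg_nonneg cos_ge_zero)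
  then show "norm (exp \<xi> + 1) \<ge> 1" using complex_Re_le_cmod[of "exp \<xi> + 1"] by simp
  have "(norm (exp \<xi>))\<^sup>2 \<le> (norm (exp \<xi> + 1))\<^sup>2"
    using c by (simp only: cmod_power2) (simp add: power2_eq_square algebra_simps)
  then have "norm (exp \<xi>) \<le> norm (exp \<xi> + 1)" by (rule power2_le_imp_le) simp
  then show "norm (exp \<xi> + 1) \<ge> exp (Re \<xi>)" by simp
qed

text \<open>The strip \<open>\<bar>Im \<xi>\<bar> \<le> \<pi> / 2\<close> parametrises the right half plane by \<open>w = e\<^sup>\<xi>\<close> and the left one by \<open>w = - e\<^sup>\<xi>\<close>.\<close>

definition strip_growth :: "real \<Rightarrow> real \<Rightarrow> real \<Rightarrow> (complex \<Rightarrow> complex) \<Rightarrow> bool" where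
  "strip_growth C \<alpha> \<beta> F \<longleftrightarrow> (\<forall>\<xi>. \<bar>Im \<xi>\<bar> \<le> pi / 2 \<longrightarrow>
     norm (F \<xi>) \<le> C * (if Re \<xi> \<ge> 0 then exp (\<alpha> * Re \<xi>) else exp (- \<beta> * Re \<xi>)))"

text \<open>F dv / (v - w) pulled back to the strip by v = exp \<xi>.\<close>

definition cauchy_kernel :: "(complex \<Rightarrow> complex) \<Rightarrow> complex \<Rightarrow> complex \<Rightarrow> complex" where
  "cauchy_kernel F w \<xi> = F \<xi> * (exp \<xi> / (exp \<xi> - w))"

section \<open>Cauchy integrals over rectangles in the strip\<close>

lemma exp_Complex_half_pi: "exp (Complex x (pi / 2)) = \<i> * exp x" "exp (Complex x (- (pi / 2))) = - (\<i> * exp x)"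
  by (simp_all add: complex_eq_iff Re_exp Im_exp exp_of_real)

lemma vertical_segment:
  assumes "t \<in> closed_segment (Complex x (- (pi / 2))) (Complex x (pi / 2))"
  shows "Re t = x" "\<bar>Im t\<bar> \<le> pi / 2"
  using assms by (auto simp: closed_segment_same_Re closed_segment_eq_real_ivl split: if_splits)

text \<open>The vertical sides are the arcs |v| = exp n and |v| = exp (- n). On the large arc the
  decay O(1 / |v|) of F suffices; on the small one the kernel contributes exp (- n), which outweighs
  exp (\<beta> n) because \<beta> < 1.\<close>

lemma cauchy_kernel_sides:
  assumes F: "continuous_on {\<xi>. \<bar>Im \<xi>\<bar> < pi} F" and g: "strip_growth C (-1) \<beta> F" and \<beta>: "\<beta> < 1" and w: "w \<noteq> 0"
  shows "(\<lambda>n. contour_integral (linepath (Complex (real n) (- (pi / 2))) (Complex (real n) (pi / 2))) (cauchy_kernel F w)) \<longlonglongrightarrow> 0"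
    and "(\<lambda>n. contour_integral (linepath (Complex (- real n) (- (pi / 2))) (Complex (- real n) (pi / 2))) (cauchy_kernel F w)) \<longlonglongrightarrow> 0"
proof -
  have bound: "norm (contour_integral (linepath (Complex x (- (pi / 2))) (Complex x (pi / 2))) (cauchy_kernel F w)) \<le> B * pi"
    if B: "\<And>t. Re t = x \<Longrightarrow> \<bar>Im t\<bar> \<le> pi / 2 \<Longrightarrow> exp t \<noteq> w \<and> norm (cauchy_kernel F w t) \<le> B" for x B
  proof -
    have "norm (contour_integral (linepath (Complex x (- (pi / 2))) (Complex x (pi / 2))) (cauchy_kernel F w))
      \<le> B * norm (Complex x (pi / 2) - Complex x (- (pi / 2)))"
    proof (rule contour_integral_bound_linepath)
      let ?c = "closed_segment (Complex x (- (pi / 2))) (Complex x (pi / 2))"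
      have "?c \<subseteq> {\<xi>. \<bar>Im \<xi>\<bar> < pi}"
      proof
        fix t assume "t \<in> ?c"
        from vertical_segment(2)[OF this] show "t \<in> {\<xi>. \<bar>Im \<xi>\<bar> < pi}"
          unfolding mem_Collect_eq using pi_gt_zero by linarith
      qed
      then have "continuous_on ?c F" by (rule continuous_on_subset[OF F])
      moreover have "exp t - w \<noteq> 0" if "t \<in> ?c" for t
        using B[of t] vertical_segment[OF that] by simp
      ultimately have "continuous_on ?c (cauchy_kernel F w)"
        unfolding cauchy_kernel_def[abs_def] by (intro continuous_intros) auto
      then show "cauchy_kernel F w contour_integrable_on linepath (Complex x (- (pi / 2))) (Complex x (pi / 2))"
        by (rule contour_integrable_continuous_linepath)
      have "norm (cauchy_kernel F w (of_real x)) \<le> B" using B[of "of_real x"] by simp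
      then show "0 \<le> B" using norm_ge_zero[of "cauchy_kernel F w (of_real x)"] by linarith
    qed (use B vertical_segment[of _ x] in auto)
    moreover have "Complex x (pi / 2) - Complex x (- (pi / 2)) = \<i> * of_real pi" by (simp add: complex_eq_iff)
    ultimately show ?thesis by (simp add: norm_mult)
  qed
  have nw: "norm w > 0" using w by simp
  have "norm (F 0) \<le> C * 1" using g[unfolded strip_growth_def, rule_format, of 0] by simp
  then have C: "C \<ge> 0" using norm_ge_zero[of "F 0"] by linarith
  show "(\<lambda>n. contour_integral (linepath (Complex (real n) (- (pi / 2))) (Complex (real n) (pi / 2))) (cauchy_kernel F w)) \<longlonglongrightarrow> 0"
  proof (rule Lim_null_comparison)
    have "eventually (\<lambda>n. exp (real n) \<ge> 2 * norm w) sequentially"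
      using nw by real_asymp
    then show "\<forall>\<^sub>F n in sequentially. norm (contour_integral (linepath (Complex (real n) (- (pi / 2))) (Complex (real n) (pi / 2))) (cauchy_kernel F w))
        \<le> (C * exp (- 1 * real n) * 2) * pi"
    proof eventually_elim
      case (elim n)
      show ?case
      proof (rule bound)
        fix t assume t: "Re t = real n" "\<bar>Im t\<bar> \<le> pi / 2"
        have e: "norm (exp t) \<le> norm (exp t - w) * 2"
          using norm_triangle_ineq2[of "exp t" w] elim t by simp
        then have ne: "exp t \<noteq> w" by auto
        have "norm (F t) \<le> C * exp (- 1 * real n)" using g t unfolding strip_growth_def by auto
        moreover have "norm (exp t) / norm (exp t - w) \<le> 2" using e ne by (simp add: field_simps)
        ultimately have "norm (F t) * (norm (exp t) / norm (exp t - w)) \<le> C * exp (- 1 * real n) * 2"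
          by (intro mult_mono) (auto simp: C)
        with ne show "exp t \<noteq> w \<and> norm (cauchy_kernel F w t) \<le> C * exp (- 1 * real n) * 2"
          by (simp add: cauchy_kernel_def norm_mult norm_divide)
      qed
    qed
    show "(\<lambda>n. (C * exp (- 1 * real n) * 2) * pi) \<longlonglongrightarrow> 0" by real_asymp
  qed
  show "(\<lambda>n. contour_integral (linepath (Complex (- real n) (- (pi / 2))) (Complex (- real n) (pi / 2))) (cauchy_kernel F w)) \<longlonglongrightarrow> 0"
  proof (rule Lim_null_comparison)
    have "eventually (\<lambda>n. exp (- real n) \<le> norm w / 2) sequentially"
      using nw by real_asymp
    with eventually_gt_at_top[of 0] show "\<forall>\<^sub>F n in sequentially. norm (contour_integral (linepath (Complex (- real n) (- (pi / 2))) (Complex (- real n) (pi / 2))) (cauchy_kernel F w))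
        \<le> (C * exp (\<beta> * real n) * (exp (- real n) * 2 / norm w)) * pi"
    proof eventually_elim
      case (elim n)
      show ?case
      proof (rule bound)
        fix t assume t: "Re t = - real n" "\<bar>Im t\<bar> \<le> pi / 2"
        have e: "norm w \<le> norm (exp t - w) * 2"
          using norm_triangle_ineq2[of w "exp t"] elim t by (simp add: norm_minus_commute)
        then have ne: "exp t \<noteq> w" using nw by auto
        have "norm (F t) \<le> C * exp (\<beta> * real n)" using g t elim(1) unfolding strip_growth_def by auto
        moreover have "norm (exp t) / norm (exp t - w) \<le> exp (- real n) * 2 / norm w"
        proof -
          have "1 / norm (exp t - w) \<le> 2 / norm w" using e ne nw by (simp add: field_simps)
          from mult_left_mono[OF this, of "exp (- real n)"] show ?thesis using t by simp
        qed
        ultimately have "norm (F t) * (norm (exp t) / norm (exp t - w)) \<le> C * exp (\<beta> * real n) * (exp (- real n) * 2 / norm w)"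
          by (intro mult_mono) (auto simp: C)
        with ne show "exp t \<noteq> w \<and> norm (cauchy_kernel F w t) \<le> C * exp (\<beta> * real n) * (exp (- real n) * 2 / norm w)"
          by (simp add: cauchy_kernel_def norm_mult norm_divide)
      qed
    qed
    have "(\<lambda>n. exp ((\<beta> - 1) * real n)) \<longlonglongrightarrow> 0" using \<beta> by real_asymp
    then have "(\<lambda>n. (C * 2 / norm w * pi) * exp ((\<beta> - 1) * real n)) \<longlonglongrightarrow> 0"
      by (rule tendsto_mult_right_zero)
    moreover have "exp ((\<beta> - 1) * real n) = exp (\<beta> * real n) * exp (- real n)" for n
      by (simp add: left_diff_distrib flip: exp_add)
    ultimately show "(\<lambda>n. (C * exp (\<beta> * real n) * (exp (- real n) * 2 / norm w)) * pi) \<longlonglongrightarrow> 0"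
      by (simp add: mult_ac)
  qed
qed

lemma convex_open_strip: "convex {\<xi>. \<bar>Im \<xi>\<bar> < a}" "open {\<xi>. \<bar>Im \<xi>\<bar> < a}"
proof -
  have eq: "{\<xi>. \<bar>Im \<xi>\<bar> < a} = {\<xi>. - a < Im \<xi>} \<inter> {\<xi>. Im \<xi> < a}" by auto
  show "convex {\<xi>. \<bar>Im \<xi>\<bar> < a}" unfolding eq
    using convex_halfspace_Im_gt[of "-a"] convex_halfspace_Im_lt[of a] by (intro convex_Int) auto
  show "open {\<xi>. \<bar>Im \<xi>\<bar> < a}" unfolding eq
    by (intro open_Int open_halfspace_Im_gt open_halfspace_Im_lt)
qed

lemma cauchy_kernel_inside:
  assumes F: "F holomorphic_on {\<xi>. \<bar>Im \<xi>\<bar> < pi}" and \<xi>0: "\<bar>Im \<xi>0\<bar> < pi / 2" and R: "\<bar>Re \<xi>0\<bar> < R"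
  shows "contour_integral (rectpath (Complex (- R) (- (pi / 2))) (Complex R (pi / 2))) (cauchy_kernel F (exp \<xi>0)) = 2 * pi * \<i> * F \<xi>0"
proof -
  let ?S = "{\<xi>. \<bar>Im \<xi>\<bar> < pi}" and ?p = "rectpath (Complex (- R) (- (pi / 2))) (Complex R (pi / 2))"
  \<comment> \<open>D is the divided difference of exp. It has no zero in the strip, because heights
    there differ from that of \<xi>0 by less than 2 \<pi>; hence g is holomorphic and Cauchy's
    formula applies in \<xi>.\<close>
  define D where "D = (\<lambda>\<xi>. if \<xi> = \<xi>0 then deriv exp \<xi>0 else (exp \<xi> - exp \<xi>0) / (\<xi> - \<xi>0))"
  have D: "D holomorphic_on UNIV" unfolding D_def by (intro pole_lemma_open holomorphic_intros) auto
  have D0: "D \<xi>0 = exp \<xi>0" by (simp add: D_def DERIV_imp_deriv[OF DERIV_exp])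
  have Dnz: "D \<xi> \<noteq> 0" if "\<xi> \<in> ?S" for \<xi>
  proof (cases "\<xi> = \<xi>0")
    case False
    have "\<bar>Im \<xi> - Im \<xi>0\<bar> < 2 * pi" using that \<xi>0 by auto
    then show ?thesis using False exp_eq_iff_strip[of \<xi> \<xi>0] by (auto simp: D_def)
  qed (simp add: D0)
  define g where "g = (\<lambda>\<xi>. F \<xi> * exp \<xi> / D \<xi>)"
  have g: "g holomorphic_on ?S"
    unfolding g_def using Dnz by (intro holomorphic_intros F holomorphic_on_subset[OF D]) auto
  have box: "\<xi>0 \<in> box (Complex (- R) (- (pi / 2))) (Complex R (pi / 2))"
    using \<xi>0 R by (auto simp: in_box_complex_iff)
  have pim: "path_image ?p \<subseteq> ?S - {\<xi>0}"
  proof -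
    have "path_image ?p = cbox (Complex (- R) (- (pi / 2))) (Complex R (pi / 2)) - box (Complex (- R) (- (pi / 2))) (Complex R (pi / 2))"
      using R by (intro path_image_rectpath_cbox_minus_box) auto
    moreover have "\<bar>Im \<xi>\<bar> < pi" if "\<xi> \<in> cbox (Complex (- R) (- (pi / 2))) (Complex R (pi / 2))" for \<xi>
    proof -
      have "- (pi / 2) \<le> Im \<xi>" "Im \<xi> \<le> pi / 2" using that by (simp_all add: in_cbox_complex_iff)
      then show ?thesis using pi_gt_zero by linarith
    qed
    ultimately show ?thesis using box by blast
  qed
  have "((\<lambda>\<xi>. g \<xi> / (\<xi> - \<xi>0)) has_contour_integral (2 * pi * \<i> * winding_number ?p \<xi>0 * g \<xi>0)) ?p"
    by (rule Cauchy_integral_formula_convex_simple[OF convex_open_strip(1) g])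
       (use pim \<xi>0 in \<open>auto simp: interior_open[OF convex_open_strip(2)]\<close>)
  also have "winding_number ?p \<xi>0 = 1" by (rule winding_number_rectpath[OF box])
  also have "g \<xi>0 = F \<xi>0" by (simp add: g_def D0)
  finally have "((\<lambda>\<xi>. g \<xi> / (\<xi> - \<xi>0)) has_contour_integral (2 * pi * \<i> * F \<xi>0)) ?p" by simp
  then have "(cauchy_kernel F (exp \<xi>0) has_contour_integral (2 * pi * \<i> * F \<xi>0)) ?p"
  proof (rule has_contour_integral_eq)
    fix \<xi> assume "\<xi> \<in> path_image ?p"
    then have "\<xi> \<noteq> \<xi>0" using pim by blast
    then show "g \<xi> / (\<xi> - \<xi>0) = cauchy_kernel F (exp \<xi>0) \<xi>"
      by (simp add: g_def D_def cauchy_kernel_def)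
  qed
  then show ?thesis by (rule contour_integral_unique)
qed

text \<open>The pole sits at - exp \<xi>0, whose logarithms have heights Im \<xi>0 \<plusminus>
  \<pi> at the nearest. The strip |Im \<xi>| < \<pi> - |Im \<xi>0| avoids them and still contains
  the rectangle, since |Im \<xi>0| < \<pi> / 2.\<close>

lemma cauchy_kernel_outside:
  assumes G: "G holomorphic_on {\<xi>. \<bar>Im \<xi>\<bar> < pi}" and \<xi>0: "\<bar>Im \<xi>0\<bar> < pi / 2" and R: "R > 0"
  shows "contour_integral (rectpath (Complex (- R) (- (pi / 2))) (Complex R (pi / 2))) (cauchy_kernel G (- exp \<xi>0)) = 0"
proof -
  let ?S = "{\<xi>. \<bar>Im \<xi>\<bar> < pi - \<bar>Im \<xi>0\<bar>}" and ?p = "rectpath (Complex (- R) (- (pi / 2))) (Complex R (pi / 2))"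
  have nz: "exp \<xi> \<noteq> - exp \<xi>0" if \<xi>: "\<xi> \<in> ?S" for \<xi>
  proof
    assume e: "exp \<xi> = - exp \<xi>0"
    define v where "v = (if Im \<xi>0 \<ge> 0 then - (\<i> * of_real pi) else \<i> * complex_of_real pi)"
    have "exp (\<xi>0 + v) = - exp \<xi>0" using exp_add_pm_pi_i(1)[of v \<xi>0] by (auto simp: v_def)
    then have "exp \<xi> = exp (\<xi>0 + v)" using e by simp
    moreover have "\<bar>Im \<xi> - Im (\<xi>0 + v)\<bar> < 2 * pi" using \<xi> by (auto simp: v_def abs_if split: if_splits)
    ultimately have "\<xi> = \<xi>0 + v" using exp_eq_iff_strip by blast
    then show False using \<xi> by (auto simp: v_def abs_if split: if_splits)
  qed
  have pim: "path_image ?p \<subseteq> ?S"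
  proof -
    have "path_image ?p \<subseteq> cbox (Complex (- R) (- (pi / 2))) (Complex R (pi / 2))"
      using R by (intro path_image_rectpath_subset_cbox) auto
    then show ?thesis using \<xi>0 by (force simp: in_cbox_complex_iff abs_less_iff)
  qed
  have "cauchy_kernel G (- exp \<xi>0) holomorphic_on ?S"
    unfolding cauchy_kernel_def[abs_def] using nz
    by (intro holomorphic_intros holomorphic_on_subset[OF G]) (auto simp: add_eq_0_iff2)
  then have "(cauchy_kernel G (- exp \<xi>0) has_contour_integral 0) ?p"
    by (rule Cauchy_theorem_convex_simple) (use pim convex_open_strip in auto)
  then show ?thesis by (rule contour_integral_unique)
qed

text \<open>The vanishing integral of G is added to the Cauchy integral of F. As v = exp \<xi> for F
  and v = - exp \<xi> for G, the edge of F at height \<pi> / 2 and the edge of G at height - \<pi> /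
  2 lie over the same half axis in v, and likewise with the heights exchanged; the horizontal
  integrals combine into jumps.\<close>

lemma cauchy_kernel_pair:
  fixes F G :: "complex \<Rightarrow> complex"
  assumes F: "F holomorphic_on {\<xi>. \<bar>Im \<xi>\<bar> < pi}" and G: "G holomorphic_on {\<xi>. \<bar>Im \<xi>\<bar> < pi}"
    and \<xi>0: "\<bar>Im \<xi>0\<bar> < pi / 2" and R: "\<bar>Re \<xi>0\<bar> < R"
  defines "jp \<equiv> \<lambda>x. F (Complex x (pi / 2)) - G (Complex x (- (pi / 2)))"
    and "jm \<equiv> \<lambda>x. F (Complex x (- (pi / 2))) - G (Complex x (pi / 2))"
    and "V \<equiv> \<lambda>K x. contour_integral (linepath (Complex x (- (pi / 2))) (Complex x (pi / 2))) K"
    and "w \<equiv> exp \<xi>0"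
  shows "2 * pi * \<i> * F \<xi>0 = integral {-R..R} (dispersion_integrand jp jm w)
     + V (cauchy_kernel F w) R - V (cauchy_kernel F w) (- R) + V (cauchy_kernel G (- w)) R - V (cauchy_kernel G (- w)) (- R)"
proof -
  let ?p = "rectpath (Complex (- R) (- (pi / 2))) (Complex R (pi / 2))"
  have wpos: "Re w > 0" using \<xi>0 by (auto simp: w_def Re_exp intro!: mult_pos_pos cos_gt_zero_pi)
  have R0: "R > 0" using R by linarith
  have pi: "pi > 0" by simp
  have pim: "path_image ?p = cbox (Complex (- R) (- (pi / 2))) (Complex R (pi / 2)) - box (Complex (- R) (- (pi / 2))) (Complex R (pi / 2))"
    using R0 by (intro path_image_rectpath_cbox_minus_box) auto
  have ims: "\<bar>Im \<xi>\<bar> \<le> pi / 2" if "\<xi> \<in> path_image ?p" for \<xi>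
    using that unfolding pim by (auto simp: in_cbox_complex_iff)
  have pS: "path_image ?p \<subseteq> {\<xi>. \<bar>Im \<xi>\<bar> < pi}"
  proof
    fix \<xi> assume "\<xi> \<in> path_image ?p"
    from ims[OF this] show "\<xi> \<in> {\<xi>. \<bar>Im \<xi>\<bar> < pi}" unfolding mem_Collect_eq using pi by linarith
  qed
  have box: "\<xi>0 \<in> box (Complex (- R) (- (pi / 2))) (Complex R (pi / 2))"
    using \<xi>0 R by (auto simp: in_box_complex_iff)
  have nz1: "exp \<xi> - w \<noteq> 0" if "\<xi> \<in> path_image ?p" for \<xi>
  proof
    assume "exp \<xi> - w = 0"
    moreover have "\<bar>Im \<xi> - Im \<xi>0\<bar> < 2 * pi" using ims[OF that] \<xi>0 by linarith
    ultimately have "\<xi> = \<xi>0" unfolding w_def using exp_eq_iff_strip by simp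
    then show False using that box unfolding pim by blast
  qed
  have nz2: "exp \<xi> - - w \<noteq> 0" if "\<xi> \<in> path_image ?p" for \<xi>
  proof
    assume "exp \<xi> - - w = 0"
    then have "Re (exp \<xi>) + Re w = 0" by (metis diff_minus_eq_add plus_complex.simps(1) zero_complex.simps(1))
    moreover have "Re (exp \<xi>) \<ge> 0" using ims[OF that] by (auto simp: Re_exp intro!: mult_nonneg_nonneg cos_ge_zero)
    ultimately show False using wpos by linarith
  qed
  have contF: "continuous_on (path_image ?p) (cauchy_kernel F w)" and contG: "continuous_on (path_image ?p) (cauchy_kernel G (- w))"
    unfolding cauchy_kernel_def[abs_def] using nz1 nz2
    by (auto intro!: continuous_intros continuous_on_subset[OF holomorphic_on_imp_continuous_on[OF F] pS]
        continuous_on_subset[OF holomorphic_on_imp_continuous_on[OF G] pS])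
  have edge: "continuous_on {-R..R} (\<lambda>x. K (Complex x y))"
    if "continuous_on (path_image ?p) K" "y = pi / 2 \<or> y = - (pi / 2)" for K :: "complex \<Rightarrow> complex" and y
  proof (rule continuous_on_compose2[OF that(1)])
    show "continuous_on {-R..R} (\<lambda>x. Complex x y)" unfolding Complex_eq by (intro continuous_intros)
    have "- (pi / 2) \<le> y" "y \<le> pi / 2" "\<not> (- (pi / 2) < y \<and> y < pi / 2)"
      using that(2) pi_gt_zero by linarith+
    then show "(\<lambda>x. Complex x y) ` {- R..R} \<subseteq> path_image ?p"
      unfolding pim using R0 by (auto simp: in_cbox_complex_iff in_box_complex_iff)
  qed
  let ?I = "\<lambda>K y. integral {-R..R} (\<lambda>x. K (Complex x y))"
  have "2 * pi * \<i> * F \<xi>0 + 0 = contour_integral ?p (cauchy_kernel F w) + contour_integral ?p (cauchy_kernel G (- w))"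
    unfolding w_def cauchy_kernel_inside[OF F \<xi>0 R] cauchy_kernel_outside[OF G \<xi>0 R0] ..
  also have "\<dots> = (?I (cauchy_kernel F w) (- (pi / 2)) - ?I (cauchy_kernel F w) (pi / 2) + ?I (cauchy_kernel G (- w)) (- (pi / 2)) - ?I (cauchy_kernel G (- w)) (pi / 2))
     + V (cauchy_kernel F w) R - V (cauchy_kernel F w) (- R) + V (cauchy_kernel G (- w)) R - V (cauchy_kernel G (- w)) (- R)"
    using contour_integral_rectpath[OF _ _ contF] contour_integral_rectpath[OF _ _ contG] R0 by (simp add: V_def)
  also have "?I (cauchy_kernel F w) (- (pi / 2)) - ?I (cauchy_kernel F w) (pi / 2) + ?I (cauchy_kernel G (- w)) (- (pi / 2)) - ?I (cauchy_kernel G (- w)) (pi / 2)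
     = integral {-R..R} (\<lambda>x. cauchy_kernel F w (Complex x (- (pi / 2))) - cauchy_kernel F w (Complex x (pi / 2))
         + cauchy_kernel G (- w) (Complex x (- (pi / 2))) - cauchy_kernel G (- w) (Complex x (pi / 2)))"
    by (simp add: Henstock_Kurzweil_Integration.integral_diff Henstock_Kurzweil_Integration.integral_add
        integrable_continuous_real edge contF contG continuous_intros)
  also have "\<dots> = integral {-R..R} (dispersion_integrand jp jm w)"
  proof (rule Henstock_Kurzweil_Integration.integral_cong)
    fix x
    have q: "- a / (- a - w) = a / (a + w)" "- a / (- a + w) = a / (a - w)" "a / (a - - w) = a / (a + w)" for a :: complex
    proof -
      have "- a - w = - (a + w)" "- a + w = - (a - w)" "a - - w = a + w" by simp_all
      then show "- a / (- a - w) = a / (a + w)" "- a / (- a + w) = a / (a - w)" "a / (a - - w) = a / (a + w)"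
        by (simp_all only: minus_divide_divide)
    qed
    have e: "\<i> * of_real (exp x) / y = of_real (exp x) * (\<i> / y)" for y by simp
    have gen: "a * (e * A) - b * (e * B) + c * (e * B) - d * (e * A) = (e * (a - d)) * A - (e * (b - c)) * B" for a b c d e A B :: complex
      by algebra
    show "cauchy_kernel F w (Complex x (- (pi / 2))) - cauchy_kernel F w (Complex x (pi / 2))
         + cauchy_kernel G (- w) (Complex x (- (pi / 2))) - cauchy_kernel G (- w) (Complex x (pi / 2)) = dispersion_integrand jp jm w x"
      unfolding cauchy_kernel_def exp_Complex_half_pi q dispersion_integrand_def jp_def jm_def scaleR_conv_of_real e
      by (rule gen)
  qed
  finally show ?thesis by simp
qed

lemma integral_symmetric_tendsto:
  fixes f :: "real \<Rightarrow> complex"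
  assumes "integrable lborel f"
  shows "(\<lambda>n. integral {- real n..real n} f) \<longlonglongrightarrow> (LINT x|lborel. f x)"
proof -
  have U: "(\<Union>n. {- real n..real n}) = UNIV"
  proof -
    have "\<exists>n. x \<in> {- real n..real n}" for x :: real
    proof -
      obtain n :: nat where "\<bar>x\<bar> \<le> real n" using real_arch_simple by blast
      then show ?thesis by (intro exI[of _ n]) auto
    qed
    then show ?thesis by auto
  qed
  have int: "set_integrable lborel UNIV f" using assms by (simp add: set_integrable_def)
  have "(\<lambda>n. LINT x:{- real n..real n}|lborel. f x) \<longlonglongrightarrow> (LINT x:(\<Union>n. {- real n..real n})|lborel. f x)"
    by (rule set_integral_cont_up) (use int in \<open>auto simp: U incseq_def\<close>)
  moreover have "(LINT x:{- real n..real n}|lborel. f x) = integral {- real n..real n} f" for n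
    by (rule set_borel_integral_eq_integral(2)) (rule set_integrable_subset[OF int], auto)
  moreover have "(LINT x:(UNIV::real set)|lborel. f x) = (LINT x|lborel. f x)" by (simp add: set_lebesgue_integral_def)
  ultimately show ?thesis unfolding U by simp
qed

lemma dispersion_decaying:
  fixes F G :: "complex \<Rightarrow> complex"
  assumes F: "F holomorphic_on {\<xi>. \<bar>Im \<xi>\<bar> < pi}" and G: "G holomorphic_on {\<xi>. \<bar>Im \<xi>\<bar> < pi}"
    and gF: "strip_growth C (-1) \<beta> F" and gG: "strip_growth C' (-1) \<beta> G" and \<beta>: "\<beta> < 1"
  defines "jp \<equiv> \<lambda>x. F (Complex x (pi / 2)) - G (Complex x (- (pi / 2)))"
    and "jm \<equiv> \<lambda>x. F (Complex x (- (pi / 2))) - G (Complex x (pi / 2))"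
  assumes ip: "integrable lborel (\<lambda>x. exp x *\<^sub>R jp x)" and im: "integrable lborel (\<lambda>x. exp x *\<^sub>R jm x)"
    and \<xi>0: "\<bar>Im \<xi>0\<bar> < pi / 2"
  shows "2 * pi * \<i> * F \<xi>0 = (LINT x|lborel. dispersion_integrand jp jm (exp \<xi>0) x)"
proof -
  define w where "w = exp \<xi>0"
  define V where "V = (\<lambda>K x. contour_integral (linepath (Complex x (- (pi / 2))) (Complex x (pi / 2))) K)"
  have w0: "w \<noteq> 0" "- w \<noteq> 0" by (simp_all add: w_def)
  have wpos: "Re w > 0" using \<xi>0 by (auto simp: w_def Re_exp intro!: mult_pos_pos cos_gt_zero_pi)
  note sF = cauchy_kernel_sides[OF holomorphic_on_imp_continuous_on[OF F] gF \<beta> w0(1)]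
  note sG = cauchy_kernel_sides[OF holomorphic_on_imp_continuous_on[OF G] gG \<beta> w0(2)]
  have "(\<lambda>n. integral {- real n..real n} (dispersion_integrand jp jm w) + V (cauchy_kernel F w) (real n) - V (cauchy_kernel F w) (- real n)
       + V (cauchy_kernel G (- w)) (real n) - V (cauchy_kernel G (- w)) (- real n)) \<longlonglongrightarrow>
     (LINT x|lborel. dispersion_integrand jp jm w x) + 0 - 0 + 0 - 0"
    unfolding V_def by (intro tendsto_add tendsto_diff sF sG integral_symmetric_tendsto dispersion_integrable ip im wpos)
  moreover have "\<forall>\<^sub>F n in sequentially. integral {- real n..real n} (dispersion_integrand jp jm w) + V (cauchy_kernel F w) (real n) - V (cauchy_kernel F w) (- real n)
       + V (cauchy_kernel G (- w)) (real n) - V (cauchy_kernel G (- w)) (- real n) = 2 * pi * \<i> * F \<xi>0"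
  proof -
    have "eventually (\<lambda>n. \<bar>Re \<xi>0\<bar> < real n) sequentially" by real_asymp
    then show ?thesis
    proof eventually_elim
      case (elim n)
      show ?case unfolding jp_def jm_def V_def w_def
        by (rule cauchy_kernel_pair[OF F G \<xi>0 elim, symmetric])
    qed
  qed
  ultimately have "(\<lambda>n::nat. 2 * pi * \<i> * F \<xi>0) \<longlonglongrightarrow> (LINT x|lborel. dispersion_integrand jp jm w x) + 0 - 0 + 0 - 0"
    by (rule Lim_transform_eventually)
  then show ?thesis by (simp add: LIMSEQ_const_iff w_def)
qed

section \<open>Lowering the degree by divided differences\<close>

lemma strip_quotient_right:
  assumes F: "F holomorphic_on {\<xi>. \<bar>Im \<xi>\<bar> < pi}" and g: "strip_growth C (real M) \<beta> F" and \<beta>: "\<beta> \<ge> 0"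
  obtains F1 C1 where "F1 holomorphic_on {\<xi>. \<bar>Im \<xi>\<bar> < pi}" "strip_growth C1 (real M - 1) \<beta> F1"
    "\<And>\<xi>. F \<xi> = F 0 + (exp \<xi> - 1) * F1 \<xi> \<or> exp \<xi> = 1 \<and> \<xi> \<noteq> 0"
proof -
  let ?S = "{\<xi>. \<bar>Im \<xi>\<bar> < pi}"
  \<comment> \<open>E / D is the divided difference of F with respect to v = exp \<xi> at v = 1. The
    other zeros of exp \<xi> - 1 lie outside the strip and are exempted by the second alternative of
    the last conclusion.\<close>
  define D where "D = (\<lambda>\<xi>. if \<xi> = 0 then deriv exp 0 else (exp \<xi> - exp 0) / (\<xi> - 0 :: complex))"
  define E where "E = (\<lambda>\<xi>. if \<xi> = 0 then deriv F 0 else (F \<xi> - F 0) / (\<xi> - 0))"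
  define F1 where "F1 = (\<lambda>\<xi>. E \<xi> / D \<xi>)"
  have D: "D holomorphic_on UNIV" unfolding D_def by (intro pole_lemma_open holomorphic_intros) auto
  have E: "E holomorphic_on ?S" unfolding E_def by (intro pole_lemma_open F convex_open_strip)
  have Dnz: "D \<xi> \<noteq> 0" if "\<xi> \<in> ?S" for \<xi>
  proof (cases "\<xi> = 0")
    case False
    have "\<bar>Im \<xi> - Im 0\<bar> < 2 * pi" using that by auto
    then show ?thesis using False exp_eq_iff_strip[of \<xi> 0] by (auto simp: D_def)
  qed (simp add: D_def DERIV_imp_deriv[OF DERIV_exp])
  have F1: "F1 holomorphic_on ?S"
    unfolding F1_def using Dnz by (intro holomorphic_intros E holomorphic_on_subset[OF D]) auto
  have eq: "F \<xi> = F 0 + (exp \<xi> - 1) * F1 \<xi> \<or> exp \<xi> = 1 \<and> \<xi> \<noteq> 0" for \<xi>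
    by (cases "\<xi> = 0"; cases "exp \<xi> = 1") (simp_all add: F1_def E_def D_def)
  \<comment> \<open>Near v = 1 division by v - 1 gives no bound; there the quotient is bounded by
    compactness, and away from it the estimate \<open>far\<close> applies.\<close>
  define Q where "Q = cbox (Complex (- 1) (- (pi / 2))) (Complex 1 (pi / 2))"
  have Qin: "\<xi> \<in> Q \<longleftrightarrow> \<bar>Re \<xi>\<bar> \<le> 1 \<and> \<bar>Im \<xi>\<bar> \<le> pi / 2" for \<xi>
    by (auto simp: Q_def in_cbox_complex_iff)
  have "Q \<subseteq> ?S"
  proof
    fix \<xi> assume "\<xi> \<in> Q"
    then have "\<bar>Im \<xi>\<bar> \<le> pi / 2" unfolding Qin by blast
    then show "\<xi> \<in> ?S" unfolding mem_Collect_eq using pi_gt_zero by linarith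
  qed
  then have "bounded (F1 ` Q)"
    by (intro compact_imp_bounded compact_continuous_image continuous_on_subset[OF holomorphic_on_imp_continuous_on[OF F1]])
       (auto simp: Q_def)
  then obtain B where "\<forall>y\<in>F1 ` Q. norm y \<le> B" unfolding bounded_iff by blast
  then have B: "norm (F1 \<xi>) \<le> B" if "\<xi> \<in> Q" for \<xi> using that by blast
  have "0 \<in> Q" by (simp add: Qin)
  then have B0: "B \<ge> 0" using B[of 0] norm_ge_zero[of "F1 0"] by linarith
  have "norm (F 0) \<le> C * 1" using g[unfolded strip_growth_def, rule_format, of 0] by simp
  then have C: "C \<ge> 0" using norm_ge_zero[of "F 0"] by linarith
  define C1 where "C1 = 2 * (C + norm (F 0)) + B * exp 1"
  have "B * 1 \<le> B * exp 1" using B0 by (intro mult_left_mono) auto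
  moreover have "2 * (C + norm (F 0)) \<ge> 0" using C by simp
  ultimately have C1: "C1 \<ge> 2 * (C + norm (F 0))" "C1 \<ge> B * exp 1" "C1 \<ge> B" "C1 \<ge> 0"
    using B0 unfolding C1_def by linarith+
  have far: "norm (F1 \<xi>) \<le> 2 * (C + norm (F 0)) * (K / d)"
    if "norm (F \<xi>) \<le> C * K" "K \<ge> 1" "norm (exp \<xi> - 1) \<ge> d / 2" "d > 0" for \<xi> K d
  proof -
    have nz: "norm (exp \<xi> - 1) > 0" using that by linarith
    then have "F \<xi> = F 0 + (exp \<xi> - 1) * F1 \<xi>" using eq[of \<xi>] by auto
    then have "F1 \<xi> = (F \<xi> - F 0) / (exp \<xi> - 1)" using nz by simp
    then have "norm (F1 \<xi>) = norm (F \<xi> - F 0) / norm (exp \<xi> - 1)" by (simp add: norm_divide)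
    also have "\<dots> \<le> ((C + norm (F 0)) * K) / (d / 2)"
    proof (rule frac_le)
      have "norm (F 0) * 1 \<le> norm (F 0) * K" using that by (intro mult_left_mono) auto
      then show "norm (F \<xi> - F 0) \<le> (C + norm (F 0)) * K"
        using that(1) norm_triangle_ineq4[of "F \<xi>" "F 0"] by (simp add: distrib_right)
    qed (use that C in auto)
    also have "x * K / (d / 2) = 2 * x * (K / d)" for x :: real by simp
    finally show ?thesis .
  qed
  have "strip_growth C1 (real M - 1) \<beta> F1"
    unfolding strip_growth_def
  proof (intro allI impI)
    fix \<xi> assume im: "\<bar>Im \<xi>\<bar> \<le> pi / 2"
    have gF: "norm (F \<xi>) \<le> C * (if Re \<xi> \<ge> 0 then exp (real M * Re \<xi>) else exp (- \<beta> * Re \<xi>))"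
      using g im unfolding strip_growth_def by blast
    consider "Re \<xi> > 1" | "0 \<le> Re \<xi>" "Re \<xi> \<le> 1" | "Re \<xi> < 0" "Re \<xi> \<ge> -1" | "Re \<xi> < -1" by linarith
    then show "norm (F1 \<xi>) \<le> C1 * (if Re \<xi> \<ge> 0 then exp ((real M - 1) * Re \<xi>) else exp (- \<beta> * Re \<xi>))"
    proof cases
      case 1
      have "exp (Re \<xi>) \<ge> 2" using exp_ge_add_one_self[of "Re \<xi>"] 1 by linarith
      then have "norm (exp \<xi> - 1) \<ge> exp (Re \<xi>) / 2" using norm_triangle_ineq2[of "exp \<xi>" 1] by simp
      then have "norm (F1 \<xi>) \<le> 2 * (C + norm (F 0)) * (exp (real M * Re \<xi>) / exp (Re \<xi>))"
        using gF 1 by (intro far) auto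
      also have "exp (real M * Re \<xi>) / exp (Re \<xi>) = exp ((real M - 1) * Re \<xi>)"
        by (simp add: left_diff_distrib exp_diff)
      also have "2 * (C + norm (F 0)) * \<dots> \<le> C1 * \<dots>" using C1 by (intro mult_right_mono) auto
      finally show ?thesis using 1 by simp
    next
      case 2
      have "\<xi> \<in> Q" using 2 im by (simp add: Qin)
      then have "norm (F1 \<xi>) \<le> B * 1" using B by simp
      also have "\<dots> \<le> B * (exp 1 * exp ((real M - 1) * Re \<xi>))"
      proof -
        have "- 1 * Re \<xi> \<le> (real M - 1) * Re \<xi>" using 2 by (intro mult_right_mono) auto
        then have "0 \<le> 1 + (real M - 1) * Re \<xi>" using 2 by linarith
        then have "1 \<le> exp (1 + (real M - 1) * Re \<xi>)" by simp
        then show ?thesis using B0 unfolding exp_add by (intro mult_left_mono) auto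
      qed
      also have "\<dots> = (B * exp 1) * exp ((real M - 1) * Re \<xi>)" by simp
      also have "\<dots> \<le> C1 * exp ((real M - 1) * Re \<xi>)" using C1 by (intro mult_right_mono) auto
      finally show ?thesis using 2 by simp
    next
      case 3
      have "\<xi> \<in> Q" using 3 im by (simp add: Qin)
      then have "norm (F1 \<xi>) \<le> C1 * 1" using B[of \<xi>] C1 by simp
      also have "\<dots> \<le> C1 * exp (- \<beta> * Re \<xi>)"
        using C1 3 \<beta> by (intro mult_left_mono) (auto simp: mult_nonneg_nonpos)
      finally show ?thesis using 3 by simp
    next
      case 4
      have "exp (Re \<xi>) \<le> exp (- 1)" using 4 by simp
      also have "\<dots> \<le> 1 / 2"
      proof -
        have "exp (- 1) * 2 \<le> exp (- 1) * exp (1::real)"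
          using exp_ge_add_one_self[of "1::real"] by (intro mult_left_mono) auto
        then show ?thesis by (simp flip: exp_add)
      qed
      finally have "norm (exp \<xi> - 1) \<ge> 1 / 2" using norm_triangle_ineq2[of 1 "exp \<xi>"] by (simp add: norm_minus_commute)
      then have "norm (F1 \<xi>) \<le> 2 * (C + norm (F 0)) * (exp (- \<beta> * Re \<xi>) / 1)"
        using gF 4 \<beta> by (intro far) (auto simp: mult_nonneg_nonpos)
      also have "\<dots> \<le> C1 * exp (- \<beta> * Re \<xi>)" using C1 by simp
      finally show ?thesis using 4 by simp
    qed
  qed
  with F1 eq that show thesis by blast
qed

text \<open>In the left half plane v = - exp \<xi> never meets 1, so any constant c may be
  subtracted. With c the value of F at v = 1, the jump of the quotients is the old jump divided by v
  - 1.\<close>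

lemma strip_quotient_left:
  fixes c :: complex
  assumes G: "G holomorphic_on {\<xi>. \<bar>Im \<xi>\<bar> < pi}" and g: "strip_growth C (real M) \<beta> G" and \<beta>: "\<beta> \<ge> 0"
  defines "G1 \<equiv> \<lambda>\<xi>. (G \<xi> - c) / (- exp \<xi> - 1)"
  shows "G1 holomorphic_on {\<xi>. \<bar>Im \<xi>\<bar> < pi}" "strip_growth (C + norm c) (real M - 1) \<beta> G1"
proof -
  have nz: "- exp \<xi> - 1 \<noteq> 0" if "\<bar>Im \<xi>\<bar> < pi" for \<xi>
  proof
    assume "- exp \<xi> - 1 = 0"
    then have "exp \<xi> = - 1" by algebra
    then have e: "exp \<xi> = exp (\<i> * of_real pi)" by simp
    have "\<bar>Im \<xi> - Im (\<i> * of_real pi)\<bar> < 2 * pi" using that by simp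
    from exp_eq_iff_strip[OF this e] show False using that by simp
  qed
  then show "G1 holomorphic_on {\<xi>. \<bar>Im \<xi>\<bar> < pi}"
    unfolding G1_def by (intro holomorphic_intros G) blast
  have "norm (G 0) \<le> C * 1" using g[unfolded strip_growth_def, rule_format, of 0] by simp
  then have C: "C \<ge> 0" using norm_ge_zero[of "G 0"] by linarith
  show "strip_growth (C + norm c) (real M - 1) \<beta> G1"
    unfolding strip_growth_def
  proof (intro allI impI)
    fix \<xi> assume im: "\<bar>Im \<xi>\<bar> \<le> pi / 2"
    define K where "K = (if Re \<xi> \<ge> 0 then exp (real M * Re \<xi>) else exp (- \<beta> * Re \<xi>))"
    define d where "d = (if Re \<xi> \<ge> 0 then exp (Re \<xi>) else 1)"
    have K: "K \<ge> 1" using \<beta> by (auto simp: K_def mult_nonneg_nonpos)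
    have gG: "norm (G \<xi>) \<le> C * K" using g im unfolding strip_growth_def K_def by blast
    have d: "d > 0" "norm (exp \<xi> + 1) \<ge> d" using norm_exp_plus_ge[OF im] by (auto simp: d_def)
    have n: "norm (- exp \<xi> - 1) = norm (exp \<xi> + 1)"
    proof -
      have "- exp \<xi> - 1 = - (exp \<xi> + 1)" by simp
      then show ?thesis by (simp only: norm_minus_cancel)
    qed
    have "norm (G1 \<xi>) = norm (G \<xi> - c) / norm (exp \<xi> + 1)" unfolding G1_def norm_divide n ..
    also have "\<dots> \<le> ((C + norm c) * K) / d"
    proof (rule frac_le)
      have "norm c * 1 \<le> norm c * K" using K by (intro mult_left_mono) auto
      then show "norm (G \<xi> - c) \<le> (C + norm c) * K"
        using gG norm_triangle_ineq4[of "G \<xi>" c] by (simp add: distrib_right)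
    qed (use d K C in auto)
    also have "\<dots> = (C + norm c) * (if Re \<xi> \<ge> 0 then exp ((real M - 1) * Re \<xi>) else exp (- \<beta> * Re \<xi>))"
      by (simp add: K_def d_def left_diff_distrib exp_diff)
    finally show "norm (G1 \<xi>) \<le> \<dots>" .
  qed
qed

text \<open>A polynomially growing \<open>F\<close> is reduced to a decaying one by the divided difference
  \<open>(F - F(1)) / (w - 1)\<close> in the variable \<open>w = e\<^sup>\<xi>\<close>, applied to both half planes; each step costs one degree of the polynomial.\<close>

lemma dispersion:
  fixes F G :: "complex \<Rightarrow> complex"
  assumes "F holomorphic_on {\<xi>. \<bar>Im \<xi>\<bar> < pi}" "G holomorphic_on {\<xi>. \<bar>Im \<xi>\<bar> < pi}"
    and "strip_growth C (real M - 1) \<beta> F" "strip_growth C' (real M - 1) \<beta> G" and \<beta>: "0 \<le> \<beta>" "\<beta> < 1"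
    and "integrable lborel (\<lambda>x. exp x *\<^sub>R (F (Complex x (pi / 2)) - G (Complex x (- (pi / 2)))))"
    and "integrable lborel (\<lambda>x. exp x *\<^sub>R (F (Complex x (- (pi / 2))) - G (Complex x (pi / 2))))"
  shows "\<exists>p. \<forall>\<xi>. \<bar>Im \<xi>\<bar> < pi / 2 \<longrightarrow> F \<xi> = poly p (exp \<xi>) +
     (LINT x|lborel. dispersion_integrand (\<lambda>x. F (Complex x (pi / 2)) - G (Complex x (- (pi / 2))))
        (\<lambda>x. F (Complex x (- (pi / 2))) - G (Complex x (pi / 2))) (exp \<xi>) x) / (2 * pi * \<i>)"
  using assms(1-4,7,8)
proof (induction M arbitrary: F G C C')
  case 0
  have "F \<xi> = (LINT x|lborel. dispersion_integrand (\<lambda>x. F (Complex x (pi / 2)) - G (Complex x (- (pi / 2))))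
        (\<lambda>x. F (Complex x (- (pi / 2))) - G (Complex x (pi / 2))) (exp \<xi>) x) / (2 * pi * \<i>)"
    if "\<bar>Im \<xi>\<bar> < pi / 2" for \<xi>
    using dispersion_decaying[OF 0(1,2), of C \<beta> C' \<xi>] 0(3-6) \<beta> that by (simp add: field_simps)
  then show ?case by (intro exI[of _ 0]) simp
next
  case (Suc M)
  let ?S = "{\<xi>. \<bar>Im \<xi>\<bar> < pi}"
  have gF: "strip_growth C (real M) \<beta> F" and gG: "strip_growth C' (real M) \<beta> G" using Suc.prems by simp_all
  obtain F1 C1 where F1: "F1 holomorphic_on ?S" "strip_growth C1 (real M - 1) \<beta> F1"
    and F1_eq: "\<And>\<xi>. F \<xi> = F 0 + (exp \<xi> - 1) * F1 \<xi> \<or> exp \<xi> = 1 \<and> \<xi> \<noteq> 0"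
    using strip_quotient_right[OF Suc.prems(1) gF \<beta>(1)] by blast
  define G1 where "G1 = (\<lambda>\<xi>. (G \<xi> - F 0) / (- exp \<xi> - 1))"
  note G1 = strip_quotient_left[OF Suc.prems(2) gG \<beta>(1), of "F 0", folded G1_def]
  define jp where "jp = (\<lambda>x. F (Complex x (pi / 2)) - G (Complex x (- (pi / 2))))"
  define jm where "jm = (\<lambda>x. F (Complex x (- (pi / 2))) - G (Complex x (pi / 2)))"
  have one: "Re 1 > 0" by simp
  have nz: "\<i> * complex_of_real (exp x) - 1 \<noteq> 0" "\<i> * complex_of_real (exp x) + 1 \<noteq> 0" for x
    using dispersion_denominator[OF one, of "exp x"] by auto
  have sub: "a = (b - c) * k \<Longrightarrow> d = (e - c) * k \<Longrightarrow> a - d = (b - e) * k" for a b c d e k :: complex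
    by algebra
  have jp1: "F1 (Complex x (pi / 2)) - G1 (Complex x (- (pi / 2))) = jp x * (1 / (\<i> * exp x - 1))" for x
  proof -
    have "F (Complex x (pi / 2)) = F 0 + (\<i> * exp x - 1) * F1 (Complex x (pi / 2))"
      using F1_eq[of "Complex x (pi / 2)"] nz(1)[of x] unfolding exp_Complex_half_pi by auto
    then have "F1 (Complex x (pi / 2)) = (F (Complex x (pi / 2)) - F 0) * (1 / (\<i> * exp x - 1))"
      using nz(1)[of x] by simp
    moreover have "G1 (Complex x (- (pi / 2))) = (G (Complex x (- (pi / 2))) - F 0) * (1 / (\<i> * exp x - 1))"
      unfolding G1_def exp_Complex_half_pi by simp
    ultimately show ?thesis unfolding jp_def by (rule sub)
  qed
  have jm1: "F1 (Complex x (- (pi / 2))) - G1 (Complex x (pi / 2)) = jm x * (1 / (- (\<i> * exp x) - 1))" for x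
  proof -
    have n: "- (\<i> * complex_of_real (exp x)) - 1 \<noteq> 0" using nz(2)[of x] by (metis minus_add neg_equal_0_iff_equal uminus_add_conv_diff add.commute)
    have "F (Complex x (- (pi / 2))) = F 0 + (- (\<i> * exp x) - 1) * F1 (Complex x (- (pi / 2)))"
      using F1_eq[of "Complex x (- (pi / 2))"] n unfolding exp_Complex_half_pi by auto
    then have "F1 (Complex x (- (pi / 2))) = (F (Complex x (- (pi / 2))) - F 0) * (1 / (- (\<i> * exp x) - 1))"
      using n by simp
    moreover have "G1 (Complex x (pi / 2)) = (G (Complex x (pi / 2)) - F 0) * (1 / (- (\<i> * exp x) - 1))"
      unfolding G1_def exp_Complex_half_pi by simp
    ultimately show ?thesis unfolding jm_def by (rule sub)
  qed
  have m: "- (\<i> * complex_of_real (exp x)) - 1 = - (\<i> * exp x + 1)" for x by simp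
  have "integrable lborel (\<lambda>x. (exp x *\<^sub>R jp x) * (1 / (\<i> * exp x - 1)))"
    by (rule integrable_mult_bounded[where B=1])
       (use Suc.prems(5) nz dispersion_denominator[OF one] in \<open>auto simp: jp_def norm_divide intro!: continuous_intros\<close>)
  then have ip: "integrable lborel (\<lambda>x. exp x *\<^sub>R (F1 (Complex x (pi / 2)) - G1 (Complex x (- (pi / 2)))))"
    by (simp only: jp1 mult_scaleR_left)
  have "integrable lborel (\<lambda>x. (exp x *\<^sub>R jm x) * (1 / (- (\<i> * exp x) - 1)))"
    unfolding m
    by (rule integrable_mult_bounded[where B=1])
       (use Suc.prems(6) nz dispersion_denominator[OF one] in \<open>auto simp: jm_def norm_divide intro!: continuous_intros simp del: minus_add_distrib\<close>)
  then have im: "integrable lborel (\<lambda>x. exp x *\<^sub>R (F1 (Complex x (- (pi / 2))) - G1 (Complex x (pi / 2))))"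
    by (simp only: jm1 mult_scaleR_left)
  from Suc.IH[OF F1(1) G1(1) F1(2) G1(2) ip im]
  obtain p where p: "\<And>\<xi>. \<bar>Im \<xi>\<bar> < pi / 2 \<Longrightarrow> F1 \<xi> = poly p (exp \<xi>) +
     (LINT x|lborel. dispersion_integrand (\<lambda>x. F1 (Complex x (pi / 2)) - G1 (Complex x (- (pi / 2))))
        (\<lambda>x. F1 (Complex x (- (pi / 2))) - G1 (Complex x (pi / 2))) (exp \<xi>) x) / (2 * pi * \<i>)" by blast
  define I where "I = (\<lambda>w. LINT x|lborel. dispersion_integrand jp jm w x)"
  have "F \<xi> = poly ([:F 0 - I 1 / (2 * pi * \<i>):] + [:-1, 1:] * p) (exp \<xi>) + I (exp \<xi>) / (2 * pi * \<i>)"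
    if \<xi>: "\<bar>Im \<xi>\<bar> < pi / 2" for \<xi>
  proof -
    define w where "w = exp \<xi>"
    have wpos: "Re w > 0" using \<xi> by (auto simp: w_def Re_exp intro!: mult_pos_pos cos_gt_zero_pi)
    have ii: "integrable lborel (dispersion_integrand jp jm w)" "integrable lborel (dispersion_integrand jp jm 1)"
      using Suc.prems(5,6) wpos by (auto intro!: dispersion_integrable simp: jp_def jm_def)
    \<comment> \<open>Partial fractions: (w - 1) / ((v - 1) (v - w)) = 1 / (v - w) - 1 / (v - 1).
      The second term is independent of w; its integral is the constant - I 1 / (2 \<pi> \<i>) in
      the new polynomial.\<close>
    have id: "(w - 1) * dispersion_integrand (\<lambda>x. F1 (Complex x (pi / 2)) - G1 (Complex x (- (pi / 2))))
        (\<lambda>x. F1 (Complex x (- (pi / 2))) - G1 (Complex x (pi / 2))) w x = dispersion_integrand jp jm w x - dispersion_integrand jp jm 1 x" for x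
    proof -
      define a where "a = \<i> * complex_of_real (exp x)"
      have d: "a + w \<noteq> 0" "a - w \<noteq> 0" "a - 1 \<noteq> 0" "a + 1 \<noteq> 0"
        using dispersion_denominator[OF wpos, of "exp x"] nz[of x] by (auto simp: a_def)
      have q1: "(w - 1) * (1 / (a - 1) * (\<i> / (a - w))) = \<i> / (a - w) - \<i> / (a - 1)"
        using d by (simp add: divide_simps) (simp add: algebra_simps)
      have q2: "(w - 1) * (1 / (- (a + 1)) * (\<i> / (a + w))) = \<i> / (a + w) - \<i> / (a + 1)"
      proof -
        have "(w - 1) * (1 / (- (a + 1)) * (\<i> / (a + w))) = (1 - w) * (1 / (a + 1) * (\<i> / (a + w)))"
          by (metis (no_types, opaque_lifting) minus_diff_eq minus_divide_right minus_mult_minus mult_minus_left)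
        also have "\<dots> = \<i> / (a + w) - \<i> / (a + 1)"
          using d by (simp add: divide_simps) (simp add: algebra_simps)
        finally show ?thesis .
      qed
      have gen: "W * (P * Q1 * R1 - S * Q2 * R2) = P * (U1 - U2) - S * (T1 - T2)"
        if "W * (Q1 * R1) = U1 - U2" "W * (Q2 * R2) = T1 - T2" for W P Q1 R1 S Q2 R2 U1 U2 T1 T2 :: complex
        using that by algebra
      have "(w - 1) * ((exp x *\<^sub>R jm x) * (1 / (- (a + 1))) * (\<i> / (a + w)) - (exp x *\<^sub>R jp x) * (1 / (a - 1)) * (\<i> / (a - w)))
        = (exp x *\<^sub>R jm x) * (\<i> / (a + w) - \<i> / (a + 1)) - (exp x *\<^sub>R jp x) * (\<i> / (a - w) - \<i> / (a - 1))"
        by (rule gen[OF q2 q1])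
      then show ?thesis
        unfolding dispersion_integrand_def jp1 jm1 m a_def[symmetric] mult_scaleR_left[symmetric]
        by (simp only: right_diff_distrib mult_scaleR_left) (simp add: algebra_simps)
    qed
    have "(w - 1) * (LINT x|lborel. dispersion_integrand (\<lambda>x. F1 (Complex x (pi / 2)) - G1 (Complex x (- (pi / 2))))
        (\<lambda>x. F1 (Complex x (- (pi / 2))) - G1 (Complex x (pi / 2))) w x) = I w - I 1"
      unfolding I_def Bochner_Integration.integral_diff[OF ii, symmetric] id[symmetric] by simp
    moreover have "F \<xi> = F 0 + (w - 1) * F1 \<xi>"
    proof -
      have "\<xi> = 0" if "exp \<xi> = 1"
        using exp_eq_iff_strip[of \<xi> 0] that \<xi> by simp
      then show ?thesis using F1_eq[of \<xi>] by (auto simp: w_def)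
    qed
    moreover have "f = (f0 - b / k) + (v - 1) * P + a / k" if "(v - 1) * J = a - b" "f = f0 + (v - 1) * (P + J / k)"
      for v J a b k f f0 P :: complex
    proof -
      have "f = f0 + (v - 1) * P + ((v - 1) * J) / k" using that(2) by (simp add: distrib_left)
      then show ?thesis unfolding that(1) by (simp add: diff_divide_distrib)
    qed
    ultimately have "F \<xi> = (F 0 - I 1 / (2 * pi * \<i>)) + (w - 1) * poly p w + I w / (2 * pi * \<i>)"
      unfolding p[OF \<xi>] w_def[symmetric] by blast
    then show ?thesis by (simp add: w_def left_diff_distrib)
  qed
  then show ?case unfolding I_def jp_def jm_def by blast
qed

section \<open>Watson's lemma\<close>

text \<open>From here on \<open>$\<close> extracts coefficients of formal power series.\<close>

unbundle no vec_syntax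

text \<open>sinh t - t starts with t^3 / 6, so t^3 can be divided out and the quotient
  inverted.\<close>

lemma sinh_kernel_has_fps_expansion: "\<exists>F. sinh_kernel has_fps_expansion F"
proof -
  define P where "P = fps_const (1/2) * (fps_exp 1 - fps_exp (-1)) - (fps_X :: complex fps)"
  have "(\<lambda>t::complex. 1/2 * (exp t - exp (- t)) - t) has_fps_expansion P"
    unfolding P_def by (intro fps_expansion_intros)
  then have e: "(\<lambda>t::complex. sinh t - t) has_fps_expansion P" by (simp add: sinh_field_def[abs_def])
  have c: "P $ n = 0" if "n < 3" for n
  proof -
    have "n = 0 \<or> n = 1 \<or> n = 2" using that by auto
    then show ?thesis by (auto simp: P_def numeral_2_eq_2)
  qed
  have c3: "P $ 3 = 1/6" by (simp add: P_def eval_nat_numeral)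
  have "3 \<le> subdegree P" using c c3 by (intro subdegree_geI) auto
  from has_fps_expansion_shift[OF e this, of "1/6"]
  have "(\<lambda>t. if t = 0 then 1/6 else (sinh t - t) / t ^ 3) has_fps_expansion fps_shift 3 P" using c3 by simp
  from has_fps_expansion_inverse[OF has_fps_expansion_cmult_left[OF this, of 6]] c3
  have "(\<lambda>t. inverse (6 * (if t = 0 then 1/6 else (sinh t - t) / t ^ 3))) has_fps_expansion inverse (fps_const 6 * fps_shift 3 P)"
    by simp
  moreover have "(\<lambda>t. inverse (6 * (if t = 0 then 1/6 else (sinh t - t) / t ^ 3))) = sinh_kernel"
  proof
    have "inverse (6 * (s / c)) = 1/6 * (c / s)" for s c :: complex by (simp add: inverse_eq_divide)
    then show "inverse (6 * (if t = 0 then 1/6 else (sinh t - t) / t ^ 3)) = sinh_kernel t" for t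
      by (cases "t = 0") (simp_all only: sinh_kernel_def if_True if_False, simp)
  qed
  ultimately show ?thesis by auto
qed

lemma sinh_kernel_0 [simp]: "sinh_kernel 0 = 1" by (simp add: sinh_kernel_def)

lemma sinh_kernel_analytic: "sinh_kernel analytic_on {0}"
  using sinh_kernel_has_fps_expansion has_fps_expansion_imp_analytic_0 by blast

lemma sinh_kernel_powr_analytic: "(\<lambda>t. sinh_kernel t powr a) analytic_on {0}"
  by (intro analytic_on_powr sinh_kernel_analytic analytic_on_const) auto

lemma sinh_kernel_nonzero: "eventually (\<lambda>t. sinh_kernel t \<noteq> 0) (nhds 0)"
proof -
  have "isCont sinh_kernel 0" using sinh_kernel_analytic by (simp add: analytic_at_imp_isCont)
  then have "(sinh_kernel \<longlongrightarrow> 1) (at 0)" by (simp add: isCont_def)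
  then have "eventually (\<lambda>t. sinh_kernel t \<noteq> 0) (at 0)" by (rule tendsto_imp_eventually_ne) simp
  then show ?thesis unfolding eventually_at_filter by eventually_elim auto
qed

text \<open>Lagrange inversion without a compositional inverse: \<open>S\<close> is the new variable, and the residue pairing of
  \<open>S' S\<^sup>k\<close> with \<open>U\<^sup>j\<^sup>+\<^sup>1 = (X / S)\<^sup>j\<^sup>+\<^sup>1\<close> is diagonal.\<close>

lemma fps_lagrange_residue:
  fixes U :: "'a :: field_char_0 fps"
  assumes U: "U $ 0 \<noteq> 0"
  defines "S \<equiv> fps_X * inverse U"
  shows "(fps_deriv S * S ^ k * U ^ (j + 1)) $ j = (if j = k then 1 else 0)"
proof -
  have UU: "U * inverse U = 1" using inverse_mult_eq_1'[OF U] .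
  have SU: "S * U = fps_X" using UU by (simp add: S_def mult.commute mult.left_commute)
  have "fps_deriv S * U + S * fps_deriv U = 1"
    using arg_cong[OF SU, of fps_deriv] by (simp add: add.commute mult.commute)
  then have "(fps_deriv S * U + S * fps_deriv U) * U = U" by simp
  \<comment> \<open>Differentiating S U = X and multiplying by U expresses S' U^2 through U
    alone.\<close>
  then have S'U2: "fps_deriv S * U ^ 2 = U - fps_X * fps_deriv U"
    using SU by (simp add: algebra_simps power2_eq_square) (metis add_diff_cancel_right' mult.assoc mult.commute)
  show ?thesis
  proof (cases "k \<le> j")
    case False
    then obtain d where d: "k = (j + 1) + d" by (metis Suc_eq_plus1 le_add_diff_inverse not_less_eq_eq)
    have "fps_deriv S * S ^ k * U ^ (j + 1) = (S * U) ^ (j + 1) * (fps_deriv S * S ^ d)"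
      by (simp add: d power_add power_mult_distrib mult_ac)
    also have "\<dots> $ j = 0" unfolding SU by (subst fps_X_power_mult_nth) simp
    finally show ?thesis using False by simp
  next
    case True
    then obtain m where m: "j = k + m" using le_iff_add by blast
    have "fps_deriv S * S ^ k * U ^ (j + 1) = (S * U) ^ k * (fps_deriv S * U ^ (m + 1))"
      by (simp add: m power_add power_mult_distrib mult_ac)
    also have "\<dots> $ j = (fps_deriv S * U ^ (m + 1)) $ m"
      unfolding SU fps_X_power_mult_nth m by simp
    finally have eq: "(fps_deriv S * S ^ k * U ^ (j + 1)) $ j = (fps_deriv S * U ^ (m + 1)) $ m" .
    show ?thesis
    proof (cases m)
      case 0
      then show ?thesis unfolding eq using U by (simp add: m S_def)
    next
      case (Suc l)
      have "fps_deriv S * U ^ (m + 1) = fps_deriv S * U ^ 2 * U ^ l"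
        by (simp add: Suc power2_eq_square mult_ac)
      also have "\<dots> = U ^ m - fps_X * (fps_deriv U * U ^ l)"
        unfolding S'U2 by (simp add: Suc algebra_simps)
      finally have G: "fps_deriv S * U ^ (m + 1) = U ^ m - fps_X * (fps_deriv U * U ^ l)" .
      have ml: "m - 1 = l" using Suc by simp
      have dp: "fps_deriv (U ^ m) = fps_const (of_nat m) * fps_deriv U * U ^ l"
        unfolding fps_deriv_power ml ..
      \<comment> \<open>Here m S' U^(m+1) = m U^m - X (U^m)', and X d/dX multiplies the coefficient
        of X^m by m, so that coefficient vanishes: a derivative has no residue.\<close>
      have "fps_const (of_nat m) * (fps_deriv S * U ^ (m + 1)) = fps_const (of_nat m) * U ^ m - fps_X * fps_deriv (U ^ m)"
        unfolding G dp right_diff_distrib by (simp only: mult_ac)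
      then have "of_nat m * (fps_deriv S * U ^ (m + 1)) $ m = (fps_const (of_nat m) * U ^ m - fps_X * fps_deriv (U ^ m)) $ m"
        by (metis fps_mult_left_const_nth)
      also have "\<dots> = of_nat m * (U ^ m) $ m - of_nat (l + 1) * (U ^ m) $ (l + 1)"
        using Suc by (simp only: fps_sub_nth fps_mult_left_const_nth fps_X_mult_nth fps_deriv_nth ml) simp
      also have "\<dots> = 0" using Suc by simp
      finally show ?thesis unfolding eq using Suc by (simp add: m del: of_nat_Suc)
    qed
  qed
qed

text \<open>The error D has vanishing pairing with U^(n+1) for all n < N. These pairings are
  triangular in the coefficients of D with diagonal entries (U $ 0)^(n+1), so the lowest nonzero
  coefficient of D cannot have an index below N.\<close>

lemma fps_lagrange_expansion:
  fixes U E :: "'a :: field_char_0 fps"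
  assumes U: "U $ 0 \<noteq> 0" and j: "j < N"
  defines "S \<equiv> fps_X * inverse U"
  shows "(E - fps_deriv S * (\<Sum>k<N. fps_const ((E * U ^ (k + 1)) $ k) * S ^ k)) $ j = 0"
proof -
  define D where "D = E - fps_deriv S * (\<Sum>k<N. fps_const ((E * U ^ (k + 1)) $ k) * S ^ k)"
  have z: "(D * U ^ (n + 1)) $ n = 0" if n: "n < N" for n
  proof -
    have "D * U ^ (n + 1) = E * U ^ (n + 1) - (\<Sum>k<N. fps_const ((E * U ^ (k + 1)) $ k) * (fps_deriv S * S ^ k * U ^ (n + 1)))"
    proof -
      have "fps_deriv S * (\<Sum>k<N. fps_const ((E * U ^ (k + 1)) $ k) * S ^ k) * W
        = (\<Sum>k<N. fps_const ((E * U ^ (k + 1)) $ k) * (fps_deriv S * S ^ k * W))" for W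
        unfolding sum_distrib_left sum_distrib_right by (intro sum.cong refl) (simp only: mult_ac)
      then show ?thesis unfolding D_def left_diff_distrib by (simp only:)
    qed
    then have "(D * U ^ (n + 1)) $ n = (E * U ^ (n + 1)) $ n - (\<Sum>k<N. (E * U ^ (k + 1)) $ k * (if n = k then 1 else 0))"
      by (simp only: fps_sub_nth fps_sum_nth fps_mult_left_const_nth fps_lagrange_residue[OF U, folded S_def])
    also have "(\<Sum>k<N. (E * U ^ (k + 1)) $ k * (if n = k then 1 else 0)) = (\<Sum>k<N. if k = n then (E * U ^ (k + 1)) $ k else 0)"
      by (intro sum.cong) auto
    also have "\<dots> = (E * U ^ (n + 1)) $ n" using n by (simp only: sum.delta finite_lessThan lessThan_iff if_True)
    also have "(E * U ^ (n + 1)) $ n - \<dots> = 0" by simp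
    finally show ?thesis .
  qed
  show ?thesis
  proof (cases "D = 0 \<or> j < subdegree D")
    case True
    then show ?thesis unfolding D_def[symmetric] using nth_less_subdegree_zero by auto
  next
    case False
    define n where "n = subdegree D"
    have "D \<noteq> 0" using False by blast
    then have D0: "D $ n \<noteq> 0" unfolding n_def by (rule nth_subdegree_nonzero)
    have "n \<le> j" using False unfolding n_def by linarith
    then have n: "n < N" using j by linarith
    have "(D * U ^ (n + 1)) $ n = (\<Sum>i=0..n. D $ i * (U ^ (n + 1)) $ (n - i))" by (rule fps_mult_nth)
    also have "\<dots> = (\<Sum>i\<in>{n}. D $ i * (U ^ (n + 1)) $ (n - i))"
    proof (rule sum.mono_neutral_right)
      show "\<forall>i\<in>{0..n} - {n}. D $ i * (U ^ (n + 1)) $ (n - i) = 0"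
      proof
        fix i assume "i \<in> {0..n} - {n}"
        then have "i < subdegree D" by (auto simp: n_def)
        then have "D $ i = 0" by (rule nth_less_subdegree_zero)
        then show "D $ i * (U ^ (n + 1)) $ (n - i) = 0" by (simp only: mult_zero_left)
      qed
    qed simp_all
    also have "\<dots> = D $ n * (U ^ (n + 1)) $ 0" by (simp only: sum.insert_if sum.empty finite.emptyI empty_iff if_False add_0_right diff_self_eq_0)
    also have "\<dots> = D $ n * (U $ 0) ^ (n + 1)" by (simp only: fps_power_zeroth)
    finally have "D $ n * (U $ 0) ^ (n + 1) = 0" unfolding z[OF n] by (rule sym)
    then show ?thesis using D0 U by simp
  qed
qed

lemma fps_vanish_imp_bound:
  fixes f :: "complex \<Rightarrow> complex"
  assumes f: "f has_fps_expansion F" and F: "\<And>j. j < N \<Longrightarrow> F $ j = 0"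
  shows "\<exists>C r. r > 0 \<and> (\<forall>t. norm t < r \<longrightarrow> norm (f t) \<le> C * norm t ^ N)"
proof (cases "F = 0")
  case True
  then have "eventually (\<lambda>t. f t = 0) (nhds 0)" using f has_fps_expansion_0_iff by blast
  then obtain r where r: "r > 0" "\<And>t. dist t 0 < r \<Longrightarrow> f t = 0" unfolding eventually_nhds_metric by blast
  then show ?thesis by (intro exI[of _ 0] exI[of _ r]) auto
next
  case False
  have "N \<le> subdegree F" using F False by (intro subdegree_geI) auto
  define h where "h = (\<lambda>t. if t = 0 then F $ N else f t / t ^ N)"
  have "h has_fps_expansion fps_shift N F"
    unfolding h_def by (rule has_fps_expansion_shift[OF f \<open>N \<le> subdegree F\<close> refl])
  then have "isCont h 0" using has_fps_expansion_imp_continuous[of h _ UNIV] by simp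
  then obtain r where r: "r > 0" "\<And>t. dist t 0 < r \<Longrightarrow> dist (h t) (h 0) < 1"
    unfolding continuous_at_eps_delta using zero_less_one by blast
  have f0: "f 0 = F $ 0" using has_fps_expansion_imp_0_eq_fps_nth_0[OF f] .
  have ft: "f t = h t * t ^ N" for t
    using f0 F[of 0] by (cases "N = 0") (auto simp: h_def)
  have "norm (f t) \<le> (norm (h 0) + 1) * norm t ^ N" if "norm t < r" for t
  proof -
    have "norm (h t) \<le> norm (h 0) + 1"
      using r(2)[of t] that norm_triangle_ineq2[of "h t" "h 0"] by (simp add: dist_norm)
    then show ?thesis unfolding ft norm_mult norm_power by (intro mult_right_mono) auto
  qed
  with r(1) show ?thesis by blast
qed

section \<open>The cubic variable at the saddle\<close>

lemma sinh_gt_self: "t < sinh t" if "0 < t" for t :: real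
  using sinh_ge_taylor[of t] that by (smt (verit) divide_pos_pos zero_less_power)

lemma sinh_sub_self_ge: "t ^ 3 / 6 \<le> sinh t - t" if "0 \<le> t" for t :: real
  using sinh_ge_taylor[of t] that by linarith

text \<open>S = t / \<open>lagrange_root t\<close> satisfies S^3 = sinh t - t near 0: it is the
  variable in which the phase is exactly cubic. The root itself is the U of Lagrange
  inversion.\<close>

definition lagrange_root :: "complex \<Rightarrow> complex" where
  "lagrange_root t = of_real (6 powr (1 / 3)) * sinh_kernel t powr (1 / 3)"

lemma lagrange_root_power:
  assumes "sinh_kernel t \<noteq> 0"
  shows "lagrange_root t ^ (k + 1) = of_real (6 powr ((real k + 1) / 3)) * sinh_kernel t powr ((of_nat k + 1) / 3)"
proof -
  have "(sinh_kernel t powr (1 / 3)) ^ (k + 1) = exp (of_nat (k + 1) * (1 / 3 * Ln (sinh_kernel t)))"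
    using assms by (simp only: powr_def if_False exp_of_nat_mult)
  also have "of_nat (k + 1) * (1 / 3 * Ln (sinh_kernel t)) = (of_nat k + 1) / 3 * Ln (sinh_kernel t)" by (simp add: algebra_simps)
  finally have 1: "(sinh_kernel t powr (1 / 3)) ^ (k + 1) = sinh_kernel t powr ((of_nat k + 1) / 3)"
    using assms by (simp only: powr_def if_False)
  have "(6 powr (1 / 3)) ^ (k + 1) = (6::real) powr ((real k + 1) / 3)"
    by (subst powr_power) (simp_all add: add_divide_distrib add.commute)
  then show ?thesis
    unfolding lagrange_root_def power_mult_distrib 1 of_real_power[symmetric] by (simp only:)
qed

text \<open>Up to 6^((k+1)/3) the Lagrange coefficient of exp (\<kappa> t) is B_k(\<kappa>); this is
  the source of the exponent (n + 1) / 3 in the definition of these polynomials.\<close>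

lemma lagrange_root_fps:
  obtains U where "lagrange_root has_fps_expansion U" "U $ 0 \<noteq> 0"
    "\<And>\<kappa> k. (fps_exp \<kappa> * U ^ (k + 1)) $ k = of_real (6 powr ((real k + 1) / 3)) * B_coeff k \<kappa>"
proof -
  obtain U where U: "lagrange_root has_fps_expansion U"
  proof
    have "lagrange_root analytic_on {0}"
      unfolding lagrange_root_def[abs_def] by (intro analytic_on_mult analytic_on_const sinh_kernel_powr_analytic)
    then show "lagrange_root has_fps_expansion fps_expansion lagrange_root 0"
      by (rule analytic_at_imp_has_fps_expansion_0)
  qed
  have "lagrange_root 0 = of_real (6 powr (1 / 3))" by (simp add: lagrange_root_def)
  then have "U $ 0 \<noteq> 0" using has_fps_expansion_imp_0_eq_fps_nth_0[OF U] by simp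
  moreover have "(fps_exp \<kappa> * U ^ (k + 1)) $ k = of_real (6 powr ((real k + 1) / 3)) * B_coeff k \<kappa>" for \<kappa> k
  proof -
    define f where "f = (\<lambda>t. exp (\<kappa> * t) * sinh_kernel t powr ((of_nat k + 1) / 3))"
    have "f analytic_on {0}" unfolding f_def
      by (intro analytic_on_mult sinh_kernel_powr_analytic analytic_intros)
    then have F: "f has_fps_expansion fps_expansion f 0" by (rule analytic_at_imp_has_fps_expansion_0)
    have "(\<lambda>t. exp (\<kappa> * t) * lagrange_root t ^ (k + 1)) has_fps_expansion (fps_exp \<kappa> * U ^ (k + 1))"
      by (intro fps_expansion_intros U)
    moreover have e: "eventually (\<lambda>t. exp (\<kappa> * t) * lagrange_root t ^ (k + 1) = of_real (6 powr ((real k + 1) / 3)) * f t) (nhds 0)"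
      using sinh_kernel_nonzero by eventually_elim (simp only: f_def lagrange_root_power mult.left_commute not_False_eq_True)
    ultimately have "(\<lambda>t. of_real (6 powr ((real k + 1) / 3)) * f t) has_fps_expansion (fps_exp \<kappa> * U ^ (k + 1))"
      using has_fps_expansion_cong[OF e refl] by (simp only:)
    moreover have "(\<lambda>t. of_real (6 powr ((real k + 1) / 3)) * f t) has_fps_expansion (fps_const (of_real (6 powr ((real k + 1) / 3))) * fps_expansion f 0)"
      by (rule has_fps_expansion_cmult_left[OF F])
    ultimately have "fps_exp \<kappa> * U ^ (k + 1) = fps_const (of_real (6 powr ((real k + 1) / 3))) * fps_expansion f 0"
      by (rule fps_expansion_unique_complex)
    moreover have "fps_expansion f 0 $ k = B_coeff k \<kappa>"
      using fps_nth_fps_expansion[OF F, of k] unfolding B_coeff_def f_def[symmetric] by simp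
    ultimately show ?thesis by (simp only: fps_mult_left_const_nth)
  qed
  ultimately show ?thesis using that U by blast
qed

lemma sinh_complex_of_real: "sinh (complex_of_real t) = of_real (sinh t)"
  and cosh_complex_of_real: "cosh (complex_of_real t) = of_real (cosh t)"
  by (simp_all only: sinh_field_def cosh_field_def of_real_minus[symmetric] exp_of_real) simp_all

lemma sinh_kernel_of_real:
  assumes "0 < t"
  shows "sinh_kernel (of_real t) = of_real (t ^ 3 / (6 * (sinh t - t)))"
  using assms sinh_gt_self[OF assms] by (simp add: sinh_kernel_def sinh_complex_of_real)

lemma lagrange_root_of_real:
  assumes "0 < t"
  shows "of_real t * inverse (lagrange_root (of_real t)) = of_real ((sinh t - t) powr (1 / 3))"
proof -
  let ?s = "sinh t - t"
  have s: "?s > 0" using sinh_gt_self[OF assms] by simp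
  have q: "t ^ 3 / (6 * ?s) \<ge> 0" using s assms by simp
  have "lagrange_root (of_real t) = of_real (6 powr (1 / 3) * (t ^ 3 / (6 * ?s)) powr (1 / 3))"
    unfolding lagrange_root_def sinh_kernel_of_real[OF assms] using powr_of_real[OF q, of "1/3"] by simp
  also have "6 powr (1 / 3) * (t ^ 3 / (6 * ?s)) powr (1 / 3) = (t ^ 3) powr (1 / 3) / ?s powr (1 / 3)"
    using s assms by (simp only: powr_divide powr_mult zero_le_power less_imp_le mult_nonneg_nonneg) simp
  also have "(t ^ 3) powr (1 / 3) = t" using assms powr_powr[of t 3 "1/3"] by simp
  finally show ?thesis using assms s by (simp add: of_real_divide)
qed

text \<open>With S^3 = sinh t - t one has 3 S^2 S' = cosh t - 1, so the real functions in the sum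
  are S' S^k. The sum is the Lagrange expansion of exp (\<kappa> t) in this system, accurate to
  O(t^N).\<close>

lemma anger_local_expansion:
  "\<exists>C r. r > 0 \<and> (\<forall>t. 0 < t \<and> t < r \<longrightarrow>
     norm (exp (\<kappa> * of_real t) - (\<Sum>k<N. of_real (6 powr ((real k + 1) / 3)) * B_coeff k \<kappa> *
       of_real ((cosh t - 1) / 3 * (sinh t - t) powr ((real k - 2) / 3)))) \<le> C * t ^ N)"
proof -
  obtain U where U: "lagrange_root has_fps_expansion U" "U $ 0 \<noteq> 0"
    and a: "\<And>\<kappa> k. (fps_exp \<kappa> * U ^ (k + 1)) $ k = of_real (6 powr ((real k + 1) / 3)) * B_coeff k \<kappa>"
    by (rule lagrange_root_fps) blast
  define S where "S = (\<lambda>t. t * inverse (lagrange_root t))"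
  define SF where "SF = fps_X * inverse U"
  define c where "c = (\<lambda>k. of_real (6 powr ((real k + 1) / 3)) * B_coeff k \<kappa>)"
  have S: "S has_fps_expansion SF" unfolding S_def SF_def by (intro fps_expansion_intros U)
  have "(\<lambda>t. exp (\<kappa> * t) - deriv S t * (\<Sum>k<N. c k * S t ^ k)) has_fps_expansion
     (fps_exp \<kappa> - fps_deriv SF * (\<Sum>k<N. fps_const (c k) * SF ^ k))"
    by (intro fps_expansion_intros S)
  moreover have "(fps_exp \<kappa> - fps_deriv SF * (\<Sum>k<N. fps_const (c k) * SF ^ k)) $ j = 0" if "j < N" for j
    unfolding c_def a[symmetric] SF_def by (rule fps_lagrange_expansion[OF U(2) that])
  ultimately obtain C r1 where r1: "r1 > 0"
    "\<And>t. norm t < r1 \<Longrightarrow> norm (exp (\<kappa> * t) - deriv S t * (\<Sum>k<N. c k * S t ^ k)) \<le> C * norm t ^ N"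
    using fps_vanish_imp_bound by blast
  obtain A where A: "open A" "0 \<in> A" "S holomorphic_on A"
    using has_fps_expansion_imp_holomorphic[OF S] by blast
  then obtain r2 where r2: "r2 > 0" "ball 0 r2 \<subseteq> A" using open_contains_ball by blast
  have hol: "S holomorphic_on ball 0 r2" using A(3) r2(2) by (rule holomorphic_on_subset)
  obtain r3 where r3: "r3 > 0" "\<And>t. dist t 0 < r3 \<Longrightarrow> sinh_kernel t \<noteq> 0"
    using sinh_kernel_nonzero unfolding eventually_nhds_metric by blast
  have cube: "S t ^ 3 = sinh t - t" if "dist t 0 < r3" for t
  proof -
    have k0: "sinh_kernel t \<noteq> 0" using r3 that by blast
    have "lagrange_root t ^ 3 = of_real (6 powr 1) * sinh_kernel t powr 1"
      using lagrange_root_power[OF k0, of 2] by (simp add: numeral_3_eq_3)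
    then have L: "lagrange_root t ^ 3 = 6 * sinh_kernel t" using k0 by (simp add: powr_def)
    show ?thesis
    proof (cases "t = 0")
      case True
      then show ?thesis by (simp add: S_def)
    next
      case False
      then have "sinh t - t \<noteq> 0" using k0 by (auto simp: sinh_kernel_def)
      then show ?thesis using False
        by (simp add: S_def power_mult_distrib power_inverse L sinh_kernel_def)
    qed
  qed
  define r where "r = min r1 (min r2 r3)"
  have der: "3 * S t ^ 2 * deriv S t = cosh t - 1" if "dist t 0 < r" for t
  proof -
    have t2: "t \<in> ball 0 r2" using that by (simp add: r_def dist_commute)
    have "(S has_field_derivative deriv S t) (at t)"
      using holomorphic_derivI[OF hol open_ball t2] .
    then have 1: "((\<lambda>t. S t ^ 3) has_field_derivative of_nat 3 * (deriv S t * S t ^ (3 - Suc 0))) (at t)"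
      by (rule DERIV_power)
    have 2: "((\<lambda>t::complex. sinh t - t) has_field_derivative cosh t - 1) (at t)"
      by (auto intro!: derivative_eq_intros)
    have "((\<lambda>t. S t ^ 3) has_field_derivative cosh t - 1) (at t)"
    proof (rule has_field_derivative_transform_within_open[OF 2 open_ball])
      show "t \<in> ball 0 r" using that by (simp add: dist_commute)
      show "sinh s - s = S s ^ 3" if "s \<in> ball 0 r" for s
        using cube[of s] that by (simp add: r_def dist_commute)
    qed
    from DERIV_unique[OF 1 this] show ?thesis by (simp add: mult_ac numeral_2_eq_2)
  qed
  have "norm (exp (\<kappa> * of_real t) - (\<Sum>k<N. c k * of_real ((cosh t - 1) / 3 * (sinh t - t) powr ((real k - 2) / 3)))) \<le> C * t ^ N"
    if t: "0 < t" "t < r" for t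
  proof -
    define p where "p = (sinh t - t) powr (1 / 3)"
    have s: "sinh t - t > 0" using sinh_gt_self[OF t(1)] by simp
    then have p0: "p > 0" by (simp add: p_def)
    have Sp: "S (of_real t) = of_real p" unfolding S_def p_def by (rule lagrange_root_of_real[OF t(1)])
    have nt: "norm (complex_of_real t) < r1" "dist (complex_of_real t) 0 < r" using t by (auto simp: r_def)
    have "deriv S (of_real t) * S (of_real t) ^ k = of_real ((cosh t - 1) / 3 * (sinh t - t) powr ((real k - 2) / 3))" for k
    proof -
      have "3 * of_real p ^ 2 * deriv S (of_real t) = of_real (cosh t - 1)"
        using der[OF nt(2)] unfolding Sp by (simp add: cosh_complex_of_real)
      then have "deriv S (of_real t) = of_real ((cosh t - 1) / (3 * p ^ 2))"
        using p0 by (simp add: field_simps)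
      then have "deriv S (of_real t) * S (of_real t) ^ k = of_real ((cosh t - 1) / 3 * (p ^ k / p ^ 2))"
        unfolding Sp by simp
      also have "p ^ k / p ^ 2 = (sinh t - t) powr (1 / 3 * real k - 1 / 3 * real 2)"
        unfolding powr_diff p_def powr_realpow[OF p0, symmetric, unfolded p_def] powr_powr ..
      also have "1 / 3 * real k - 1 / 3 * real 2 = (real k - 2) / 3" by (simp add: field_simps)
      finally show ?thesis .
    qed
    then have "deriv S (of_real t) * (\<Sum>k<N. c k * S (of_real t) ^ k)
      = (\<Sum>k<N. c k * of_real ((cosh t - 1) / 3 * (sinh t - t) powr ((real k - 2) / 3)))"
      unfolding sum_distrib_left by (intro sum.cong refl) (simp only: mult_ac)
    then show ?thesis using r1(2)[OF nt(1)] t by simp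
  qed
  moreover have "r > 0" using r1 r2 r3 by (simp add: r_def)
  ultimately show ?thesis unfolding c_def by blast
qed

section \<open>Gamma integrals and the remainder estimate on the positive axis\<close>

lemma set_integral_half_line_open:
  fixes f :: "real \<Rightarrow> complex"
  shows "set_integrable lborel {0..} f \<longleftrightarrow> set_integrable lborel {0<..} f"
    and "(LINT x:{0..}|lborel. f x) = (LINT x:{0<..}|lborel. f x)"
proof -
  have eq: "indicator {0..} x *\<^sub>R f x = indicator {0<..} x *\<^sub>R f x" if "x \<notin> {0}" for x :: real
    using that by (auto simp: indicator_def)
  show "set_integrable lborel {0..} f \<longleftrightarrow> set_integrable lborel {0<..} f"
    unfolding set_integrable_def by (rule integrable_discrete_difference[of "{0}"]) (use eq in auto)
  show "(LINT x:{0..}|lborel. f x) = (LINT x:{0<..}|lborel. f x)"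
    unfolding set_lebesgue_integral_def by (rule integral_discrete_difference[of "{0}"]) (use eq in auto)
qed

lemma sinh_sub_self_strict_mono: "sinh x - x < sinh y - y" if "0 \<le> x" "x < y" for x y :: real
proof (rule DERIV_pos_imp_increasing_open[OF that(2)])
  show "\<exists>d. ((\<lambda>t. sinh t - t) has_real_derivative d) (at t) \<and> 0 < d" if "x < t" "t < y" for t
  proof (intro exI conjI)
    show "((\<lambda>t. sinh t - t) has_real_derivative cosh t - 1) (at t)" by (auto intro!: derivative_eq_intros)
    show "0 < cosh t - 1" using cosh_real_strict_mono[of 0 t] \<open>0 \<le> x\<close> that by simp
  qed
qed (intro continuous_intros)

lemma sinh_sub_self_image:
  fixes X :: real
  assumes "X > 0"
  shows "(\<lambda>t. X * (sinh t - t)) ` {0<..} = {0<..}"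
proof
  show "(\<lambda>t. X * (sinh t - t)) ` {0<..} \<subseteq> {0<..}" using assms sinh_gt_self by auto
  show "{0<..} \<subseteq> (\<lambda>t. X * (sinh t - t)) ` {0<..}"
  proof
    fix u :: real assume u: "u \<in> {0<..}"
    define b where "b = 6 * u / X + 1"
    have b: "b \<ge> 1" "6 * u / X \<le> b" using u assms by (simp_all add: b_def)
    then have "b ^ 1 \<le> b ^ 3" by (intro power_increasing) auto
    then have "6 * u / X \<le> b ^ 3" using b by simp
    then have "6 * u / X \<le> 6 * (sinh b - b)" using sinh_sub_self_ge[of b] b by simp
    then have "u \<le> X * (sinh b - b)" using assms by (simp add: field_simps)
    then have "\<exists>t\<ge>0. t \<le> b \<and> X * (sinh t - t) = u"
      using u b by (intro IVT'[of "\<lambda>t. X * (sinh t - t)"] continuous_intros) auto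
    then obtain t where t: "t \<ge> 0" "X * (sinh t - t) = u" by blast
    with u have "t \<noteq> 0" by auto
    with t show "u \<in> (\<lambda>t. X * (sinh t - t)) ` {0<..}" by force
  qed
qed

lemma Gamma_integral_real_open:
  fixes s :: real
  assumes "s > 0"
  shows "((\<lambda>u. u powr (s - 1) / exp u) has_integral Gamma s) {0<..}"
    and "(\<lambda>u. u powr (s - 1) / exp u) absolutely_integrable_on {0<..}"
proof -
  have "{x \<in> {0..} - {0<..}. x powr (s - 1) / exp x \<noteq> (0::real)} = {}" "{x \<in> {0<..} - {0..}. x powr (s - 1) / exp x \<noteq> (0::real)} = {}" by auto
  then show i: "((\<lambda>u. u powr (s - 1) / exp u) has_integral Gamma s) {0<..}"
    using has_integral_spike_set_eq[of "{0..}" "{0<..}" "\<lambda>u. u powr (s - 1) / exp u" "Gamma s"] Gamma_integral_real[OF assms] negligible_empty by metis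
  show "(\<lambda>u. u powr (s - 1) / exp u) absolutely_integrable_on {0<..}"
    by (rule nonnegative_absolutely_integrable_1) (use i in auto)
qed

lemma powr_exp_integrable:
  fixes s :: real
  assumes "s > 0"
  shows "set_integrable lborel {0<..} (\<lambda>u. u powr (s - 1) / exp u)"
  using Gamma_integral_real_open(2)[OF assms] unfolding set_integrable_def by (subst (asm) integrable_completion) auto

text \<open>The substitution u = X (sinh t - t) is a bijection of the half line and produces Euler's
  integral without error term; this is the benefit of expanding in powers of sinh t - t rather than
  of t.\<close>

lemma sinh_sub_self_Gamma_integral:
  fixes s X :: real
  assumes s: "s > 0" and X: "X > 0"
  defines "w \<equiv> \<lambda>t. (cosh t - 1) * (sinh t - t) powr (s - 1) * exp (- X * (sinh t - t))"
  shows "set_integrable lborel {0<..} w" and "(LINT t:{0<..}|lborel. w t) = Gamma s * X powr (- s)"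
proof -
  define f where "f = (\<lambda>u. u powr (s - 1) / exp u)"
  define g where "g = (\<lambda>t. X * (sinh t - t))"
  define h where "h = (\<lambda>t. X * (cosh t - 1))"
  have f: "f absolutely_integrable_on g ` {0<..} \<and> integral (g ` {0<..}) f = Gamma s"
    unfolding g_def sinh_sub_self_image[OF X] f_def
    using Gamma_integral_real_open[OF s] by (auto intro: integral_unique)
  have "(\<lambda>t. \<bar>h t\<bar> *\<^sub>R f (g t)) absolutely_integrable_on {0<..} \<and> integral {0<..} (\<lambda>t. \<bar>h t\<bar> *\<^sub>R f (g t)) = Gamma s"
  proof (rule iffD2[OF has_absolute_integral_change_of_variables_real[of "{0<..}" g h f "Gamma s"]])
    show "(g has_field_derivative h t) (at t within {0<..})" for t
      unfolding g_def h_def by (auto intro!: derivative_eq_intros)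
    show "inj_on g {0<..}"
    proof (rule inj_onI)
      fix x y :: real assume "x \<in> {0<..}" "y \<in> {0<..}" "g x = g y"
      then show "x = y"
        using sinh_sub_self_strict_mono[of x y] sinh_sub_self_strict_mono[of y x] X
        by (cases x y rule: linorder_cases) (auto simp: g_def)
    qed
  qed (use f in auto)
  moreover have eq: "\<bar>h t\<bar> *\<^sub>R f (g t) = X powr s * w t" if "t \<in> {0<..}" for t
  proof -
    have p: "sinh t - t > 0" using sinh_gt_self[of t] that by simp
    have c: "cosh t - 1 \<ge> 0" using cosh_real_ge_1[of t] by simp
    have "f (g t) = X powr (s - 1) * (sinh t - t) powr (s - 1) * exp (- X * (sinh t - t))"
      unfolding f_def g_def using p X by (subst powr_mult) (auto simp: exp_minus divide_inverse)
    moreover have "X powr s = X * X powr (s - 1)" using X powr_mult_base[of X "s - 1"] by simp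
    ultimately show ?thesis using c X by (simp add: h_def w_def abs_mult mult_ac)
  qed
  moreover have "(\<lambda>t. \<bar>h t\<bar> *\<^sub>R f (g t)) absolutely_integrable_on {0<..} \<longleftrightarrow> (\<lambda>t. X powr s * w t) absolutely_integrable_on {0<..}"
    by (rule set_integrable_cong[OF refl refl eq])
  moreover have "integral {0<..} (\<lambda>t. \<bar>h t\<bar> *\<^sub>R f (g t)) = integral {0<..} (\<lambda>t. X powr s * w t)"
    by (rule integral_cong[OF eq])
  ultimately have "(\<lambda>t. X powr s * w t) absolutely_integrable_on {0<..}"
    and i: "integral {0<..} (\<lambda>t. X powr s * w t) = Gamma s" by simp_all
  then have a: "w absolutely_integrable_on {0<..}"
    using X by (simp add: set_integrable_mult_right_iff)
  have "w \<in> borel_measurable borel" unfolding w_def sinh_def cosh_def by measurable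
  then show int: "set_integrable lborel {0<..} w"
    using a unfolding set_integrable_def by (subst (asm) integrable_completion) auto
  have "(LINT t:{0<..}|lborel. w t) = integral {0<..} w"
    by (rule set_borel_integral_eq_integral(2)[OF int])
  moreover have "X powr s * integral {0<..} w = Gamma s" using i by simp
  ultimately show "(LINT t:{0<..}|lborel. w t) = Gamma s * X powr (- s)"
    using X by (simp add: powr_minus field_simps)
qed

text \<open>The argument - \<kappa> is due to the factor exp (- \<kappa> t) of the integrand; the
  divisor 3 comes from S' = (cosh t - 1) / (3 S^2).\<close>

definition anger_coeff :: "nat \<Rightarrow> complex \<Rightarrow> complex" where
  "anger_coeff k \<kappa> = of_real (6 powr ((real k + 1) / 3) * Gamma ((real k + 1) / 3) / 3) * B_coeff k (- \<kappa>)"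

lemma sinh_sub_self_le_exp: "sinh t - t \<le> exp t" and cosh_minus_one_le_exp: "cosh t - 1 \<le> exp t"
  if "0 \<le> t" for t :: real
proof -
  have q: "exp (- t) \<le> 1" using that by simp
  have p: "exp (- t) > 0" "exp t > 0" by simp_all
  show "sinh t - t \<le> exp t"
    using that p q unfolding sinh_field_def diff_divide_distrib by linarith
  show "cosh t - 1 \<le> exp t"
    using that p q unfolding cosh_field_def add_divide_distrib by linarith
qed

text \<open>For t \<ge> r every single term is O(exp (L t)), and (t / r)^N \<ge> 1 supplies the
  power of t present in the local bound. The exponential allowance is affordable because the phase
  is damped at least like exp (- X t^3 / 6).\<close>

lemma anger_global_expansion:
  "\<exists>C L. 0 \<le> C \<and> 0 \<le> L \<and> (\<forall>t>0.
     norm (exp (\<kappa> * of_real t) - (\<Sum>k<N. of_real (6 powr ((real k + 1) / 3)) * B_coeff k \<kappa> *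
       of_real ((cosh t - 1) / 3 * (sinh t - t) powr ((real k - 2) / 3)))) \<le> C * t ^ N * exp (L * t))"
proof -
  define c where "c = (\<lambda>k. of_real (6 powr ((real k + 1) / 3)) * B_coeff k \<kappa>)"
  define e where "e = (\<lambda>t. exp (\<kappa> * of_real t) - (\<Sum>k<N. c k * of_real ((cosh t - 1) / 3 * (sinh t - t) powr ((real k - 2) / 3))))"
  obtain C r where r: "r > 0" and C: "\<And>t. 0 < t \<Longrightarrow> t < r \<Longrightarrow> norm (e t) \<le> C * t ^ N"
    using anger_local_expansion[of \<kappa> N] unfolding e_def c_def by blast
  define L where "L = norm \<kappa> + real N + 2"
  define K where "K = 1 + (\<Sum>k<N. norm (c k) * (6 / r ^ 3))"
  have L0: "L \<ge> 0" by (simp add: L_def)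
  have K0: "K \<ge> 0" unfolding K_def using r by (intro add_nonneg_nonneg sum_nonneg) auto
  have far: "norm (e t) \<le> K * exp (L * t)" if t: "t \<ge> r" for t
  proof -
    have t0: "t > 0" using t r by simp
    have s0: "sinh t - t > 0" using sinh_gt_self[OF t0] by simp
    have trm: "norm (c k * of_real ((cosh t - 1) / 3 * (sinh t - t) powr ((real k - 2) / 3))) \<le> norm (c k) * (6 / r ^ 3) * exp (L * t)"
      if k: "k < N" for k
    proof -
      have "(sinh t - t) powr ((real k - 2) / 3) = (sinh t - t) powr ((real k + 1) / 3 - 1)" by (simp add: diff_divide_distrib add_divide_distrib)
      also have "\<dots> = (sinh t - t) powr ((real k + 1) / 3) / (sinh t - t)" using s0 by (simp add: powr_diff)
      also have "\<dots> \<le> exp (real N * t) / (r ^ 3 / 6)"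
      proof (rule frac_le)
        have "(sinh t - t) powr ((real k + 1) / 3) \<le> exp t powr ((real k + 1) / 3)"
          using s0 sinh_sub_self_le_exp[of t] t0 by (intro powr_mono2) auto
        also have "\<dots> = exp (t * ((real k + 1) / 3))" by (simp add: powr_def)
        also have "\<dots> \<le> exp (real N * t)"
          using k t0 mult_right_mono[of "(real k + 1) / 3" "real N" t] by (simp add: mult.commute)
        finally show "(sinh t - t) powr ((real k + 1) / 3) \<le> exp (real N * t)" .
        have "r ^ 3 \<le> t ^ 3" using t r by (intro power_mono) auto
        then show "r ^ 3 / 6 \<le> sinh t - t" using sinh_sub_self_ge[of t] t0 by linarith
      qed (use r in auto)
      finally have p: "(sinh t - t) powr ((real k - 2) / 3) \<le> exp (real N * t) / (r ^ 3 / 6)" .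
      have h: "0 \<le> cosh t - 1" "(cosh t - 1) / 3 \<le> exp t"
        using cosh_real_ge_1[of t] cosh_minus_one_le_exp[of t] t0 by auto
      have "norm (c k * of_real ((cosh t - 1) / 3 * (sinh t - t) powr ((real k - 2) / 3)))
        = norm (c k) * ((cosh t - 1) / 3 * (sinh t - t) powr ((real k - 2) / 3))"
        using h(1) unfolding norm_mult norm_of_real abs_mult by simp
      also have "\<dots> \<le> norm (c k) * (exp t * (exp (real N * t) / (r ^ 3 / 6)))"
        using h p by (intro mult_left_mono mult_mono) auto
      also have "\<dots> = norm (c k) * (6 / r ^ 3) * exp (t + real N * t)" by (simp add: exp_add)
      also have "\<dots> \<le> norm (c k) * (6 / r ^ 3) * exp (L * t)"
      proof (intro mult_left_mono)
        show "exp (t + real N * t) \<le> exp (L * t)"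
          using t0 mult_right_mono[of "1 + real N" L t] by (simp add: L_def distrib_right)
      qed (use r in auto)
      finally show ?thesis .
    qed
    have "norm (e t) \<le> norm (exp (\<kappa> * of_real t)) + norm (\<Sum>k<N. c k * of_real ((cosh t - 1) / 3 * (sinh t - t) powr ((real k - 2) / 3)))"
      unfolding e_def by (rule norm_triangle_ineq4)
    also have "\<dots> \<le> exp (L * t) + (\<Sum>k<N. norm (c k) * (6 / r ^ 3) * exp (L * t))"
    proof (rule add_mono)
      have "Re \<kappa> * t \<le> L * t"
        using complex_Re_le_cmod[of \<kappa>] t0 by (intro mult_right_mono) (auto simp: L_def)
      then show "norm (exp (\<kappa> * of_real t)) \<le> exp (L * t)" by simp
    qed (intro sum_norm_le trm, simp)
    also have "\<dots> = K * exp (L * t)" by (simp add: K_def distrib_right sum_distrib_right)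
    finally show ?thesis .
  qed
  have "norm (e t) \<le> (\<bar>C\<bar> + K / r ^ N) * t ^ N * exp (L * t)" if t: "t > 0" for t
  proof (cases "t < r")
    case True
    have E: "1 \<le> exp (L * t)" using L0 t by simp
    have "C * t ^ N \<le> \<bar>C\<bar> * t ^ N" using t by (intro mult_right_mono) auto
    with C[OF t True] have "norm (e t) \<le> \<bar>C\<bar> * t ^ N" by (rule order_trans)
    also have "\<dots> \<le> (\<bar>C\<bar> + K / r ^ N) * t ^ N" using K0 r t by (intro mult_right_mono) auto
    also have "\<dots> \<le> (\<bar>C\<bar> + K / r ^ N) * t ^ N * exp (L * t)"
    proof -
      have "0 \<le> (\<bar>C\<bar> + K / r ^ N) * t ^ N" using K0 r t by (intro mult_nonneg_nonneg add_nonneg_nonneg) auto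
      from mult_left_mono[OF E this] show ?thesis by simp
    qed
    finally show ?thesis .
  next
    case False
    then have tr: "t \<ge> r" by simp
    have "1 \<le> t ^ N / r ^ N" using power_mono[OF tr, of N] r by simp
    then have "K * exp (L * t) * 1 \<le> K * exp (L * t) * (t ^ N / r ^ N)" using K0 by (intro mult_left_mono) auto
    also have "\<dots> = K / r ^ N * t ^ N * exp (L * t)" by simp
    also have "\<dots> \<le> (\<bar>C\<bar> + K / r ^ N) * t ^ N * exp (L * t)" using t by (intro mult_right_mono) auto
    finally show ?thesis using far[OF tr] by linarith
  qed
  moreover have "0 \<le> \<bar>C\<bar> + K / r ^ N" using K0 r by simp
  ultimately show ?thesis using L0 unfolding e_def c_def by blast
qed

text \<open>The cubic lies above its tangent at t = 2 a.\<close>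

lemma cubic_ge_linear: "a\<^sup>2 * t - 4 / 3 * a ^ 3 \<le> t ^ 3 / 12" if "0 \<le> t" "0 \<le> a" for a t :: real
proof -
  have "0 \<le> (t - 2 * a)\<^sup>2 * (t + 4 * a)" using that by (intro mult_nonneg_nonneg) auto
  also have "\<dots> = t ^ 3 - 12 * a\<^sup>2 * t + 16 * a ^ 3" by (simp add: power2_eq_square power3_eq_cube algebra_simps)
  finally show ?thesis by simp
qed

text \<open>In s = X^(1/3) t the dependence on X becomes the factor X^(- N / 3); s^N \<le> N! exp s
  and the tangent of s^3 / 12 at s = 2 bound the rest.\<close>

lemma power_exp_cubic_le:
  fixes t X :: real
  assumes "0 < t" "0 < X"
  shows "t ^ N * exp (- X * t ^ 3 / 12) \<le> fact N * exp 2 * X powr (- (real N / 3))"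
proof -
  define q where "q = X powr (1 / 3)"
  have q: "q > 0" using assms by (simp add: q_def)
  have q3: "q ^ 3 = X" unfolding q_def using assms by (subst powr_power) auto
  define s where "s = q * t"
  have s: "s > 0" using q assms by (simp add: s_def)
  have "(\<Sum>n\<in>{N}. s ^ n /\<^sub>R fact n) \<le> exp s"
    unfolding exp_def by (rule sum_le_suminf[OF summable_exp_generic]) (use s in auto)
  then have 1: "s ^ N \<le> fact N * exp s" by (simp add: field_simps)
  have "1 * s - 4 / 3 \<le> s ^ 3 / 12" using cubic_ge_linear[of s 1] s by simp
  then have 2: "exp s * exp (- (s ^ 3) / 12) \<le> exp 2" unfolding exp_add[symmetric] by simp
  have "s ^ N * exp (- (s ^ 3) / 12) \<le> fact N * exp s * exp (- (s ^ 3) / 12)" by (intro mult_right_mono 1) auto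
  also have "\<dots> \<le> fact N * exp 2" unfolding mult.assoc by (intro mult_left_mono 2) auto
  finally have 3: "s ^ N * exp (- (s ^ 3) / 12) \<le> fact N * exp 2" .
  have "q ^ N = X powr (real N / 3)" unfolding q_def using assms by (subst powr_power) auto
  then have qN: "X powr (- (real N / 3)) = 1 / q ^ N" by (simp only: powr_minus_divide)
  have s3: "s ^ 3 = X * t ^ 3" by (simp add: s_def power_mult_distrib q3)
  have "t ^ N * exp (- X * t ^ 3 / 12) = s ^ N * exp (- (s ^ 3) / 12) / q ^ N"
    using q unfolding s3 unfolding s_def power_mult_distrib by simp
  also have "\<dots> \<le> fact N * exp 2 / q ^ N" using 3 q by (intro divide_right_mono) auto
  finally show ?thesis unfolding qN by simp
qed

lemma set_integrable_complex_of_real: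
  fixes f :: "'a \<Rightarrow> real"
  assumes "set_integrable M A f"
  shows "set_integrable M A (\<lambda>x. complex_of_real (f x))"
proof -
  have "indicator A x *\<^sub>R complex_of_real (f x) = of_real (indicator A x *\<^sub>R f x)" for x by (simp add: scaleR_conv_of_real)
  then show ?thesis using assms unfolding set_integrable_def by (simp only: integrable_of_real)
qed

lemma anger_of_real:
  assumes X: "X > 0"
  shows "set_integrable lborel {0<..} (\<lambda>t. exp (- \<kappa> * of_real t) * of_real (exp (- X * (sinh t - t))))"
    and "anger \<kappa> (of_real (ln X)) = (LINT t:{0<..}|lborel. exp (- \<kappa> * of_real t) * of_real (exp (- X * (sinh t - t))))"
proof -
  have X': "exp (complex_of_real (ln X)) = of_real X" unfolding exp_of_real using X by simp
  have eq: "exp (- of_real X * sinh (0 + complex_of_real t) + (of_real X - \<kappa>) * (0 + of_real t))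
    = exp (- \<kappa> * of_real t) * of_real (exp (- X * (sinh t - t)))" for t
    unfolding exp_of_real[symmetric] exp_add[symmetric] by (simp add: sinh_complex_of_real algebra_simps)
  have im: "\<bar>Im (complex_of_real (ln X) + 0)\<bar> < pi / 2" by simp
  note p = sommerfeld_integral_path[OF im, of "of_real X - \<kappa>", unfolded X' eq]
  show "set_integrable lborel {0<..} (\<lambda>t. exp (- \<kappa> * of_real t) * of_real (exp (- X * (sinh t - t))))"
    using p(2) unfolding set_integral_half_line_open .
  show "anger \<kappa> (of_real (ln X)) = (LINT t:{0<..}|lborel. exp (- \<kappa> * of_real t) * of_real (exp (- X * (sinh t - t))))"
    using p(1) unfolding anger_def X' set_integral_half_line_open by simp
qed

text \<open>Of the damping X t^3 / 6 one half turns t^N into X^(- N / 3); the other half, at least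
  t^3 / 12 since X \<ge> 1, absorbs exp (L t). The rate N / 3 is that of the last retained term; one
  further term sharpens it in \<open>anger_diff_remainder\<close>.\<close>

lemma anger_asymptotic:
  "\<exists>C. \<forall>X\<ge>1. norm (anger \<kappa> (of_real (ln X)) - (\<Sum>k<N. anger_coeff k \<kappa> * of_real (X powr (- ((real k + 1) / 3)))))
     \<le> C * X powr (- (real N / 3))"
proof -
  define c where "c = (\<lambda>k. of_real (6 powr ((real k + 1) / 3)) * B_coeff k (- \<kappa>))"
  define e where "e = (\<lambda>t. exp (- \<kappa> * of_real t) - (\<Sum>k<N. c k * of_real ((cosh t - 1) / 3 * (sinh t - t) powr ((real k - 2) / 3))))"
  obtain C L where CL: "0 \<le> C" "0 \<le> L" and e: "\<And>t. t > 0 \<Longrightarrow> norm (e t) \<le> C * t ^ N * exp (L * t)"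
    using anger_global_expansion[of "- \<kappa>" N] unfolding e_def c_def by blast
  define D where "D = exp (4 / 3 * (L + 1) ^ 3)"
  have "norm (anger \<kappa> (of_real (ln X)) - (\<Sum>k<N. anger_coeff k \<kappa> * of_real (X powr (- ((real k + 1) / 3)))))
     \<le> C * (fact N * exp 2) * D * X powr (- (real N / 3))" if X1: "X \<ge> 1" for X
  proof -
    have X: "X > 0" using X1 by simp
    define E where "E = (\<lambda>t. exp (- X * (sinh t - t)))"
    define T where "T = (\<lambda>k t. c k / 3 * of_real ((cosh t - 1) * (sinh t - t) powr ((real k + 1) / 3 - 1) * E t))"
    have Tint: "set_integrable lborel {0<..} (T k)"
      and Tval: "(LINT t:{0<..}|lborel. T k t) = anger_coeff k \<kappa> * of_real (X powr (- ((real k + 1) / 3)))" for k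
    proof -
      have k: "(real k + 1) / 3 > 0" by simp
      note G = sinh_sub_self_Gamma_integral[OF k X]
      show "set_integrable lborel {0<..} (T k)"
        using G(1) unfolding T_def E_def by (intro set_integrable_mult_right set_integrable_complex_of_real)
      have "(LINT t:{0<..}|lborel. T k t) = c k / 3 * of_real (Gamma ((real k + 1) / 3) * X powr (- ((real k + 1) / 3)))"
        unfolding T_def E_def set_integral_mult_right set_integral_complex_of_real G(2) ..
      then show "(LINT t:{0<..}|lborel. T k t) = anger_coeff k \<kappa> * of_real (X powr (- ((real k + 1) / 3)))"
        by (simp add: c_def anger_coeff_def)
    qed
    have sumT: "set_integrable lborel {0<..} (\<lambda>t. \<Sum>k<N. T k t)"
      "(LINT t:{0<..}|lborel. \<Sum>k<N. T k t) = (\<Sum>k<N. LINT t:{0<..}|lborel. T k t)"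
      using Tint unfolding set_integrable_def set_lebesgue_integral_def scaleR_sum_right
      by (rule_tac Bochner_Integration.integrable_sum Bochner_Integration.integral_sum, assumption)+
    have Ee: "e t * of_real (E t) = exp (- \<kappa> * of_real t) * of_real (E t) - (\<Sum>k<N. T k t)" for t
    proof -
      have ex: "(real k - 2) / 3 = (real k + 1) / 3 - 1" for k by (simp add: field_simps)
      have "c k * of_real ((cosh t - 1) / 3 * (sinh t - t) powr ((real k - 2) / 3)) * of_real (E t) = T k t" for k
        unfolding T_def ex of_real_mult of_real_divide by simp
      then show ?thesis unfolding e_def left_diff_distrib sum_distrib_right by (simp only:)
    qed
    have E_eq: "exp (- X * (sinh t - t)) = E t" for t by (simp add: E_def)
    note a = anger_of_real[OF X, of \<kappa>, unfolded E_eq]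
    have int: "set_integrable lborel {0<..} (\<lambda>t. e t * of_real (E t))"
      unfolding Ee by (rule set_integral_diff(1)[OF a(1) sumT(1)])
    have val: "anger \<kappa> (of_real (ln X)) - (\<Sum>k<N. anger_coeff k \<kappa> * of_real (X powr (- ((real k + 1) / 3))))
        = (LINT t:{0<..}|lborel. e t * of_real (E t))"
      unfolding Ee Tval[symmetric] sumT(2)[symmetric] a(2) set_integral_diff(2)[OF a(1) sumT(1)] ..
    have bound: "norm (e t * of_real (E t)) \<le> C * (fact N * exp 2) * D * X powr (- (real N / 3)) * exp (- 1 * t)"
      if t: "t > 0" for t
    proof -
      have "X * (t ^ 3 / 6) \<le> X * (sinh t - t)" using sinh_sub_self_ge[of t] t X by (intro mult_left_mono) auto
      moreover have "1 * (t ^ 3 / 12) \<le> X * (t ^ 3 / 12)" using X1 t by (intro mult_right_mono) auto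
      ultimately have "- X * (sinh t - t) \<le> - X * t ^ 3 / 12 + - (t ^ 3 / 12)" by linarith
      then have E: "E t \<le> exp (- X * t ^ 3 / 12) * exp (- (t ^ 3 / 12))" unfolding E_def exp_add[symmetric] by simp
      \<comment> \<open>L + 1 in place of L leaves a factor exp (- t) for the integration.\<close>
      have "(L + 1) * 1 * t \<le> (L + 1) * (L + 1) * t" using CL t by (intro mult_right_mono mult_left_mono) auto
      then have "L * t + t \<le> (L + 1)\<^sup>2 * t" by (simp only: power2_eq_square mult_1_right distrib_right mult_1_left)
      then have "L * t + - (t ^ 3 / 12) \<le> 4 / 3 * (L + 1) ^ 3 + - 1 * t"
        using cubic_ge_linear[of t "L + 1"] t CL by linarith
      then have D: "exp (L * t) * exp (- (t ^ 3 / 12)) \<le> D * exp (- 1 * t)"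
        unfolding D_def exp_add[symmetric] exp_le_cancel_iff .
      have "norm (e t * of_real (E t)) = norm (e t) * E t" by (simp add: norm_mult E_def)
      also have "\<dots> \<le> (C * t ^ N * exp (L * t)) * (exp (- X * t ^ 3 / 12) * exp (- (t ^ 3 / 12)))"
        using e[OF t] E CL t by (intro mult_mono) (auto simp: E_def)
      also have "\<dots> = C * (t ^ N * exp (- X * t ^ 3 / 12)) * (exp (L * t) * exp (- (t ^ 3 / 12)))" by (simp only: mult_ac)
      also have "\<dots> \<le> C * (fact N * exp 2 * X powr (- (real N / 3))) * (D * exp (- 1 * t))"
        by (rule mult_mono[OF mult_left_mono[OF power_exp_cubic_le[OF t X] CL(1)] D]) (use CL in auto)
      finally show ?thesis by (simp only: mult_ac)
    qed
    have i1: "set_integrable lborel {0<..} (\<lambda>t::real. exp (- 1 * t))"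
      by (rule set_integrable_subset[OF exp_minus_half_line(1)[of 1 0]]) auto
    have "norm (LINT t:{0<..}|lborel. e t * of_real (E t)) \<le> (LINT t:{0<..}|lborel. norm (e t * of_real (E t)))"
      by (rule set_integral_norm_bound[OF int])
    also have "\<dots> \<le> (LINT t:{0<..}|lborel. C * (fact N * exp 2) * D * X powr (- (real N / 3)) * exp (- 1 * t))"
      by (rule set_integral_mono) (use int i1 bound in \<open>auto intro!: set_integrable_norm\<close>)
    also have "\<dots> = C * (fact N * exp 2) * D * X powr (- (real N / 3)) * (LINT t:{0<..}|lborel. exp (- 1 * t))"
      by (rule set_integral_mult_right)
    also have "(LINT t:{0<..}|lborel. exp (- 1 * t)) = (1::real)"
    proof -
      have "complex_of_real (LINT t:{0<..}|lborel. exp (- 1 * t)) = of_real (LINT t:{0..}|lborel. exp (- 1 * t))"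
        unfolding set_integral_complex_of_real[symmetric] set_integral_half_line_open ..
      then show ?thesis using exp_minus_half_line(2)[of 1 0] by (simp del: of_real_eq_iff)
    qed
    finally show ?thesis unfolding val by simp
  qed
  then show ?thesis by blast
qed

section \<open>Derivatives and jump\<close>

lemma sommerfeld_integral_has_derivative:
  "(sommerfeld_integral \<mu> has_field_derivative
     exp \<zeta> / 2 * (sommerfeld_integral (\<mu> - 1) \<zeta> - sommerfeld_integral (\<mu> + 1) \<zeta>)) (at \<zeta>)"
proof -
  have "sommerfeld_integral \<mu> holomorphic_on UNIV"
    using sommerfeld_integral_holomorphic[of "\<lambda>_. \<mu>" "\<lambda>w. w"] by (simp add: holomorphic_on_const holomorphic_on_ident)
  from holomorphic_derivI[OF this open_UNIV UNIV_I, of \<zeta>] show ?thesis unfolding sommerfeld_integral_deriv .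
qed

text \<open>The order \<nu> is held fixed under differentiation; its relation to \<kappa> is imposed
  only at the point \<zeta>. The orders \<nu> - 1 and \<nu> + 1 then read as \<kappa> + 1 and
  \<kappa> - 1.\<close>

lemma sommerfeld_integral_anger_derivative:
  assumes \<nu>: "\<nu> + \<kappa> = exp \<zeta>"
  shows "(sommerfeld_integral \<nu> has_field_derivative exp \<zeta> * anger_diff \<kappa> \<zeta>) (at \<zeta>)"
proof -
  have e: "exp \<zeta> - (\<kappa> + 1) = \<nu> - 1" "exp \<zeta> - (\<kappa> - 1) = \<nu> + 1" using \<nu> by (auto simp: algebra_simps)
  show ?thesis
    using sommerfeld_integral_has_derivative[of \<nu> \<zeta>] unfolding anger_diff_def anger_def e by simp
qed

text \<open>After a half turn - \<nu> + (- \<kappa>) = exp (\<zeta> + w): the turned function of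
  order - \<nu> belongs to the parameter - \<kappa>. This is where the second sheet enters.\<close>

lemma sommerfeld_integral_anger_derivative_rotated:
  assumes w: "w = \<i> * of_real pi \<or> w = - (\<i> * of_real pi)" and \<nu>: "\<nu> + \<kappa> = exp \<zeta>"
  shows "((\<lambda>u. sommerfeld_integral (- \<nu>) (u + w)) has_field_derivative - (exp \<zeta> * anger_diff (- \<kappa>) (\<zeta> + w))) (at \<zeta>)"
proof -
  have "- \<nu> + - \<kappa> = exp (\<zeta> + w)" unfolding exp_add_pm_pi_i(1)[OF w] \<nu>[symmetric] by simp
  from sommerfeld_integral_anger_derivative[OF this]
  have "(sommerfeld_integral (- \<nu>) has_field_derivative - (exp \<zeta> * anger_diff (- \<kappa>) (\<zeta> + w))) (at (\<zeta> + w))"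
    unfolding exp_add_pm_pi_i(1)[OF w] by simp
  then show ?thesis by (simp only: DERIV_shift)
qed

lemma ls_deriv_eqI:
  assumes "(\<lambda>w. f (Log_Point w)) = g" and "(g has_field_derivative exp \<zeta> * d) (at \<zeta>)"
  shows "ls_deriv f (Log_Point \<zeta>) = d"
  using assms by (simp add: ls_deriv_def ls_proj_def DERIV_imp_deriv)

context
  fixes \<nu> \<kappa> \<zeta> :: complex
  assumes \<nu>: "\<nu> + \<kappa> = exp \<zeta>"
begin

private lemma d0: "(sommerfeld_integral \<nu> has_field_derivative exp \<zeta> * anger_diff \<kappa> \<zeta>) (at \<zeta>)"
  by (rule sommerfeld_integral_anger_derivative[OF \<nu>])

private lemma dp: "((\<lambda>u. sommerfeld_integral (- \<nu>) (u + \<i> * of_real pi)) has_field_derivative - (exp \<zeta> * anger_diff (- \<kappa>) (\<zeta> + \<i> * of_real pi))) (at \<zeta>)"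
  using sommerfeld_integral_anger_derivative_rotated[OF _ \<nu>, of "\<i> * of_real pi"] by simp

private lemma dm: "((\<lambda>u. sommerfeld_integral (- \<nu>) (u - \<i> * of_real pi)) has_field_derivative - (exp \<zeta> * anger_diff (- \<kappa>) (\<zeta> - \<i> * of_real pi))) (at \<zeta>)"
  using sommerfeld_integral_anger_derivative_rotated[OF _ \<nu>, of "- (\<i> * of_real pi)"] by simp

lemma Hankel1_deriv_anger:
  "ls_deriv (Hankel1 \<nu>) (Log_Point \<zeta>) = (anger_diff \<kappa> \<zeta> - anger_diff (- \<kappa>) (\<zeta> - \<i> * of_real pi)) / (of_real pi * \<i>)"
proof (rule ls_deriv_eqI)
  show "(\<lambda>w. Hankel1 \<nu> (Log_Point w)) = (\<lambda>w. (sommerfeld_integral (- \<nu>) (w - \<i> * of_real pi) + sommerfeld_integral \<nu> w) / (of_real pi * \<i>))"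
    by (rule ext, rule Hankel1_sommerfeld)
  have "(- (exp \<zeta> * a) + exp \<zeta> * b) / c = exp \<zeta> * ((b - a) / c)" for a b c by (simp add: algebra_simps diff_divide_distrib)
  with DERIV_cdivide[OF DERIV_add[OF dm d0], of "of_real pi * \<i>"]
  show "((\<lambda>w. (sommerfeld_integral (- \<nu>) (w - \<i> * of_real pi) + sommerfeld_integral \<nu> w) / (of_real pi * \<i>))
    has_field_derivative exp \<zeta> * ((anger_diff \<kappa> \<zeta> - anger_diff (- \<kappa>) (\<zeta> - \<i> * of_real pi)) / (of_real pi * \<i>))) (at \<zeta>)"
    by (simp only:)
qed

lemma Hankel2_deriv_anger:
  "ls_deriv (Hankel2 \<nu>) (Log_Point \<zeta>) = - ((anger_diff \<kappa> \<zeta> - anger_diff (- \<kappa>) (\<zeta> + \<i> * of_real pi)) / (of_real pi * \<i>))"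
proof (rule ls_deriv_eqI)
  show "(\<lambda>w. Hankel2 \<nu> (Log_Point w)) = (\<lambda>w. - (sommerfeld_integral (- \<nu>) (w + \<i> * of_real pi) + sommerfeld_integral \<nu> w) / (of_real pi * \<i>))"
    by (rule ext, rule Hankel2_sommerfeld)
  have "- (- (exp \<zeta> * a) + exp \<zeta> * b) / c = exp \<zeta> * - ((b - a) / c)" for a b c by (simp add: algebra_simps diff_divide_distrib)
  with DERIV_cdivide[OF DERIV_minus[OF DERIV_add[OF dp d0]], of "of_real pi * \<i>"]
  show "((\<lambda>w. - (sommerfeld_integral (- \<nu>) (w + \<i> * of_real pi) + sommerfeld_integral \<nu> w) / (of_real pi * \<i>))
    has_field_derivative exp \<zeta> * - ((anger_diff \<kappa> \<zeta> - anger_diff (- \<kappa>) (\<zeta> + \<i> * of_real pi)) / (of_real pi * \<i>))) (at \<zeta>)"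
    by (simp only:)
qed

lemma Bessel_J_deriv_anger:
  "ls_deriv (Bessel_J \<nu>) (Log_Point \<zeta>) =
     (anger_diff (- \<kappa>) (\<zeta> + \<i> * of_real pi) - anger_diff (- \<kappa>) (\<zeta> - \<i> * of_real pi)) / (2 * of_real pi * \<i>)"
proof (rule ls_deriv_eqI)
  show "(\<lambda>w. Bessel_J \<nu> (Log_Point w)) = (\<lambda>w. (sommerfeld_integral (- \<nu>) (w - \<i> * of_real pi) - sommerfeld_integral (- \<nu>) (w + \<i> * of_real pi)) / (2 * of_real pi * \<i>))"
    by (rule ext, rule Bessel_J_sommerfeld)
  have "(- (exp \<zeta> * a) - - (exp \<zeta> * b)) / c = exp \<zeta> * ((b - a) / c)" for a b c by (simp add: algebra_simps diff_divide_distrib)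
  with DERIV_cdivide[OF DERIV_diff[OF dm dp], of "2 * of_real pi * \<i>"]
  show "((\<lambda>w. (sommerfeld_integral (- \<nu>) (w - \<i> * of_real pi) - sommerfeld_integral (- \<nu>) (w + \<i> * of_real pi)) / (2 * of_real pi * \<i>))
    has_field_derivative exp \<zeta> * ((anger_diff (- \<kappa>) (\<zeta> + \<i> * of_real pi) - anger_diff (- \<kappa>) (\<zeta> - \<i> * of_real pi)) / (2 * of_real pi * \<i>))) (at \<zeta>)"
    by (simp only:)
qed

lemma Bessel_Y_deriv_anger:
  "ls_deriv (Bessel_Y \<nu>) (Log_Point \<zeta>) =
     (anger_diff (- \<kappa>) (\<zeta> - \<i> * of_real pi) + anger_diff (- \<kappa>) (\<zeta> + \<i> * of_real pi) - 2 * anger_diff \<kappa> \<zeta>) / (2 * of_real pi)"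
proof (rule ls_deriv_eqI)
  show "(\<lambda>w. Bessel_Y \<nu> (Log_Point w)) = (\<lambda>w. - (sommerfeld_integral (- \<nu>) (w - \<i> * of_real pi) + sommerfeld_integral (- \<nu>) (w + \<i> * of_real pi)
      + 2 * sommerfeld_integral \<nu> w) / (2 * of_real pi))"
    by (rule ext, rule Bessel_Y_sommerfeld)
  have "- (- (exp \<zeta> * a) + - (exp \<zeta> * b) + 2 * (exp \<zeta> * d)) / c = exp \<zeta> * ((a + b - 2 * d) / c)" for a b c d
    by (simp add: algebra_simps diff_divide_distrib add_divide_distrib)
  with DERIV_cdivide[OF DERIV_minus[OF DERIV_add[OF DERIV_add[OF dm dp] DERIV_cmult[OF d0, of 2]]], of "2 * of_real pi"]
  show "((\<lambda>w. - (sommerfeld_integral (- \<nu>) (w - \<i> * of_real pi) + sommerfeld_integral (- \<nu>) (w + \<i> * of_real pi)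
      + 2 * sommerfeld_integral \<nu> w) / (2 * of_real pi)) has_field_derivative exp \<zeta> * ((anger_diff (- \<kappa>) (\<zeta> - \<i> * of_real pi)
      + anger_diff (- \<kappa>) (\<zeta> + \<i> * of_real pi) - 2 * anger_diff \<kappa> \<zeta>) / (2 * of_real pi))) (at \<zeta>)"
    by (simp only:)
qed

end

section \<open>Connection formulas and the jump between the edges of the sector\<close>

lemma Bessel_J_rotate:
  assumes w: "w = \<i> * of_real pi \<or> w = - (\<i> * of_real pi)"
  shows "Bessel_J \<nu> (Log_Point (\<zeta> + w)) = exp (\<nu> * w) * Bessel_J \<nu> (Log_Point \<zeta>)"
proof -
  have "exp (\<nu> * (\<zeta> + w - of_real (ln 2))) = exp (\<nu> * w) * exp (\<nu> * (\<zeta> - of_real (ln 2)))"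
    unfolding exp_add[symmetric] by (simp add: algebra_simps)
  moreover have "(- exp \<zeta> / 2) ^ (2 * k) = (exp \<zeta> / 2) ^ (2 * k)" for k by (simp add: power_mult)
  ultimately show ?thesis
    unfolding Bessel_J_def ls_proj_def log_surface.sel exp_add_pm_pi_i(1)[OF w] by (simp only: mult.assoc)
qed

text \<open>The bracket on the right is \<pi> \<i> times the first Hankel function at \<zeta>. The
  points \<zeta> + w and \<zeta> - 2 w are three half turns apart; two reflections, by w and by - w,
  and the law of J of order - \<nu> under a half turn link their values.\<close>

lemma sommerfeld_integral_jump:
  defines "w \<equiv> \<i> * of_real pi"
  shows "sommerfeld_integral (- \<nu>) (\<zeta> + w) + sommerfeld_integral \<nu> (\<zeta> - 2 * w)
    = exp (2 * \<nu> * w) * (sommerfeld_integral (- \<nu>) (\<zeta> - w) + sommerfeld_integral \<nu> \<zeta>)"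
proof -
  let ?S = sommerfeld_integral
  have w: "w = \<i> * of_real pi \<or> w = - (\<i> * of_real pi)" "- w = \<i> * of_real pi \<or> - w = - (\<i> * of_real pi)"
    by (simp_all add: w_def)
  define E F where "E = exp (\<nu> * w)" and "F = exp (- \<nu> * w)"
  have EF: "E * F = 1" unfolding E_def F_def exp_add[symmetric] by simp
  have E2: "exp (2 * \<nu> * w) = E * E" unfolding E_def exp_add[symmetric] by (simp add: algebra_simps)
  have rp: "?S \<nu> (\<zeta> + w) + ?S (- \<nu>) \<zeta> = F * (?S (- \<nu>) (\<zeta> + w) + ?S \<nu> \<zeta>)"
    unfolding F_def by (rule sommerfeld_integral_reflect[OF w(1)])
  have rm: "?S \<nu> (\<zeta> - w) + ?S (- \<nu>) \<zeta> = E * (?S (- \<nu>) (\<zeta> - w) + ?S \<nu> \<zeta>)"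
    using sommerfeld_integral_reflect[OF w(2), of \<nu> \<zeta>] by (simp add: E_def)
  have q: "?S \<nu> (\<zeta> - 2 * w) - ?S \<nu> \<zeta> = E * (?S \<nu> (\<zeta> - w) - ?S \<nu> (\<zeta> + w))"
  proof -
    have "Bessel_J (- \<nu>) (Log_Point (\<zeta> + - w)) = exp (- \<nu> * - w) * Bessel_J (- \<nu>) (Log_Point \<zeta>)" by (rule Bessel_J_rotate[OF w(2)])
    moreover have "\<zeta> + - w - w = \<zeta> - 2 * w" "\<zeta> + - w + w = \<zeta>" "exp (- \<nu> * - w) = E" by (simp_all add: E_def)
    ultimately show ?thesis
      unfolding Bessel_J_sommerfeld w_def[symmetric] by (simp add: w_def[symmetric] field_simps)
  qed
  show ?thesis unfolding E2 using rp rm q EF by algebra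
qed

text \<open>With \<nu> = exp \<zeta> + \<kappa> the orders on the left are - \<nu> at \<zeta> + w
  and \<nu> at \<zeta> - 2 w. The factor exp (2 \<pi> \<i> \<nu>) becomes exp (2 \<pi> \<i> \<kappa>
  - 2 \<pi> t) at z = \<i> t, which is the damping in all later integrals.\<close>

lemma anger_jump:
  defines "w \<equiv> \<i> * of_real pi"
  shows "anger \<kappa> (\<zeta> + w) + anger (- \<kappa>) (\<zeta> - 2 * w)
    = exp (2 * (exp \<zeta> + \<kappa>) * w) * (anger \<kappa> (\<zeta> - w) + anger (- \<kappa>) \<zeta>)"
proof -
  have w: "w = \<i> * of_real pi \<or> w = - (\<i> * of_real pi)" by (simp add: w_def)
  have e2: "exp (\<zeta> - 2 * w) = exp \<zeta>"
    using exp_add_pm_pi_i(2)[OF w, of "\<zeta> - w"] exp_add_pm_pi_i(2)[OF w, of \<zeta>] by (simp add: algebra_simps)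
  have a: "- exp \<zeta> - \<kappa> = - (exp \<zeta> + \<kappa>)" "exp \<zeta> - - \<kappa> = exp \<zeta> + \<kappa>" by simp_all
  show ?thesis
    unfolding anger_def exp_add_pm_pi_i(1,2)[OF w] e2 a unfolding w_def by (rule sommerfeld_integral_jump)
qed

text \<open>Replacing \<kappa> by \<kappa> \<plusminus> 1 changes the factor by exp (\<plusminus> 2
  \<pi> \<i>) = 1, so the jump relation passes to the difference.\<close>

lemma anger_diff_jump:
  defines "w \<equiv> \<i> * of_real pi"
  shows "anger_diff \<kappa> (\<zeta> + w) - anger_diff (- \<kappa>) (\<zeta> - 2 * w)
    = exp (2 * (exp \<zeta> + \<kappa>) * w) * (anger_diff \<kappa> (\<zeta> - w) - anger_diff (- \<kappa>) \<zeta>)"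
proof -
  have p: "exp (2 * w) = 1" by (simp add: w_def mult.commute mult.left_commute)
  then have m: "exp (- (2 * w)) = 1" by (simp add: exp_minus)
  have "exp (2 * (exp \<zeta> + (\<kappa> + 1)) * w) = exp (2 * (exp \<zeta> + \<kappa>) * w) * exp (2 * w)"
    "exp (2 * (exp \<zeta> + (\<kappa> - 1)) * w) = exp (2 * (exp \<zeta> + \<kappa>) * w) * exp (- (2 * w))"
    unfolding exp_add[symmetric] by (simp_all add: algebra_simps)
  then have e: "exp (2 * (exp \<zeta> + (\<kappa> + 1)) * w) = exp (2 * (exp \<zeta> + \<kappa>) * w)"
    "exp (2 * (exp \<zeta> + (\<kappa> - 1)) * w) = exp (2 * (exp \<zeta> + \<kappa>) * w)" unfolding p m by simp_all
  have n: "- (\<kappa> + 1) = - \<kappa> - 1" "- (\<kappa> - 1) = - \<kappa> + 1" by simp_all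
  note j = anger_jump[of "\<kappa> + 1" \<zeta>, folded w_def, unfolded e n] anger_jump[of "\<kappa> - 1" \<zeta>, folded w_def, unfolded e n]
  have gen: "a + d = X * (e + h) \<Longrightarrow> b + c = X * (f + g) \<Longrightarrow>
    (a - b) / 2 - (c - d) / 2 = X * ((e - f) / 2 - (g - h) / 2)" for a b c d e f g h X :: complex
    by (simp add: field_simps) algebra
  show ?thesis unfolding anger_diff_def by (rule gen[OF j])
qed

text \<open>Order \<i> t + \<kappa> at \<i> t means \<nu> - \<kappa> = z, so the parameter of the
  first branch is - \<kappa>.\<close>

lemma Hankel1_deriv_imag_anger:
  fixes x :: real
  shows "Hankel1_deriv_imag \<kappa> (exp x) = (anger_diff (- \<kappa>) (Complex x (pi / 2)) - anger_diff \<kappa> (Complex x (- (pi / 2)))) / (of_real pi * \<i>)"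
proof -
  have l: "ls_point (exp x) (pi / 2) = Log_Point (Complex x (pi / 2))" by (simp add: ls_point_def)
  have c: "Complex x (pi / 2) - \<i> * of_real pi = Complex x (- (pi / 2))" by (simp add: complex_eq_iff)
  have "\<i> * of_real (exp x) + \<kappa> + - \<kappa> = exp (Complex x (pi / 2))" by (simp add: exp_Complex_half_pi)
  from Hankel1_deriv_anger[OF this] show ?thesis unfolding Hankel1_deriv_imag_def l c by simp
qed

text \<open>At arg z = \<pi> / 2 the points \<zeta> + w and \<zeta> - 2 w have arguments
  \<plusminus> 3 \<pi> / 2. Their cube roots have arguments \<plusminus> \<pi> / 2, where the two
  half planes meet.\<close>

lemma anger_diff_jump_imag:
  fixes x :: real
  shows "anger_diff \<kappa> (Complex x (3 * pi / 2)) - anger_diff (- \<kappa>) (Complex x (- (3 * pi / 2)))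
    = - (of_real pi * \<i> * exp (2 * of_real pi * \<kappa> * \<i>) * of_real (exp (- 2 * pi * exp x)) * Hankel1_deriv_imag \<kappa> (exp x))"
proof -
  let ?w = "\<i> * of_real pi" and ?\<zeta> = "Complex x (pi / 2)"
  have c: "?\<zeta> + ?w = Complex x (3 * pi / 2)" "?\<zeta> - 2 * ?w = Complex x (- (3 * pi / 2))" "?\<zeta> - ?w = Complex x (- (pi / 2))"
    by (simp_all add: complex_eq_iff)
  have "2 * (exp ?\<zeta> + \<kappa>) * ?w = 2 * of_real pi * \<kappa> * \<i> + of_real (- 2 * pi * exp x)"
    unfolding exp_Complex_half_pi by (simp add: algebra_simps)
  then have e: "exp (2 * (exp ?\<zeta> + \<kappa>) * ?w) = exp (2 * of_real pi * \<kappa> * \<i>) * of_real (exp (- 2 * pi * exp x))"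
    by (simp only: exp_add exp_of_real)
  have gen: "P \<noteq> 0 \<Longrightarrow> e * d * (a - b) = - (P * e * d * ((b - a) / P))" for P e d a b :: complex by (simp add: field_simps)
  show ?thesis unfolding anger_diff_jump[of \<kappa> ?\<zeta>, unfolded c] e Hankel1_deriv_imag_anger by (rule gen) simp
qed

section \<open>Parity and derivative form of the coefficients\<close>

definition anger_diff_coeff :: "nat \<Rightarrow> complex \<Rightarrow> complex" where
  "anger_diff_coeff k \<kappa> = (-1) ^ k * of_real (6 powr ((real k + 1) / 3) * Gamma ((real k + 1) / 3) / 3) * D_coeff k \<kappa>"

lemma sinh_kernel_minus: "sinh_kernel (- t) = sinh_kernel t"
proof (cases "t = 0")
  case False
  have "(- t) ^ 3 = - (t ^ 3)" "sinh (- t) - - t = - (sinh t - t)" by simp_all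
  then show ?thesis using False unfolding sinh_kernel_def by (simp only: minus_divide_divide neg_equal_0_iff_equal)
qed simp

lemma sinh_kernel_powr_holomorphic:
  obtains S where "open S" "0 \<in> S" "\<And>\<kappa>. (\<lambda>t. exp (\<kappa> * t) * sinh_kernel t powr a) holomorphic_on S"
proof -
  obtain S where S: "open S" "0 \<in> S" "(\<lambda>t. sinh_kernel t powr a) holomorphic_on S"
    using sinh_kernel_powr_analytic[of a] by (auto simp: analytic_at)
  show ?thesis by (rule that[OF S(1,2)]) (intro holomorphic_intros S)
qed

text \<open>\<open>sinh_kernel\<close> is even, so t \<rightarrow> - t exchanges \<kappa> and -
  \<kappa>.\<close>

lemma B_coeff_minus: "B_coeff n (- \<kappa>) = (-1) ^ n * B_coeff n \<kappa>"
proof -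
  obtain S where S: "open S" "0 \<in> S"
    "\<And>\<kappa>. (\<lambda>t. exp (\<kappa> * t) * sinh_kernel t powr ((of_nat n + 1) / 3)) holomorphic_on S"
    by (rule sinh_kernel_powr_holomorphic) blast
  define f where "f = (\<lambda>t. exp (\<kappa> * t) * sinh_kernel t powr ((of_nat n + 1) / 3))"
  have "(deriv ^^ n) (\<lambda>t. f (- 1 * t)) 0 = (- 1) ^ n * (deriv ^^ n) f (- 1 * 0)"
  proof (rule higher_deriv_compose_linear[of f S "uminus ` S"])
    show "f holomorphic_on S" unfolding f_def by (rule S)
    show "open (uminus ` S)" using S(1) by (rule open_negations)
  qed (use S in auto)
  moreover have "(\<lambda>t. f (- 1 * t)) = (\<lambda>t. exp (- \<kappa> * t) * sinh_kernel t powr ((of_nat n + 1) / 3))"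
    by (simp add: f_def sinh_kernel_minus)
  ultimately show ?thesis unfolding B_coeff_def f_def by simp
qed

lemma D_coeff_eq_deriv:
  "D_coeff n \<kappa> = 1 / fact n * (deriv ^^ n) (\<lambda>t. exp (\<kappa> * t) * sinh t * sinh_kernel t powr ((of_nat n + 1) / 3)) 0"
proof -
  obtain S where S: "open S" "0 \<in> S"
    "\<And>\<kappa>. (\<lambda>t. exp (\<kappa> * t) * sinh_kernel t powr ((of_nat n + 1) / 3)) holomorphic_on S"
    by (rule sinh_kernel_powr_holomorphic) blast
  define f where "f = (\<lambda>\<kappa> t. exp (\<kappa> * t) * sinh_kernel t powr ((of_nat n + 1) / 3))"
  have fe: "(\<lambda>t. exp (\<kappa> * t) * sinh_kernel t powr ((of_nat n + 1) / 3)) = f \<kappa>" for \<kappa> by (simp add: f_def)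
  have f: "f \<kappa> holomorphic_on S" for \<kappa> unfolding f_def by (rule S)
  have "exp (\<kappa> * t) * sinh t * sinh_kernel t powr ((of_nat n + 1) / 3) = 1 / 2 * (f (\<kappa> + 1) t - f (\<kappa> - 1) t)" for t
  proof -
    have "exp ((\<kappa> + 1) * t) = exp (\<kappa> * t) * exp t" "exp ((\<kappa> - 1) * t) = exp (\<kappa> * t) * exp (- t)"
      unfolding exp_add[symmetric] by (simp_all add: algebra_simps)
    moreover have "E * ((a - b) / 2) * k = 1 / 2 * (E * a * k - E * b * k)" for E a b k :: complex by (simp add: field_simps)
    ultimately show ?thesis unfolding f_def sinh_field_def by (simp only:)
  qed
  moreover have "(deriv ^^ n) (\<lambda>t. 1 / 2 * (f (\<kappa> + 1) t - f (\<kappa> - 1) t)) 0 = 1 / 2 * (deriv ^^ n) (\<lambda>t. f (\<kappa> + 1) t - f (\<kappa> - 1) t) 0"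
    by (rule higher_deriv_cmult[OF _ S(2,1)]) (intro holomorphic_intros f)
  moreover have "(deriv ^^ n) (\<lambda>t. f (\<kappa> + 1) t - f (\<kappa> - 1) t) 0 = (deriv ^^ n) (f (\<kappa> + 1)) 0 - (deriv ^^ n) (f (\<kappa> - 1)) 0"
    by (rule higher_deriv_diff[OF f f S(1,2)])
  ultimately show ?thesis unfolding D_coeff_def B_coeff_def fe by (simp add: right_diff_distrib)
qed

text \<open>B_0 is constant in \<kappa>; for this reason the sums of the theorem begin at n =
  1.\<close>

lemma D_coeff_0: "D_coeff 0 \<kappa> = 0"
  by (simp add: D_coeff_def B_coeff_def)

lemma D_coeff_minus: "D_coeff n (- \<kappa>) = (-1) ^ (n + 1) * D_coeff n \<kappa>"
proof -
  have "B_coeff n (- \<kappa> + 1) = (-1) ^ n * B_coeff n (\<kappa> - 1)" "B_coeff n (- \<kappa> - 1) = (-1) ^ n * B_coeff n (\<kappa> + 1)"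
    using B_coeff_minus[of n "\<kappa> - 1"] B_coeff_minus[of n "\<kappa> + 1"] by simp_all
  then show ?thesis unfolding D_coeff_def by (simp add: algebra_simps diff_divide_distrib)
qed

lemma anger_diff_coeff_eq: "anger_diff_coeff k \<kappa> = (anger_coeff k (\<kappa> + 1) - anger_coeff k (\<kappa> - 1)) / 2"
proof -
  have gen: "s * c * ((a - b) / 2) = (c * (s * a) - c * (s * b)) / 2" for s c a b :: complex by (simp add: algebra_simps)
  show ?thesis unfolding anger_diff_coeff_def anger_coeff_def B_coeff_minus D_coeff_def by (rule gen)
qed

lemma anger_diff_asymptotic:
  "\<exists>C. \<forall>X\<ge>1. norm (anger_diff \<kappa> (of_real (ln X)) - (\<Sum>k<N. anger_diff_coeff k \<kappa> * of_real (X powr (- ((real k + 1) / 3)))))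
     \<le> C * X powr (- (real N / 3))"
proof -
  define p where "p = (\<lambda>X \<kappa>. \<Sum>k<N. anger_coeff k \<kappa> * complex_of_real (X powr (- ((real k + 1) / 3))))"
  obtain C1 where C1: "\<And>X. X \<ge> 1 \<Longrightarrow> norm (anger (\<kappa> + 1) (of_real (ln X)) - p X (\<kappa> + 1)) \<le> C1 * X powr (- (real N / 3))"
    using anger_asymptotic[of "\<kappa> + 1" N] unfolding p_def by blast
  obtain C2 where C2: "\<And>X. X \<ge> 1 \<Longrightarrow> norm (anger (\<kappa> - 1) (of_real (ln X)) - p X (\<kappa> - 1)) \<le> C2 * X powr (- (real N / 3))"
    using anger_asymptotic[of "\<kappa> - 1" N] unfolding p_def by blast
  have "norm (anger_diff \<kappa> (of_real (ln X)) - (\<Sum>k<N. anger_diff_coeff k \<kappa> * of_real (X powr (- ((real k + 1) / 3)))))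
     \<le> (C1 + C2) * X powr (- (real N / 3))" if X: "X \<ge> 1" for X
  proof -
    let ?a = "anger (\<kappa> + 1) (of_real (ln X)) - p X (\<kappa> + 1)" and ?b = "anger (\<kappa> - 1) (of_real (ln X)) - p X (\<kappa> - 1)"
    have "(\<Sum>k<N. anger_diff_coeff k \<kappa> * of_real (X powr (- ((real k + 1) / 3)))) = (p X (\<kappa> + 1) - p X (\<kappa> - 1)) / 2"
      unfolding p_def anger_diff_coeff_eq sum_subtractf[symmetric] sum_divide_distrib
      by (intro sum.cong refl) (simp only: times_divide_eq_left left_diff_distrib)
    then have eq: "anger_diff \<kappa> (of_real (ln X)) - (\<Sum>k<N. anger_diff_coeff k \<kappa> * of_real (X powr (- ((real k + 1) / 3)))) = (?a - ?b) / 2"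
      unfolding anger_diff_def by (simp add: diff_divide_distrib)
    have "norm ((?a - ?b) / 2) \<le> norm (?a - ?b)" by (simp add: norm_divide)
    then show ?thesis unfolding eq using norm_triangle_ineq4[of ?a ?b] C1[OF X] C2[OF X] unfolding distrib_right by linarith
  qed
  then show ?thesis by blast
qed

lemma anger_diff_holomorphic: "anger_diff \<kappa> holomorphic_on UNIV"
  unfolding anger_diff_def[abs_def] by (intro holomorphic_intros anger_holomorphic) auto

text \<open>The two shifts of \<kappa> raise the threshold for the exponent at z = 0 to |Re
  \<kappa>| + 1.\<close>

lemma anger_diff_growth:
  assumes \<rho>: "\<rho> > \<bar>Re \<kappa>\<bar> + 1"
  shows "\<exists>C\<ge>0. \<forall>\<zeta>. \<bar>Im \<zeta>\<bar> \<le> 3 * pi / 2 \<longrightarrow> norm (anger_diff \<kappa> \<zeta>) \<le> C * (1 + exp (- \<rho> * Re \<zeta>))"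
proof -
  have "\<rho> > \<bar>Re (\<kappa> + 1)\<bar>" "\<rho> > \<bar>Re (\<kappa> - 1)\<bar>" using \<rho> by auto
  then obtain C1 C2 where C: "\<And>\<zeta>. \<bar>Im \<zeta>\<bar> \<le> 3 * pi / 2 \<Longrightarrow> norm (anger (\<kappa> + 1) \<zeta>) \<le> C1 * (1 + exp (- \<rho> * Re \<zeta>))"
    "\<And>\<zeta>. \<bar>Im \<zeta>\<bar> \<le> 3 * pi / 2 \<Longrightarrow> norm (anger (\<kappa> - 1) \<zeta>) \<le> C2 * (1 + exp (- \<rho> * Re \<zeta>))"
    using anger_growth by metis
  have "norm (anger_diff \<kappa> \<zeta>) \<le> (\<bar>C1\<bar> + \<bar>C2\<bar>) * (1 + exp (- \<rho> * Re \<zeta>))" if \<zeta>: "\<bar>Im \<zeta>\<bar> \<le> 3 * pi / 2" for \<zeta>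
  proof -
    have p: "1 + exp (- \<rho> * Re \<zeta>) \<ge> 0" by (intro add_nonneg_nonneg) auto
    have "norm (anger_diff \<kappa> \<zeta>) \<le> norm (anger (\<kappa> + 1) \<zeta> - anger (\<kappa> - 1) \<zeta>)" by (simp add: anger_diff_def norm_divide)
    then show ?thesis
      using norm_triangle_ineq4[of "anger (\<kappa> + 1) \<zeta>" "anger (\<kappa> - 1) \<zeta>"] C[OF \<zeta>]
        mult_right_mono[OF abs_ge_self p, of C1] mult_right_mono[OF abs_ge_self p, of C2]
      unfolding distrib_right[of "\<bar>C1\<bar>"] by linarith
  qed
  then show ?thesis by (intro exI[of _ "\<bar>C1\<bar> + \<bar>C2\<bar>"]) auto
qed

section \<open>Stieltjes transforms\<close>

definition hankel_weight :: "nat \<Rightarrow> complex \<Rightarrow> real \<Rightarrow> complex" where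
  "hankel_weight N \<kappa> y = of_real (y powr ((real N - 2) / 3) * exp (- 2 * pi * y)) * Hankel1_deriv_imag \<kappa> y"

text \<open>\<open>exp c\<close> stands for a unit factor times z^(- 1 / 3), and Im c is the angle
  of the ray added to 1 in the denominator; |Im c| < \<pi> keeps the denominator from vanishing. The
  logarithmic parameter makes rotations of z translations of c.\<close>

definition stieltjes_integrand :: "nat \<Rightarrow> complex \<Rightarrow> complex \<Rightarrow> real \<Rightarrow> complex" where
  "stieltjes_integrand N \<kappa> c y = hankel_weight N \<kappa> y * (1 / (1 + exp c * of_real (y powr (1 / 3))))"

definition stieltjes :: "nat \<Rightarrow> complex \<Rightarrow> complex \<Rightarrow> complex" where
  "stieltjes N \<kappa> c = (LINT y:{0<..}|lborel. stieltjes_integrand N \<kappa> c y)"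

lemma Hankel1_deriv_imag_continuous: "continuous_on {0<..} (Hankel1_deriv_imag \<kappa>)"
proof -
  have "continuous_on {0<..} (\<lambda>y. (anger_diff (- \<kappa>) (Complex (ln y) (pi / 2)) - anger_diff \<kappa> (Complex (ln y) (- (pi / 2)))) / (of_real pi * \<i>))"
    by (intro continuous_intros continuous_on_compose2[OF holomorphic_on_imp_continuous_on[OF anger_diff_holomorphic]]) auto
  then show ?thesis
  proof (rule continuous_on_eq)
    fix y :: real assume "y \<in> {0<..}"
    then show "(anger_diff (- \<kappa>) (Complex (ln y) (pi / 2)) - anger_diff \<kappa> (Complex (ln y) (- (pi / 2)))) / (of_real pi * \<i>) = Hankel1_deriv_imag \<kappa> y"
      using Hankel1_deriv_imag_anger[of \<kappa> "ln y"] by simp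
  qed
qed

lemma Hankel1_deriv_imag_bound:
  assumes "\<rho> > \<bar>Re \<kappa>\<bar> + 1"
  shows "\<exists>C\<ge>0. \<forall>y>0. norm (Hankel1_deriv_imag \<kappa> y) \<le> C * (1 + y powr (- \<rho>))"
proof -
  have "\<rho> > \<bar>Re (- \<kappa>)\<bar> + 1" using assms by simp
  then obtain C1 C2 where C0: "C1 \<ge> 0" "C2 \<ge> 0"
    and C: "\<And>\<zeta>. \<bar>Im \<zeta>\<bar> \<le> 3 * pi / 2 \<Longrightarrow> norm (anger_diff (- \<kappa>) \<zeta>) \<le> C1 * (1 + exp (- \<rho> * Re \<zeta>))"
      "\<And>\<zeta>. \<bar>Im \<zeta>\<bar> \<le> 3 * pi / 2 \<Longrightarrow> norm (anger_diff \<kappa> \<zeta>) \<le> C2 * (1 + exp (- \<rho> * Re \<zeta>))"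
    using anger_diff_growth assms by metis
  have "norm (Hankel1_deriv_imag \<kappa> y) \<le> (C1 + C2) * (1 + y powr (- \<rho>))" if y: "y > 0" for y
  proof -
    let ?a = "anger_diff (- \<kappa>) (Complex (ln y) (pi / 2))" and ?b = "anger_diff \<kappa> (Complex (ln y) (- (pi / 2)))"
    have H: "Hankel1_deriv_imag \<kappa> y = (?a - ?b) / (of_real pi * \<i>)"
      using Hankel1_deriv_imag_anger[of \<kappa> "ln y"] y by simp
    have e: "exp (- \<rho> * ln y) = y powr (- \<rho>)" using y by (simp add: powr_def)
    have "norm (Hankel1_deriv_imag \<kappa> y) = norm (?a - ?b) / pi" unfolding H by (simp add: norm_divide norm_mult)
    also have "\<dots> \<le> norm (?a - ?b) / 1" using pi_gt3 by (intro divide_left_mono) auto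
    also have "\<dots> \<le> norm ?a + norm ?b" using norm_triangle_ineq4[of ?a ?b] by simp
    also have "\<dots> \<le> C1 * (1 + y powr (- \<rho>)) + C2 * (1 + y powr (- \<rho>))"
      using C(1)[of "Complex (ln y) (pi / 2)"] C(2)[of "Complex (ln y) (- (pi / 2))"] pi_gt_zero unfolding e[symmetric]
      by (intro add_mono) (auto simp del: exp_le_cancel_iff)
    finally show ?thesis by (simp add: distrib_right)
  qed
  with C0 show ?thesis by (intro exI[of _ "C1 + C2"]) auto
qed

lemma hankel_weight_continuous: "continuous_on {0<..} (hankel_weight N \<kappa>)"
  unfolding hankel_weight_def[abs_def] by (intro continuous_intros Hankel1_deriv_imag_continuous) auto

lemma set_borel_measurable_half_line:
  fixes f :: "real \<Rightarrow> complex"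
  assumes "continuous_on {0<..} f"
  shows "set_borel_measurable lborel {0<..} f"
  unfolding set_borel_measurable_def using borel_measurable_continuous_on_indicator[OF _ assms] by simp

text \<open>At 0 the weight is O(y^((N-2)/3 - \<rho>)) for some \<rho> between |Re \<kappa>| + 1 and
  (N + 1) / 3, an exponent above - 1; the factor \<open>exp (- 2 * pi * y)\<close> settles
  infinity.\<close>

lemma hankel_weight_integrable:
  assumes "\<bar>Re \<kappa>\<bar> + 1 < (real N + 1) / 3"
  shows "set_integrable lborel {0<..} (hankel_weight N \<kappa>)"
proof -
  define \<rho> where "\<rho> = (\<bar>Re \<kappa>\<bar> + 1 + (real N + 1) / 3) / 2"
  have \<rho>: "\<rho> > \<bar>Re \<kappa>\<bar> + 1" using assms by (simp add: \<rho>_def field_simps)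
  have \<rho>': "\<rho> < (real N + 1) / 3" using assms by (simp add: \<rho>_def field_simps)
  obtain C where C: "C \<ge> 0" "\<And>y. y > 0 \<Longrightarrow> norm (Hankel1_deriv_imag \<kappa> y) \<le> C * (1 + y powr (- \<rho>))"
    using Hankel1_deriv_imag_bound[OF \<rho>] by blast
  define s where "s = (real N + 1) / 3"
  have s: "s > 0" "s - \<rho> > 0" "(real N - 2) / 3 = s - 1" using \<rho>' by (simp_all add: s_def field_simps)
  show ?thesis
  proof (rule set_integrable_bound)
    show "set_integrable lborel {0<..} (\<lambda>y. C * (y powr (s - 1) / exp y + y powr (s - \<rho> - 1) / exp y))"
      by (intro set_integrable_mult_right set_integral_add powr_exp_integrable s)
    show "set_borel_measurable lborel {0<..} (hankel_weight N \<kappa>)"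
      by (rule set_borel_measurable_half_line[OF hankel_weight_continuous])
    have "norm (hankel_weight N \<kappa> y) \<le> norm (C * (y powr (s - 1) / exp y + y powr (s - \<rho> - 1) / exp y))" if y: "y > 0" for y
    proof -
      have "- 2 * pi * y \<le> - y" using pi_gt3 y mult_right_mono[of 1 "2 * pi" y] by simp
      then have e: "exp (- 2 * pi * y) \<le> 1 / exp y" by (simp add: exp_minus_inverse[symmetric] exp_minus field_simps del: exp_minus_inverse)
      have "norm (hankel_weight N \<kappa> y) = y powr (s - 1) * exp (- 2 * pi * y) * norm (Hankel1_deriv_imag \<kappa> y)"
        unfolding hankel_weight_def s(3) by (simp add: norm_mult)
      also have "\<dots> \<le> y powr (s - 1) * (1 / exp y) * (C * (1 + y powr (- \<rho>)))"
        using e C y by (intro mult_mono) auto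
      also have "\<dots> = C * (y powr (s - 1) / exp y + y powr (s - 1) * y powr (- \<rho>) / exp y)" by (simp add: field_simps)
      also have "y powr (s - 1) * y powr (- \<rho>) = y powr (s - \<rho> - 1)" unfolding powr_add[symmetric] by (simp add: algebra_simps)
      finally show ?thesis using abs_ge_self order_trans unfolding real_norm_def by blast
    qed
    then show "AE y\<in>{0<..} in lborel. norm (hankel_weight N \<kappa> y) \<le> norm (C * (y powr (s - 1) / exp y + y powr (s - \<rho> - 1) / exp y))"
      by simp
  qed
qed

text \<open>The distance of - 1 from the ray of direction Im c is 1 if |Im c| \<le> \<pi> / 2, and
  |sin (Im c)| otherwise.\<close>

lemma one_plus_exp_bound:
  assumes "\<bar>Im c\<bar> < pi"
  shows "\<exists>m>0. \<forall>r\<ge>0. m \<le> norm (1 + exp c * of_real r)"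
proof (cases "cos (Im c) \<ge> 0")
  case True
  have "1 \<le> norm (1 + exp c * of_real r)" if "r \<ge> 0" for r
    using complex_Re_le_cmod[of "1 + exp c * of_real r"] mult_nonneg_nonneg[OF mult_nonneg_nonneg[OF exp_ge_zero True] that, of "Re c"] by (simp add: Re_exp)
  then show ?thesis by (intro exI[of _ 1]) auto
next
  case False
  have "sin (Im c) \<noteq> 0"
  proof
    assume "sin (Im c) = 0"
    then have "Im c = 0" using sin_gt_zero[of "Im c"] sin_gt_zero[of "- Im c"] assms by (cases "Im c" "0::real" rule: linorder_cases) auto
    then show False using False by simp
  qed
  then have "\<bar>sin (Im c)\<bar> > 0" by simp
  moreover have "\<bar>sin (Im c)\<bar> \<le> norm (1 + exp c * of_real r)" if "r \<ge> 0" for r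
  proof -
    \<comment> \<open>Multiplication by this unit factor makes the ray real and leaves the imaginary
      part - sin (Im c).\<close>
    define a where "a = exp (- \<i> * of_real (Im c))"
    have ec: "exp c = of_real (exp (Re c)) * exp (\<i> * of_real (Im c))"
      using exp_eq_polar[of c] by (simp add: cis_conv_exp)
    have na: "norm a = 1" by (simp add: a_def)
    have "a * exp (\<i> * of_real (Im c)) = 1" unfolding a_def exp_add[symmetric] by simp
    then have "a * (1 + exp c * of_real r) = a + of_real (exp (Re c) * r)"
      unfolding ec by (simp add: algebra_simps)
    then have "norm (1 + exp c * of_real r) = norm (a + of_real (exp (Re c) * r))"
      using na by (metis mult_1 norm_mult)
    moreover have "Im a = - sin (Im c)" by (simp add: a_def Im_exp)
    ultimately show ?thesis using abs_Im_le_cmod[of "a + of_real (exp (Re c) * r)"] by simp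
  qed
  ultimately show ?thesis by blast
qed

lemma stieltjes_integrand_continuous:
  assumes "\<bar>Im c\<bar> < pi"
  shows "continuous_on {0<..} (stieltjes_integrand N \<kappa> c)"
proof -
  obtain m where m: "m > 0" "\<And>r. r \<ge> 0 \<Longrightarrow> m \<le> norm (1 + exp c * of_real r)" using one_plus_exp_bound[OF assms] by blast
  have "1 + exp c * of_real (y powr (1 / 3)) \<noteq> 0" for y using m(2)[of "y powr (1/3)"] m(1) by auto
  then show ?thesis unfolding stieltjes_integrand_def[abs_def]
    by (intro continuous_intros hankel_weight_continuous) auto
qed

lemma stieltjes_integrable:
  assumes "\<bar>Re \<kappa>\<bar> + 1 < (real N + 1) / 3" "\<bar>Im c\<bar> < pi"
  shows "set_integrable lborel {0<..} (stieltjes_integrand N \<kappa> c)"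
proof -
  obtain m where m: "m > 0" "\<And>r. r \<ge> 0 \<Longrightarrow> m \<le> norm (1 + exp c * of_real r)" using one_plus_exp_bound[OF assms(2)] by blast
  show ?thesis
  proof (rule set_integrable_bound)
    show "set_integrable lborel {0<..} (\<lambda>y. hankel_weight N \<kappa> y * of_real (1 / m))"
      by (intro set_integrable_mult_left hankel_weight_integrable assms)
    show "set_borel_measurable lborel {0<..} (stieltjes_integrand N \<kappa> c)"
      by (rule set_borel_measurable_half_line[OF stieltjes_integrand_continuous[OF assms(2)]])
    have "norm (stieltjes_integrand N \<kappa> c y) \<le> norm (hankel_weight N \<kappa> y * of_real (1 / m))" for y
    proof -
      have "norm (1 / (1 + exp c * of_real (y powr (1 / 3)))) \<le> 1 / m"
        using m(2)[of "y powr (1/3)"] m(1) unfolding norm_divide norm_one by (intro divide_left_mono mult_pos_pos) auto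
      then show ?thesis using m(1) unfolding stieltjes_integrand_def norm_mult norm_of_real by (intro mult_left_mono) auto
    qed
    then show "AE y\<in>{0<..} in lborel. norm (stieltjes_integrand N \<kappa> c y) \<le> norm (hankel_weight N \<kappa> y * of_real (1 / m))" by simp
  qed
qed

section \<open>The dispersion relation for the two sheets\<close>

lemma cube_exp_substitution:
  fixes f :: "real \<Rightarrow> complex"
  assumes f: "set_integrable lborel {0<..} f" and c: "continuous_on {0<..} f"
  shows "integrable lborel (\<lambda>x. (3 * exp (3 * x)) *\<^sub>R f (exp (3 * x)))"
    and "(LINT x|lborel. (3 * exp (3 * x)) *\<^sub>R f (exp (3 * x))) = (LINT y:{0<..}|lborel. f y)"
proof -
  \<comment> \<open>x = log |w| is the coordinate along the cut, y = exp (3 x) = |z| the variable of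
    the final integrals.\<close>
  define g where "g = (\<lambda>x::real. exp (3 * x))"
  define h where "h = (\<lambda>x::real. 3 * exp (3 * x))"
  have im: "g ` UNIV = {0<..}"
  proof
    show "{0<..} \<subseteq> g ` UNIV"
    proof
      fix y :: real assume "y \<in> {0<..}"
      then have "y = g (ln y / 3)" by (simp add: g_def)
      then show "y \<in> g ` UNIV" by blast
    qed
  qed (auto simp: g_def)
  have fa: "f absolutely_integrable_on {0<..}"
    using f unfolding set_integrable_def by (intro integrable_completion[THEN iffD2]) auto
  have b: "(LINT y:{0<..}|lborel. f y) = integral {0<..} f" by (rule set_borel_integral_eq_integral(2)[OF f])
  have "(\<lambda>x. \<bar>h x\<bar> *\<^sub>R f (g x)) absolutely_integrable_on UNIV \<and> integral UNIV (\<lambda>x. \<bar>h x\<bar> *\<^sub>R f (g x)) = integral {0<..} f"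
  proof (rule iffD2[OF has_absolute_integral_change_of_variables_real[of UNIV g h f]])
    show "(g has_field_derivative h x) (at x within UNIV)" for x
      unfolding g_def h_def by (auto intro!: derivative_eq_intros)
    show "inj_on g UNIV" by (rule inj_onI) (simp add: g_def)
    show "f absolutely_integrable_on g ` UNIV \<and> integral (g ` UNIV) f = integral {0<..} f" unfolding im using fa by simp
  qed simp
  moreover have "\<bar>h x\<bar> *\<^sub>R f (g x) = (3 * exp (3 * x)) *\<^sub>R f (exp (3 * x))" for x by (simp add: h_def g_def)
  ultimately have a: "(\<lambda>x. (3 * exp (3 * x)) *\<^sub>R f (exp (3 * x))) absolutely_integrable_on UNIV"
    and i: "integral UNIV (\<lambda>x. (3 * exp (3 * x)) *\<^sub>R f (exp (3 * x))) = integral {0<..} f" by simp_all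
  have cont: "continuous_on UNIV (\<lambda>x. (3 * exp (3 * x)) *\<^sub>R f (exp (3 * x)))"
    by (intro continuous_intros continuous_on_compose2[OF c]) auto
  have int: "integrable lborel (\<lambda>x. (3 * exp (3 * x)) *\<^sub>R f (exp (3 * x)))"
    using a borel_measurable_continuous_onI[OF cont] unfolding set_integrable_def by (simp add: integrable_completion)
  then show "integrable lborel (\<lambda>x. (3 * exp (3 * x)) *\<^sub>R f (exp (3 * x)))" .
  show "(LINT x|lborel. (3 * exp (3 * x)) *\<^sub>R f (exp (3 * x))) = (LINT y:{0<..}|lborel. f y)"
    unfolding b i[symmetric] by (rule integral_lborel[OF int, symmetric])
qed

text \<open>The first term comes from the lower, the second from the upper half of the imaginary
  w-axis; the powers of \<i> are those of w^N on these rays.\<close>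

definition stieltjes_pair :: "nat \<Rightarrow> complex \<Rightarrow> complex \<Rightarrow> complex" where
  "stieltjes_pair N \<kappa> \<xi> = (- \<i>) ^ N * exp (- (2 * of_real pi * \<kappa> * \<i>)) * stieltjes N (- \<kappa>) (\<i> * of_real (pi / 2) - \<xi>)
     - \<i> ^ N * exp (2 * of_real pi * \<kappa> * \<i>) * stieltjes N \<kappa> (- (\<i> * of_real (pi / 2)) - \<xi>)"

text \<open>On the cut w^N dw contributes exp ((N + 1) x), and dy = 3 exp (3 x) dx uses up three of
  these powers: the origin of the exponent (N - 2) / 3.\<close>

lemma scaled_hankel_weight:
  "of_real (exp ((real N + 1) * x)) * of_real (exp (- 2 * pi * exp (3 * x))) * Hankel1_deriv_imag \<kappa> (exp (3 * x))
     = (3 * exp (3 * x)) *\<^sub>R hankel_weight N \<kappa> (exp (3 * x)) / 3"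
proof -
  have "exp (3 * x) powr ((real N - 2) / 3) = exp ((real N - 2) * x)" by (simp add: powr_def mult.commute)
  then have "exp ((real N + 1) * x) = exp (3 * x) * exp (3 * x) powr ((real N - 2) / 3)"
    by (simp add: exp_add[symmetric] algebra_simps)
  then show ?thesis unfolding hankel_weight_def by (simp add: scaleR_conv_of_real)
qed

lemma cube_root_exp: "exp (3 * x) powr (1 / 3) = exp (x::real)"
  by (simp add: powr_def)

text \<open>F is w^N times the sheet of \<kappa>, with w = exp \<xi> and log z = 3 \<xi>. G is w^N
  times the sheet of - \<kappa>, now with w = - exp \<xi>, whence the sign (- 1)^N. Across the
  imaginary w-axis their difference is the jump of \<open>anger_diff_jump_imag\<close>, for \<kappa>
  on the upper half and for - \<kappa> on the lower.\<close>

lemma anger_diff_dispersion: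
  assumes \<kappa>: "\<bar>Re \<kappa>\<bar> + 1 < (real N + 1) / 3"
  shows "\<exists>p. \<forall>\<xi>. \<bar>Im \<xi>\<bar> < pi / 2 \<longrightarrow>
    exp (of_nat N * \<xi>) * anger_diff \<kappa> (3 * \<xi>) = poly p (exp \<xi>) + exp (- \<xi>) * (\<i> / 6) * stieltjes_pair N \<kappa> \<xi>"
proof -
  define F where "F = (\<lambda>\<xi>. exp (of_nat N * \<xi>) * anger_diff \<kappa> (3 * \<xi>))"
  define G where "G = (\<lambda>\<xi>. (-1) ^ N * exp (of_nat N * \<xi>) * anger_diff (- \<kappa>) (3 * \<xi>))"
  define jp where "jp = (\<lambda>x. F (Complex x (pi / 2)) - G (Complex x (- (pi / 2))))"
  define jm where "jm = (\<lambda>x. F (Complex x (- (pi / 2))) - G (Complex x (pi / 2)))"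
  define cp where "cp = - (of_real pi * \<i> * \<i> ^ N * exp (2 * of_real pi * \<kappa> * \<i>)) / 3"
  define cm where "cm = of_real pi * \<i> * (- \<i>) ^ N * exp (- (2 * of_real pi * \<kappa> * \<i>)) / 3"
  define Q where "Q = (\<lambda>\<kappa> x. (3 * exp (3 * x)) *\<^sub>R hankel_weight N \<kappa> (exp (3 * x)))"
  have \<kappa>': "\<bar>Re (- \<kappa>)\<bar> + 1 < (real N + 1) / 3" using \<kappa> by simp
  have Qint: "integrable lborel (Q \<kappa>)" "integrable lborel (Q (- \<kappa>))"
    unfolding Q_def by (intro cube_exp_substitution hankel_weight_integrable hankel_weight_continuous \<kappa> \<kappa>')+
  have three: "3 * Complex x (pi / 2) = Complex (3 * x) (3 * pi / 2)" "3 * Complex x (- (pi / 2)) = Complex (3 * x) (- (3 * pi / 2))" for x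
    by (simp_all add: complex_eq_iff)
  have expN: "exp (of_nat N * Complex x (pi / 2)) = \<i> ^ N * of_real (exp (real N * x))"
    "exp (of_nat N * Complex x (- (pi / 2))) = (- \<i>) ^ N * of_real (exp (real N * x))" for x
  proof -
    have e: "of_real (exp (real N * x)) = complex_of_real (exp x) ^ N" by (simp add: exp_of_nat_mult)
    have m: "- (\<i> * complex_of_real (exp x)) = (- \<i>) * of_real (exp x)" by simp
    show "exp (of_nat N * Complex x (pi / 2)) = \<i> ^ N * of_real (exp (real N * x))"
      unfolding e unfolding exp_of_nat_mult exp_Complex_half_pi power_mult_distrib ..
    show "exp (of_nat N * Complex x (- (pi / 2))) = (- \<i>) ^ N * of_real (exp (real N * x))"
      unfolding e unfolding exp_of_nat_mult exp_Complex_half_pi m power_mult_distrib ..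
  qed
  have sgn: "(-1) ^ N * (- \<i>) ^ N = \<i> ^ N" "(-1) ^ N * \<i> ^ N = (- \<i>) ^ N"
    unfolding power_mult_distrib[symmetric] by simp_all
  have w: "of_real (exp x) * of_real (exp (real N * x)) * of_real (exp (- 2 * pi * exp (3 * x))) * Hankel1_deriv_imag k (exp (3 * x)) = Q k x / 3" for k x
  proof -
    have "exp ((real N + 1) * x) = exp x * exp (real N * x)" unfolding exp_add[symmetric] by (simp add: algebra_simps)
    then show ?thesis using scaled_hankel_weight[of N x k] unfolding Q_def by simp
  qed
  have jp: "exp x *\<^sub>R jp x = cp * Q \<kappa> x" for x
  proof -
    have "jp x = \<i> ^ N * of_real (exp (real N * x)) * (anger_diff \<kappa> (Complex (3 * x) (3 * pi / 2)) - anger_diff (- \<kappa>) (Complex (3 * x) (- (3 * pi / 2))))"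
      unfolding jp_def F_def G_def three expN mult.assoc[symmetric] sgn by (simp add: right_diff_distrib)
    moreover have "e * (k * n * - (P * f * d * H)) = - (P * k * f) / 3 * q" if "e * n * d * H = q / 3" for e k n P f d H q :: complex
      using that by algebra
    ultimately show ?thesis
      unfolding scaleR_conv_of_real anger_diff_jump_imag cp_def using w[of x \<kappa>] by (simp only:)
  qed
  have jm: "exp x *\<^sub>R jm x = cm * Q (- \<kappa>) x" for x
  proof -
    have "jm x = (- \<i>) ^ N * of_real (exp (real N * x)) * (- 1) * (anger_diff (- \<kappa>) (Complex (3 * x) (3 * pi / 2)) - anger_diff (- (- \<kappa>)) (Complex (3 * x) (- (3 * pi / 2))))"
      unfolding jm_def F_def G_def three expN mult.assoc[symmetric] sgn by (simp add: right_diff_distrib)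
    moreover have "e * (k * n * (- 1) * - (P * f * d * H)) = P * k * f / 3 * q" if "e * n * d * H = q / 3" for e k n P f d H q :: complex
      using that by algebra
    moreover have "2 * of_real pi * - \<kappa> * \<i> = - (2 * of_real pi * \<kappa> * \<i>)" by simp
    ultimately show ?thesis
      unfolding scaleR_conv_of_real anger_diff_jump_imag cm_def using w[of x "- \<kappa>"] by (simp only:)
  qed
  obtain C1 C2 \<beta> where \<beta>: "0 \<le> \<beta>" "\<beta> < 1" and gF: "strip_growth C1 (real N) \<beta> F" and gG: "strip_growth C2 (real N) \<beta> G"
  proof -
    define \<rho> where "\<rho> = (\<bar>Re \<kappa>\<bar> + 1 + (real N + 1) / 3) / 2"
    have \<rho>: "\<rho> > \<bar>Re \<kappa>\<bar> + 1" "\<rho> > \<bar>Re (- \<kappa>)\<bar> + 1" "3 * \<rho> - real N < 1" using \<kappa> by (simp_all add: \<rho>_def field_simps)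
    \<comment> \<open>At w = 0 the product of w^N and z^(- \<rho>) is of size |w|^(N - 3 \<rho>), so
      the hypothesis on \<kappa> amounts to 3 \<rho> - N < 1. The maximum with 0 makes \<beta>
      nonnegative, as the divided differences demand.\<close>
    define \<beta> where "\<beta> = max 0 (3 * \<rho> - real N)"
    have gr: "strip_growth (2 * C) (real N) \<beta> (\<lambda>\<xi>. s * exp (of_nat N * \<xi>) * f (3 * \<xi>))"
      if C: "C \<ge> 0" "\<And>\<zeta>. \<bar>Im \<zeta>\<bar> \<le> 3 * pi / 2 \<Longrightarrow> norm (f \<zeta>) \<le> C * (1 + exp (- \<rho> * Re \<zeta>))" and s: "norm s = 1" for C f s
      unfolding strip_growth_def
    proof (intro allI impI)
      fix \<xi> :: complex assume \<xi>: "\<bar>Im \<xi>\<bar> \<le> pi / 2"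
      have \<rho>0: "\<rho> \<ge> 0" using \<rho>(1) by linarith
      have "norm (s * exp (of_nat N * \<xi>) * f (3 * \<xi>)) = exp (real N * Re \<xi>) * norm (f (3 * \<xi>))"
        using s by (simp add: norm_mult)
      also have "\<dots> \<le> exp (real N * Re \<xi>) * (C * (1 + exp (- \<rho> * Re (3 * \<xi>))))"
        using C(2)[of "3 * \<xi>"] \<xi> by (intro mult_left_mono) auto
      also have "\<dots> = C * (exp (real N * Re \<xi>) + exp ((real N - 3 * \<rho>) * Re \<xi>))"
        by (simp add: distrib_left exp_add[symmetric] algebra_simps)
      also have "\<dots> \<le> C * (2 * (if Re \<xi> \<ge> 0 then exp (real N * Re \<xi>) else exp (- \<beta> * Re \<xi>)))"
      proof (intro mult_left_mono C(1), cases "Re \<xi> \<ge> 0")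
        case True
        have "(real N - 3 * \<rho>) * Re \<xi> \<le> real N * Re \<xi>" using True \<rho>0 by (intro mult_right_mono) auto
        then show "exp (real N * Re \<xi>) + exp ((real N - 3 * \<rho>) * Re \<xi>) \<le> 2 * (if Re \<xi> \<ge> 0 then exp (real N * Re \<xi>) else exp (- \<beta> * Re \<xi>))"
          using True by simp
      next
        case False
        have "real N * Re \<xi> \<le> - \<beta> * Re \<xi>" "(real N - 3 * \<rho>) * Re \<xi> \<le> - \<beta> * Re \<xi>"
          using False by (intro mult_right_mono_neg; simp add: \<beta>_def)+
        then have "exp (real N * Re \<xi>) \<le> exp (- \<beta> * Re \<xi>)" "exp ((real N - 3 * \<rho>) * Re \<xi>) \<le> exp (- \<beta> * Re \<xi>)"
          unfolding exp_le_cancel_iff .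
        then have "exp (real N * Re \<xi>) + exp ((real N - 3 * \<rho>) * Re \<xi>) \<le> 2 * exp (- \<beta> * Re \<xi>)" by linarith
        then show "exp (real N * Re \<xi>) + exp ((real N - 3 * \<rho>) * Re \<xi>) \<le> 2 * (if Re \<xi> \<ge> 0 then exp (real N * Re \<xi>) else exp (- \<beta> * Re \<xi>))"
          using False by simp
      qed
      finally show "norm (s * exp (of_nat N * \<xi>) * f (3 * \<xi>)) \<le> 2 * C * (if Re \<xi> \<ge> 0 then exp (real N * Re \<xi>) else exp (- \<beta> * Re \<xi>))"
        by (simp only: mult.assoc mult.left_commute)
    qed
    obtain C where "C \<ge> 0" "\<And>\<zeta>. \<bar>Im \<zeta>\<bar> \<le> 3 * pi / 2 \<Longrightarrow> norm (anger_diff \<kappa> \<zeta>) \<le> C * (1 + exp (- \<rho> * Re \<zeta>))"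
      using anger_diff_growth[OF \<rho>(1)] by blast
    from gr[OF this, of 1] have 1: "strip_growth (2 * C) (real N) \<beta> F" unfolding F_def by simp
    obtain C' where "C' \<ge> 0" "\<And>\<zeta>. \<bar>Im \<zeta>\<bar> \<le> 3 * pi / 2 \<Longrightarrow> norm (anger_diff (- \<kappa>) \<zeta>) \<le> C' * (1 + exp (- \<rho> * Re \<zeta>))"
      using anger_diff_growth[OF \<rho>(2)] by blast
    from gr[OF this, of "(-1) ^ N"] have 2: "strip_growth (2 * C') (real N) \<beta> G" unfolding G_def by (simp add: norm_power)
    show ?thesis by (rule that[OF _ _ 1 2]) (use \<rho>(3) in \<open>auto simp: \<beta>_def\<close>)
  qed
  \<comment> \<open>Growth of degree N takes N + 1 divided differences before the decay O(1 / |w|)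
    is reached.\<close>
  have g: "strip_growth C1 (real (Suc N) - 1) \<beta> F" "strip_growth C2 (real (Suc N) - 1) \<beta> G" using gF gG by simp_all
  have hol: "F holomorphic_on {\<xi>. \<bar>Im \<xi>\<bar> < pi}" "G holomorphic_on {\<xi>. \<bar>Im \<xi>\<bar> < pi}"
    unfolding F_def G_def
    by (intro holomorphic_intros holomorphic_on_compose_gen[OF _ anger_diff_holomorphic, unfolded o_def] subset_UNIV)+
  have ji: "integrable lborel (\<lambda>x. exp x *\<^sub>R jp x)" "integrable lborel (\<lambda>x. exp x *\<^sub>R jm x)"
    unfolding jp jm using Qint by (auto intro: integrable_mult_right)
  obtain p where p: "\<And>\<xi>. \<bar>Im \<xi>\<bar> < pi / 2 \<Longrightarrow> F \<xi> = poly p (exp \<xi>) + (LINT x|lborel. dispersion_integrand jp jm (exp \<xi>) x) / (2 * pi * \<i>)"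
    using dispersion[OF hol g \<beta> ji[unfolded jp_def jm_def]] unfolding jp_def jm_def by blast
  have "F \<xi> = poly p (exp \<xi>) + exp (- \<xi>) * (\<i> / 6) * stieltjes_pair N \<kappa> \<xi>" if \<xi>: "\<bar>Im \<xi>\<bar> < pi / 2" for \<xi>
  proof -
    define c1 c2 where "c1 = \<i> * of_real (pi / 2) - \<xi>" and "c2 = - (\<i> * of_real (pi / 2)) - \<xi>"
    have ec: "exp c1 = \<i> * exp (- \<xi>)" "exp c2 = - \<i> * exp (- \<xi>)"
    proof -
      have e: "exp (\<i> * of_real (pi / 2)) = \<i>" "exp (- (\<i> * of_real (pi / 2))) = - \<i>"
        by (simp_all add: complex_eq_iff Re_exp Im_exp)
      show "exp c1 = \<i> * exp (- \<xi>)" "exp c2 = - \<i> * exp (- \<xi>)"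
        unfolding c1_def c2_def diff_conv_add_uminus exp_add e by simp_all
    qed
    have ic: "\<bar>Im c1\<bar> < pi" "\<bar>Im c2\<bar> < pi" using \<xi> by (auto simp: c1_def c2_def)
    define T where "T = (\<lambda>\<kappa> c x. (3 * exp (3 * x)) *\<^sub>R stieltjes_integrand N \<kappa> c (exp (3 * x)))"
    have T: "integrable lborel (T \<kappa> c2)" "integrable lborel (T (- \<kappa>) c1)"
      "(LINT x|lborel. T \<kappa> c2 x) = stieltjes N \<kappa> c2" "(LINT x|lborel. T (- \<kappa>) c1 x) = stieltjes N (- \<kappa>) c1"
      unfolding T_def stieltjes_def
      by (intro cube_exp_substitution stieltjes_integrable stieltjes_integrand_continuous \<kappa> \<kappa>' ic)+
    have E: "exp (- \<xi>) * exp \<xi> = 1" unfolding exp_add[symmetric] by simp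
    have d: "dispersion_integrand jp jm (exp \<xi>) x = \<i> * exp (- \<xi>) * (cm * T (- \<kappa>) c1 x + cp * T \<kappa> c2 x)" for x
    proof -
      have n: "Re (exp \<xi>) > 0" using \<xi> by (simp add: Re_exp cos_gt_zero_pi abs_less_iff)
      note nz = dispersion_denominator(3,4)[OF n, of "exp x"]
      have k1: "\<i> / (\<i> * exp x + exp \<xi>) = \<i> * exp (- \<xi>) * (1 / (1 + exp c1 * of_real (exp x)))"
      proof -
        have "\<i> * exp (- \<xi>) * (\<i> * exp x + exp \<xi>) = \<i> * (1 + exp c1 * of_real (exp x))"
          unfolding ec using E by algebra
        moreover from this nz(1) have "1 + exp c1 * of_real (exp x) \<noteq> 0" by auto
        ultimately show ?thesis using nz(1) by (simp add: divide_eq_eq eq_divide_eq mult.commute)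
      qed
      have k2: "\<i> / (\<i> * exp x - exp \<xi>) = - (\<i> * exp (- \<xi>) * (1 / (1 + exp c2 * of_real (exp x))))"
      proof -
        have "\<i> * exp (- \<xi>) * (\<i> * exp x - exp \<xi>) = - \<i> * (1 + exp c2 * of_real (exp x))"
          unfolding ec using E by algebra
        moreover from this nz(2) have "1 + exp c2 * of_real (exp x) \<noteq> 0" by auto
        ultimately show ?thesis using nz(2) by (simp add: divide_eq_eq eq_divide_eq mult.commute)
      qed
      have gen: "m * q1 * (i * (1 / a)) - p * q2 * - (i * (1 / b)) = i * (m * (q1 * (1 / a)) + p * (q2 * (1 / b)))"
        for m q1 i a p q2 b :: complex by (simp add: algebra_simps)
      have TQ: "T \<kappa> c x = Q \<kappa> x * (1 / (1 + exp c * of_real (exp x)))" for \<kappa> c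
        unfolding T_def Q_def stieltjes_integrand_def cube_root_exp by (simp only: mult_scaleR_left)
      show ?thesis unfolding dispersion_integrand_def jp jm k1 k2 TQ by (rule gen)
    qed
    have "(LINT x|lborel. dispersion_integrand jp jm (exp \<xi>) x) = \<i> * exp (- \<xi>) * (cm * stieltjes N (- \<kappa>) c1 + cp * stieltjes N \<kappa> c2)"
      unfolding d using T by (simp add: Bochner_Integration.integral_add)
    moreover have "\<i> * E * (of_real pi * \<i> * a * b / 3 * S + - (of_real pi * \<i> * a' * b') / 3 * S') / (2 * pi * \<i>)
       = E * (\<i> / 6) * (a * b * S - a' * b' * S')" for E a b S a' b' S' :: complex
      by (simp add: field_simps)
    ultimately show ?thesis
      unfolding p[OF \<xi>] stieltjes_pair_def c1_def[symmetric] c2_def[symmetric] cm_def cp_def by simp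
  qed
  then show ?thesis unfolding F_def by blast
qed

section \<open>Identification of the polynomial\<close>

lemma stieltjes_bound:
  assumes \<kappa>: "\<bar>Re \<kappa>\<bar> + 1 < (real N + 1) / 3" and c: "\<bar>Im c\<bar> \<le> pi / 2"
  shows "norm (stieltjes N \<kappa> c) \<le> (LINT y:{0<..}|lborel. norm (hankel_weight N \<kappa> y))"
proof -
  have c': "\<bar>Im c\<bar> < pi" using c pi_gt_zero by linarith
  note int = stieltjes_integrable[OF \<kappa> c']
  have "norm (stieltjes N \<kappa> c) \<le> (LINT y:{0<..}|lborel. norm (stieltjes_integrand N \<kappa> c y))"
    unfolding stieltjes_def by (rule set_integral_norm_bound[OF int])
  also have "\<dots> \<le> (LINT y:{0<..}|lborel. norm (hankel_weight N \<kappa> y))"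
  proof (rule set_integral_mono)
    show "norm (stieltjes_integrand N \<kappa> c y) \<le> norm (hankel_weight N \<kappa> y)" for y
    proof -
      have "cos (Im c) \<ge> 0" using c by (intro cos_ge_zero) auto
      then have "0 \<le> exp (Re c) * cos (Im c) * y powr (1 / 3)" by (intro mult_nonneg_nonneg) auto
      then have "1 \<le> norm (1 + exp c * of_real (y powr (1 / 3)))"
        using complex_Re_le_cmod[of "1 + exp c * of_real (y powr (1 / 3))"] by (simp add: Re_exp)
      then have "norm (1 / (1 + exp c * of_real (y powr (1 / 3)))) \<le> 1"
        unfolding norm_divide norm_one by (subst divide_le_eq_1) auto
      then show ?thesis unfolding stieltjes_integrand_def norm_mult by (intro mult_left_le) auto
    qed
  qed (intro set_integrable_norm int hankel_weight_integrable \<kappa>)+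
  finally show ?thesis .
qed

lemma stieltjes_pair_bound:
  assumes \<kappa>: "\<bar>Re \<kappa>\<bar> + 1 < (real N + 1) / 3"
  shows "\<exists>K. \<forall>x::real. norm (stieltjes_pair N \<kappa> (of_real x)) \<le> K"
proof -
  define K where "K = (\<lambda>\<kappa>. LINT y:{0<..}|lborel. norm (hankel_weight N \<kappa> y))"
  define a b where "a = (- \<i>) ^ N * exp (- (2 * of_real pi * \<kappa> * \<i>))" and "b = \<i> ^ N * exp (2 * of_real pi * \<kappa> * \<i>)"
  have \<kappa>': "\<bar>Re (- \<kappa>)\<bar> + 1 < (real N + 1) / 3" using \<kappa> by simp
  have "norm (stieltjes_pair N \<kappa> (of_real x)) \<le> norm a * K (- \<kappa>) + norm b * K \<kappa>" for x :: real
  proof -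
    have "norm (stieltjes_pair N \<kappa> (of_real x)) \<le> norm a * norm (stieltjes N (- \<kappa>) (\<i> * of_real (pi / 2) - of_real x))
        + norm b * norm (stieltjes N \<kappa> (- (\<i> * of_real (pi / 2)) - of_real x))"
      unfolding stieltjes_pair_def a_def[symmetric] b_def[symmetric] norm_mult[symmetric] by (rule norm_triangle_ineq4)
    also have "\<dots> \<le> norm a * K (- \<kappa>) + norm b * K \<kappa>"
      unfolding K_def by (intro add_mono mult_left_mono stieltjes_bound \<kappa> \<kappa>') auto
    finally show ?thesis .
  qed
  then show ?thesis by blast
qed

text \<open>For p \<noteq> 0 the polynomial X p is not constant and tends to infinity, whereas the
  hypothesis bounds it by K on [1, \<infinity>).\<close>

lemma poly_eq_0_if_decaying:
  fixes p :: "complex poly"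
  assumes "\<And>x::real. x \<ge> 0 \<Longrightarrow> norm (poly p (of_real (exp x))) \<le> K * exp (- x)"
  shows "p = 0"
proof (rule ccontr)
  assume "p \<noteq> 0"
  then obtain r where r: "\<And>z. r \<le> norm z \<Longrightarrow> K + 1 \<le> norm (poly (pCons 0 p) z)"
    using poly_infinity[of p "K + 1" 0] by blast
  define x where "x = \<bar>r\<bar>"
  have "r \<le> exp x" using exp_ge_add_one_self[of x] abs_ge_self[of r] unfolding x_def by linarith
  then have "K + 1 \<le> norm (poly (pCons 0 p) (of_real (exp x)))" by (intro r) (simp add: norm_of_real)
  also have "\<dots> = exp x * norm (poly p (of_real (exp x)))" by (simp add: norm_mult)
  also have "\<dots> \<le> exp x * (K * exp (- x))" by (intro mult_left_mono assms) (auto simp: x_def)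
  also have "\<dots> = K" by (simp add: exp_minus)
  finally show False by simp
qed

text \<open>On the positive axis the Stieltjes part of the dispersion relation and the error of the
  asymptotic expansion, multiplied by w^N, are both O(1 / w). The polynomial is therefore the
  truncated expansion, and the asymptotic statement becomes an exact formula in the whole
  sector.\<close>

lemma anger_diff_remainder:
  assumes \<kappa>: "\<bar>Re \<kappa>\<bar> + 1 < (real N + 1) / 3" and \<zeta>: "\<bar>Im \<zeta>\<bar> < 3 * pi / 2"
  shows "anger_diff \<kappa> \<zeta> = (\<Sum>k<N. anger_diff_coeff k \<kappa> * exp (- (of_nat k + 1) * \<zeta> / 3))
    + exp (- (of_nat N + 1) * \<zeta> / 3) * (\<i> / 6) * stieltjes_pair N \<kappa> (\<zeta> / 3)"
proof -
  obtain p where p: "\<And>\<xi>. \<bar>Im \<xi>\<bar> < pi / 2 \<Longrightarrow>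
      exp (of_nat N * \<xi>) * anger_diff \<kappa> (3 * \<xi>) = poly p (exp \<xi>) + exp (- \<xi>) * (\<i> / 6) * stieltjes_pair N \<kappa> \<xi>"
    using anger_diff_dispersion[OF \<kappa>] by blast
  \<comment> \<open>After multiplication by w^N the term with w^(- (k+1)) has degree N - 1 -
    k.\<close>
  define q where "q = (\<Sum>k<N. monom (anger_diff_coeff k \<kappa>) (N - 1 - k))"
  have q: "poly q (exp \<xi>) = exp (of_nat N * \<xi>) * (\<Sum>k<N. anger_diff_coeff k \<kappa> * exp (- (of_nat k + 1) * \<xi>))" for \<xi>
  proof -
    have "exp \<xi> ^ (N - 1 - k) = exp (of_nat N * \<xi>) * exp (- (of_nat k + 1) * \<xi>)" if "k < N" for k
    proof -
      have o: "of_nat (N - 1 - k) = (of_nat N - 1 - of_nat k :: complex)" using that by (simp add: of_nat_diff)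
      have "of_nat (N - 1 - k) * \<xi> = of_nat N * \<xi> + - (of_nat k + 1) * \<xi>" unfolding o by (simp add: algebra_simps)
      then show ?thesis unfolding exp_of_nat_mult[symmetric] exp_add[symmetric] by (simp only:)
    qed
    then show ?thesis unfolding q_def poly_sum poly_monom sum_distrib_left by (intro sum.cong refl) (simp add: mult_ac)
  qed
  \<comment> \<open>One term beyond q is expanded: the error bound for N + 1 terms has the size w^(-
    (N+1)) of that extra term, so both pass into the error.\<close>
  obtain C where C: "\<And>X. X \<ge> 1 \<Longrightarrow> norm (anger_diff \<kappa> (of_real (ln X)) - (\<Sum>k<N + 1. anger_diff_coeff k \<kappa> * of_real (X powr (- ((real k + 1) / 3)))))
     \<le> C * X powr (- (real (N + 1) / 3))" using anger_diff_asymptotic[of \<kappa> "N + 1"] by blast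
  obtain K where K: "\<And>x::real. norm (stieltjes_pair N \<kappa> (of_real x)) \<le> K" using stieltjes_pair_bound[OF \<kappa>] by blast
  have "p - q = 0"
  proof (rule poly_eq_0_if_decaying)
    fix x :: real assume x: "x \<ge> 0"
    define d where "d = anger_diff \<kappa> (3 * of_real x) - (\<Sum>k<N. anger_diff_coeff k \<kappa> * exp (- (of_nat k + 1) * of_real x))"
    have "norm d \<le> (C + norm (anger_diff_coeff N \<kappa>)) * exp (- (real N + 1) * x)"
    proof -
      have po: "exp (3 * x) powr (- (a / 3)) = exp (- a * x)" for a by (simp add: powr_def)
      have ln3: "complex_of_real (ln (exp (3 * x))) = 3 * of_real x" by simp
      have pk: "complex_of_real (exp (3 * x) powr (- ((real k + 1) / 3))) = exp (- (of_nat k + 1) * of_real x)" for k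
        unfolding po exp_of_real[symmetric] by simp
      have "(\<Sum>k<N + 1. anger_diff_coeff k \<kappa> * of_real (exp (3 * x) powr (- ((real k + 1) / 3))))
        = (\<Sum>k<N. anger_diff_coeff k \<kappa> * exp (- (of_nat k + 1) * of_real x)) + anger_diff_coeff N \<kappa> * exp (- (of_nat N + 1) * of_real x)"
        unfolding pk by simp
      then have "anger_diff \<kappa> (of_real (ln (exp (3 * x)))) - (\<Sum>k<N + 1. anger_diff_coeff k \<kappa> * of_real (exp (3 * x) powr (- ((real k + 1) / 3))))
        = d - anger_diff_coeff N \<kappa> * exp (- (of_nat N + 1) * of_real x)"
        unfolding ln3 d_def by (simp only: diff_diff_eq)
      moreover have "exp (3 * x) powr (- (real (N + 1) / 3)) = exp (- (real N + 1) * x)" unfolding po by simp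
      moreover have "1 \<le> exp (3 * x)" using x by simp
      note C[OF this]
      ultimately have "norm (d - anger_diff_coeff N \<kappa> * exp (- (of_nat N + 1) * of_real x)) \<le> C * exp (- (real N + 1) * x)"
        by (simp only:)
      moreover have "norm (anger_diff_coeff N \<kappa> * exp (- (of_nat N + 1) * of_real x)) = norm (anger_diff_coeff N \<kappa>) * exp (- (real N + 1) * x)"
        by (simp add: norm_mult)
      ultimately show ?thesis
        using norm_triangle_ineq2[of d "anger_diff_coeff N \<kappa> * exp (- (of_nat N + 1) * of_real x)"] unfolding distrib_right[of C] by linarith
    qed
    then have "exp (real N * x) * norm d \<le> exp (real N * x) * ((C + norm (anger_diff_coeff N \<kappa>)) * exp (- (real N + 1) * x))"
      by (intro mult_left_mono) auto
    also have "\<dots> = (C + norm (anger_diff_coeff N \<kappa>)) * exp (- x)"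
    proof -
      have "exp (real N * x) * exp (- (real N + 1) * x) = exp (- x)" unfolding exp_add[symmetric] by (simp add: algebra_simps)
      then show ?thesis by (subst mult.left_commute) (simp only:)
    qed
    finally have 1: "norm (exp (of_nat N * of_real x) * d) \<le> (C + norm (anger_diff_coeff N \<kappa>)) * exp (- x)" by (simp add: norm_mult)
    have 2: "norm (exp (- of_real x) * (\<i> / 6) * stieltjes_pair N \<kappa> (of_real x)) \<le> K * exp (- x)"
    proof -
      have "norm (exp (- complex_of_real x) * (\<i> / 6) * stieltjes_pair N \<kappa> (of_real x)) = exp (- x) * (1 / 6 * norm (stieltjes_pair N \<kappa> (of_real x)))"
        by (simp add: norm_mult norm_divide)
      also have "\<dots> \<le> exp (- x) * K" using K[of x] norm_ge_zero[of "stieltjes_pair N \<kappa> (of_real x)"] by (intro mult_left_mono) (linarith, simp)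
      finally show ?thesis by (simp only: mult.commute)
    qed
    have "poly (p - q) (of_real (exp x)) = exp (of_nat N * of_real x) * d - exp (- of_real x) * (\<i> / 6) * stieltjes_pair N \<kappa> (of_real x)"
      using p[of "of_real x"] q[of "of_real x"] unfolding d_def poly_diff exp_of_real[symmetric] by (simp add: right_diff_distrib)
    then show "norm (poly (p - q) (of_real (exp x))) \<le> (C + norm (anger_diff_coeff N \<kappa>) + K) * exp (- x)"
      using norm_triangle_ineq4[of "exp (of_nat N * of_real x) * d" "exp (- of_real x) * (\<i> / 6) * stieltjes_pair N \<kappa> (of_real x)"] 1 2
      unfolding distrib_right[of _ K] by simp
  qed
  then have pq: "p = q" by simp
  define \<xi> where "\<xi> = \<zeta> / 3"
  have \<xi>: "\<bar>Im \<xi>\<bar> < pi / 2" "3 * \<xi> = \<zeta>" using \<zeta> by (auto simp: \<xi>_def)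
  have e: "exp (- (of_nat k + 1) * \<zeta> / 3) = exp (- (of_nat k + 1) * \<xi>)" for k by (simp add: \<xi>_def)
  have "exp (of_nat N * \<xi>) * (anger_diff \<kappa> \<zeta> - (\<Sum>k<N. anger_diff_coeff k \<kappa> * exp (- (of_nat k + 1) * \<xi>)))
    = exp (of_nat N * \<xi>) * (exp (- (of_nat N + 1) * \<xi>) * (\<i> / 6) * stieltjes_pair N \<kappa> \<xi>)"
  proof -
    have "exp (of_nat N * \<xi>) * exp (- (of_nat N + 1) * \<xi>) = exp (- \<xi>)" unfolding exp_add[symmetric] by (simp add: algebra_simps)
    moreover have "EN * (A - Q) = EN * (s * j * S)" if "EN * s = m" "EN * A = EN * Q + m * j * S" for EN s m A Q j S :: complex
      using that(2) unfolding that(1)[symmetric] right_diff_distrib by (simp add: mult.assoc)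
    ultimately show ?thesis using p[OF \<xi>(1)] unfolding pq q \<xi>(2) by blast
  qed
  then have "anger_diff \<kappa> \<zeta> - (\<Sum>k<N. anger_diff_coeff k \<kappa> * exp (- (of_nat k + 1) * \<xi>)) = exp (- (of_nat N + 1) * \<xi>) * (\<i> / 6) * stieltjes_pair N \<kappa> \<xi>"
    by simp
  then show ?thesis unfolding e \<xi>_def[symmetric] by (simp only: diff_eq_eq add.commute)
qed

section \<open>Expansions\<close>

text \<open>\<theta> is the angle of the ray for positive z. Half turns of z move it by \<pi> / 3,
  so only \<plusminus> \<pi> / 6, \<plusminus> \<pi> / 2 and \<plusminus> 5 \<pi> / 6 occur
  below.\<close>

definition stieltjes_ray :: "nat \<Rightarrow> complex \<Rightarrow> complex \<Rightarrow> real \<Rightarrow> complex" where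
  "stieltjes_ray N \<kappa> \<zeta> \<theta> = stieltjes N \<kappa> (\<i> * of_real \<theta> - \<zeta> / 3)"

definition monodromy :: "complex \<Rightarrow> complex" where
  "monodromy \<kappa> = exp (2 * of_real pi * \<kappa> * \<i>)"

definition sixth_root :: "nat \<Rightarrow> complex" where
  "sixth_root n = exp ((of_nat n + 1) * of_real pi * \<i> / 3)"

definition cbrt_power :: "nat \<Rightarrow> complex \<Rightarrow> complex" where
  "cbrt_power n \<zeta> = exp (- (of_nat n + 1) * \<zeta> / 3)"

definition gamma_factor :: "nat \<Rightarrow> complex" where
  "gamma_factor n = of_real (6 powr ((real n + 1) / 3)) * of_real (Gamma ((real n + 1) / 3)) / 3"

lemma stieltjes_ray_rotate: "stieltjes_ray N \<kappa> (\<zeta> + \<i> * of_real \<phi>) \<theta> = stieltjes_ray N \<kappa> \<zeta> (\<theta> - \<phi> / 3)"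
  unfolding stieltjes_ray_def by (simp add: algebra_simps add_divide_distrib)

lemma stieltjes_pair_ray:
  "stieltjes_pair N \<kappa> (\<zeta> / 3) = (- \<i>) ^ N * monodromy (- \<kappa>) * stieltjes_ray N (- \<kappa>) \<zeta> (pi / 2)
     - \<i> ^ N * monodromy \<kappa> * stieltjes_ray N \<kappa> \<zeta> (- (pi / 2))"
  unfolding stieltjes_pair_def stieltjes_ray_def monodromy_def by simp

lemma sixth_root_inverse: "exp (- ((of_nat n + 1) * of_real pi * \<i> / 3)) = inverse (sixth_root n)"
  unfolding sixth_root_def exp_minus ..

lemma sixth_root_nonzero: "sixth_root n \<noteq> 0"
  by (simp add: sixth_root_def)

lemma exp_Suc_pi: "exp ((of_nat n + 1) * of_real pi * \<i>) = - ((-1) ^ n)"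
proof -
  have "exp ((of_nat n + 1) * of_real pi * \<i>) = exp (of_nat n * (\<i> * of_real pi)) * exp (\<i> * of_real pi)"
    unfolding exp_add[symmetric] by (simp add: algebra_simps)
  then show ?thesis unfolding exp_of_nat_mult by simp
qed

lemma sixth_root_cube: "sixth_root n ^ 3 = - ((-1) ^ n)"
  unfolding sixth_root_def exp_of_nat_mult[symmetric] exp_Suc_pi[symmetric] by simp

lemma sixth_root_square: "exp (2 * (of_nat n + 1) * of_real pi * \<i> / 3) = sixth_root n ^ 2"
  unfolding sixth_root_def exp_of_nat_mult[symmetric] by (simp add: algebra_simps)

lemma sin_sixth_root: "of_real (sin ((real n + 1) * pi / 3)) = (sixth_root n - inverse (sixth_root n)) / (2 * \<i>)"
proof -
  have e: "\<i> * of_real ((real n + 1) * pi / 3) = (of_nat n + 1) * of_real pi * \<i> / 3" by simp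
  show ?thesis unfolding sin_of_real[symmetric] sin_exp_eq e sixth_root_inverse sixth_root_def[symmetric] ..
qed

lemma i_power_sign: "(-1) ^ N * (- \<i>) ^ N = \<i> ^ N" "(-1) ^ N * \<i> ^ N = (- \<i>) ^ N"
  unfolding power_mult_distrib[symmetric] by simp_all

lemma cbrt_power_rotate:
  "cbrt_power n (\<zeta> + \<i> * of_real pi) = cbrt_power n \<zeta> * inverse (sixth_root n)"
  "cbrt_power n (\<zeta> - \<i> * of_real pi) = cbrt_power n \<zeta> * sixth_root n"
  unfolding cbrt_power_def sixth_root_def exp_minus[symmetric] exp_add[symmetric] by (simp_all add: algebra_simps diff_divide_distrib add_divide_distrib)

lemma divide_ls_powr: "a / ls_powr (Log_Point \<zeta>) ((of_nat n + 1) / 3) = a * cbrt_power n \<zeta>"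
proof -
  have "- (of_nat n + 1) * \<zeta> / 3 = - ((of_nat n + 1) / 3 * \<zeta>)" by (simp only: minus_mult_left times_divide_eq_left minus_divide_left)
  then show ?thesis unfolding ls_powr_def cbrt_power_def log_surface.sel by (simp only: exp_minus divide_inverse)
qed

text \<open>Under \<kappa> \<rightarrow> - \<kappa> the parity factor (- 1)^(k+1) of D_k cancels the
  alternating sign up to an overall minus.\<close>

lemma anger_diff_coeff_gamma: "anger_diff_coeff k \<kappa> = (-1) ^ k * gamma_factor k * D_coeff k \<kappa>"
  "anger_diff_coeff k (- \<kappa>) = - (gamma_factor k * D_coeff k \<kappa>)"
proof -
  show "anger_diff_coeff k \<kappa> = (-1) ^ k * gamma_factor k * D_coeff k \<kappa>" for \<kappa>
    unfolding anger_diff_coeff_def gamma_factor_def by simp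
  from this[of "- \<kappa>"] have "anger_diff_coeff k (- \<kappa>) = (-1) ^ k * gamma_factor k * ((-1) ^ (k + 1) * D_coeff k \<kappa>)" unfolding D_coeff_minus .
  moreover have "(-1) ^ k * (-1) ^ (k + 1) = (-1 :: complex)" unfolding power_add[symmetric] by simp
  moreover have "s * g * (t * D) = s * t * (g * D)" for s g t D :: complex by (simp only: mult_ac)
  ultimately show "anger_diff_coeff k (- \<kappa>) = - (gamma_factor k * D_coeff k \<kappa>)" by simp
qed

lemma sum_from_one:
  fixes f :: "nat \<Rightarrow> complex"
  assumes "f 0 = 0" "N > 0"
  shows "(\<Sum>k<N. f k) = (\<Sum>n = 1..N - 1. f n)"
proof -
  have "{..<N} = insert 0 {1..N - 1}" using assms by auto
  then show ?thesis using assms by simp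
qed

context
  fixes N :: nat and \<kappa> :: complex
  assumes \<kappa>: "\<bar>Re \<kappa>\<bar> + 1 < (real N + 1) / 3"
begin

private lemma \<kappa>': "\<bar>Re (- \<kappa>)\<bar> + 1 < (real N + 1) / 3"
  using \<kappa> by simp

lemma anger_diff_ray:
  assumes "\<bar>Im \<zeta>\<bar> < 3 * pi / 2"
  shows "anger_diff \<kappa> \<zeta> = (\<Sum>k<N. (-1) ^ k * gamma_factor k * D_coeff k \<kappa> * cbrt_power k \<zeta>)
    + cbrt_power N \<zeta> * (\<i> / 6) * ((- \<i>) ^ N * monodromy (- \<kappa>) * stieltjes_ray N (- \<kappa>) \<zeta> (pi / 2)
       - \<i> ^ N * monodromy \<kappa> * stieltjes_ray N \<kappa> \<zeta> (- (pi / 2)))"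
  using anger_diff_remainder[OF \<kappa> assms]
  unfolding cbrt_power_def[symmetric] stieltjes_pair_ray anger_diff_coeff_gamma(1) .

lemma anger_diff_minus_ray:
  assumes "\<bar>Im \<zeta>\<bar> < 3 * pi / 2"
  shows "anger_diff (- \<kappa>) \<zeta> = - (\<Sum>k<N. gamma_factor k * D_coeff k \<kappa> * cbrt_power k \<zeta>)
    + cbrt_power N \<zeta> * (\<i> / 6) * ((- \<i>) ^ N * monodromy \<kappa> * stieltjes_ray N \<kappa> \<zeta> (pi / 2)
       - \<i> ^ N * monodromy (- \<kappa>) * stieltjes_ray N (- \<kappa>) \<zeta> (- (pi / 2)))"
  using anger_diff_remainder[OF \<kappa>' assms]
  unfolding cbrt_power_def[symmetric] stieltjes_pair_ray anger_diff_coeff_gamma(2)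
  by (simp add: sum_negf)

text \<open>The half turn multiplies the powers z^(- (k+1)/3) by sixth roots of unity and lowers
  both ray angles by \<pi> / 3.\<close>

lemma anger_diff_minus_ray_up:
  assumes "\<bar>Im \<zeta> + pi\<bar> < 3 * pi / 2"
  shows "anger_diff (- \<kappa>) (\<zeta> + \<i> * of_real pi) = - (\<Sum>k<N. gamma_factor k * D_coeff k \<kappa> * (cbrt_power k \<zeta> * inverse (sixth_root k)))
    + cbrt_power N \<zeta> * inverse (sixth_root N) * (\<i> / 6) * ((- \<i>) ^ N * monodromy \<kappa> * stieltjes_ray N \<kappa> \<zeta> (pi / 6)
       - \<i> ^ N * monodromy (- \<kappa>) * stieltjes_ray N (- \<kappa>) \<zeta> (- (5 * pi / 6)))"
proof -
  have r: "pi / 2 - pi / 3 = pi / 6" "- (pi / 2) - pi / 3 = - (5 * pi / 6)" by simp_all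
  have "\<bar>Im (\<zeta> + \<i> * of_real pi)\<bar> < 3 * pi / 2" using assms by simp
  from anger_diff_minus_ray[OF this] show ?thesis unfolding stieltjes_ray_rotate cbrt_power_rotate r .
qed

lemma anger_diff_minus_ray_down:
  assumes "\<bar>Im \<zeta> - pi\<bar> < 3 * pi / 2"
  shows "anger_diff (- \<kappa>) (\<zeta> - \<i> * of_real pi) = - (\<Sum>k<N. gamma_factor k * D_coeff k \<kappa> * (cbrt_power k \<zeta> * sixth_root k))
    + cbrt_power N \<zeta> * sixth_root N * (\<i> / 6) * ((- \<i>) ^ N * monodromy \<kappa> * stieltjes_ray N \<kappa> \<zeta> (5 * pi / 6)
       - \<i> ^ N * monodromy (- \<kappa>) * stieltjes_ray N (- \<kappa>) \<zeta> (- (pi / 6)))"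
proof -
  have r: "pi / 2 - - pi / 3 = 5 * pi / 6" "- (pi / 2) - - pi / 3 = - (pi / 6)" by simp_all
  have m: "\<zeta> + \<i> * of_real (- pi) = \<zeta> - \<i> * of_real pi" by simp
  have "\<bar>Im (\<zeta> - \<i> * of_real pi)\<bar> < 3 * pi / 2" using assms by simp
  from anger_diff_minus_ray[OF this] show ?thesis
    unfolding cbrt_power_rotate stieltjes_ray_rotate[of N _ \<zeta> "- pi", unfolded m] r .
qed

end

section \<open>The remainders of the theorem as Stieltjes transforms\<close>

lemma stieltjes_ray_integral:
  assumes "\<bar>Re \<kappa>\<bar> + 1 < (real N + 1) / 3" "\<bar>\<theta> - Im \<zeta> / 3\<bar> < pi"
  shows "set_integrable lborel {0<..} (stieltjes_integrand N \<kappa> (\<i> * of_real \<theta> - \<zeta> / 3))"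
    and "(LINT y:{0<..}|lborel. stieltjes_integrand N \<kappa> (\<i> * of_real \<theta> - \<zeta> / 3) y) = stieltjes_ray N \<kappa> \<zeta> \<theta>"
  using stieltjes_integrable[OF assms(1)] assms(2) by (simp_all add: stieltjes_ray_def stieltjes_def)

text \<open>The dictionary between the six ray angles and the six denominators in the remainder
  integrals.\<close>

lemma stieltjes_ray_exp:
  "exp (\<i> * of_real (pi / 2) - \<zeta> / 3) * of_real (t powr (1 / 3)) = \<i> * cbrt_quot t (Log_Point \<zeta>)"
  "exp (\<i> * of_real (- (pi / 2)) - \<zeta> / 3) * of_real (t powr (1 / 3)) = - (\<i> * cbrt_quot t (Log_Point \<zeta>))"
  "exp (\<i> * of_real (5 * pi / 6) - \<zeta> / 3) * of_real (t powr (1 / 3)) = \<i> * cbrt_quot t (Log_Point \<zeta>) * exp (of_real pi / 3 * \<i>)"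
  "exp (\<i> * of_real (- (pi / 6)) - \<zeta> / 3) * of_real (t powr (1 / 3)) = - (\<i> * cbrt_quot t (Log_Point \<zeta>) * exp (of_real pi / 3 * \<i>))"
  "exp (\<i> * of_real (pi / 6) - \<zeta> / 3) * of_real (t powr (1 / 3)) = \<i> * cbrt_quot t (Log_Point \<zeta>) * exp (- (of_real pi / 3) * \<i>)"
  "exp (\<i> * of_real (- (5 * pi / 6)) - \<zeta> / 3) * of_real (t powr (1 / 3)) = - (\<i> * cbrt_quot t (Log_Point \<zeta>) * exp (- (of_real pi / 3) * \<i>))"
proof -
  have i: "exp (\<i> * of_real (pi / 2)) = \<i>" "exp (\<i> * of_real (- (pi / 2))) = - \<i>"
    by (simp_all add: complex_eq_iff Re_exp Im_exp)
  have q: "cbrt_quot t (Log_Point \<zeta>) = of_real (t powr (1 / 3)) * exp (- (\<zeta> / 3))"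
  proof -
    have "exp (- (\<zeta> / 3)) = inverse (exp (1 / 3 * \<zeta>))" by (simp flip: exp_minus)
    then show ?thesis unfolding cbrt_quot_def ls_powr_def log_surface.sel by (simp only: divide_inverse)
  qed
  have s: "exp (\<i> * of_real (\<theta> + \<phi>) - \<zeta> / 3) * of_real (t powr (1 / 3)) = exp (\<i> * of_real \<theta>) * cbrt_quot t (Log_Point \<zeta>) * exp (of_real \<phi> * \<i>)" for \<theta> \<phi>
  proof -
    have "\<i> * of_real (\<theta> + \<phi>) - \<zeta> / 3 = \<i> * of_real \<theta> + - (\<zeta> / 3) + of_real \<phi> * \<i>" by (simp add: algebra_simps)
    then show ?thesis unfolding q by (simp only: exp_add mult_ac)
  qed
  have f: "5 * pi / 6 = pi / 2 + pi / 3" "- (pi / 6) = - (pi / 2) + pi / 3" "pi / 6 = pi / 2 + - (pi / 3)" "- (5 * pi / 6) = - (pi / 2) + - (pi / 3)"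
    by simp_all
  show "exp (\<i> * of_real (pi / 2) - \<zeta> / 3) * of_real (t powr (1 / 3)) = \<i> * cbrt_quot t (Log_Point \<zeta>)"
    "exp (\<i> * of_real (- (pi / 2)) - \<zeta> / 3) * of_real (t powr (1 / 3)) = - (\<i> * cbrt_quot t (Log_Point \<zeta>))"
    using s[of "pi / 2" 0] s[of "- (pi / 2)" 0] unfolding i by simp_all
  show "exp (\<i> * of_real (5 * pi / 6) - \<zeta> / 3) * of_real (t powr (1 / 3)) = \<i> * cbrt_quot t (Log_Point \<zeta>) * exp (of_real pi / 3 * \<i>)"
    unfolding f(1) s i by simp
  show "exp (\<i> * of_real (- (pi / 6)) - \<zeta> / 3) * of_real (t powr (1 / 3)) = - (\<i> * cbrt_quot t (Log_Point \<zeta>) * exp (of_real pi / 3 * \<i>))"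
    unfolding f(2) s i by simp
  show "exp (\<i> * of_real (pi / 6) - \<zeta> / 3) * of_real (t powr (1 / 3)) = \<i> * cbrt_quot t (Log_Point \<zeta>) * exp (- (of_real pi / 3) * \<i>)"
    unfolding f(3) s i by simp
  show "exp (\<i> * of_real (- (5 * pi / 6)) - \<zeta> / 3) * of_real (t powr (1 / 3)) = - (\<i> * cbrt_quot t (Log_Point \<zeta>) * exp (- (of_real pi / 3) * \<i>))"
    unfolding f(4) s i by simp
qed

lemma set_integral_combination:
  fixes f g :: "real \<Rightarrow> complex"
  assumes "set_integrable lborel {0<..} f" "set_integrable lborel {0<..} g"
  shows "set_integrable lborel {0<..} (\<lambda>t. a * f t - b * g t)"
    and "(LINT t:{0<..}|lborel. a * f t - b * g t) = a * (LINT t:{0<..}|lborel. f t) - b * (LINT t:{0<..}|lborel. g t)"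
proof -
  have "set_integrable lborel {0<..} (\<lambda>t. a * f t)" "set_integrable lborel {0<..} (\<lambda>t. b * g t)"
    using assms by (auto intro: set_integrable_mult_right)
  from set_integral_diff[OF this] show "set_integrable lborel {0<..} (\<lambda>t. a * f t - b * g t)"
    "(LINT t:{0<..}|lborel. a * f t - b * g t) = a * (LINT t:{0<..}|lborel. f t) - b * (LINT t:{0<..}|lborel. g t)"
    by simp_all
qed

lemma RH_integrand_stieltjes:
  "RH_integrand1 N (Log_Point \<zeta>) \<kappa> = (\<lambda>t. sixth_root N * stieltjes_integrand N \<kappa> (\<i> * of_real (5 * pi / 6) - \<zeta> / 3) t
     - (- ((-1) ^ N)) * stieltjes_integrand N \<kappa> (\<i> * of_real (- (pi / 2)) - \<zeta> / 3) t)"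
  "RH_integrand2 N (Log_Point \<zeta>) \<kappa> = (\<lambda>t. sixth_root N * stieltjes_integrand N (- \<kappa>) (\<i> * of_real (- (pi / 6)) - \<zeta> / 3) t
     - (- ((-1) ^ N)) * stieltjes_integrand N (- \<kappa>) (\<i> * of_real (pi / 2) - \<zeta> / 3) t)"
proof -
  have m: "1 + - u = 1 - u" for u :: complex by simp
  have gen: "w * (x / p - y / q) * h = x * (w * h * (1 / p)) - y * (w * h * (1 / q))" for w x p y q h :: complex
    by (simp add: algebra_simps)
  show "RH_integrand1 N (Log_Point \<zeta>) \<kappa> = (\<lambda>t. sixth_root N * stieltjes_integrand N \<kappa> (\<i> * of_real (5 * pi / 6) - \<zeta> / 3) t
     - (- ((-1) ^ N)) * stieltjes_integrand N \<kappa> (\<i> * of_real (- (pi / 2)) - \<zeta> / 3) t)"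
    unfolding RH_integrand1_def[abs_def] stieltjes_integrand_def hankel_weight_def stieltjes_ray_exp m sixth_root_def[symmetric] exp_Suc_pi
    by (rule ext, rule gen)
  show "RH_integrand2 N (Log_Point \<zeta>) \<kappa> = (\<lambda>t. sixth_root N * stieltjes_integrand N (- \<kappa>) (\<i> * of_real (- (pi / 6)) - \<zeta> / 3) t
     - (- ((-1) ^ N)) * stieltjes_integrand N (- \<kappa>) (\<i> * of_real (pi / 2) - \<zeta> / 3) t)"
    unfolding RH_integrand2_def[abs_def] stieltjes_integrand_def hankel_weight_def stieltjes_ray_exp m sixth_root_def[symmetric] exp_Suc_pi
    by (rule ext, rule gen)
qed

lemma sixth_root_minus: "exp (- (of_nat n + 1) * of_real pi * \<i> / 3) = inverse (sixth_root n)"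
  unfolding sixth_root_inverse[symmetric] by (simp only: minus_mult_left minus_divide_left)

lemma RJ_integrand_stieltjes:
  "RJ_integrand1 N (Log_Point \<zeta>) \<kappa> = (\<lambda>t. sixth_root N * stieltjes_integrand N \<kappa> (\<i> * of_real (5 * pi / 6) - \<zeta> / 3) t
     - inverse (sixth_root N) * stieltjes_integrand N \<kappa> (\<i> * of_real (pi / 6) - \<zeta> / 3) t)"
  "RJ_integrand2 N (Log_Point \<zeta>) \<kappa> = (\<lambda>t. sixth_root N * stieltjes_integrand N (- \<kappa>) (\<i> * of_real (- (pi / 6)) - \<zeta> / 3) t
     - inverse (sixth_root N) * stieltjes_integrand N (- \<kappa>) (\<i> * of_real (- (5 * pi / 6)) - \<zeta> / 3) t)"
proof -
  have m: "1 + - u = 1 - u" for u :: complex by simp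
  have gen: "w * (x / p - y / q) * h = x * (w * h * (1 / p)) - y * (w * h * (1 / q))" for w x p y q h :: complex
    by (simp add: algebra_simps)
  show "RJ_integrand1 N (Log_Point \<zeta>) \<kappa> = (\<lambda>t. sixth_root N * stieltjes_integrand N \<kappa> (\<i> * of_real (5 * pi / 6) - \<zeta> / 3) t
     - inverse (sixth_root N) * stieltjes_integrand N \<kappa> (\<i> * of_real (pi / 6) - \<zeta> / 3) t)"
    unfolding RJ_integrand1_def[abs_def] stieltjes_integrand_def hankel_weight_def stieltjes_ray_exp m sixth_root_minus sixth_root_def[symmetric]
    by (rule ext, rule gen)
  show "RJ_integrand2 N (Log_Point \<zeta>) \<kappa> = (\<lambda>t. sixth_root N * stieltjes_integrand N (- \<kappa>) (\<i> * of_real (- (pi / 6)) - \<zeta> / 3) t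
     - inverse (sixth_root N) * stieltjes_integrand N (- \<kappa>) (\<i> * of_real (- (5 * pi / 6)) - \<zeta> / 3) t)"
    unfolding RJ_integrand2_def[abs_def] stieltjes_integrand_def hankel_weight_def stieltjes_ray_exp m sixth_root_minus sixth_root_def[symmetric]
    by (rule ext, rule gen)
qed

text \<open>The factor 1 and the double sign shape the three terms into nested combinations
  \<open>a * f - b * g\<close>, the form of \<open>set_integral_combination\<close>.\<close>

lemma RY_integrand_stieltjes:
  "RY_integrand1 N (Log_Point \<zeta>) \<kappa> = (\<lambda>t. 1 * (sixth_root N * stieltjes_integrand N \<kappa> (\<i> * of_real (5 * pi / 6) - \<zeta> / 3) t
     - (- inverse (sixth_root N)) * stieltjes_integrand N \<kappa> (\<i> * of_real (pi / 6) - \<zeta> / 3) t)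
     - 2 * (- ((-1) ^ N)) * stieltjes_integrand N \<kappa> (\<i> * of_real (- (pi / 2)) - \<zeta> / 3) t)"
  "RY_integrand2 N (Log_Point \<zeta>) \<kappa> = (\<lambda>t. 1 * (sixth_root N * stieltjes_integrand N (- \<kappa>) (\<i> * of_real (- (pi / 6)) - \<zeta> / 3) t
     - (- inverse (sixth_root N)) * stieltjes_integrand N (- \<kappa>) (\<i> * of_real (- (5 * pi / 6)) - \<zeta> / 3) t)
     - 2 * (- ((-1) ^ N)) * stieltjes_integrand N (- \<kappa>) (\<i> * of_real (pi / 2) - \<zeta> / 3) t)"
proof -
  have m: "1 + - u = 1 - u" for u :: complex by simp
  have gen: "w * (x / p + y / q - 2 * z / r) * h = 1 * (x * (w * h * (1 / p)) - - y * (w * h * (1 / q))) - 2 * z * (w * h * (1 / r))"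
    for w x p y q z r h :: complex by (simp add: algebra_simps)
  show "RY_integrand1 N (Log_Point \<zeta>) \<kappa> = (\<lambda>t. 1 * (sixth_root N * stieltjes_integrand N \<kappa> (\<i> * of_real (5 * pi / 6) - \<zeta> / 3) t
     - (- inverse (sixth_root N)) * stieltjes_integrand N \<kappa> (\<i> * of_real (pi / 6) - \<zeta> / 3) t)
     - 2 * (- ((-1) ^ N)) * stieltjes_integrand N \<kappa> (\<i> * of_real (- (pi / 2)) - \<zeta> / 3) t)"
    unfolding RY_integrand1_def[abs_def] stieltjes_integrand_def hankel_weight_def stieltjes_ray_exp m sixth_root_minus sixth_root_def[symmetric] exp_Suc_pi
    by (rule ext, rule gen)
  show "RY_integrand2 N (Log_Point \<zeta>) \<kappa> = (\<lambda>t. 1 * (sixth_root N * stieltjes_integrand N (- \<kappa>) (\<i> * of_real (- (pi / 6)) - \<zeta> / 3) t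
     - (- inverse (sixth_root N)) * stieltjes_integrand N (- \<kappa>) (\<i> * of_real (- (5 * pi / 6)) - \<zeta> / 3) t)
     - 2 * (- ((-1) ^ N)) * stieltjes_integrand N (- \<kappa>) (\<i> * of_real (pi / 2) - \<zeta> / 3) t)"
    unfolding RY_integrand2_def[abs_def] stieltjes_integrand_def hankel_weight_def stieltjes_ray_exp m sixth_root_minus sixth_root_def[symmetric] exp_Suc_pi
    by (rule ext, rule gen)
qed

lemma monodromy_phase:
  "exp ((2 * of_real pi * \<kappa> - of_real pi / 2 * of_nat N) * \<i>) = (- \<i>) ^ N * monodromy \<kappa>"
  "exp (- (2 * of_real pi * \<kappa> - of_real pi / 2 * of_nat N) * \<i>) = \<i> ^ N * monodromy (- \<kappa>)"
proof -
  have i: "exp (\<i> * of_real (pi / 2)) = \<i>" "exp (- (\<i> * of_real (pi / 2))) = - \<i>"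
    by (simp_all add: complex_eq_iff Re_exp Im_exp)
  have "(2 * of_real pi * \<kappa> - of_real pi / 2 * of_nat N) * \<i> = of_nat N * - (\<i> * of_real (pi / 2)) + 2 * of_real pi * \<kappa> * \<i>"
    "- (2 * of_real pi * \<kappa> - of_real pi / 2 * of_nat N) * \<i> = of_nat N * (\<i> * of_real (pi / 2)) + 2 * of_real pi * - \<kappa> * \<i>"
    by (simp_all add: algebra_simps)
  then show "exp ((2 * of_real pi * \<kappa> - of_real pi / 2 * of_nat N) * \<i>) = (- \<i>) ^ N * monodromy \<kappa>"
    "exp (- (2 * of_real pi * \<kappa> - of_real pi / 2 * of_nat N) * \<i>) = \<i> ^ N * monodromy (- \<kappa>)"
    unfolding monodromy_def by (simp_all only: exp_add exp_of_nat_mult i)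
qed

lemma divide_mult_ls_powr: "a / (c * ls_powr (Log_Point \<zeta>) ((of_nat N + 1) / 3)) = a / c * cbrt_power N \<zeta>"
  using divide_ls_powr[of "a / c" \<zeta> N] by (simp add: divide_divide_eq_left)

context
  fixes N :: nat and \<kappa> :: complex
  assumes \<kappa>: "\<bar>Re \<kappa>\<bar> + 1 < (real N + 1) / 3"
begin

private lemma minus_bound: "\<bar>Re (- \<kappa>)\<bar> + 1 < (real N + 1) / 3"
  using \<kappa> by simp

text \<open>The sector is where all four ray angles stay within \<pi>: |5 \<pi> / 6 - arg z / 3| <
  \<pi> gives arg z > - \<pi> / 2, and |\<pi> / 2 + arg z / 3| < \<pi> gives arg z < 3 \<pi> / 2;
  the other two rays allow more.\<close>

lemma R_H_ray:
  assumes "- pi / 2 < Im \<zeta>" "Im \<zeta> < 3 * pi / 2"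
  shows "set_integrable lborel {0<..} (RH_integrand1 N (Log_Point \<zeta>) \<kappa>)"
    "set_integrable lborel {0<..} (RH_integrand2 N (Log_Point \<zeta>) \<kappa>)"
    "R_H N (Log_Point \<zeta>) \<kappa> = - ((- \<i>) ^ N * monodromy \<kappa>) / (6 * of_real pi) * cbrt_power N \<zeta>
        * (sixth_root N * stieltjes_ray N \<kappa> \<zeta> (5 * pi / 6) - (- ((-1) ^ N)) * stieltjes_ray N \<kappa> \<zeta> (- (pi / 2)))
      + \<i> ^ N * monodromy (- \<kappa>) / (6 * of_real pi) * cbrt_power N \<zeta>
        * (sixth_root N * stieltjes_ray N (- \<kappa>) \<zeta> (- (pi / 6)) - (- ((-1) ^ N)) * stieltjes_ray N (- \<kappa>) \<zeta> (pi / 2))"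
proof -
  have a: "\<bar>5 * pi / 6 - Im \<zeta> / 3\<bar> < pi" "\<bar>- (pi / 2) - Im \<zeta> / 3\<bar> < pi" "\<bar>- (pi / 6) - Im \<zeta> / 3\<bar> < pi" "\<bar>pi / 2 - Im \<zeta> / 3\<bar> < pi"
    using assms pi_gt_zero by linarith+
  note r1 = stieltjes_ray_integral[OF \<kappa> a(1)] and r2 = stieltjes_ray_integral[OF \<kappa> a(2)]
    and r3 = stieltjes_ray_integral[OF minus_bound a(3)] and r4 = stieltjes_ray_integral[OF minus_bound a(4)]
  show "set_integrable lborel {0<..} (RH_integrand1 N (Log_Point \<zeta>) \<kappa>)"
    "set_integrable lborel {0<..} (RH_integrand2 N (Log_Point \<zeta>) \<kappa>)"
    unfolding RH_integrand_stieltjes by (rule set_integral_combination(1)[OF r1(1) r2(1)], rule set_integral_combination(1)[OF r3(1) r4(1)])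
  show "R_H N (Log_Point \<zeta>) \<kappa> = - ((- \<i>) ^ N * monodromy \<kappa>) / (6 * of_real pi) * cbrt_power N \<zeta>
        * (sixth_root N * stieltjes_ray N \<kappa> \<zeta> (5 * pi / 6) - (- ((-1) ^ N)) * stieltjes_ray N \<kappa> \<zeta> (- (pi / 2)))
      + \<i> ^ N * monodromy (- \<kappa>) / (6 * of_real pi) * cbrt_power N \<zeta>
        * (sixth_root N * stieltjes_ray N (- \<kappa>) \<zeta> (- (pi / 6)) - (- ((-1) ^ N)) * stieltjes_ray N (- \<kappa>) \<zeta> (pi / 2))"
    unfolding R_H_def monodromy_phase divide_mult_ls_powr RH_integrand_stieltjes
      set_integral_combination(2)[OF r1(1) r2(1)] set_integral_combination(2)[OF r3(1) r4(1)] r1(2) r2(2) r3(2) r4(2) ..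
qed

text \<open>Here the angles 5 \<pi> / 6 and - 5 \<pi> / 6 bind, from below and from above, which
  gives the symmetric sector.\<close>

lemma R_J_ray:
  assumes "\<bar>Im \<zeta>\<bar> < pi / 2"
  shows "set_integrable lborel {0<..} (RJ_integrand1 N (Log_Point \<zeta>) \<kappa>)"
    "set_integrable lborel {0<..} (RJ_integrand2 N (Log_Point \<zeta>) \<kappa>)"
    "R_J N (Log_Point \<zeta>) \<kappa> = - ((- \<i>) ^ N * monodromy \<kappa>) / (12 * of_real pi) * cbrt_power N \<zeta>
        * (sixth_root N * stieltjes_ray N \<kappa> \<zeta> (5 * pi / 6) - inverse (sixth_root N) * stieltjes_ray N \<kappa> \<zeta> (pi / 6))
      + \<i> ^ N * monodromy (- \<kappa>) / (12 * of_real pi) * cbrt_power N \<zeta>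
        * (sixth_root N * stieltjes_ray N (- \<kappa>) \<zeta> (- (pi / 6)) - inverse (sixth_root N) * stieltjes_ray N (- \<kappa>) \<zeta> (- (5 * pi / 6)))"
proof -
  have a: "\<bar>5 * pi / 6 - Im \<zeta> / 3\<bar> < pi" "\<bar>pi / 6 - Im \<zeta> / 3\<bar> < pi" "\<bar>- (pi / 6) - Im \<zeta> / 3\<bar> < pi" "\<bar>- (5 * pi / 6) - Im \<zeta> / 3\<bar> < pi"
    using assms pi_gt_zero unfolding abs_less_iff by linarith+
  note r1 = stieltjes_ray_integral[OF \<kappa> a(1)] and r2 = stieltjes_ray_integral[OF \<kappa> a(2)]
    and r3 = stieltjes_ray_integral[OF minus_bound a(3)] and r4 = stieltjes_ray_integral[OF minus_bound a(4)]
  show "set_integrable lborel {0<..} (RJ_integrand1 N (Log_Point \<zeta>) \<kappa>)"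
    "set_integrable lborel {0<..} (RJ_integrand2 N (Log_Point \<zeta>) \<kappa>)"
    unfolding RJ_integrand_stieltjes by (rule set_integral_combination(1)[OF r1(1) r2(1)], rule set_integral_combination(1)[OF r3(1) r4(1)])
  show "R_J N (Log_Point \<zeta>) \<kappa> = - ((- \<i>) ^ N * monodromy \<kappa>) / (12 * of_real pi) * cbrt_power N \<zeta>
        * (sixth_root N * stieltjes_ray N \<kappa> \<zeta> (5 * pi / 6) - inverse (sixth_root N) * stieltjes_ray N \<kappa> \<zeta> (pi / 6))
      + \<i> ^ N * monodromy (- \<kappa>) / (12 * of_real pi) * cbrt_power N \<zeta>
        * (sixth_root N * stieltjes_ray N (- \<kappa>) \<zeta> (- (pi / 6)) - inverse (sixth_root N) * stieltjes_ray N (- \<kappa>) \<zeta> (- (5 * pi / 6)))"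
    unfolding R_J_def monodromy_phase divide_mult_ls_powr RJ_integrand_stieltjes
      set_integral_combination(2)[OF r1(1) r2(1)] set_integral_combination(2)[OF r3(1) r4(1)] r1(2) r2(2) r3(2) r4(2) ..
qed

lemma R_Y_ray:
  assumes "\<bar>Im \<zeta>\<bar> < pi / 2"
  shows "set_integrable lborel {0<..} (RY_integrand1 N (Log_Point \<zeta>) \<kappa>)"
    "set_integrable lborel {0<..} (RY_integrand2 N (Log_Point \<zeta>) \<kappa>)"
    "R_Y N (Log_Point \<zeta>) \<kappa> = - ((- \<i>) ^ N * monodromy \<kappa>) / (12 * of_real pi * \<i>) * cbrt_power N \<zeta>
        * (1 * (sixth_root N * stieltjes_ray N \<kappa> \<zeta> (5 * pi / 6) - (- inverse (sixth_root N)) * stieltjes_ray N \<kappa> \<zeta> (pi / 6))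
           - 2 * (- ((-1) ^ N)) * stieltjes_ray N \<kappa> \<zeta> (- (pi / 2)))
      + \<i> ^ N * monodromy (- \<kappa>) / (12 * of_real pi * \<i>) * cbrt_power N \<zeta>
        * (1 * (sixth_root N * stieltjes_ray N (- \<kappa>) \<zeta> (- (pi / 6)) - (- inverse (sixth_root N)) * stieltjes_ray N (- \<kappa>) \<zeta> (- (5 * pi / 6)))
           - 2 * (- ((-1) ^ N)) * stieltjes_ray N (- \<kappa>) \<zeta> (pi / 2))"
proof -
  have a: "\<bar>5 * pi / 6 - Im \<zeta> / 3\<bar> < pi" "\<bar>pi / 6 - Im \<zeta> / 3\<bar> < pi" "\<bar>- (pi / 6) - Im \<zeta> / 3\<bar> < pi" "\<bar>- (5 * pi / 6) - Im \<zeta> / 3\<bar> < pi"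
    "\<bar>- (pi / 2) - Im \<zeta> / 3\<bar> < pi" "\<bar>pi / 2 - Im \<zeta> / 3\<bar> < pi"
    using assms pi_gt_zero unfolding abs_less_iff by linarith+
  note r1 = stieltjes_ray_integral[OF \<kappa> a(1)] and r2 = stieltjes_ray_integral[OF \<kappa> a(2)]
    and r3 = stieltjes_ray_integral[OF minus_bound a(3)] and r4 = stieltjes_ray_integral[OF minus_bound a(4)]
    and r5 = stieltjes_ray_integral[OF \<kappa> a(5)] and r6 = stieltjes_ray_integral[OF minus_bound a(6)]
  note c1 = set_integral_combination[OF r1(1) r2(1)] and c2 = set_integral_combination[OF r3(1) r4(1)]
  show "set_integrable lborel {0<..} (RY_integrand1 N (Log_Point \<zeta>) \<kappa>)"
    "set_integrable lborel {0<..} (RY_integrand2 N (Log_Point \<zeta>) \<kappa>)"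
    unfolding RY_integrand_stieltjes by (rule set_integral_combination(1)[OF c1(1) r5(1)], rule set_integral_combination(1)[OF c2(1) r6(1)])
  show "R_Y N (Log_Point \<zeta>) \<kappa> = - ((- \<i>) ^ N * monodromy \<kappa>) / (12 * of_real pi * \<i>) * cbrt_power N \<zeta>
        * (1 * (sixth_root N * stieltjes_ray N \<kappa> \<zeta> (5 * pi / 6) - (- inverse (sixth_root N)) * stieltjes_ray N \<kappa> \<zeta> (pi / 6))
           - 2 * (- ((-1) ^ N)) * stieltjes_ray N \<kappa> \<zeta> (- (pi / 2)))
      + \<i> ^ N * monodromy (- \<kappa>) / (12 * of_real pi * \<i>) * cbrt_power N \<zeta>
        * (1 * (sixth_root N * stieltjes_ray N (- \<kappa>) \<zeta> (- (pi / 6)) - (- inverse (sixth_root N)) * stieltjes_ray N (- \<kappa>) \<zeta> (- (5 * pi / 6)))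
           - 2 * (- ((-1) ^ N)) * stieltjes_ray N (- \<kappa>) \<zeta> (pi / 2))"
    unfolding R_Y_def monodromy_phase divide_mult_ls_powr RY_integrand_stieltjes
      set_integral_combination(2)[OF c1(1) r5(1)] set_integral_combination(2)[OF c2(1) r6(1)] c1(2) c2(2) r1(2) r2(2) r3(2) r4(2) r5(2) r6(2) ..
qed

end

section \<open>Integral representation of the coefficients\<close>

lemma hankel_weight_Suc: "hankel_weight (Suc n) \<kappa> y = hankel_weight n \<kappa> y * of_real (y powr (1 / 3))"
proof -
  have "(real (Suc n) - 2) / 3 = (real n - 2) / 3 + 1 / 3" by (simp add: field_simps)
  then have "y powr ((real (Suc n) - 2) / 3) = y powr ((real n - 2) / 3) * y powr (1 / 3)" by (simp only: powr_add)
  then show ?thesis unfolding hankel_weight_def by (simp only: of_real_mult mult_ac)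
qed

text \<open>1 / (1 + u) = 1 - u / (1 + u) with u = exp c y^(1/3); the extra power of y turns the
  weight of index n into that of index n + 1. This compares consecutive remainders.\<close>

lemma stieltjes_Suc:
  assumes \<kappa>: "\<bar>Re \<kappa>\<bar> + 1 < (real n + 1) / 3" and c: "\<bar>Im c\<bar> < pi"
  shows "stieltjes n \<kappa> c = (LINT y:{0<..}|lborel. hankel_weight n \<kappa> y) - exp c * stieltjes (Suc n) \<kappa> c"
proof -
  have \<kappa>': "\<bar>Re \<kappa>\<bar> + 1 < (real (Suc n) + 1) / 3" using \<kappa> by simp
  obtain m where m: "m > 0" "\<And>r. r \<ge> 0 \<Longrightarrow> m \<le> norm (1 + exp c * of_real r)" using one_plus_exp_bound[OF c] by blast
  have "stieltjes_integrand n \<kappa> c = (\<lambda>y. 1 * hankel_weight n \<kappa> y - exp c * stieltjes_integrand (Suc n) \<kappa> c y)"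
  proof
    fix y :: real
    have nz: "1 + exp c * of_real (y powr (1 / 3)) \<noteq> 0" using m(2)[of "y powr (1 / 3)"] m(1) by auto
    have "w * (1 / (1 + e * r)) = 1 * w - e * (w * r * (1 / (1 + e * r)))" if "1 + e * r \<noteq> 0" for w e r :: complex
      using that by (simp add: field_simps)
    from this[OF nz] show "stieltjes_integrand n \<kappa> c y = 1 * hankel_weight n \<kappa> y - exp c * stieltjes_integrand (Suc n) \<kappa> c y"
      unfolding stieltjes_integrand_def hankel_weight_Suc .
  qed
  then show ?thesis
    unfolding stieltjes_def
    using set_integral_combination(2)[OF hankel_weight_integrable[OF \<kappa>] stieltjes_integrable[OF \<kappa>' c], of 1 "exp c"] by simp
qed

lemma D_integrand_hankel_weight:
  "D_integrand n \<kappa> = (\<lambda>t. \<i> * ((- \<i>) ^ n * monodromy \<kappa>) * hankel_weight n \<kappa> t - \<i> * (\<i> ^ n * monodromy (- \<kappa>)) * hankel_weight n (- \<kappa>) t)"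
proof
  fix t
  have "w * \<i> * (a * h - b * k) = \<i> * a * (w * h) - \<i> * b * (w * k)" for w a h b k by (simp add: algebra_simps)
  then show "D_integrand n \<kappa> t = \<i> * ((- \<i>) ^ n * monodromy \<kappa>) * hankel_weight n \<kappa> t - \<i> * (\<i> ^ n * monodromy (- \<kappa>)) * hankel_weight n (- \<kappa>) t"
    unfolding D_integrand_def monodromy_phase hankel_weight_def .
qed

text \<open>The remainder formulas with n and with n + 1 terms describe the same number, so the
  coefficient of index n is the difference of two remainders; by \<open>stieltjes_Suc\<close> the
  Stieltjes transforms cancel and only the integrals of the weights are left.\<close>

lemma D_coeff_integral:
  assumes \<kappa>: "\<bar>Re \<kappa>\<bar> + 1 < (real n + 1) / 3"
  shows "set_integrable lborel {0<..} (D_integrand n \<kappa>)"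
    and "D_coeff n \<kappa> = - of_real (6 powr (- ((real n + 1) / 3)) / (2 * Gamma ((real n + 1) / 3))) * (LINT t:{0<..}|lborel. D_integrand n \<kappa> t)"
proof -
  have \<kappa>': "\<bar>Re (- \<kappa>)\<bar> + 1 < (real n + 1) / 3" using \<kappa> by simp
  have \<kappa>S: "\<bar>Re \<kappa>\<bar> + 1 < (real (Suc n) + 1) / 3" using \<kappa> by simp
  note c = set_integral_combination[OF hankel_weight_integrable[OF \<kappa>] hankel_weight_integrable[OF \<kappa>']]
  show "set_integrable lborel {0<..} (D_integrand n \<kappa>)"
    unfolding D_integrand_hankel_weight by (rule c(1))
  define h k where "h = (LINT t:{0<..}|lborel. hankel_weight n \<kappa> t)" and "k = (LINT t:{0<..}|lborel. hankel_weight n (- \<kappa>) t)"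
  define a b where "a = monodromy \<kappa>" and "b = monodromy (- \<kappa>)"
  define m p where "m = (- \<i>) ^ n" and "p = \<i> ^ n"
  have D: "(LINT t:{0<..}|lborel. D_integrand n \<kappa> t) = \<i> * (m * a) * h - \<i> * (p * b) * k"
    unfolding D_integrand_hankel_weight c(2) h_def k_def a_def b_def m_def p_def ..
  have i: "exp (\<i> * of_real (pi / 2)) = \<i>" "exp (\<i> * of_real (- (pi / 2))) = - \<i>"
    by (simp_all add: complex_eq_iff Re_exp Im_exp)
  have im: "\<bar>Im (\<i> * of_real (pi / 2))\<bar> < pi" "\<bar>Im (\<i> * of_real (- (pi / 2)))\<bar> < pi" by simp_all
  have r: "stieltjes_ray n (- \<kappa>) 0 (pi / 2) = k - \<i> * stieltjes_ray (Suc n) (- \<kappa>) 0 (pi / 2)"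
    "stieltjes_ray n \<kappa> 0 (- (pi / 2)) = h - - \<i> * stieltjes_ray (Suc n) \<kappa> 0 (- (pi / 2))"
    using stieltjes_Suc[OF \<kappa>' im(1)] stieltjes_Suc[OF \<kappa> im(2)] unfolding stieltjes_ray_def h_def k_def i by simp_all
  have p1: "stieltjes_pair n \<kappa> 0 = m * b * (k - \<i> * stieltjes_ray (Suc n) (- \<kappa>) 0 (pi / 2)) - p * a * (h - - \<i> * stieltjes_ray (Suc n) \<kappa> 0 (- (pi / 2)))"
    using stieltjes_pair_ray[of n \<kappa> 0] unfolding r a_def b_def m_def p_def by simp
  have p2: "stieltjes_pair (Suc n) \<kappa> 0 = - \<i> * m * b * stieltjes_ray (Suc n) (- \<kappa>) 0 (pi / 2) - \<i> * p * a * stieltjes_ray (Suc n) \<kappa> 0 (- (pi / 2))"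
    using stieltjes_pair_ray[of "Suc n" \<kappa> 0] unfolding a_def b_def m_def p_def by simp
  have pair: "stieltjes_pair n \<kappa> 0 = m * b * k - p * a * h + stieltjes_pair (Suc n) \<kappa> 0"
    unfolding p1 p2 by (simp add: algebra_simps)
  \<comment> \<open>Comparison at \<zeta> = 0, that is at z = 1, is enough: all powers of z are 1
    there.\<close>
  have z: "\<bar>Im 0\<bar> < 3 * pi / 2" by simp
  have "anger_diff \<kappa> 0 = (\<Sum>k<n. anger_diff_coeff k \<kappa>) + \<i> / 6 * stieltjes_pair n \<kappa> 0"
    "anger_diff \<kappa> 0 = (\<Sum>k<n. anger_diff_coeff k \<kappa>) + anger_diff_coeff n \<kappa> + \<i> / 6 * stieltjes_pair (Suc n) \<kappa> 0"
    using anger_diff_remainder[OF \<kappa> z] anger_diff_remainder[OF \<kappa>S z] by simp_all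
  then have "anger_diff_coeff n \<kappa> = \<i> / 6 * (m * b * k - p * a * h)" unfolding pair by (simp add: algebra_simps)
  then have e: "(-1) ^ n * gamma_factor n * D_coeff n \<kappa> = \<i> / 6 * (m * b * k - p * a * h)"
    unfolding anger_diff_coeff_gamma .
  have "Gamma ((real n + 1) / 3) > 0" by (intro Gamma_real_pos) simp
  then have g: "Gamma ((real n + 1) / 3) \<noteq> 0" by linarith
  define g6 where "g6 = complex_of_real (6 powr ((real n + 1) / 3) * Gamma ((real n + 1) / 3))"
  have g60: "g6 \<noteq> 0" using g by (simp add: g6_def)
  have gf: "gamma_factor n = g6 / 3" by (simp add: gamma_factor_def g6_def)
  have co: "complex_of_real (6 powr (- ((real n + 1) / 3)) / (2 * Gamma ((real n + 1) / 3))) = 1 / (2 * g6)"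
    unfolding g6_def powr_minus_divide by simp
  have sq: "(-1) ^ n * (-1) ^ n = (1::complex)" unfolding power_mult_distrib[symmetric] by simp
  have mp: "(-1) ^ n * m = p" "(-1) ^ n * p = m" unfolding m_def p_def by (rule i_power_sign)+
  have "g6 / 3 * D_coeff n \<kappa> = (-1) ^ n * ((-1) ^ n * gamma_factor n * D_coeff n \<kappa>)" unfolding gf using sq by simp
  also have "\<dots> = \<i> / 6 * ((-1) ^ n * m * b * k - (-1) ^ n * p * a * h)" unfolding e by (simp add: algebra_simps)
  finally have gD: "g6 / 3 * D_coeff n \<kappa> = \<i> / 6 * (p * b * k - m * a * h)" unfolding mp .
  have "D_coeff n \<kappa> = 3 / g6 * (g6 / 3 * D_coeff n \<kappa>)" using g60 by simp
  then have Dn: "D_coeff n \<kappa> = 3 / g6 * (\<i> / 6 * (p * b * k - m * a * h))" unfolding gD .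
  have "3 / g * (j / 6 * (p * b * k - m * a * h)) = - (1 / (2 * g)) * (j * (m * a) * h - j * (p * b) * k)" for g j p b k m a h :: complex
    by (cases "g = 0") (auto simp: field_simps)
  then show "D_coeff n \<kappa> = - of_real (6 powr (- ((real n + 1) / 3)) / (2 * Gamma ((real n + 1) / 3))) * (LINT t:{0<..}|lborel. D_integrand n \<kappa> t)"
    unfolding co D Dn .
qed

section \<open>The finite sums\<close>

lemma sin_phase:
  "sixth_root n ^ 2 * of_real (sin ((real n + 1) * pi / 3)) = - ((-1) ^ n + sixth_root n) / (2 * \<i>)"
  "inverse (sixth_root n) ^ 2 * of_real (sin ((real n + 1) * pi / 3)) = ((-1) ^ n + inverse (sixth_root n)) / (2 * \<i>)"
  "(-1) ^ n * of_real ((sin ((real n + 1) * pi / 3))\<^sup>2) = (2 * (-1) ^ n + sixth_root n + inverse (sixth_root n)) / 4"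
proof -
  define x y where "x = sixth_root n" and "y = inverse (sixth_root n)"
  define s where "s = (-1 :: complex) ^ n"
  have xy: "x * y = 1" using sixth_root_nonzero[of n] by (simp add: x_def y_def)
  have y': "inverse x = y" by (simp add: x_def y_def)
  \<comment> \<open>With x y = 1 and x^3 = y^3 = - s the sine identities become polynomial
    identities in the sixth roots of unity x and y.\<close>
  have x3: "x ^ 3 = - s" unfolding x_def s_def by (rule sixth_root_cube)
  have ss: "s * s = 1" unfolding s_def power_mult_distrib[symmetric] by simp
  have y3: "y ^ 3 = - s"
  proof -
    have "x ^ 3 * y ^ 3 = 1" unfolding power_mult_distrib[symmetric] xy by simp
    then have "- s * (- s * y ^ 3) = - s" unfolding x3 by simp
    then show ?thesis using ss by (simp add: mult.assoc[symmetric])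
  qed
  have S: "of_real (sin ((real n + 1) * pi / 3)) = (x - y) / (2 * \<i>)" unfolding x_def y_def by (rule sin_sixth_root)
  have "x ^ 2 * (x - y) = - (s + x)" using x3 xy by algebra
  then show "sixth_root n ^ 2 * of_real (sin ((real n + 1) * pi / 3)) = - ((-1) ^ n + sixth_root n) / (2 * \<i>)"
    unfolding S x_def[symmetric] s_def[symmetric] by simp
  have "y ^ 2 * (x - y) = s + y" using y3 xy by algebra
  then show "inverse (sixth_root n) ^ 2 * of_real (sin ((real n + 1) * pi / 3)) = ((-1) ^ n + inverse (sixth_root n)) / (2 * \<i>)"
    unfolding S y_def[symmetric] s_def[symmetric] by simp
  have "s * (x - y) ^ 2 = - (2 * s + x + y)" using x3 y3 xy ss by algebra
  moreover have "s * ((x - y) / (2 * \<i>)) ^ 2 = - (s * (x - y) ^ 2) / 4" by (simp add: power_divide power_mult_distrib)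
  ultimately have "s * ((x - y) / (2 * \<i>)) ^ 2 = (2 * s + x + y) / 4" by (simp only: minus_minus)
  then show "(-1) ^ n * of_real ((sin ((real n + 1) * pi / 3))\<^sup>2) = (2 * (-1) ^ n + sixth_root n + inverse (sixth_root n)) / 4"
    unfolding of_real_power S x_def[symmetric] s_def[symmetric] unfolding y' .
qed

context
  fixes N :: nat and \<kappa> \<zeta> :: complex
  assumes N: "N > 0"
begin

private definition t where "t k = gamma_factor k * D_coeff k \<kappa> * cbrt_power k \<zeta>"

private lemma t0: "t 0 = 0"
  by (simp add: t_def D_coeff_0)

private lemma term_eq: "of_real (6 powr ((real n + 1) / 3)) * D_coeff n \<kappa> * X * S * of_real (Gamma ((real n + 1) / 3)) * cbrt_power n \<zeta> = 3 * t n * (X * S)"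
  "of_real (6 powr ((real n + 1) / 3)) * D_coeff n \<kappa> * S * of_real (Gamma ((real n + 1) / 3)) * cbrt_power n \<zeta> = 3 * t n * S"
  "X * of_real (6 powr ((real n + 1) / 3)) * D_coeff n \<kappa> * S * of_real (Gamma ((real n + 1) / 3)) * cbrt_power n \<zeta> = 3 * t n * (X * S)"
  unfolding t_def gamma_factor_def by simp_all

private lemma sums:
  "(\<Sum>k<N. (-1) ^ k * gamma_factor k * D_coeff k \<kappa> * cbrt_power k \<zeta>) = (\<Sum>k<N. t k * (-1) ^ k)"
  "(\<Sum>k<N. gamma_factor k * D_coeff k \<kappa> * (cbrt_power k \<zeta> * w k)) = (\<Sum>k<N. t k * w k)"
  unfolding t_def by (intro sum.cong refl; simp)+

private lemma from_one: "(\<Sum>n = 1..N - 1. 3 * t n * f n) = (\<Sum>k<N. 3 * t k * f k)"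
  by (rule sum_from_one[symmetric]) (use N t0 in auto)

text \<open>The two branches contribute (- 1)^k + x to the term of index k, with x =
  \<open>sixth_root k\<close>; up to a constant, \<open>sin_phase\<close> rewrites this as x^2 times
  a sine.\<close>

lemma Hankel1_sum:
  "((\<Sum>k<N. (-1) ^ k * gamma_factor k * D_coeff k \<kappa> * cbrt_power k \<zeta>) + (\<Sum>k<N. gamma_factor k * D_coeff k \<kappa> * (cbrt_power k \<zeta> * sixth_root k)))
      / (of_real pi * \<i>) =
   - 2 / (3 * of_real pi) * (\<Sum>n = 1..N - 1. of_real (6 powr ((real n + 1) / 3)) * D_coeff n \<kappa> *
      exp (2 * (of_nat n + 1) * of_real pi * \<i> / 3) * of_real (sin ((real n + 1) * pi / 3)) *
      of_real (Gamma ((real n + 1) / 3)) / ls_powr (Log_Point \<zeta>) ((of_nat n + 1) / 3))"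
  unfolding divide_ls_powr sixth_root_square term_eq sin_phase from_one sums sum_distrib_left sum.distrib[symmetric] sum_divide_distrib
  by (intro sum.cong refl) (simp add: field_simps)

lemma Hankel2_sum:
  "- (((\<Sum>k<N. (-1) ^ k * gamma_factor k * D_coeff k \<kappa> * cbrt_power k \<zeta>) + (\<Sum>k<N. gamma_factor k * D_coeff k \<kappa> * (cbrt_power k \<zeta> * inverse (sixth_root k))))
      / (of_real pi * \<i>)) =
   - 2 / (3 * of_real pi) * (\<Sum>n = 1..N - 1. of_real (6 powr ((real n + 1) / 3)) * D_coeff n \<kappa> *
      exp (- (2 * (of_nat n + 1) * of_real pi * \<i> / 3)) * of_real (sin ((real n + 1) * pi / 3)) *
      of_real (Gamma ((real n + 1) / 3)) / ls_powr (Log_Point \<zeta>) ((of_nat n + 1) / 3))"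
proof -
  have e: "exp (- (2 * (of_nat n + 1) * of_real pi * \<i> / 3)) = inverse (sixth_root n) ^ 2" for n
    unfolding exp_minus sixth_root_square power_inverse ..
  show ?thesis
    unfolding divide_ls_powr e term_eq sin_phase from_one sums sum_distrib_left sum.distrib[symmetric] sum_divide_distrib sum_negf[symmetric]
    by (intro sum.cong refl) (simp add: field_simps)
qed

lemma Bessel_J_sum:
  "((\<Sum>k<N. gamma_factor k * D_coeff k \<kappa> * (cbrt_power k \<zeta> * sixth_root k)) - (\<Sum>k<N. gamma_factor k * D_coeff k \<kappa> * (cbrt_power k \<zeta> * inverse (sixth_root k))))
      / (2 * of_real pi * \<i>) =
   1 / (3 * of_real pi) * (\<Sum>n = 1..N - 1. of_real (6 powr ((real n + 1) / 3)) * D_coeff n \<kappa> *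
      of_real (sin ((real n + 1) * pi / 3)) * of_real (Gamma ((real n + 1) / 3)) / ls_powr (Log_Point \<zeta>) ((of_nat n + 1) / 3))"
  unfolding divide_ls_powr term_eq sin_sixth_root from_one sums sum_distrib_left sum_subtractf[symmetric] sum_divide_distrib
  by (intro sum.cong refl) (simp add: field_simps)

lemma Bessel_Y_sum:
  "- ((\<Sum>k<N. gamma_factor k * D_coeff k \<kappa> * (cbrt_power k \<zeta> * sixth_root k)) + (\<Sum>k<N. gamma_factor k * D_coeff k \<kappa> * (cbrt_power k \<zeta> * inverse (sixth_root k)))
       + 2 * (\<Sum>k<N. (-1) ^ k * gamma_factor k * D_coeff k \<kappa> * cbrt_power k \<zeta>)) / (2 * of_real pi) =
   - 2 / (3 * of_real pi) * (\<Sum>n = 1..N - 1. (-1) ^ n * of_real (6 powr ((real n + 1) / 3)) * D_coeff n \<kappa> *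
      of_real ((sin ((real n + 1) * pi / 3))\<^sup>2) * of_real (Gamma ((real n + 1) / 3)) / ls_powr (Log_Point \<zeta>) ((of_nat n + 1) / 3))"
  unfolding divide_ls_powr term_eq sin_phase from_one sums sum_distrib_left sum.distrib[symmetric] sum_divide_distrib sum_negf[symmetric]
  by (intro sum.cong refl) (simp add: field_simps)

end

section \<open>The four expansions\<close>

context
  fixes N :: nat and \<kappa> \<nu> \<zeta> :: complex
  assumes \<kappa>: "\<bar>Re \<kappa>\<bar> + 1 < (real N + 1) / 3" and \<nu>: "\<nu> + \<kappa> = exp \<zeta>" and N: "N > 0"
begin

private abbreviation "A \<equiv> \<Sum>k<N. (-1) ^ k * gamma_factor k * D_coeff k \<kappa> * cbrt_power k \<zeta>"
private abbreviation "B \<equiv> \<Sum>k<N. gamma_factor k * D_coeff k \<kappa> * (cbrt_power k \<zeta> * sixth_root k)"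
private abbreviation "B' \<equiv> \<Sum>k<N. gamma_factor k * D_coeff k \<kappa> * (cbrt_power k \<zeta> * inverse (sixth_root k))"

lemma Hankel1_deriv_expansion:
  assumes "- pi / 2 < Im \<zeta>" "Im \<zeta> < 3 * pi / 2"
  shows "ls_deriv (Hankel1 \<nu>) (Log_Point \<zeta>) = (A + B) / (of_real pi * \<i>) + R_H N (Log_Point \<zeta>) \<kappa>"
proof -
  have a: "\<bar>Im \<zeta>\<bar> < 3 * pi / 2" "\<bar>Im \<zeta> - pi\<bar> < 3 * pi / 2" using assms pi_gt_zero by linarith+
  \<comment> \<open>With s = (- 1)^N, m = (- \<i>)^N and p = \<i>^N, the relations s m = p and s p =
    m account for the sign exp ((N + 1) \<pi> \<i>) = - s in the remainder integrals; the rest is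
    linear in the transforms S1 to S4.\<close>
  have gen: "((A + E * (\<i> / 6) * (m * b * S1 - p * a * S2)) - (- B + E * x * (\<i> / 6) * (m * a * S3 - p * b * S4))) / (P * \<i>)
    = (A + B) / (P * \<i>) + (- (m * a) / (6 * P) * E * (x * S3 - (- s) * S2) + p * b / (6 * P) * E * (x * S4 - (- s) * S1))"
    if "P \<noteq> 0" "s * m = p" "s * p = m" for A B E m b p a x s P S1 S2 S3 S4 :: complex
  proof -
    have "m * a * (x * S3 - (- s) * S2) = m * a * x * S3 + p * a * S2" unfolding that(2)[symmetric] by (simp add: algebra_simps)
    moreover have "p * b * (x * S4 - (- s) * S1) = p * b * x * S4 + m * b * S1" unfolding that(3)[symmetric] by (simp add: algebra_simps)
    moreover have "- (m * a) / (6 * P) * E * u + p * b / (6 * P) * E * v = E / (6 * P) * (p * b * v - m * a * u)" for u v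
      by (simp add: algebra_simps add_divide_distrib diff_divide_distrib)
    ultimately have R: "- (m * a) / (6 * P) * E * (x * S3 - (- s) * S2) + p * b / (6 * P) * E * (x * S4 - (- s) * S1)
      = E / (6 * P) * ((p * b * x * S4 + m * b * S1) - (m * a * x * S3 + p * a * S2))" by (simp only:)
    show ?thesis unfolding R using that(1) by (simp add: field_simps)
  qed
  show ?thesis
    unfolding Hankel1_deriv_anger[OF \<nu>] anger_diff_ray[OF \<kappa> a(1)] anger_diff_minus_ray_down[OF \<kappa> a(2)] R_H_ray(3)[OF \<kappa> assms]
    by (rule gen[OF _ i_power_sign(1,2)]) simp
qed

lemma Hankel2_deriv_expansion:
  assumes "- 3 * pi / 2 < Im \<zeta>" "Im \<zeta> < pi / 2"
  shows "ls_deriv (Hankel2 \<nu>) (Log_Point \<zeta>) = - ((A + B') / (of_real pi * \<i>)) + R_H N (Log_Point (\<zeta> + \<i> * of_real pi)) (- \<kappa>)"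
proof -
  have a: "\<bar>Im \<zeta>\<bar> < 3 * pi / 2" "\<bar>Im \<zeta> + pi\<bar> < 3 * pi / 2" using assms pi_gt_zero by linarith+
  have up: "- pi / 2 < Im (\<zeta> + \<i> * of_real pi)" "Im (\<zeta> + \<i> * of_real pi) < 3 * pi / 2" using assms by simp_all
  have \<kappa>': "\<bar>Re (- \<kappa>)\<bar> + 1 < (real N + 1) / 3" using \<kappa> by simp
  \<comment> \<open>The remainder is taken at z exp (\<pi> \<i>) with - \<kappa>; lowering its ray
    angles by \<pi> / 3 returns the angles that occur at z.\<close>
  have r: "5 * pi / 6 - pi / 3 = pi / 2" "- (pi / 2) - pi / 3 = - (5 * pi / 6)" "- (pi / 6) - pi / 3 = - (pi / 2)" "pi / 2 - pi / 3 = pi / 6"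
    by simp_all
  have gen: "- (((A + E * (\<i> / 6) * (m * b * S1 - p * a * S2)) - (- B + E * y * (\<i> / 6) * (m * a * S5 - p * b * S6))) / (P * \<i>))
    = - ((A + B) / (P * \<i>)) + (- (m * b) / (6 * P) * (E * y) * (x * S1 - (- s) * S6) + p * a / (6 * P) * (E * y) * (x * S2 - (- s) * S5))"
    if "P \<noteq> 0" "s * m = p" "s * p = m" "x * y = 1" for A B E m b p a x y s P S1 S2 S5 S6 :: complex
  proof -
    have "m * b * (x * S1 - (- s) * S6) = m * b * x * S1 + p * b * S6" unfolding that(2)[symmetric] by (simp add: algebra_simps)
    moreover have "p * a * (x * S2 - (- s) * S5) = p * a * x * S2 + m * a * S5" unfolding that(3)[symmetric] by (simp add: algebra_simps)
    moreover have "- (m * b) / (6 * P) * (E * y) * u + p * a / (6 * P) * (E * y) * v = E / (6 * P) * (y * (p * a * v - m * b * u))" for u v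
      by (simp add: algebra_simps add_divide_distrib diff_divide_distrib)
    ultimately have "- (m * b) / (6 * P) * (E * y) * (x * S1 - (- s) * S6) + p * a / (6 * P) * (E * y) * (x * S2 - (- s) * S5)
      = E / (6 * P) * (y * ((p * a * x * S2 + m * a * S5) - (m * b * x * S1 + p * b * S6)))" by (simp only:)
    also have "y * ((p * a * x * S2 + m * a * S5) - (m * b * x * S1 + p * b * S6)) = p * a * S2 + y * m * a * S5 - m * b * S1 - y * p * b * S6"
      using that(4) by algebra
    finally have R: "- (m * b) / (6 * P) * (E * y) * (x * S1 - (- s) * S6) + p * a / (6 * P) * (E * y) * (x * S2 - (- s) * S5)
      = E / (6 * P) * (p * a * S2 + y * m * a * S5 - m * b * S1 - y * p * b * S6)" .
    show ?thesis unfolding R using that(1) by (simp add: field_simps)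
  qed
  show ?thesis
    unfolding Hankel2_deriv_anger[OF \<nu>] anger_diff_ray[OF \<kappa> a(1)] anger_diff_minus_ray_up[OF \<kappa> a(2)] R_H_ray(3)[OF \<kappa>' up]
      stieltjes_ray_rotate cbrt_power_rotate r minus_minus
    by (rule gen[OF _ i_power_sign(1,2)]) (use sixth_root_nonzero in auto)
qed

lemma Bessel_J_deriv_expansion:
  assumes "\<bar>Im \<zeta>\<bar> < pi / 2"
  shows "ls_deriv (Bessel_J \<nu>) (Log_Point \<zeta>) = (B - B') / (2 * of_real pi * \<i>) + R_J N (Log_Point \<zeta>) \<kappa>"
proof -
  have a: "\<bar>Im \<zeta> + pi\<bar> < 3 * pi / 2" "\<bar>Im \<zeta> - pi\<bar> < 3 * pi / 2" using assms pi_gt_zero unfolding abs_less_iff by linarith+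
  have gen: "((- B' + E * y * (\<i> / 6) * (m * a * S5 - p * b * S6)) - (- B + E * x * (\<i> / 6) * (m * a * S3 - p * b * S4))) / (2 * P * \<i>)
    = (B - B') / (2 * P * \<i>) + (- (m * a) / (12 * P) * E * (x * S3 - y * S5) + p * b / (12 * P) * E * (x * S4 - y * S6))"
    if "P \<noteq> 0" for B B' E m b p a x y P S3 S4 S5 S6 :: complex
    using that by (simp add: field_simps)
  show ?thesis
    unfolding Bessel_J_deriv_anger[OF \<nu>] anger_diff_minus_ray_up[OF \<kappa> a(1)] anger_diff_minus_ray_down[OF \<kappa> a(2)] R_J_ray(3)[OF \<kappa> assms]
    by (rule gen) simp
qed

lemma Bessel_Y_deriv_expansion:
  assumes "\<bar>Im \<zeta>\<bar> < pi / 2"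
  shows "ls_deriv (Bessel_Y \<nu>) (Log_Point \<zeta>) = - (B + B' + 2 * A) / (2 * of_real pi) + R_Y N (Log_Point \<zeta>) \<kappa>"
proof -
  have a: "\<bar>Im \<zeta> + pi\<bar> < 3 * pi / 2" "\<bar>Im \<zeta> - pi\<bar> < 3 * pi / 2" "\<bar>Im \<zeta>\<bar> < 3 * pi / 2"
    using assms pi_gt_zero unfolding abs_less_iff by linarith+
  have gen: "((- B + E * x * (\<i> / 6) * (m * a * S3 - p * b * S4)) + (- B' + E * y * (\<i> / 6) * (m * a * S5 - p * b * S6))
      - 2 * (A + E * (\<i> / 6) * (m * b * S1 - p * a * S2))) / (2 * P)
    = - (B + B' + 2 * A) / (2 * P) + (- (m * a) / (12 * P * \<i>) * E * (1 * (x * S3 - (- y) * S5) - 2 * (- s) * S2)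
      + p * b / (12 * P * \<i>) * E * (1 * (x * S4 - (- y) * S6) - 2 * (- s) * S1))"
    if "P \<noteq> 0" "s * m = p" "s * p = m" for A B B' E m b p a x y s P S1 S2 S3 S4 S5 S6 :: complex
  proof -
    have "m * a * (1 * (x * S3 - (- y) * S5) - 2 * (- s) * S2) = m * a * x * S3 + m * a * y * S5 + 2 * (p * a * S2)"
      unfolding that(2)[symmetric] by (simp add: algebra_simps)
    moreover have "p * b * (1 * (x * S4 - (- y) * S6) - 2 * (- s) * S1) = p * b * x * S4 + p * b * y * S6 + 2 * (m * b * S1)"
      unfolding that(3)[symmetric] by (simp add: algebra_simps)
    moreover have "- (m * a) / (12 * P * \<i>) * E * u + p * b / (12 * P * \<i>) * E * v = E / (12 * P * \<i>) * (p * b * v - m * a * u)" for u v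
      by (simp add: algebra_simps add_divide_distrib diff_divide_distrib)
    ultimately have R: "- (m * a) / (12 * P * \<i>) * E * (1 * (x * S3 - (- y) * S5) - 2 * (- s) * S2)
      + p * b / (12 * P * \<i>) * E * (1 * (x * S4 - (- y) * S6) - 2 * (- s) * S1)
      = E / (12 * P * \<i>) * ((p * b * x * S4 + p * b * y * S6 + 2 * (m * b * S1)) - (m * a * x * S3 + m * a * y * S5 + 2 * (p * a * S2)))"
      by (simp only:)
    show ?thesis unfolding R using that(1) by (simp add: field_simps)
  qed
  show ?thesis
    unfolding Bessel_Y_deriv_anger[OF \<nu>] anger_diff_ray[OF \<kappa> a(3)] anger_diff_minus_ray_up[OF \<kappa> a(1)] anger_diff_minus_ray_down[OF \<kappa> a(2)]
      R_Y_ray(3)[OF \<kappa> assms]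
    by (rule gen[OF _ i_power_sign(1,2)]) simp
qed

end

theorem theorem1p2:
  fixes N :: nat and \<kappa> \<nu> :: complex and z :: log_surface
  assumes N: "N > 2"
    and kappa: "\<bar>Re \<kappa>\<bar> + 1 < (real N + 1) / 3"
    and nu: "\<nu> + \<kappa> = ls_proj z"
  shows
    "(- pi / 2 < ls_arg z \<and> ls_arg z < 3 * pi / 2 \<longrightarrow>
        set_integrable lborel {0<..} (RH_integrand1 N z \<kappa>) \<and>
        set_integrable lborel {0<..} (RH_integrand2 N z \<kappa>) \<and>
        ls_deriv (Hankel1 \<nu>) z =
          - 2 / (3 * of_real pi) *
            (\<Sum>n = 1..N - 1. of_real (6 powr ((real n + 1) / 3)) * D_coeff n \<kappa> *
               exp (2 * (of_nat n + 1) * of_real pi * \<i> / 3) *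
               of_real (sin ((real n + 1) * pi / 3)) *
               of_real (Gamma ((real n + 1) / 3)) / ls_powr z ((of_nat n + 1) / 3))
          + R_H N z \<kappa>) \<and>
     (- 3 * pi / 2 < ls_arg z \<and> ls_arg z < pi / 2 \<longrightarrow>
        set_integrable lborel {0<..} (RH_integrand1 N (ls_rotate z pi) (- \<kappa>)) \<and>
        set_integrable lborel {0<..} (RH_integrand2 N (ls_rotate z pi) (- \<kappa>)) \<and>
        ls_deriv (Hankel2 \<nu>) z =
          - 2 / (3 * of_real pi) *
            (\<Sum>n = 1..N - 1. of_real (6 powr ((real n + 1) / 3)) * D_coeff n \<kappa> *
               exp (- (2 * (of_nat n + 1) * of_real pi * \<i> / 3)) *
               of_real (sin ((real n + 1) * pi / 3)) *
               of_real (Gamma ((real n + 1) / 3)) / ls_powr z ((of_nat n + 1) / 3))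
          + R_H N (ls_rotate z pi) (- \<kappa>)) \<and>
     (\<bar>ls_arg z\<bar> < pi / 2 \<longrightarrow>
        set_integrable lborel {0<..} (RJ_integrand1 N z \<kappa>) \<and>
        set_integrable lborel {0<..} (RJ_integrand2 N z \<kappa>) \<and>
        ls_deriv (Bessel_J \<nu>) z =
          1 / (3 * of_real pi) *
            (\<Sum>n = 1..N - 1. of_real (6 powr ((real n + 1) / 3)) * D_coeff n \<kappa> *
               of_real (sin ((real n + 1) * pi / 3)) *
               of_real (Gamma ((real n + 1) / 3)) / ls_powr z ((of_nat n + 1) / 3))
          + R_J N z \<kappa>) \<and>
     (\<bar>ls_arg z\<bar> < pi / 2 \<longrightarrow>
        set_integrable lborel {0<..} (RY_integrand1 N z \<kappa>) \<and>
        set_integrable lborel {0<..} (RY_integrand2 N z \<kappa>) \<and>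
        ls_deriv (Bessel_Y \<nu>) z =
          - 2 / (3 * of_real pi) *
            (\<Sum>n = 1..N - 1. (-1) ^ n * of_real (6 powr ((real n + 1) / 3)) * D_coeff n \<kappa> *
               of_real ((sin ((real n + 1) * pi / 3))\<^sup>2) *
               of_real (Gamma ((real n + 1) / 3)) / ls_powr z ((of_nat n + 1) / 3))
          + R_Y N z \<kappa>) \<and>
     (\<forall>n. D_coeff n \<kappa> =
        1 / fact n * (deriv ^^ n)
          (\<lambda>t. exp (\<kappa> * t) * sinh t * sinh_kernel t powr ((of_nat n + 1) / 3)) 0) \<and>
     (\<forall>n. \<bar>Re \<kappa>\<bar> + 1 < (real n + 1) / 3 \<longrightarrow>
        set_integrable lborel {0<..} (D_integrand n \<kappa>) \<and>
        D_coeff n \<kappa> =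
          - of_real (6 powr (- ((real n + 1) / 3)) / (2 * Gamma ((real n + 1) / 3))) *
            (LINT t:{0<..}|lborel. D_integrand n \<kappa> t))"
proof -
  obtain \<zeta> where z: "z = Log_Point \<zeta>" by (cases z)
  have \<nu>: "\<nu> + \<kappa> = exp \<zeta>" using nu by (simp add: z ls_proj_def)
  have N0: "N > 0" using N by simp
  have \<kappa>': "\<bar>Re (- \<kappa>)\<bar> + 1 < (real N + 1) / 3" using kappa by simp
  have arg: "ls_arg z = Im \<zeta>" by (simp add: z ls_arg_def)
  have rot: "ls_rotate z pi = Log_Point (\<zeta> + \<i> * of_real pi)" by (simp add: z ls_rotate_def)
  note expansions = Hankel1_deriv_expansion[OF kappa \<nu> N0] Hankel2_deriv_expansion[OF kappa \<nu> N0]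
    Bessel_J_deriv_expansion[OF kappa \<nu> N0] Bessel_Y_deriv_expansion[OF kappa \<nu> N0]
  have up: "- pi / 2 < Im (\<zeta> + \<i> * of_real pi)" "Im (\<zeta> + \<i> * of_real pi) < 3 * pi / 2"
    if "- 3 * pi / 2 < Im \<zeta>" "Im \<zeta> < pi / 2"
    using that by simp_all
  note sums = Hankel1_sum[OF N0] Hankel2_sum[OF N0] Bessel_J_sum[OF N0] Bessel_Y_sum[OF N0]
  show ?thesis
    unfolding arg rot unfolding z
  proof (intro conjI impI allI; (elim conjE)?)
    assume a: "- pi / 2 < Im \<zeta>" "Im \<zeta> < 3 * pi / 2"
    show "set_integrable lborel {0<..} (RH_integrand1 N (Log_Point \<zeta>) \<kappa>)" by (rule R_H_ray(1)[OF kappa a])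
    show "set_integrable lborel {0<..} (RH_integrand2 N (Log_Point \<zeta>) \<kappa>)" by (rule R_H_ray(2)[OF kappa a])
    note expansions(1)[OF a, unfolded sums]
    then show "ls_deriv (Hankel1 \<nu>) (Log_Point \<zeta>) = - 2 / (3 * of_real pi) *
            (\<Sum>n = 1..N - 1. of_real (6 powr ((real n + 1) / 3)) * D_coeff n \<kappa> *
               exp (2 * (of_nat n + 1) * of_real pi * \<i> / 3) *
               of_real (sin ((real n + 1) * pi / 3)) *
               of_real (Gamma ((real n + 1) / 3)) / ls_powr (Log_Point \<zeta>) ((of_nat n + 1) / 3))
          + R_H N (Log_Point \<zeta>) \<kappa>" .
  next
    assume a: "- 3 * pi / 2 < Im \<zeta>" "Im \<zeta> < pi / 2"
    show "set_integrable lborel {0<..} (RH_integrand1 N (Log_Point (\<zeta> + \<i> * of_real pi)) (- \<kappa>))" by (rule R_H_ray(1)[OF \<kappa>' up[OF a]])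
    show "set_integrable lborel {0<..} (RH_integrand2 N (Log_Point (\<zeta> + \<i> * of_real pi)) (- \<kappa>))" by (rule R_H_ray(2)[OF \<kappa>' up[OF a]])
    note expansions(2)[OF a, unfolded sums]
    then show "ls_deriv (Hankel2 \<nu>) (Log_Point \<zeta>) = - 2 / (3 * of_real pi) *
            (\<Sum>n = 1..N - 1. of_real (6 powr ((real n + 1) / 3)) * D_coeff n \<kappa> *
               exp (- (2 * (of_nat n + 1) * of_real pi * \<i> / 3)) *
               of_real (sin ((real n + 1) * pi / 3)) *
               of_real (Gamma ((real n + 1) / 3)) / ls_powr (Log_Point \<zeta>) ((of_nat n + 1) / 3))
          + R_H N (Log_Point (\<zeta> + \<i> * of_real pi)) (- \<kappa>)" .
  next
    assume a: "\<bar>Im \<zeta>\<bar> < pi / 2"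
    show "set_integrable lborel {0<..} (RJ_integrand1 N (Log_Point \<zeta>) \<kappa>)" by (rule R_J_ray(1)[OF kappa a])
    show "set_integrable lborel {0<..} (RJ_integrand2 N (Log_Point \<zeta>) \<kappa>)" by (rule R_J_ray(2)[OF kappa a])
    show "set_integrable lborel {0<..} (RY_integrand1 N (Log_Point \<zeta>) \<kappa>)" by (rule R_Y_ray(1)[OF kappa a])
    show "set_integrable lborel {0<..} (RY_integrand2 N (Log_Point \<zeta>) \<kappa>)" by (rule R_Y_ray(2)[OF kappa a])
    note expansions(3)[OF a, unfolded sums]
    then show "ls_deriv (Bessel_J \<nu>) (Log_Point \<zeta>) = 1 / (3 * of_real pi) *
            (\<Sum>n = 1..N - 1. of_real (6 powr ((real n + 1) / 3)) * D_coeff n \<kappa> *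
               of_real (sin ((real n + 1) * pi / 3)) *
               of_real (Gamma ((real n + 1) / 3)) / ls_powr (Log_Point \<zeta>) ((of_nat n + 1) / 3))
          + R_J N (Log_Point \<zeta>) \<kappa>" .
    note expansions(4)[OF a, unfolded sums]
    then show "ls_deriv (Bessel_Y \<nu>) (Log_Point \<zeta>) = - 2 / (3 * of_real pi) *
            (\<Sum>n = 1..N - 1. (-1) ^ n * of_real (6 powr ((real n + 1) / 3)) * D_coeff n \<kappa> *
               of_real ((sin ((real n + 1) * pi / 3))\<^sup>2) *
               of_real (Gamma ((real n + 1) / 3)) / ls_powr (Log_Point \<zeta>) ((of_nat n + 1) / 3))
          + R_Y N (Log_Point \<zeta>) \<kappa>" .
  next
    fix n
    show "D_coeff n \<kappa> = 1 / fact n * (deriv ^^ n) (\<lambda>t. exp (\<kappa> * t) * sinh t * sinh_kernel t powr ((of_nat n + 1) / 3)) 0"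
      by (rule D_coeff_eq_deriv)
    assume a: "\<bar>Re \<kappa>\<bar> + 1 < (real n + 1) / 3"
    show "set_integrable lborel {0<..} (D_integrand n \<kappa>)" by (rule D_coeff_integral(1)[OF a])
    show "D_coeff n \<kappa> = - of_real (6 powr (- ((real n + 1) / 3)) / (2 * Gamma ((real n + 1) / 3))) * (LINT t:{0<..}|lborel. D_integrand n \<kappa> t)"
      by (rule D_coeff_integral(2)[OF a])
  qed
qed

end
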